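(* Let $X$ be a one-dimensional fractional Brownian motion with Hurst parameter $1/4$ on $[0,T]$, $W$ a standard Brownian motion independent of $X$, and $\rho\in(4,5)$. There exist (after having fixed $W$, and up to modifications) four distinct $\rho$-branched rough paths over $X$ (i.e. $\langle\bullet,\mathbf X_{s,t}\rangle=X_t-X_s$), denoted $\mathbf X^{S,S},\mathbf X^{I,I},\mathbf X^{S,I},\mathbf X^{I,S}$, satisfying the conditions (for $\mathbf X$ any of the four) $$\langle\pi(\bullet\bullet),\mathbf X_{s,t}\rangle=W_t-W_s,\qquad\langle\bullet\top\pi(\bullet\bullet),\mathbf X_{s,t}\rangle=\int_s^t(X_r-X_s)\,\mathrm dW_r,$$ $$\langle\pi(\bullet\bullet)\top\bullet,\mathbf X_{s,t}\rangle=(X_t-X_s)(W_t-W_s)-\int_s^t(X_r-X_s)\,\mathrm dW_r,$$ $$\langle\pi(\bullet\bullet\bullet),\mathbf X_{s,t}\rangle=\langle\pi(\bullet\bullet\bullet)\top\bullet,\mathbf X_{s,t}\rangle=\langle\bullet\top\pi(\bullet\bullet\bullet),\mathbf X_{s,t}\rangle=0,$$ and with $\langle\bullet\top\bullet\top\pi(\bullet\bullet),\mathbf X_{s,t}\rangle$ and $\langle\pi(\bullet\bullet)\top\pi(\bullet\bullet),\mathbf X_{s,t}\rangle$ defined as Itô or Stratonovich integrals: $$\langle\bullet\top\bullet\top\pi(\bullet\bullet),\mathbf X^{I,I}_{s,t}\rangle=\langle\bullet\top\bullet\top\pi(\bullet\bullet),\mathbf X^{I,S}_{s,t}\rangle=\int_s^t\frac{(X_r-X_s)^2-(W_r-W_s)}2\,\mathrm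 dW_r,$$ $$\langle\bullet\top\bullet\top\pi(\bullet\bullet),\mathbf X^{S,I}_{s,t}\rangle=\langle\bullet\top\bullet\top\pi(\bullet\bullet),\mathbf X^{S,S}_{s,t}\rangle=\int_s^t\frac{(X_r-X_s)^2-(W_r-W_s)}2\circ\mathrm dW_r,$$ $$\langle\pi(\bullet\bullet)\top\pi(\bullet\bullet),\mathbf X^{I,S}_{s,t}\rangle=\langle\pi(\bullet\bullet)\top\pi(\bullet\bullet),\mathbf X^{S,S}_{s,t}\rangle=\int_s^t(W_r-W_s)\circ\mathrm dW_r=\frac{(W_t-W_s)^2}2,$$ $$\langle\pi(\bullet\bullet)\top\pi(\bullet\bullet),\mathbf X^{S,I}_{s,t}\rangle=\langle\pi(\bullet\bullet)\top\pi(\bullet\bullet),\mathbf X^{I,I}_{s,t}\rangle=\int_s^t(W_r-W_s)\,\mathrm dW_r.$$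
   Context: $X$ is the centred Gaussian process with covariance $\mathbb E[X_sX_t]=\frac12(\sqrt s+\sqrt t-\sqrt{|t-s|})$. $\mathrm dW$ is Itô and $\circ\,\mathrm dW$ Stratonovich integration. $\mathcal H_{\mathrm{CK}}=\mathcal H_{\mathrm{CK}}(\mathbb R)$ is the (undecorated) Connes–Kreimer Hopf algebra spanned by non-planar rooted forests, with disjoint union product and $\Delta_{\mathrm{CK}}f=\sum_Af|_A\otimes f|_{A^c}$, over vertex subsets $A$ closed under passing to descendants (upper part on the left); $\mathbf 1$ is the empty forest, $\bullet$ the one-vertex tree, $|f|$ the number of vertices, $\mathcal P$ the primitives. Natural growth $\top$ is bilinear with $f\top\mathbf 1=f=\mathbf 1\top f$ and $f\top g=\frac1{|g|}\sum_v(\text{graft all roots of }f\text{ onto }v\in g)$ for non-empty forests; iterates are bracketed from the left. $p_1\otimes\cdots\otimes p_n\mapsto p_1\top\cdots\top p_n$ is a coalgebra isomorphism $\bigotimes(\mathcal P)\to\mathcal H_{\mathrm{CK}}$ (deconcatenation on the left), and $\pi\colon\mathcal H_{\mathrm{CK}}\to\mathcal P$ is the corresponding projection onto words of length one; explicitly $\pi(\mathbf 1)=0$ and $\pi=\mathrm{id}-\top\circ(\mathrm{id}\otimes\pi)\circ\widetilde\Delta_{\mathrm{CK}}$ on non-empty forests, with $\widetilde\Delta_{\mathrm{CK}}$ the reduced coproduct. A ($\mathbb R$-valued) $\rho$-branched rough path on $[0,T]$ controlled by a control $\omega$ (continuous, superadditive, zero on the diagonal) assigns to $0\le s\le t\le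 T$ a linear functional $\langle\cdot,\mathbf X_{s,t}\rangle$ on forests of weight $\le\lfloor\rho\rfloor$ that is multiplicative for the forest product with $\langle\mathbf 1,\mathbf X_{s,t}\rangle=1$, satisfies $\langle h,\mathbf X_{s,t}\rangle=\langle\Delta_{\mathrm{CK}}h,\mathbf X_{s,u}\otimes\mathbf X_{u,t}\rangle$, and has $\sup_{s<t}|\langle f,\mathbf X_{s,t}\rangle|/\omega(s,t)^{|f|/\rho}<\infty$. Here the rough paths are random, with these properties holding almost surely. *)

theory Defs
  imports "HOL-Probability.Probability" "HOL-Library.Poly_Mapping"
begin

section \<open>Non-planar rooted forests\<close>

text \<open>
  Trees carry labels so that individual vertices can be addressed: an undecorated tree is a
  \<open>unit tree\<close>, and its vertices are named by labelling it injectively with natural numbers.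
  The commutative monoid of multisets of trees has disjoint union as its addition and the empty
  forest as its zero.
\<close>

datatype (vertices: 'a) tree = Node (root: 'a) (children: "'a tree multiset")

type_synonym forest = "unit tree multiset"

primrec tree_labels :: "'a tree \<Rightarrow> 'a multiset" where
  "tree_labels (Node a F) = add_mset a (\<Sum>\<^sub># (image_mset tree_labels F))"

definition labels :: "'a tree multiset \<Rightarrow> 'a multiset" where
  "labels F = \<Sum>\<^sub># (image_mset tree_labels F)"

definition weight :: "'a tree multiset \<Rightarrow> nat" where
  "weight F = size (labels F)"

definition forget :: "'a tree multiset \<Rightarrow> forest" where
  "forget F = image_mset (map_tree (\<lambda>_. ())) F"

definition is_labelling :: "nat tree multiset \<Rightarrow> forest \<Rightarrow> bool" where
  "is_labelling F f \<longleftrightarrow> forget F = f \<and> (\<forall>v. count (labels F) v \<le> 1)"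

text \<open>An arbitrary labelling; everything defined from it below is invariant under relabelling.\<close>

definition labelling :: "forest \<Rightarrow> nat tree multiset" where
  "labelling f = (SOME F. is_labelling F f)"

primrec subtrees :: "'a tree \<Rightarrow> 'a tree set" where
  "subtrees (Node a F) = insert (Node a F) (\<Union> (set_mset (image_mset subtrees F)))"

definition descendant_closed :: "'a tree multiset \<Rightarrow> 'a set \<Rightarrow> bool" where
  "descendant_closed F A \<longleftrightarrow>
     (\<forall>t\<in>#F. \<forall>u\<in>subtrees t. root u \<in> A \<longrightarrow> vertices u \<subseteq> A)"

text \<open>Restriction to a set of vertices, with the induced ancestor order.\<close>

primrec restrict_tree :: "'a set \<Rightarrow> 'a tree \<Rightarrow> 'a tree multiset" where
  "restrict_tree A (Node a F) =
     (let R = \<Sum>\<^sub># (image_mset (restrict_tree A) F) in if a \<in> A then {#Node a R#} else R)"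

definition restrict_forest :: "'a set \<Rightarrow> 'a tree multiset \<Rightarrow> 'a tree multiset" where
  "restrict_forest A F = \<Sum>\<^sub># (image_mset (restrict_tree A) F)"

text \<open>Grafting all roots of \<open>f\<close> onto the vertex \<open>v\<close>.\<close>

primrec graft_tree :: "forest \<Rightarrow> 'a \<Rightarrow> 'a tree \<Rightarrow> unit tree" where
  "graft_tree f v (Node a G) =
     Node () (image_mset (graft_tree f v) G + (if a = v then f else {#}))"

definition graft :: "forest \<Rightarrow> 'a \<Rightarrow> 'a tree multiset \<Rightarrow> forest" where
  "graft f v G = image_mset (graft_tree f v) G"


section \<open>The Connes--Kreimer Hopf algebra\<close>

text \<open>The product \<open>*\<close> of this type is the bilinear extension of the disjoint union.\<close>

type_synonym ck = "forest \<Rightarrow>\<^sub>0 real"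

text \<open>Tensors are identified with finitely supported functions on pairs of forests.\<close>

type_synonym ck_tensor = "(forest \<times> forest) \<Rightarrow>\<^sub>0 real"

definition lin_ext :: "('a \<Rightarrow> ('b \<Rightarrow>\<^sub>0 real)) \<Rightarrow> ('a \<Rightarrow>\<^sub>0 real) \<Rightarrow> ('b \<Rightarrow>\<^sub>0 real)" where
  "lin_ext \<phi> p = (\<Sum>a\<in>Poly_Mapping.keys p.
     Poly_Mapping.map (\<lambda>x. Poly_Mapping.lookup p a * x) (\<phi> a))"

abbreviation basis :: "'a \<Rightarrow> ('a \<Rightarrow>\<^sub>0 real)" where
  "basis a \<equiv> Poly_Mapping.single a 1"

definition coproduct :: "forest \<Rightarrow> ck_tensor" where
  "coproduct f = (let F = labelling f; V = set_mset (labels F) in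
     \<Sum>A | A \<subseteq> V \<and> descendant_closed F A.
       basis (forget (restrict_forest A F), forget (restrict_forest (V - A) F)))"

definition reduced_coproduct :: "forest \<Rightarrow> ck_tensor" where
  "reduced_coproduct f = coproduct f - basis (f, {#}) - basis ({#}, f)"

definition grow :: "forest \<Rightarrow> forest \<Rightarrow> ck" where
  "grow f g = (if g = {#} then basis f else
     (\<Sum>v\<in>set_mset (labels (labelling g)).
        Poly_Mapping.single (graft f v (labelling g)) (1 / real (weight g))))"

definition natural_growth :: "ck \<Rightarrow> ck \<Rightarrow> ck" (infixl \<open>\<^bold>\<top>\<close> 70) where
  "x \<^bold>\<top> y = lin_ext (\<lambda>f. lin_ext (\<lambda>g. grow f g) y) x"

lemma lin_ext_cong [fundef_cong]:
  assumes "p = q" "\<And>a. a \<in> Poly_Mapping.keys q \<Longrightarrow> \<phi> a = \<psi> a"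
  shows "lin_ext \<phi> p = lin_ext \<psi> q"
  using assms by (simp add: lin_ext_def)

lemma labels_simps [simp]:
  "labels {#} = {#}" "labels (add_mset t F) = tree_labels t + labels F"
  "labels (F + G) = labels F + labels G"
  by (simp_all add: labels_def)

lemma labels_sum_mset: "labels (\<Sum>\<^sub># M) = \<Sum>\<^sub># (image_mset labels M)"
  by (induction M) auto

lemma labels_eq_empty_iff [simp]: "labels F = {#} \<longleftrightarrow> F = {#}"
proof (cases F)
  case (add t G)
  then show ?thesis by (cases t) simp
qed simp

lemma tree_labels_map: "tree_labels (map_tree g t) = image_mset g (tree_labels t)"
proof (induction t)
  case (Node a F)
  have "image_mset tree_labels (image_mset (map_tree g) F)
      = image_mset (image_mset g) (image_mset tree_labels F)"
    unfolding multiset.map_comp by (rule image_mset_cong) (simp add: Node)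
  moreover have "\<Sum>\<^sub># (image_mset (image_mset g) N) = image_mset g (\<Sum>\<^sub># N)" for N
    by (induction N) auto
  ultimately show ?case by simp
qed

lemma weight_forget [simp]: "weight (forget F) = weight F"
proof -
  have "labels (forget F) = image_mset (\<lambda>_. ()) (labels F)"
    unfolding forget_def by (induction F) (auto simp: tree_labels_map)
  then show ?thesis by (simp add: weight_def)
qed

lemma labels_restrict_tree:
  "labels (restrict_tree A t) = filter_mset (\<lambda>v. v \<in> A) (tree_labels t)"
proof (induction t)
  case (Node a F)
  have "image_mset labels (image_mset (restrict_tree A) F)
      = image_mset (filter_mset (\<lambda>v. v \<in> A)) (image_mset tree_labels F)"
    unfolding multiset.map_comp by (rule image_mset_cong) (simp add: Node)
  moreover have "\<Sum>\<^sub># (image_mset (filter_mset (\<lambda>v. v \<in> A)) N) = filter_mset (\<lambda>v. v \<in> A) (\<Sum>\<^sub># N)" for N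
    by (induction N) auto
  ultimately have "labels (\<Sum>\<^sub># (image_mset (restrict_tree A) F))
      = filter_mset (\<lambda>v. v \<in> A) (\<Sum>\<^sub># (image_mset tree_labels F))"
    by (simp add: labels_sum_mset)
  then show ?case by (simp add: Let_def labels_def)
qed

lemma labels_restrict_forest:
  "labels (restrict_forest A F) = filter_mset (\<lambda>v. v \<in> A) (labels F)"
  by (induction F) (auto simp: restrict_forest_def labels_restrict_tree)

lemma restrict_tree_all: "set_mset (tree_labels t) \<subseteq> A \<Longrightarrow> restrict_tree A t = {#t#}"
proof (induction t)
  case (Node a F)
  have "image_mset (restrict_tree A) F = image_mset (\<lambda>t. {#t#}) F"
    by (rule image_mset_cong) (use Node in force)
  with Node.prems show ?case by (simp add: Let_def)
qed

lemma restrict_forest_all: "set_mset (labels F) \<subseteq> A \<Longrightarrow> restrict_forest A F = F"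
  by (induction F) (auto simp: restrict_forest_def restrict_tree_all)

lemma labelling_exists_aux:
  assumes "\<And>t S. t \<in># f \<Longrightarrow> finite S \<Longrightarrow> \<exists>G. map_tree (\<lambda>_. ()) G = t \<and>
             (\<forall>v::nat. count (tree_labels G) v \<le> 1) \<and> set_mset (tree_labels G) \<inter> S = {}"
    and "finite S"
  shows "\<exists>F. is_labelling F f \<and> set_mset (labels F) \<inter> S = {}"
  using assms(1)
proof (induction f)
  case empty
  then show ?case by (auto simp: is_labelling_def forget_def)
next
  case (add t f)
  then obtain F where F: "is_labelling F f" "set_mset (labels F) \<inter> S = {}"
    by (metis union_iff add_mset_add_single)
  obtain G where G: "map_tree (\<lambda>_. ()) G = t" "\<And>v. count (tree_labels G) v \<le> 1"
      "set_mset (tree_labels G) \<inter> (S \<union> set_mset (labels F)) = {}"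
    using add.prems[of t "S \<union> set_mset (labels F)"] \<open>finite S\<close> by auto
  have "count (tree_labels G + labels F) v \<le> 1" for v
  proof (cases "v \<in># tree_labels G")
    case True
    then have "v \<notin># labels F" using G(3) by auto
    then have "count (labels F) v = 0" by (simp add: count_eq_zero_iff)
    then show ?thesis using G(2)[of v] by simp
  next
    case False
    then have "count (tree_labels G) v = 0" by (simp add: count_eq_zero_iff)
    then show ?thesis using F(1) by (simp add: is_labelling_def)
  qed
  then have "is_labelling (add_mset G F) (add_mset t f)"
    using F G by (auto simp: is_labelling_def forget_def)
  moreover have "set_mset (labels (add_mset G F)) \<inter> S = {}"
    using F G by auto
  ultimately show ?case by blast
qed

lemma tree_labelling_exists:
  fixes t :: "unit tree" and S :: "nat set"
  assumes "finite S"
  shows "\<exists>G. map_tree (\<lambda>_. ()) G = t \<and> (\<forall>v. count (tree_labels G) v \<le> 1) \<and>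
             set_mset (tree_labels G) \<inter> S = {}"
  using assms
proof (induction t arbitrary: S)
  case (Node a f)
  obtain v where v: "v \<notin> S" using Node.prems ex_new_if_finite infinite_UNIV_nat by blast
  obtain F where F: "is_labelling F f" "set_mset (labels F) \<inter> insert v S = {}"
    using labelling_exists_aux[of f "insert v S"] Node by auto
  have "count (labels F) v = 0" using F(2) by (simp add: count_eq_zero_iff)
  then have "\<forall>w. count (add_mset v (labels F)) w \<le> 1"
    using F(1) by (auto simp: is_labelling_def)
  then show ?case
    using F v by (intro exI[of _ "Node v F"]) (auto simp: is_labelling_def forget_def labels_def)
qed

lemma is_labelling_labelling: "is_labelling (labelling f) f"
  unfolding labelling_def
  using labelling_exists_aux[of f "{}"] tree_labelling_exists by (metis finite.emptyI someI_ex)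

lemma weight_reduced_coproduct_less:
  assumes ab: "(a, b) \<in> Poly_Mapping.keys (reduced_coproduct f)" and f: "f \<noteq> {#}"
  shows "weight b < weight f"
proof -
  define F where "F = labelling f"
  define V where "V = set_mset (labels F)"
  define cut where "cut A = (forget (restrict_forest A F), forget (restrict_forest (V - A) F))" for A
  define \<A> where "\<A> = {A. A \<subseteq> V \<and> descendant_closed F A}"
  have fF: "forget F = f"
    using is_labelling_labelling[of f] by (simp add: is_labelling_def F_def)
  have weight_f: "weight f = size (labels F)"
    using fF by (metis weight_forget weight_def)
  have "finite \<A>" unfolding \<A>_def V_def by (rule finite_subset[of _ "Pow (set_mset (labels F))"]) auto
  moreover have "{} \<in> \<A>" by (simp add: \<A>_def descendant_closed_def)
  moreover have "cut {} = ({#}, f)"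
  proof -
    have "restrict_forest {} F = {#}"
      using labels_restrict_forest[of "{}" F] by simp
    then show ?thesis by (simp add: cut_def fF restrict_forest_all V_def) (simp add: forget_def)
  qed
  ultimately have "coproduct f = basis ({#}, f) + (\<Sum>A\<in>\<A> - {{}}. basis (cut A))"
    by (simp add: coproduct_def Let_def sum.remove flip: F_def V_def \<A>_def cut_def)
  then have "reduced_coproduct f = (\<Sum>A\<in>\<A> - {{}}. basis (cut A)) - basis (f, {#})"
    by (simp add: reduced_coproduct_def)
  with ab have "(a, b) \<in> Poly_Mapping.keys (\<Sum>A\<in>\<A> - {{}}. (basis (cut A) :: ck_tensor)) \<union> {(f, {#})}"
    using keys_diff[of "\<Sum>A\<in>\<A> - {{}}. (basis (cut A) :: ck_tensor)" "basis (f, {#})"] by auto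
  moreover have "Poly_Mapping.keys (\<Sum>A\<in>\<A> - {{}}. (basis (cut A) :: ck_tensor))
      \<subseteq> (\<Union>A\<in>\<A> - {{}}. {cut A})"
    by (rule order.trans[OF keys_sum]) auto
  ultimately consider "b = {#}" | A where "A \<in> \<A>" "A \<noteq> {}" "(a, b) = cut A" by blast
  then show ?thesis
  proof cases
    case 1
    then show ?thesis using f labels_eq_empty_iff[of f]
      by (simp add: weight_def del: labels_eq_empty_iff) (metis gr0I size_eq_0_iff_empty)
  next
    case 2
    then obtain v where v: "v \<in> A" "v \<in># labels F" by (auto simp: \<A>_def V_def)
    have "weight b = size (filter_mset (\<lambda>v. v \<in> V - A) (labels F))"
      using 2(3) by (simp add: cut_def) (simp add: weight_def labels_restrict_forest)
    also have "\<dots> < size (labels F)"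
      using v by (intro mset_subset_size) (metis DiffE filter_mset_eq_conv multiset_filter_subset subset_mset.le_neq_trans)
    finally show ?thesis by (simp add: weight_f)
  qed
qed

text \<open>
  The projection onto words of length one in the tensor coalgebra of the primitive elements,
  on basis elements and extended linearly.
\<close>

function proj_forest :: "forest \<Rightarrow> ck" where
  "proj_forest f = (if f = {#} then 0 else
     basis f - lin_ext (\<lambda>(a, b). basis a \<^bold>\<top> proj_forest b) (reduced_coproduct f))"
  by auto
termination
  by (relation "Wellfounded.measure weight") (auto dest: weight_reduced_coproduct_less)

declare proj_forest.simps [simp del]

definition proj :: "ck \<Rightarrow> ck" (\<open>\<pi>\<^sub>P\<close>) where
  "proj x = lin_ext proj_forest x"

definition bullet :: ck (\<open>\<^bold>\<bullet>\<close>) where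
  "bullet = basis {#Node () {#}#}"

text \<open>Linear functionals are given by their values on forests.\<close>

definition pairing :: "ck \<Rightarrow> (forest \<Rightarrow> real) \<Rightarrow> real" (\<open>\<langle>_, _\<rangle>\<close>) where
  "\<langle>h, x\<rangle> = (\<Sum>f\<in>Poly_Mapping.keys h. Poly_Mapping.lookup h f * x f)"


section \<open>Branched rough paths\<close>

definition control :: "real \<Rightarrow> (real \<Rightarrow> real \<Rightarrow> real) \<Rightarrow> bool" where
  "control T c \<longleftrightarrow>
     continuous_on {(s, t). 0 \<le> s \<and> s \<le> t \<and> t \<le> T} (\<lambda>(s, t). c s t) \<and>
     (\<forall>s t. 0 \<le> s \<and> s \<le> t \<and> t \<le> T \<longrightarrow> 0 \<le> c s t) \<and>
     (\<forall>s u t. 0 \<le> s \<and> s \<le> u \<and> u \<le> t \<and> t \<le> T \<longrightarrow> c s u + c u t \<le> c s t) \<and>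
     (\<forall>t. 0 \<le> t \<and> t \<le> T \<longrightarrow> c t t = 0)"

text \<open>
  Only the values on forests of weight at most \<open>\<lfloor>\<rho>\<rfloor>\<close> matter. The supremum condition is written
  without division, so that it forces \<open>x s t f = 0\<close> where the control vanishes; for the
  empty forest it is vacuous and therefore omitted.
\<close>

definition branched_rough_path ::
  "real \<Rightarrow> real \<Rightarrow> (real \<Rightarrow> real \<Rightarrow> real) \<Rightarrow> (real \<Rightarrow> real \<Rightarrow> forest \<Rightarrow> real) \<Rightarrow> bool" where
  "branched_rough_path \<rho> T c x \<longleftrightarrow>
     (\<forall>s t. 0 \<le> s \<and> s \<le> t \<and> t \<le> T \<longrightarrow>
        x s t {#} = 1 \<and>
        (\<forall>f g. int (weight (f + g)) \<le> \<lfloor>\<rho>\<rfloor> \<longrightarrow> x s t (f + g) = x s t f * x s t g)) \<and>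
     (\<forall>s u t f. 0 \<le> s \<and> s \<le> u \<and> u \<le> t \<and> t \<le> T \<and> int (weight f) \<le> \<lfloor>\<rho>\<rfloor> \<longrightarrow>
        x s t f = (\<Sum>(a, b)\<in>Poly_Mapping.keys (coproduct f).
          Poly_Mapping.lookup (coproduct f) (a, b) * (x s u a * x u t b))) \<and>
     (\<forall>f. f \<noteq> {#} \<and> int (weight f) \<le> \<lfloor>\<rho>\<rfloor> \<longrightarrow>
        (\<exists>C. \<forall>s t. 0 \<le> s \<and> s < t \<and> t \<le> T \<longrightarrow>
           \<bar>x s t f\<bar> \<le> C * c s t powr (real (weight f) / \<rho>)))"

type_synonym 'a random_path = "'a \<Rightarrow> real \<Rightarrow> real \<Rightarrow> forest \<Rightarrow> real"

definition random_branched_rough_path ::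
  "'a measure \<Rightarrow> real \<Rightarrow> real \<Rightarrow> 'a random_path \<Rightarrow> bool" where
  "random_branched_rough_path M \<rho> T Y \<longleftrightarrow>
     (\<forall>s t f. 0 \<le> s \<and> s \<le> t \<and> t \<le> T \<and> int (weight f) \<le> \<lfloor>\<rho>\<rfloor> \<longrightarrow>
        (\<lambda>\<omega>. Y \<omega> s t f) \<in> borel_measurable M) \<and>
     (AE \<omega> in M. \<exists>c. control T c \<and> branched_rough_path \<rho> T c (Y \<omega>))"

definition modification ::
  "'a measure \<Rightarrow> real \<Rightarrow> real \<Rightarrow> 'a random_path \<Rightarrow> 'a random_path \<Rightarrow> bool" where
  "modification M \<rho> T Y Z \<longleftrightarrow>
     (\<forall>s t. 0 \<le> s \<and> s \<le> t \<and> t \<le> T \<longrightarrow>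
        (AE \<omega> in M. \<forall>f. int (weight f) \<le> \<lfloor>\<rho>\<rfloor> \<longrightarrow> Y \<omega> s t f = Z \<omega> s t f))"


section \<open>Gaussian processes\<close>

text \<open>Univariate Gaussian law, including the degenerate one.\<close>

definition gaussian :: "'a measure \<Rightarrow> ('a \<Rightarrow> real) \<Rightarrow> bool" where
  "gaussian M Y \<longleftrightarrow> Y \<in> borel_measurable M \<and>
     (\<exists>\<mu> \<sigma>. (\<sigma> = 0 \<and> (AE \<omega> in M. Y \<omega> = \<mu>)) \<or>
            (\<sigma> > 0 \<and> distributed M lborel Y (normal_density \<mu> \<sigma>)))"

definition centred_gaussian_process ::
  "'a measure \<Rightarrow> real set \<Rightarrow> (real \<Rightarrow> real \<Rightarrow> real) \<Rightarrow> (real \<Rightarrow> 'a \<Rightarrow> real) \<Rightarrow> bool" where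
  "centred_gaussian_process M I K X \<longleftrightarrow>
     (\<forall>J c. finite J \<and> J \<subseteq> I \<longrightarrow> gaussian M (\<lambda>\<omega>. \<Sum>t\<in>J. c t * X t \<omega>)) \<and>
     (\<forall>t\<in>I. (LINT \<omega>|M. X t \<omega>) = 0) \<and>
     (\<forall>s\<in>I. \<forall>t\<in>I. (LINT \<omega>|M. X s \<omega> * X t \<omega>) = K s t)"

text \<open>Fractional Brownian motion of Hurst parameter 1/4, in its continuous version.\<close>

definition fbm_quarter :: "'a measure \<Rightarrow> real \<Rightarrow> (real \<Rightarrow> 'a \<Rightarrow> real) \<Rightarrow> bool" where
  "fbm_quarter M T X \<longleftrightarrow>
     centred_gaussian_process M {0..T} (\<lambda>s t. (sqrt s + sqrt t - sqrt \<bar>t - s\<bar>) / 2) X \<and>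
     (AE \<omega> in M. continuous_on {0..T} (\<lambda>t. X t \<omega>))"

definition partition :: "real \<Rightarrow> real \<Rightarrow> nat \<Rightarrow> (nat \<Rightarrow> real) \<Rightarrow> bool" where
  "partition s t n \<tau> \<longleftrightarrow> \<tau> 0 = s \<and> \<tau> n = t \<and> (\<forall>i<n. \<tau> i \<le> \<tau> (Suc i))"

definition brownian_motion :: "'a measure \<Rightarrow> real \<Rightarrow> (real \<Rightarrow> 'a \<Rightarrow> real) \<Rightarrow> bool" where
  "brownian_motion M T W \<longleftrightarrow>
     (\<forall>t\<in>{0..T}. W t \<in> borel_measurable M) \<and>
     (AE \<omega> in M. W 0 \<omega> = 0) \<and>
     (\<forall>n \<tau>. partition 0 T n \<tau> \<longrightarrow>
        prob_space.indep_vars M (\<lambda>_. borel) (\<lambda>i \<omega>. W (\<tau> (Suc i)) \<omega> - W (\<tau> i) \<omega>) {..<n}) \<and>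
     (\<forall>s t. 0 \<le> s \<and> s < t \<and> t \<le> T \<longrightarrow>
        distributed M lborel (\<lambda>\<omega>. W t \<omega> - W s \<omega>) (normal_density 0 (sqrt (t - s)))) \<and>
     (AE \<omega> in M. continuous_on {0..T} (\<lambda>t. W t \<omega>))"

definition independent_processes ::
  "'a measure \<Rightarrow> real set \<Rightarrow> (real \<Rightarrow> 'a \<Rightarrow> real) \<Rightarrow> (real \<Rightarrow> 'a \<Rightarrow> real) \<Rightarrow> bool" where
  "independent_processes M I X W \<longleftrightarrow>
     prob_space.indep_var M
       (\<Pi>\<^sub>M t\<in>I. borel) (\<lambda>\<omega>. \<lambda>t\<in>I. X t \<omega>) (\<Pi>\<^sub>M t\<in>I. borel) (\<lambda>\<omega>. \<lambda>t\<in>I. W t \<omega>)"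


section \<open>Stochastic integrals\<close>

text \<open>The filtration generated by the pair \<open>(X, W)\<close>.\<close>

definition natural_filtration ::
  "'a measure \<Rightarrow> (real \<Rightarrow> 'a \<Rightarrow> real) \<Rightarrow> (real \<Rightarrow> 'a \<Rightarrow> real) \<Rightarrow> real \<Rightarrow> 'a measure" where
  "natural_filtration M X W t = sigma (space M)
     (\<Union>Z\<in>{X, W}. \<Union>r\<in>{0..t}. {Z r -` B \<inter> space M |B. B \<in> sets borel})"

text \<open>
  Simple adapted process on \<open>[s, t]\<close>, taking the value \<open>\<xi> i\<close> on \<open>(\<tau> i, \<tau> (i + 1)]\<close>.
\<close>

definition simple_process ::
  "'a measure \<Rightarrow> (real \<Rightarrow> 'a measure) \<Rightarrow> real \<Rightarrow> real \<Rightarrow> nat \<Rightarrow> (nat \<Rightarrow> real) \<Rightarrow>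
     (nat \<Rightarrow> 'a \<Rightarrow> real) \<Rightarrow> bool" where
  "simple_process M \<F> s t n \<tau> \<xi> \<longleftrightarrow> partition s t n \<tau> \<and>
     (\<forall>i<n. \<xi> i \<in> borel_measurable (\<F> (\<tau> i)) \<and> integrable M (\<lambda>\<omega>. (\<xi> i \<omega>)\<^sup>2))"

definition simple_value ::
  "nat \<Rightarrow> (nat \<Rightarrow> real) \<Rightarrow> (nat \<Rightarrow> 'a \<Rightarrow> real) \<Rightarrow> real \<Rightarrow> 'a \<Rightarrow> real" where
  "simple_value n \<tau> \<xi> r \<omega> = (\<Sum>i<n. \<xi> i \<omega> * indicator {\<tau> i<..\<tau> (Suc i)} r)"

definition simple_integral ::
  "(real \<Rightarrow> 'a \<Rightarrow> real) \<Rightarrow> nat \<Rightarrow> (nat \<Rightarrow> real) \<Rightarrow> (nat \<Rightarrow> 'a \<Rightarrow> real) \<Rightarrow> 'a \<Rightarrow> real" where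
  "simple_integral W n \<tau> \<xi> \<omega> = (\<Sum>i<n. \<xi> i \<omega> * (W (\<tau> (Suc i)) \<omega> - W (\<tau> i) \<omega>))"

text \<open>
  \<open>J\<close> is a version of the Ito integral of \<open>H\<close> against \<open>W\<close> over \<open>[s, t]\<close>, for \<open>H\<close> square
  integrable on \<open>[s, t] \<times> \<Omega>\<close>: the \<open>L\<^sup>2\<close> limit of integrals of simple adapted processes
  converging to \<open>H\<close> in \<open>L\<^sup>2\<close>.
\<close>

definition has_ito_integral ::
  "'a measure \<Rightarrow> (real \<Rightarrow> 'a measure) \<Rightarrow> (real \<Rightarrow> 'a \<Rightarrow> real) \<Rightarrow> (real \<Rightarrow> 'a \<Rightarrow> real) \<Rightarrow>
     real \<Rightarrow> real \<Rightarrow> ('a \<Rightarrow> real) \<Rightarrow> bool" where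
  "has_ito_integral M \<F> W H s t J \<longleftrightarrow> J \<in> borel_measurable M \<and>
     (\<exists>n \<tau> \<xi>. (\<forall>k. simple_process M \<F> s t (n k) (\<tau> k) (\<xi> k)) \<and>
        (\<lambda>k. \<integral>\<^sup>+\<omega>. (\<integral>\<^sup>+r\<in>{s..t}. ennreal ((H r \<omega> - simple_value (n k) (\<tau> k) (\<xi> k) r \<omega>)\<^sup>2) \<partial>lborel) \<partial>M)
           \<longlonglongrightarrow> 0 \<and>
        (\<lambda>k. \<integral>\<^sup>+\<omega>. ennreal ((J \<omega> - simple_integral W (n k) (\<tau> k) (\<xi> k) \<omega>)\<^sup>2) \<partial>M) \<longlonglongrightarrow> 0)"

text \<open>
  \<open>J\<close> is a version of the Stratonovich integral: the limit in probability of the trapezoidal sums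
  as the mesh of the partition tends to zero.
\<close>

definition has_stratonovich_integral ::
  "'a measure \<Rightarrow> (real \<Rightarrow> 'a \<Rightarrow> real) \<Rightarrow> (real \<Rightarrow> 'a \<Rightarrow> real) \<Rightarrow>
     real \<Rightarrow> real \<Rightarrow> ('a \<Rightarrow> real) \<Rightarrow> bool" where
  "has_stratonovich_integral M W H s t J \<longleftrightarrow> J \<in> borel_measurable M \<and>
     (\<forall>\<epsilon>>0. \<exists>\<delta>>0. \<forall>n \<tau>. partition s t n \<tau> \<and> (\<forall>i<n. \<tau> (Suc i) - \<tau> i < \<delta>) \<longrightarrow>
        measure M {\<omega> \<in> space M.
          \<bar>(\<Sum>i<n. (H (\<tau> i) \<omega> + H (\<tau> (Suc i)) \<omega>) / 2 * (W (\<tau> (Suc i)) \<omega> - W (\<tau> i) \<omega>)) - J \<omega>\<bar>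
            > \<epsilon>} < \<epsilon>)"

datatype calculus = Ito | Stratonovich

fun has_stochastic_integral ::
  "calculus \<Rightarrow> 'a measure \<Rightarrow> (real \<Rightarrow> 'a measure) \<Rightarrow> (real \<Rightarrow> 'a \<Rightarrow> real) \<Rightarrow>
     (real \<Rightarrow> 'a \<Rightarrow> real) \<Rightarrow> real \<Rightarrow> real \<Rightarrow> ('a \<Rightarrow> real) \<Rightarrow> bool" where
  "has_stochastic_integral Ito M \<F> W H s t J = has_ito_integral M \<F> W H s t J"
| "has_stochastic_integral Stratonovich M \<F> W H s t J = has_stratonovich_integral M W H s t J"

section \<open>The lifts of fractional Brownian motion\<close>

text \<open>
  The first argument selects the calculus for the integral giving \<open>\<bullet> \<top> \<bullet> \<top> \<pi>(\<bullet>\<bullet>)\<close>, the second one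
  that for \<open>\<pi>(\<bullet>\<bullet>) \<top> \<pi>(\<bullet>\<bullet>)\<close>. Identities between continuous processes hold simultaneously for all
  \<open>s \<le> t\<close> almost surely; a stochastic integral over \<open>[s, t]\<close> is only defined up to a null set
  depending on \<open>s\<close> and \<open>t\<close>.
\<close>

definition is_lift ::
  "'a measure \<Rightarrow> real \<Rightarrow> real \<Rightarrow> (real \<Rightarrow> 'a \<Rightarrow> real) \<Rightarrow> (real \<Rightarrow> 'a \<Rightarrow> real) \<Rightarrow>
     calculus \<Rightarrow> calculus \<Rightarrow> 'a random_path \<Rightarrow> bool" where
  "is_lift M \<rho> T X W \<alpha> \<beta> Y \<longleftrightarrow>
     (let p2 = \<pi>\<^sub>P (\<^bold>\<bullet> * \<^bold>\<bullet>); p3 = \<pi>\<^sub>P (\<^bold>\<bullet> * \<^bold>\<bullet> * \<^bold>\<bullet>); \<F> = natural_filtration M X W in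
       random_branched_rough_path M \<rho> T Y \<and>
       (AE \<omega> in M. \<forall>s t. 0 \<le> s \<and> s \<le> t \<and> t \<le> T \<longrightarrow>
          \<langle>\<^bold>\<bullet>, Y \<omega> s t\<rangle> = X t \<omega> - X s \<omega> \<and>
          \<langle>p2, Y \<omega> s t\<rangle> = W t \<omega> - W s \<omega> \<and>
          \<langle>p3, Y \<omega> s t\<rangle> = 0 \<and> \<langle>p3 \<^bold>\<top> \<^bold>\<bullet>, Y \<omega> s t\<rangle> = 0 \<and> \<langle>\<^bold>\<bullet> \<^bold>\<top> p3, Y \<omega> s t\<rangle> = 0) \<and>
       (\<forall>s t. 0 \<le> s \<and> s \<le> t \<and> t \<le> T \<longrightarrow>
          (\<exists>J. has_ito_integral M \<F> W (\<lambda>r \<omega>. X r \<omega> - X s \<omega>) s t J \<and>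
             (AE \<omega> in M.
                \<langle>\<^bold>\<bullet> \<^bold>\<top> p2, Y \<omega> s t\<rangle> = J \<omega> \<and>
                \<langle>p2 \<^bold>\<top> \<^bold>\<bullet>, Y \<omega> s t\<rangle> = (X t \<omega> - X s \<omega>) * (W t \<omega> - W s \<omega>) - J \<omega>)) \<and>
          (\<exists>J. has_stochastic_integral \<alpha> M \<F> W
                 (\<lambda>r \<omega>. ((X r \<omega> - X s \<omega>)\<^sup>2 - (W r \<omega> - W s \<omega>)) / 2) s t J \<and>
             (AE \<omega> in M. \<langle>(\<^bold>\<bullet> \<^bold>\<top> \<^bold>\<bullet>) \<^bold>\<top> p2, Y \<omega> s t\<rangle> = J \<omega>)) \<and>
          (\<exists>J. has_stochastic_integral \<beta> M \<F> W (\<lambda>r \<omega>. W r \<omega> - W s \<omega>) s t J \<and>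
             (AE \<omega> in M. \<langle>p2 \<^bold>\<top> p2, Y \<omega> s t\<rangle> = J \<omega> \<and>
                (\<beta> = Stratonovich \<longrightarrow> J \<omega> = (W t \<omega> - W s \<omega>)\<^sup>2 / 2)))))"

end

theory Submission
  imports Defs
begin

text \<open>
  Trees with at most four vertices are eight in number, so a multiplicative functional on forests
  of weight at most four is a choice of eight numbers for every \<open>s \<le> t\<close>. The words prescribed in
  the statement are, modulo products of smaller forests, a triangular system of linear forms in
  these numbers. Solving it (\<open>tree_val\<close>, \<open>forest_val_unique\<close>) expresses every tree as a polynomial
  in the increments \<open>x\<close>, \<open>w\<close> of \<open>X\<close>, \<open>W\<close> and in the values \<open>j\<close>, \<open>k\<close>, \<open>m\<close> of the words
  \<open>\<bullet> \<top> \<pi>(\<bullet>\<bullet>)\<close>, \<open>\<bullet> \<top> \<bullet> \<top> \<pi>(\<bullet>\<bullet>)\<close>, \<open>\<pi>(\<bullet>\<bullet>) \<top> \<pi>(\<bullet>\<bullet>)\<close>. Words deconcatenate, so \<open>j\<close>, \<open>k\<close>, \<open>m\<close> satisfy the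
  Chen relations of iterated integrals, and Chen's identity for forests is a polynomial identity
  (\<open>chen_forest\<close>). Uniqueness up to modification is the uniqueness of the solution of the linear
  system together with the almost sure uniqueness of the three stochastic integrals. The lifts are
  distinct because the Ito and the Stratonovich values of \<open>k\<close> and \<open>m\<close> differ by \<open>(t - s) / 4\<close> and
  \<open>(t - s) / 2\<close>, quantities that do not depend on chance.

  The analytic content of existence is a single random control that bounds a forest \<open>f\<close> by a
  multiple of its power \<open>|f| / \<rho>\<close>, for all \<open>s < t\<close> at once. Everything is a polynomial in the
  increments of \<open>X\<close>, \<open>W\<close>, \<open>A = \<integral> X dW\<close> and \<open>B = \<integral> X\<^sup>2 dW\<close>, and these carry a homogeneous norm that is
  subadditive along adjacent intervals (\<open>hom_bound_trans\<close>). Hence it is enough to bound it on dyadic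
  intervals: if the \<open>\<rho>\<close>-th powers of the norm over the dyadic intervals of length \<open>T / 2 ^ n\<close>,
  weighted by \<open>r ^ n\<close> with \<open>r > 1\<close>, have a finite sum, then spreading each of them uniformly over
  its interval gives an additive continuous control, and chaining over dyadic scales gives the bound
  everywhere (\<open>dyadic_control\<close>). The expected \<open>\<rho>\<close>-th power over an interval of length \<open>h\<close> is at most
  a multiple of \<open>h\<close> to the power \<open>\<rho> / 4\<close> (\<open>variation_moment\<close>), and \<open>\<rho> > 4\<close> makes the sum finite. As
  \<open>A\<close> and \<open>B\<close> enter with the powers \<open>\<rho> / 3\<close> and \<open>\<rho> / 4\<close>, both below 2, second moments of stochastic
  integrals suffice, and these come from the isometry.

  The integrals are limits of dyadic Riemann sums. The isometry is proved for the filtration that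
  knows all of \<open>X\<close> in advance; independence of \<open>X\<close> and \<open>W\<close> keeps the increments of \<open>W\<close> independent
  of its past (\<open>past_indep_increment\<close>). The predicate \<open>ito_limit\<close> records the only property of an
  Ito integral that is used afterwards. The Stratonovich sums differ from the Ito sums by half of a
  covariation, in which \<open>X\<close> contributes nothing in the limit and \<open>W\<close> contributes its quadratic
  variation (\<open>trapezoid_bound\<close>).
\<close>

section \<open>Linear functionals on finitely supported combinations\<close>

text \<open>
  The functional with prescribed values on basis elements. The pairing with a rough path and the
  evaluation of the coproduct in Chen's identity are both of this form, which allows all computations
  in the Hopf algebra to be made on values instead of on formal combinations.
\<close>

definition ev :: "('a \<Rightarrow> real) \<Rightarrow> ('a \<Rightarrow>\<^sub>0 real) \<Rightarrow> real" where
  "ev \<Phi> p = (\<Sum>a\<in>Poly_Mapping.keys p. Poly_Mapping.lookup p a * \<Phi> a)"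

lemma pairing_eq_ev: "\<langle>h, x\<rangle> = ev x h"
  by (simp add: pairing_def ev_def)

lemma ev_superset:
  assumes "finite S" "Poly_Mapping.keys p \<subseteq> S"
  shows "ev \<Phi> p = (\<Sum>a\<in>S. Poly_Mapping.lookup p a * \<Phi> a)"
  unfolding ev_def using assms by (intro sum.mono_neutral_left) (auto simp: in_keys_iff)

lemma ev_zero [simp]: "ev \<Phi> 0 = 0"
  by (simp add: ev_def)

lemma ev_single [simp]: "ev \<Phi> (Poly_Mapping.single a c) = c * \<Phi> a"
  by (simp add: ev_def)

lemma ev_add [simp]: "ev \<Phi> (p + q) = ev \<Phi> p + ev \<Phi> q"
proof -
  let ?S = "Poly_Mapping.keys p \<union> Poly_Mapping.keys q"
  have "Poly_Mapping.keys (p + q) \<subseteq> ?S" by (rule keys_add)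
  then show ?thesis
    by (simp add: ev_superset[of ?S] lookup_add distrib_right sum.distrib)
qed

lemma ev_diff [simp]: "ev \<Phi> (p - q) = ev \<Phi> p - ev \<Phi> (q :: 'a \<Rightarrow>\<^sub>0 real)"
  using ev_add[of \<Phi> "p - q" q] by simp

lemma ev_sum [simp]: "ev \<Phi> (sum g I) = (\<Sum>i\<in>I. ev \<Phi> (g i))"
  by (induction I rule: infinite_finite_induct) auto

lemma ev_scale [simp]: "ev \<Phi> (Poly_Mapping.map (\<lambda>x. c * x) p) = c * ev \<Phi> p"
proof -
  have "Poly_Mapping.keys (Poly_Mapping.map (\<lambda>x. c * x) p) \<subseteq> Poly_Mapping.keys p"
    by (auto simp: in_keys_iff Poly_Mapping.map.rep_eq when_def)
  then show ?thesis
    by (auto simp: ev_superset[of "Poly_Mapping.keys p"] Poly_Mapping.map.rep_eq when_def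
        sum_distrib_left mult.assoc intro!: sum.cong)
qed

lemma ev_lin_ext [simp]: "ev \<Phi> (lin_ext \<phi> p) = ev (\<lambda>a. ev \<Phi> (\<phi> a)) p"
  unfolding lin_ext_def by (simp add: ev_def[of "\<lambda>a. ev \<Phi> (\<phi> a)"])

lemma ev_indicator: "ev (\<lambda>b. if b = a then 1 else 0) p = Poly_Mapping.lookup p a"
  by (simp add: ev_def in_keys_iff if_distrib[of "\<lambda>x. _ * x"] cong: if_cong)

text \<open>
  Functionals separate points, so identities between linear extensions follow from \<open>ev_lin_ext\<close>.
\<close>

lemma poly_mapping_eqI_ev: "(\<And>\<Phi>. ev \<Phi> p = ev \<Phi> q) \<Longrightarrow> p = q"
  by (rule poly_mapping_eqI) (metis ev_indicator)

lemma lin_ext_zero [simp]: "lin_ext \<phi> 0 = 0"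
  by (rule poly_mapping_eqI_ev) simp
lemma lin_ext_add [simp]: "lin_ext \<phi> (p + q) = lin_ext \<phi> p + lin_ext \<phi> q"
  by (rule poly_mapping_eqI_ev) simp
lemma lin_ext_sum: "lin_ext \<phi> (sum g I) = (\<Sum>i\<in>I. lin_ext \<phi> (g i))"
  by (rule poly_mapping_eqI_ev) simp
lemma lin_ext_basis [simp]: "lin_ext \<phi> (basis a) = \<phi> a"
  by (rule poly_mapping_eqI_ev) simp

lemma sum_singles: "p = (\<Sum>a\<in>Poly_Mapping.keys p. Poly_Mapping.single a (Poly_Mapping.lookup p a :: real))"
proof (rule poly_mapping_eqI_ev)
  fix \<Phi> :: "'a \<Rightarrow> real"
  show "ev \<Phi> p = ev \<Phi> (\<Sum>a\<in>Poly_Mapping.keys p. Poly_Mapping.single a (Poly_Mapping.lookup p a))"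
    by (simp only: ev_sum ev_single) (simp add: ev_def)
qed

text \<open>
  This is what reduces Chen's identity from forests to trees.
\<close>

lemma ev_mult:
  fixes p q :: "'a::comm_monoid_add \<Rightarrow>\<^sub>0 real"
  assumes "\<And>a b. \<Phi> (a + b) = \<Phi> a * \<Phi> b"
  shows "ev \<Phi> (p * q) = ev \<Phi> p * ev \<Phi> q"
proof -
  have "ev \<Phi> ((\<Sum>a\<in>Poly_Mapping.keys p. Poly_Mapping.single a (Poly_Mapping.lookup p a)) *
      (\<Sum>b\<in>Poly_Mapping.keys q. Poly_Mapping.single b (Poly_Mapping.lookup q b))) = ev \<Phi> p * ev \<Phi> q"
    by (simp add: sum_product mult_single assms ev_def[of \<Phi> p] ev_def[of \<Phi> q] mult_ac)
  then show ?thesis by (simp only: sum_singles[symmetric])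
qed

section \<open>The coproduct as a product over trees\<close>

lemma tree_labels_Node [simp]: "tree_labels (Node a F) = add_mset a (labels F)"
  by (simp add: labels_def)

declare tree_labels.simps [simp del]

lemma set_labels: "set_mset (labels F) = (\<Union>t\<in>set_mset F. set_mset (tree_labels t))"
  by (simp add: labels_def)

definition cuts :: "'a tree multiset \<Rightarrow> 'a set set" where
  "cuts F = {A. A \<subseteq> set_mset (labels F) \<and> descendant_closed F A}"

text \<open>
  The coproduct as read off from a given labelling.
\<close>

definition cut_sum :: "'a tree multiset \<Rightarrow> ck_tensor" where
  "cut_sum F = (\<Sum>A\<in>cuts F. basis (forget (restrict_forest A F),
     forget (restrict_forest (set_mset (labels F) - A) F)))"

lemma coproduct_eq_cut_sum: "coproduct f = cut_sum (labelling f)"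
  by (simp add: coproduct_def cut_sum_def cuts_def Let_def)

lemma finite_cuts [simp]: "finite (cuts F)"
  unfolding cuts_def by (rule finite_subset[of _ "Pow (set_mset (labels F))"]) auto

lemma vertices_eq_labels: "vertices t = set_mset (tree_labels t)"
  by (induction t) (auto simp: set_labels)

lemma root_in_labels: "root t \<in># tree_labels t"
  by (cases t) simp

lemma subtrees_labels: "u \<in> subtrees t \<Longrightarrow> set_mset (tree_labels u) \<subseteq> set_mset (tree_labels t)"
  by (induction t) (auto simp: set_labels)

lemma restrict_tree_cong:
  "A \<inter> set_mset (tree_labels t) = B \<inter> set_mset (tree_labels t) \<Longrightarrow> restrict_tree A t = restrict_tree B t"
proof (induction t)
  case (Node a F)
  have "image_mset (restrict_tree A) F = image_mset (restrict_tree B) F"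
  proof (rule image_mset_cong)
    fix u assume u: "u \<in># F"
    show "restrict_tree A u = restrict_tree B u"
      by (rule Node.IH[OF u]) (use Node.prems u in \<open>auto simp: set_labels\<close>)
  qed
  with Node.prems show ?case by (auto simp: Let_def)
qed

lemma restrict_forest_cong:
  assumes "A \<inter> set_mset (labels F) = B \<inter> set_mset (labels F)"
  shows "restrict_forest A F = restrict_forest B F"
  unfolding restrict_forest_def
proof (intro arg_cong[where f = sum_mset] image_mset_cong restrict_tree_cong)
  fix t assume "t \<in># F"
  with assms show "A \<inter> set_mset (tree_labels t) = B \<inter> set_mset (tree_labels t)"
    by (auto simp: labels_def)
qed

lemma restrict_forest_add [simp]:
  "restrict_forest A (F + G) = restrict_forest A F + restrict_forest A G"
  "restrict_forest A {#} = {#}"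
  by (simp_all add: restrict_forest_def)

lemma forget_add [simp]: "forget (F + G) = forget F + forget G" "forget {#} = {#}"
  "forget (add_mset t F) = add_mset (map_tree (\<lambda>_. ()) t) (forget F)"
  by (simp_all add: forget_def)

lemma descendant_closed_add [simp]:
  "descendant_closed (F + G) A \<longleftrightarrow> descendant_closed F A \<and> descendant_closed G A"
  by (auto simp: descendant_closed_def)

lemma descendant_closed_cong:
  assumes "A \<inter> set_mset (labels F) = B \<inter> set_mset (labels F)"
  shows "descendant_closed F A \<longleftrightarrow> descendant_closed F B"
proof -
  have *: "descendant_closed F B" if "A \<inter> set_mset (labels F) = B \<inter> set_mset (labels F)"
      "descendant_closed F A" for A B
    unfolding descendant_closed_def
  proof (intro ballI impI)
    fix t u assume t: "t \<in># F" "u \<in> subtrees t" "root u \<in> B"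
    have sub: "vertices u \<subseteq> set_mset (labels F)"
      using subtrees_labels[OF t(2)] t(1) by (auto simp: vertices_eq_labels labels_def)
    moreover have "root u \<in> vertices u" by (simp add: vertices_eq_labels root_in_labels)
    ultimately have "root u \<in> A" using t(3) that(1) by auto
    then have "vertices u \<subseteq> A" using that(2) t by (auto simp: descendant_closed_def)
    then show "vertices u \<subseteq> B" using sub that(1) by auto
  qed
  show ?thesis using *[of A B] *[of B A] assms by auto
qed

text \<open>
  A descendant-closed set of a disjoint union is a pair of descendant-closed sets, one in each part.
\<close>

lemma cut_sum_add:
  assumes disj: "set_mset (labels F) \<inter> set_mset (labels G) = {}"
  shows "cut_sum (F + G) = cut_sum F * cut_sum G"
proof -
  let ?L = "\<lambda>F. set_mset (labels F)"
  have bij: "bij_betw (\<lambda>(A, B). A \<union> B) (cuts F \<times> cuts G) (cuts (F + G))"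
  proof (rule bij_betw_byWitness[where f' = "\<lambda>C. (C \<inter> ?L F, C \<inter> ?L G)"])
    show "\<forall>a\<in>cuts F \<times> cuts G. (\<lambda>C. (C \<inter> ?L F, C \<inter> ?L G)) (case a of (A, B) \<Rightarrow> A \<union> B) = a"
      using disj by (auto simp: cuts_def)
    show "\<forall>a'\<in>cuts (F + G). (case (a' \<inter> ?L F, a' \<inter> ?L G) of (A, B) \<Rightarrow> A \<union> B) = a'"
      by (auto simp: cuts_def)
    have "descendant_closed F (A \<union> B) \<and> descendant_closed G (A \<union> B)"
      if "A \<in> cuts F" "B \<in> cuts G" for A B
      using that disj descendant_closed_cong[of A F "A \<union> B"] descendant_closed_cong[of B G "A \<union> B"]
      by (auto simp: cuts_def)
    then show "(\<lambda>(A, B). A \<union> B) ` (cuts F \<times> cuts G) \<subseteq> cuts (F + G)"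
      by (auto simp: cuts_def)
    show "(\<lambda>C. (C \<inter> ?L F, C \<inter> ?L G)) ` cuts (F + G) \<subseteq> cuts F \<times> cuts G"
    proof clarify
      fix C assume "C \<in> cuts (F + G)"
      then show "C \<inter> ?L F \<in> cuts F \<and> C \<inter> ?L G \<in> cuts G"
        using descendant_closed_cong[of C F "C \<inter> ?L F"] descendant_closed_cong[of C G "C \<inter> ?L G"]
        by (auto simp: cuts_def)
    qed
  qed
  have "cut_sum F * cut_sum G = (\<Sum>(A, B)\<in>cuts F \<times> cuts G.
      basis (forget (restrict_forest A F) + forget (restrict_forest B G),
        forget (restrict_forest (?L F - A) F) + forget (restrict_forest (?L G - B) G)))"
    by (simp add: cut_sum_def sum_product sum.cartesian_product mult_single)
  also have "\<dots> = (\<Sum>(A, B)\<in>cuts F \<times> cuts G. basis (forget (restrict_forest (A \<union> B) (F + G)),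
        forget (restrict_forest (?L (F + G) - (A \<union> B)) (F + G))))"
  proof (intro sum.cong refl, clarify)
    fix A B assume "A \<in> cuts F" "B \<in> cuts G"
    then have *: "A \<subseteq> ?L F" "B \<subseteq> ?L G" by (auto simp: cuts_def)
    have "restrict_forest A F = restrict_forest (A \<union> B) F"
      "restrict_forest B G = restrict_forest (A \<union> B) G"
      "restrict_forest (?L F - A) F = restrict_forest (?L (F + G) - (A \<union> B)) F"
      "restrict_forest (?L G - B) G = restrict_forest (?L (F + G) - (A \<union> B)) G"
      using * disj by (auto intro!: restrict_forest_cong)
    then show "basis (forget (restrict_forest A F) + forget (restrict_forest B G),
        forget (restrict_forest (?L F - A) F) + forget (restrict_forest (?L G - B) G)) =
      basis (forget (restrict_forest (A \<union> B) (F + G)),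
        forget (restrict_forest (?L (F + G) - (A \<union> B)) (F + G)))" by simp
  qed
  also have "\<dots> = cut_sum (F + G)"
    using sum.reindex_bij_betw[OF bij, of "\<lambda>C. basis (forget (restrict_forest C (F + G)),
        forget (restrict_forest (?L (F + G) - C) (F + G)))"]
    by (simp add: cut_sum_def case_prod_unfold)
  finally show ?thesis by simp
qed

text \<open>
  A descendant-closed set that contains the root contains everything. Any other one lies in the
  forest below the root, and then the root stays in the lower part, the right tensor factor.
\<close>

lemma cut_sum_Node:
  assumes a: "a \<notin># labels F"
  shows "cut_sum {#Node a F#} = basis ({#Node () (forget F)#}, {#})
    + lin_ext (\<lambda>(f, g). basis (f, {#Node () g#})) (cut_sum F)"
proof -
  let ?V = "insert a (set_mset (labels F))"
  have L: "set_mset (labels {#Node a F#}) = ?V" by simp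
  have dc: "descendant_closed {#Node a F#} A \<longleftrightarrow>
      (a \<in> A \<longrightarrow> ?V \<subseteq> A) \<and> descendant_closed F A" for A
    unfolding descendant_closed_def by (simp add: ball_Un set_labels[symmetric] vertices_eq_labels)
  have "descendant_closed F ?V"
    unfolding descendant_closed_def vertices_eq_labels set_labels using subtrees_labels by blast
  then have cuts: "cuts {#Node a F#} = insert ?V (cuts F)"
    using a unfolding cuts_def L dc by auto
  have nin: "?V \<notin> cuts F" using a by (auto simp: cuts_def)
  have "restrict_forest ?V {#Node a F#} = {#Node a F#}"
    by (rule restrict_forest_all) simp
  moreover have "restrict_forest {} {#Node a F#} = {#}"
    using labels_restrict_forest[of "{}" "{#Node a F#}"] by simp
  moreover have "restrict_forest A {#Node a F#} = restrict_forest A F"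
      "restrict_forest (?V - A) {#Node a F#} = {#Node a (restrict_forest (set_mset (labels F) - A) F)#}"
    if "A \<in> cuts F" for A
  proof -
    have aA: "a \<notin> A" using that a by (auto simp: cuts_def)
    show "restrict_forest A {#Node a F#} = restrict_forest A F"
      using aA by (simp add: restrict_forest_def Let_def)
    have "restrict_forest (?V - A) F = restrict_forest (set_mset (labels F) - A) F"
      using a by (intro restrict_forest_cong) auto
    then show "restrict_forest (?V - A) {#Node a F#} =
        {#Node a (restrict_forest (set_mset (labels F) - A) F)#}"
      using aA by (simp add: restrict_forest_def Let_def)
  qed
  ultimately show ?thesis
    using nin by (simp add: cut_sum_def L cuts lin_ext_sum forget_def)
qed

text \<open>
  The cocycle property of grafting onto a new root, taken as a recursion. It is free of labels.
\<close>

primrec tree_coproduct :: "unit tree \<Rightarrow> ck_tensor" where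
  "tree_coproduct (Node a F) = basis ({#Node a F#}, {#})
     + lin_ext (\<lambda>(f, g). basis (f, {#Node () g#})) (\<Prod>\<^sub># (image_mset tree_coproduct F))"

lemma cut_sum_forest:
  fixes F :: "'a tree multiset"
  assumes "\<And>t. t \<in># F \<Longrightarrow> cut_sum {#t#} = tree_coproduct (map_tree (\<lambda>_. ()) t)"
    and "\<And>v. count (labels F) v \<le> 1"
  shows "cut_sum F = \<Prod>\<^sub># (image_mset tree_coproduct (forget F))"
  using assms
proof (induction F)
  case empty
  have "cuts ({#} :: 'a tree multiset) = {{}}" by (auto simp: cuts_def descendant_closed_def)
  then show ?case by (simp add: cut_sum_def zero_prod_def[symmetric])
next
  case (add t F)
  have le: "count (tree_labels t) v + count (labels F) v \<le> 1" for v
    using add.prems(2)[of v] by simp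
  have disj: "set_mset (labels {#t#}) \<inter> set_mset (labels F) = {}"
  proof -
    have "count (tree_labels t) v = 0 \<or> count (labels F) v = 0" for v using le[of v] by linarith
    then show ?thesis by (auto simp: count_eq_zero_iff)
  qed
  have "cut_sum F = \<Prod>\<^sub># (image_mset tree_coproduct (forget F))"
  proof (rule add.IH)
    show "count (labels F) v \<le> 1" for v using le[of v] by linarith
  qed (use add.prems(1) in simp)
  then show ?case using cut_sum_add[OF disj] add.prems(1)[of t] by simp
qed

lemma cut_sum_tree:
  "(\<And>v. count (tree_labels t) v \<le> 1) \<Longrightarrow> cut_sum {#t#} = tree_coproduct (map_tree (\<lambda>_. ()) t)"
proof (induction t)
  case (Node a F)
  have c: "count (labels F) v + (if v = a then 1 else 0) \<le> 1" for v
    using Node.prems[of v] by (simp split: if_splits)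
  have "cut_sum F = \<Prod>\<^sub># (image_mset tree_coproduct (forget F))"
  proof (rule cut_sum_forest)
    fix t assume t: "t \<in># F"
    show "cut_sum {#t#} = tree_coproduct (map_tree (\<lambda>_. ()) t)"
    proof (rule Node.IH[OF t])
      fix v
      have "count (labels F) v = count (tree_labels t) v + count (labels (F - {#t#})) v"
        using t by (metis insert_DiffM labels_simps(2) count_union)
      with c[of v] show "count (tree_labels t) v \<le> 1" by linarith
    qed
  next
    fix v show "count (labels F) v \<le> 1" using c[of v] by linarith
  qed
  moreover have "a \<notin># labels F" using c[of a] by (simp add: count_eq_zero_iff)
  ultimately show ?case by (simp add: cut_sum_Node forget_def)
qed

text \<open>
  The sum over cuts of any labelling obeys the recursion of \<open>tree_coproduct\<close>. This shows at the same
  time that the choice of labels is irrelevant and that the coproduct is multiplicative.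
\<close>

theorem coproduct_eq_prod: "coproduct f = \<Prod>\<^sub># (image_mset tree_coproduct f)"
proof -
  have *: "forget (labelling f) = f" "count (labels (labelling f)) v \<le> 1" for v
    using is_labelling_labelling[of f] by (auto simp: is_labelling_def)
  have "cut_sum (labelling f) = \<Prod>\<^sub># (image_mset tree_coproduct (forget (labelling f)))"
  proof (rule cut_sum_forest[OF cut_sum_tree])
    fix t v assume "t \<in># labelling f"
    then have "count (labels (labelling f)) v = count (tree_labels t) v + count (labels (labelling f - {#t#})) v"
        by (metis insert_DiffM labels_simps(2) count_union)
    then show "count (tree_labels t) v \<le> 1" using *(2)[of v] by linarith
  qed (use * in auto)
  then show ?thesis by (simp add: coproduct_eq_cut_sum *)
qed

section \<open>Forests with at most four vertices\<close>

abbreviation rooted :: "forest \<Rightarrow> unit tree" where "rooted f \<equiv> Node () f"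
abbreviation dot :: "unit tree" where "dot \<equiv> rooted {#}"
abbreviation ladder2 :: "unit tree" where "ladder2 \<equiv> rooted {#dot#}"
abbreviation ladder3 :: "unit tree" where "ladder3 \<equiv> rooted {#ladder2#}"
abbreviation ladder4 :: "unit tree" where "ladder4 \<equiv> rooted {#ladder3#}"
abbreviation cherry :: "unit tree" where "cherry \<equiv> rooted {#dot, dot#}"
abbreviation cherry_stem :: "unit tree" where "cherry_stem \<equiv> rooted {#cherry#}"
abbreviation fork :: "unit tree" where "fork \<equiv> rooted {#dot, ladder2#}"
abbreviation claw :: "unit tree" where "claw \<equiv> rooted {#dot, dot, dot#}"

lemma weight_simps [simp]:
  "weight {#} = 0" "weight (add_mset t f) = size (tree_labels t) + weight f"
  "weight (f + g) = weight f + weight g"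
  by (simp_all add: weight_def)

lemma size_labels [simp]: "size (labels f) = weight f"
  by (simp add: weight_def)

text \<open>
  Removing the root of one tree lowers the weight by one; iterated, this enumerates small forests.
\<close>

lemma forest_weight_le_Suc:
  assumes "weight f \<le> Suc n"
  shows "f = {#} \<or> (\<exists>h g. f = add_mset (rooted h) g \<and> weight h + weight g \<le> n)"
proof (cases f)
  case (add t g)
  then obtain h where "t = rooted h" by (cases t) auto
  then have "f = add_mset (rooted h) g" "weight h + weight g \<le> n" using assms add by auto
  then show ?thesis by blast
qed simp

lemma forest_weight_0: "weight f \<le> 0 \<Longrightarrow> f = {#}"
  by (simp add: size_labels[symmetric] del: size_labels)

lemma forest_weight_le_1: "weight f \<le> 1 \<Longrightarrow> f \<in> {{#}, {#dot#}}"
  using forest_weight_le_Suc[of f 0] forest_weight_0 by auto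

lemma forest_weight_le_2:
  assumes "weight f \<le> 2" shows "f \<in> {{#}, {#dot#}, {#dot, dot#}, {#ladder2#}}"
proof (cases "f = {#}")
  case False
  then obtain h g where f: "f = add_mset (rooted h) g" "weight h + weight g \<le> 1"
    using forest_weight_le_Suc[of f 1] assms by (auto simp: numeral_2_eq_2)
  then have "h \<in> {{#}, {#dot#}}" "g \<in> {{#}, {#dot#}}" using forest_weight_le_1 by simp_all
  with f show ?thesis by auto
qed simp

lemma forest_weight_le_3:
  assumes "weight f \<le> 3"
  shows "f \<in> {{#}, {#dot#}, {#dot, dot#}, {#ladder2#}, {#dot, dot, dot#}, {#dot, ladder2#},
    {#ladder3#}, {#cherry#}}"
proof (cases "f = {#}")
  case False
  then obtain h g where f: "f = add_mset (rooted h) g" "weight h + weight g \<le> 2"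
    using forest_weight_le_Suc[of f 2] assms by (auto simp: numeral_eq_Suc)
  then have "h \<in> {{#}, {#dot#}, {#dot, dot#}, {#ladder2#}}" "g \<in> {{#}, {#dot#}, {#dot, dot#}, {#ladder2#}}"
    using forest_weight_le_2 by simp_all
  with f show ?thesis by auto
qed simp

lemma tree_weight_le_4:
  assumes "size (tree_labels t) \<le> 4"
  shows "t \<in> {dot, ladder2, ladder3, cherry, ladder4, cherry_stem, fork, claw}"
proof -
  obtain f where t: "t = rooted f" by (cases t) auto
  with assms have "weight f \<le> 3" by simp
  from forest_weight_le_3[OF this] show ?thesis unfolding t by auto
qed

section \<open>Natural growth and the projection onto primitives\<close>

lemma forget_eq_empty [simp]: "forget F = {#} \<longleftrightarrow> F = {#}"
  by (simp add: forget_def)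

lemma forget_eq_add_mset:
  "forget F = add_mset t f \<longleftrightarrow> (\<exists>G F'. F = add_mset G F' \<and> map_tree (\<lambda>_. ()) G = t \<and> forget F' = f)"
  unfolding forget_def using msed_map_invR[of "map_tree (\<lambda>_. ())" F t f] by auto

lemma forget_tree_eq_rooted:
  "map_tree (\<lambda>_. ()) G = rooted f \<longleftrightarrow> (\<exists>a F. G = Node a F \<and> forget F = f)"
  by (cases G) (auto simp: forget_def)

lemmas forget_eq_simps = forget_eq_add_mset forget_tree_eq_rooted

lemma forget_labelling: "forget (labelling f) = f"
  using is_labelling_labelling[of f] by (simp add: is_labelling_def)

text \<open>
  The injectivity of a labelling as a constant, so that it can be rewritten one vertex at a time.
\<close>

definition multiplicity_free :: "'a multiset \<Rightarrow> bool" where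
  "multiplicity_free N \<longleftrightarrow> (\<forall>v. count N v \<le> 1)"

lemma multiplicity_free_simps [simp]:
  "multiplicity_free {#}"
  "multiplicity_free (add_mset a N) \<longleftrightarrow> a \<notin># N \<and> multiplicity_free N"
proof -
  show "multiplicity_free (add_mset a N) \<longleftrightarrow> a \<notin># N \<and> multiplicity_free N"
  proof
    assume *: "multiplicity_free (add_mset a N)"
    have "count N a = 0" using *[unfolded multiplicity_free_def, THEN spec, of a] by simp
    moreover have "count N v \<le> 1" for v
      using *[unfolded multiplicity_free_def, THEN spec, of v] by (simp split: if_splits)
    ultimately show "a \<notin># N \<and> multiplicity_free N"
      by (simp add: multiplicity_free_def count_eq_zero_iff)
  next
    assume "a \<notin># N \<and> multiplicity_free N"
    then show "multiplicity_free (add_mset a N)"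
      by (auto simp: multiplicity_free_def count_eq_zero_iff[symmetric])
  qed
qed (simp add: multiplicity_free_def)

lemma labelling_multiplicity_free: "multiplicity_free (labels (labelling f))"
  using is_labelling_labelling[of f] by (simp add: is_labelling_def multiplicity_free_def)

text \<open>
  A forest whose labels erase to one of these shapes is that shape with names put on its vertices, and
  the names are distinct; the sum over vertices then has one explicit term for each of them.
\<close>

lemma ev_grow:
  "ev \<Phi> (grow f {#dot#}) = \<Phi> {#rooted f#}"
  "ev \<Phi> (grow f {#dot, dot#}) = \<Phi> {#dot, rooted f#}"
  "ev \<Phi> (grow f {#ladder2#}) = (\<Phi> {#rooted (add_mset dot f)#} + \<Phi> {#rooted {#rooted f#}#}) / 2"
  "ev \<Phi> (grow f {#dot, dot, dot#}) = \<Phi> {#dot, dot, rooted f#}"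
  "ev \<Phi> (grow f {#dot, ladder2#}) = (\<Phi> {#rooted f, ladder2#} +
     \<Phi> {#dot, rooted (add_mset dot f)#} + \<Phi> {#dot, rooted {#rooted f#}#}) / 3"
  "ev \<Phi> (grow f {#ladder3#}) = (\<Phi> {#rooted (add_mset ladder2 f)#} +
     \<Phi> {#rooted {#rooted (add_mset dot f)#}#} + \<Phi> {#rooted {#rooted {#rooted f#}#}#}) / 3"
proof -
  let ?goal = "\<lambda>g r. ev \<Phi> (grow f g) = r"
  show "?goal {#dot#} (\<Phi> {#rooted f#})"
    using forget_labelling[of "{#dot#}"] labelling_multiplicity_free[of "{#dot#}"]
    by (auto simp: forget_eq_simps grow_def graft_def)
  show "?goal {#dot, dot#} (\<Phi> {#dot, rooted f#})"
    using forget_labelling[of "{#dot, dot#}"] labelling_multiplicity_free[of "{#dot, dot#}"]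
    by (auto simp: forget_eq_simps grow_def graft_def add_mset_commute split: if_splits)
  show "?goal {#ladder2#} ((\<Phi> {#rooted (add_mset dot f)#} + \<Phi> {#rooted {#rooted f#}#}) / 2)"
    using forget_labelling[of "{#ladder2#}"] labelling_multiplicity_free[of "{#ladder2#}"]
    by (auto simp: forget_eq_simps grow_def graft_def split: if_splits)
  show "?goal {#dot, dot, dot#} (\<Phi> {#dot, dot, rooted f#})"
    using forget_labelling[of "{#dot, dot, dot#}"] labelling_multiplicity_free[of "{#dot, dot, dot#}"]
    by (auto simp: forget_eq_simps grow_def graft_def add_mset_commute split: if_splits)
  show "?goal {#dot, ladder2#} ((\<Phi> {#rooted f, ladder2#} +
     \<Phi> {#dot, rooted (add_mset dot f)#} + \<Phi> {#dot, rooted {#rooted f#}#}) / 3)"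
    using forget_labelling[of "{#dot, ladder2#}"] labelling_multiplicity_free[of "{#dot, ladder2#}"]
    by (auto simp: forget_eq_simps grow_def graft_def add_mset_commute split: if_splits)
  show "?goal {#ladder3#} ((\<Phi> {#rooted (add_mset ladder2 f)#} +
     \<Phi> {#rooted {#rooted (add_mset dot f)#}#} + \<Phi> {#rooted {#rooted {#rooted f#}#}#}) / 3)"
    using forget_labelling[of "{#ladder3#}"] labelling_multiplicity_free[of "{#ladder3#}"]
    by (auto simp: forget_eq_simps grow_def graft_def split: if_splits)
qed

lemma ev_natural_growth: "ev \<Phi> (x \<^bold>\<top> y) = ev (\<lambda>f. ev (\<lambda>g. ev \<Phi> (grow f g)) y) x"
  by (simp add: natural_growth_def)

lemma ev_numeral_mult [simp]:
  fixes p :: "'a::comm_monoid_add \<Rightarrow>\<^sub>0 real"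
  shows "ev \<Phi> (numeral n * p) = numeral n * ev \<Phi> p"
proof -
  have "ev \<Phi> (of_nat k * p) = of_nat k * ev \<Phi> p" for k
    by (induction k) (simp_all add: algebra_simps)
  from this[of "numeral n"] show ?thesis by simp
qed

lemma lin_ext_numeral_mult [simp]:
  fixes p :: "'a::comm_monoid_add \<Rightarrow>\<^sub>0 real" and \<phi> :: "'a \<Rightarrow> 'b::comm_monoid_add \<Rightarrow>\<^sub>0 real"
  shows "lin_ext \<phi> (numeral n * p) = numeral n * lin_ext \<phi> p"
  by (rule poly_mapping_eqI_ev) simp

lemma tree_coproduct_values:
  "tree_coproduct dot = basis ({#dot#}, {#}) + basis ({#}, {#dot#})"
  "tree_coproduct ladder2 = basis ({#ladder2#}, {#}) + basis ({#dot#}, {#dot#}) + basis ({#}, {#ladder2#})"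
  "tree_coproduct ladder3 = basis ({#ladder3#}, {#}) + basis ({#ladder2#}, {#dot#})
     + basis ({#dot#}, {#ladder2#}) + basis ({#}, {#ladder3#})"
  "tree_coproduct cherry = basis ({#cherry#}, {#}) + basis ({#dot, dot#}, {#dot#})
     + 2 * basis ({#dot#}, {#ladder2#}) + basis ({#}, {#cherry#})"
proof -
  show 1: "tree_coproduct dot = basis ({#dot#}, {#}) + basis ({#}, {#dot#})"
    by (simp flip: single_one add: zero_prod_def)
  show 2: "tree_coproduct ladder2 = basis ({#ladder2#}, {#}) + basis ({#dot#}, {#dot#}) + basis ({#}, {#ladder2#})"
    by (simp add: 1 add.assoc del: tree_coproduct.simps add: tree_coproduct.simps[of _ "{#dot#}"])
  show 3: "tree_coproduct ladder3 = basis ({#ladder3#}, {#}) + basis ({#ladder2#}, {#dot#})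
     + basis ({#dot#}, {#ladder2#}) + basis ({#}, {#ladder3#})"
    by (simp add: 2 add.assoc del: tree_coproduct.simps add: tree_coproduct.simps[of _ "{#ladder2#}"])
  show "tree_coproduct cherry = basis ({#cherry#}, {#}) + basis ({#dot, dot#}, {#dot#})
     + 2 * basis ({#dot#}, {#ladder2#}) + basis ({#}, {#cherry#})"
    by (simp add: 1 distrib_left distrib_right mult_single ac_simps del: tree_coproduct.simps
        add: tree_coproduct.simps[of _ "{#dot, dot#}"])
qed

lemma tree_coproduct_values_4:
  "tree_coproduct ladder4 = basis ({#ladder4#}, {#}) + basis ({#ladder3#}, {#dot#})
     + basis ({#ladder2#}, {#ladder2#}) + basis ({#dot#}, {#ladder3#}) + basis ({#}, {#ladder4#})"
  "tree_coproduct cherry_stem = basis ({#cherry_stem#}, {#}) + basis ({#cherry#}, {#dot#})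
     + basis ({#dot, dot#}, {#ladder2#}) + 2 * basis ({#dot#}, {#ladder3#}) + basis ({#}, {#cherry_stem#})"
  "tree_coproduct fork = basis ({#fork#}, {#}) + basis ({#dot, ladder2#}, {#dot#})
     + basis ({#dot, dot#}, {#ladder2#}) + basis ({#dot#}, {#ladder3#}) + basis ({#ladder2#}, {#ladder2#})
     + basis ({#dot#}, {#cherry#}) + basis ({#}, {#fork#})"
  "tree_coproduct claw = basis ({#claw#}, {#}) + basis ({#dot, dot, dot#}, {#dot#})
     + 3 * basis ({#dot, dot#}, {#ladder2#}) + 3 * basis ({#dot#}, {#cherry#}) + basis ({#}, {#claw#})"
  by (simp_all del: tree_coproduct.simps add: tree_coproduct_values distrib_left distrib_right
      mult_single ac_simps add_mset_commute tree_coproduct.simps[of _ "{#ladder3#}"] tree_coproduct.simps[of _ "{#cherry#}"]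
      tree_coproduct.simps[of _ "{#dot, ladder2#}"] tree_coproduct.simps[of _ "{#dot, dot, dot#}"])

declare tree_coproduct.simps [simp del]

text \<open>
  Only powers of the one-vertex tree have to be projected: \<open>\<pi>\<close> is applied to \<open>\<bullet>\<bullet>\<close> and \<open>\<bullet>\<bullet>\<bullet>\<close> alone.
\<close>

lemma coproduct_dots:
  "reduced_coproduct {#dot#} = 0"
  "reduced_coproduct {#dot, dot#} = 2 * basis ({#dot#}, {#dot#})"
  "reduced_coproduct {#dot, dot, dot#} = 3 * basis ({#dot#}, {#dot, dot#}) + 3 * basis ({#dot, dot#}, {#dot#})"
  by (simp_all add: reduced_coproduct_def coproduct_eq_prod tree_coproduct_values
      distrib_left distrib_right mult_single ac_simps)

lemma ev_proj_forest:
  assumes "f \<noteq> {#}"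
  shows "ev \<Phi> (proj_forest f) = \<Phi> f -
    ev (\<lambda>(a, b). ev (\<lambda>g. ev \<Phi> (grow a g)) (proj_forest b)) (reduced_coproduct f)"
  using assms by (subst proj_forest.simps) (simp add: ev_natural_growth case_prod_unfold)

lemma ev_proj_dot: "ev \<Phi> (proj_forest {#dot#}) = \<Phi> {#dot#}"
  by (simp add: ev_proj_forest coproduct_dots)

lemma ev_proj_dot2: "ev \<Phi> (proj_forest {#dot, dot#}) = \<Phi> {#dot, dot#} - 2 * \<Phi> {#ladder2#}"
  by (simp add: ev_proj_forest coproduct_dots ev_proj_dot ev_grow)

lemma ev_proj_dot3: "ev \<Phi> (proj_forest {#dot, dot, dot#}) =
    \<Phi> {#dot, dot, dot#} - 3 * \<Phi> {#dot, ladder2#} + 3 * \<Phi> {#ladder3#}"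
  by (simp add: ev_proj_forest coproduct_dots ev_proj_dot ev_proj_dot2 ev_grow) (simp add: field_simps)

abbreviation "p2 \<equiv> \<pi>\<^sub>P (\<^bold>\<bullet> * \<^bold>\<bullet>)"
abbreviation "p3 \<equiv> \<pi>\<^sub>P (\<^bold>\<bullet> * \<^bold>\<bullet> * \<^bold>\<bullet>)"

lemma ev_primitives:
  "ev \<Phi> \<^bold>\<bullet> = \<Phi> {#dot#}"
  "ev \<Phi> p2 = \<Phi> {#dot, dot#} - 2 * \<Phi> {#ladder2#}"
  "ev \<Phi> p3 = \<Phi> {#dot, dot, dot#} - 3 * \<Phi> {#dot, ladder2#} + 3 * \<Phi> {#ladder3#}"
  by (simp_all add: proj_def bullet_def mult_single ev_proj_dot2 ev_proj_dot3)

lemmas pairing_simps = pairing_eq_ev ev_natural_growth ev_primitives ev_grow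

text \<open>
  In each line the forests that are not trees have known values once the lower weights are known. What
  remains in weight four are four independent linear forms in the four trees with four vertices.
\<close>

lemma pairing_words:
  "\<langle>\<^bold>\<bullet>, x\<rangle> = x {#dot#}"
  "\<langle>p2, x\<rangle> = x {#dot, dot#} - 2 * x {#ladder2#}"
  "\<langle>p3, x\<rangle> = x {#dot, dot, dot#} - 3 * x {#dot, ladder2#} + 3 * x {#ladder3#}"
  "\<langle>\<^bold>\<bullet> \<^bold>\<top> p2, x\<rangle> = x {#dot, ladder2#} - x {#cherry#} - x {#ladder3#}"
  "\<langle>p2 \<^bold>\<top> \<^bold>\<bullet>, x\<rangle> = x {#cherry#} - 2 * x {#ladder3#}"
  "\<langle>p3 \<^bold>\<top> \<^bold>\<bullet>, x\<rangle> = x {#claw#} - 3 * x {#fork#} + 3 * x {#ladder4#}"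
  "\<langle>\<^bold>\<bullet> \<^bold>\<top> p3, x\<rangle> = x {#dot, dot, ladder2#}
     - (x {#ladder2, ladder2#} + x {#dot, cherry#} + x {#dot, ladder3#})
     + (x {#fork#} + x {#cherry_stem#} + x {#ladder4#})"
  "\<langle>(\<^bold>\<bullet> \<^bold>\<top> \<^bold>\<bullet>) \<^bold>\<top> p2, x\<rangle> = x {#dot, ladder3#} - (x {#fork#} + x {#ladder4#})"
  "\<langle>p2 \<^bold>\<top> p2, x\<rangle> = x {#dot, cherry#} - (x {#claw#} + x {#cherry_stem#})
     - 2 * x {#dot, ladder3#} + 2 * (x {#fork#} + x {#ladder4#})"
  by (simp_all add: pairing_simps add_mset_commute) (simp_all add: field_simps)

section \<open>Multiplicative functionals with prescribed values on words\<close>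

text \<open>
  The solution of the system \<open>pairing_words\<close> when the words \<open>\<bullet>\<close>, \<open>\<pi>(\<bullet>\<bullet>)\<close>, \<open>\<bullet> \<top> \<pi>(\<bullet>\<bullet>)\<close>,
  \<open>\<bullet> \<top> \<bullet> \<top> \<pi>(\<bullet>\<bullet>)\<close>, \<open>\<pi>(\<bullet>\<bullet>) \<top> \<pi>(\<bullet>\<bullet>)\<close> have the values \<open>x\<close>, \<open>w\<close>, \<open>j\<close>, \<open>k\<close>, \<open>m\<close> and the three words
  containing \<open>\<pi>(\<bullet>\<bullet>\<bullet>)\<close> vanish. \<open>S\<close> is the sum of the values of \<open>fork\<close> and \<open>ladder4\<close>. Trees with more
  than four vertices get the default value 0.
\<close>

definition tree_val :: "real \<Rightarrow> real \<Rightarrow> real \<Rightarrow> real \<Rightarrow> real \<Rightarrow> unit tree \<Rightarrow> real" where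
  "tree_val x w j k m t =
    (let l2 = (x\<^sup>2 - w) / 2; l3 = x ^ 3 / 6 - x * w / 2; Y = x ^ 3 / 3 - j;
         S = x * l3 - k; stem = l2\<^sup>2 - x\<^sup>2 * l2 + x * Y + k; claw3 = x * Y - stem - 2 * k - m
     in if t = dot then x else if t = ladder2 then l2 else if t = ladder3 then l3
     else if t = cherry then Y else if t = cherry_stem then stem else if t = claw then claw3
     else if t = fork then (S + claw3 / 3) / 2 else if t = ladder4 then (S - claw3 / 3) / 2 else 0)"

definition forest_val :: "real \<Rightarrow> real \<Rightarrow> real \<Rightarrow> real \<Rightarrow> real \<Rightarrow> forest \<Rightarrow> real" where
  "forest_val x w j k m f = \<Prod>\<^sub># (image_mset (tree_val x w j k m) f)"

lemma forest_val_simps [simp]: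
  "forest_val x w j k m {#} = 1"
  "forest_val x w j k m (add_mset t f) = tree_val x w j k m t * forest_val x w j k m f"
  "forest_val x w j k m (f + g) = forest_val x w j k m f * forest_val x w j k m g"
  by (simp_all add: forest_val_def)

lemma tree_val_simps:
  "tree_val x w j k m dot = x"
  "tree_val x w j k m ladder2 = (x\<^sup>2 - w) / 2"
  "tree_val x w j k m ladder3 = x ^ 3 / 6 - x * w / 2"
  "tree_val x w j k m cherry = x ^ 3 / 3 - j"
  "tree_val x w j k m cherry_stem = x ^ 4 / 12 + w\<^sup>2 / 4 - x * j + k"
  "tree_val x w j k m claw = x ^ 4 / 4 - w\<^sup>2 / 4 - 3 * k - m"
  "tree_val x w j k m fork = x ^ 4 / 8 - x\<^sup>2 * w / 4 - w\<^sup>2 / 24 - k - m / 6"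
  "tree_val x w j k m ladder4 = x ^ 4 / 24 - x\<^sup>2 * w / 4 + w\<^sup>2 / 24 + m / 6"
  by (simp_all add: tree_val_def Let_def field_simps power2_eq_square power3_eq_cube power4_eq_xxxx)

lemma pairing_forest_val:
  "\<langle>\<^bold>\<bullet>, forest_val x w j k m\<rangle> = x"
  "\<langle>p2, forest_val x w j k m\<rangle> = w"
  "\<langle>p3, forest_val x w j k m\<rangle> = 0"
  "\<langle>\<^bold>\<bullet> \<^bold>\<top> p2, forest_val x w j k m\<rangle> = j"
  "\<langle>p2 \<^bold>\<top> \<^bold>\<bullet>, forest_val x w j k m\<rangle> = x * w - j"
  "\<langle>p3 \<^bold>\<top> \<^bold>\<bullet>, forest_val x w j k m\<rangle> = 0"
  "\<langle>\<^bold>\<bullet> \<^bold>\<top> p3, forest_val x w j k m\<rangle> = 0"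
  "\<langle>(\<^bold>\<bullet> \<^bold>\<top> \<^bold>\<bullet>) \<^bold>\<top> p2, forest_val x w j k m\<rangle> = k"
  "\<langle>p2 \<^bold>\<top> p2, forest_val x w j k m\<rangle> = m"
  by (simp_all add: pairing_words tree_val_simps) (simp_all add: field_simps power2_eq_square power3_eq_cube power4_eq_xxxx)

text \<open>
  The arguments on the right are the Chen relations of iterated integrals, that is, deconcatenation of
  words. Since the trees solve the system for the words, their values follow the coproduct of trees.
\<close>

lemma chen_tree:
  fixes x w j k m x' w' j' k' m' :: real
  assumes t: "size (tree_labels t) \<le> 4"
  shows "ev (\<lambda>(a, b). forest_val x w j k m a * forest_val x' w' j' k' m' b) (tree_coproduct t) =
    tree_val (x + x') (w + w') (j + j' + x * w') (k + k' + (x\<^sup>2 - w) / 2 * w' + x * j')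
      (m + m' + w * w') t"
  using tree_weight_le_4[OF t]
  by (elim insertE emptyE; simp add: tree_coproduct_values tree_coproduct_values_4 tree_val_simps)
    (simp_all add: field_simps power2_eq_square power3_eq_cube power4_eq_xxxx)

lemma chen_forest:
  assumes "weight f \<le> 4"
  shows "ev (\<lambda>(a, b). forest_val x w j k m a * forest_val x' w' j' k' m' b) (coproduct f) =
    forest_val (x + x') (w + w') (j + j' + x * w') (k + k' + (x\<^sup>2 - w) / 2 * w' + x * j')
      (m + m' + w * w') f"
  using assms
proof (induction f)
  case empty
  then show ?case by (simp add: coproduct_eq_prod flip: single_one) (simp add: zero_prod_def)
next
  case (add t f)
  have "ev (\<lambda>(a, b). forest_val x w j k m a * forest_val x' w' j' k' m' b) (coproduct (add_mset t f)) =
    ev (\<lambda>(a, b). forest_val x w j k m a * forest_val x' w' j' k' m' b) (tree_coproduct t) *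
    ev (\<lambda>(a, b). forest_val x w j k m a * forest_val x' w' j' k' m' b) (coproduct f)"
    by (simp add: coproduct_eq_prod) (rule ev_mult, auto)
  then show ?case using add by (simp add: chen_tree)
qed

text \<open>
  The equations for the words are solved one weight at a time, each weight using the products of the
  lower ones.
\<close>

lemma forest_val_unique:
  fixes y :: "forest \<Rightarrow> real"
  assumes empty: "y {#} = 1"
    and mult: "\<And>f g. weight (f + g) \<le> 4 \<Longrightarrow> y (f + g) = y f * y g"
    and words: "\<langle>\<^bold>\<bullet>, y\<rangle> = x" "\<langle>p2, y\<rangle> = w" "\<langle>p3, y\<rangle> = 0" "\<langle>\<^bold>\<bullet> \<^bold>\<top> p2, y\<rangle> = j"
      "\<langle>p3 \<^bold>\<top> \<^bold>\<bullet>, y\<rangle> = 0" "\<langle>\<^bold>\<bullet> \<^bold>\<top> p3, y\<rangle> = 0" "\<langle>(\<^bold>\<bullet> \<^bold>\<top> \<^bold>\<bullet>) \<^bold>\<top> p2, y\<rangle> = k" "\<langle>p2 \<^bold>\<top> p2, y\<rangle> = m"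
    and f: "weight f \<le> 4"
  shows "y f = forest_val x w j k m f"
proof -
  have mult': "y (add_mset t f) = y {#t#} * y f" if "weight (add_mset t f) \<le> 4" for t f
    using mult[of "{#t#}" f] that by simp
  have dot: "y {#dot#} = x" using words(1) by (simp add: pairing_words)
  have l2: "y {#ladder2#} = (x\<^sup>2 - w) / 2"
    using words(2) mult'[of dot "{#dot#}"] by (simp add: pairing_words dot power2_eq_square)
  have dots: "y {#dot, dot, dot#} = x ^ 3" "y {#dot, ladder2#} = x * ((x\<^sup>2 - w) / 2)"
    using mult'[of dot "{#dot, dot#}"] mult'[of dot "{#dot#}"] mult'[of dot "{#ladder2#}"]
    by (simp_all add: dot l2 power3_eq_cube)
  have l3: "y {#ladder3#} = x ^ 3 / 6 - x * w / 2"
    using words(3) unfolding pairing_words dots by (simp add: field_simps power2_eq_square power3_eq_cube)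
  have cherry: "y {#cherry#} = x ^ 3 / 3 - j"
    using words(4) unfolding pairing_words dots l3 by (simp add: field_simps power2_eq_square power3_eq_cube)
  have prods: "y {#dot, dot, ladder2#} = x\<^sup>2 * ((x\<^sup>2 - w) / 2)"
    "y {#ladder2, ladder2#} = ((x\<^sup>2 - w) / 2)\<^sup>2"
    "y {#dot, cherry#} = x * (x ^ 3 / 3 - j)" "y {#dot, ladder3#} = x * (x ^ 3 / 6 - x * w / 2)"
    using mult'[of dot "{#dot, ladder2#}"] mult'[of ladder2 "{#ladder2#}"] mult'[of dot "{#cherry#}"]
      mult'[of dot "{#ladder3#}"]
    by (simp_all add: dot l2 l3 cherry dots power2_eq_square)
  note eqs = words(5-8)[unfolded pairing_words prods]
  have stem: "y {#cherry_stem#} = x ^ 4 / 12 + w\<^sup>2 / 4 - x * j + k"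
    using eqs by (simp add: field_simps power2_eq_square power3_eq_cube power4_eq_xxxx)
  have claw: "y {#claw#} = x ^ 4 / 4 - w\<^sup>2 / 4 - 3 * k - m"
    using eqs stem by (simp add: field_simps power2_eq_square power3_eq_cube power4_eq_xxxx)
  have fork: "y {#fork#} = x ^ 4 / 8 - x\<^sup>2 * w / 4 - w\<^sup>2 / 24 - k - m / 6"
    using eqs stem claw by (simp add: field_simps power2_eq_square power3_eq_cube power4_eq_xxxx)
  have l4: "y {#ladder4#} = x ^ 4 / 24 - x\<^sup>2 * w / 4 + w\<^sup>2 / 24 + m / 6"
    using eqs stem claw fork by (simp add: field_simps power2_eq_square power3_eq_cube power4_eq_xxxx)
  have tree: "y {#t#} = tree_val x w j k m t" if "size (tree_labels t) \<le> 4" for t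
    using tree_weight_le_4[OF that]
    by (elim insertE emptyE; simp add: tree_val_simps dot l2 l3 cherry stem claw fork l4)
  show ?thesis using f
  proof (induction f)
    case (add t f)
    then show ?case using mult'[of t f] tree[of t] by simp
  qed (simp add: empty)
qed

text \<open>
  Every value is a homogeneous polynomial whose degree is the number of vertices, when \<open>x\<close>, \<open>w\<close>, \<open>j\<close>
  have the degrees 1, 2, 3 and \<open>k\<close>, \<open>m\<close> the degree 4. The absolute values of its coefficients sum to
  less than 6.
\<close>

lemma tree_val_bound:
  fixes a :: real
  assumes a: "0 \<le> a" and t: "size (tree_labels t) \<le> 4"
    and b: "\<bar>x\<bar> \<le> a" "\<bar>w\<bar> \<le> a\<^sup>2" "\<bar>j\<bar> \<le> a ^ 3" "\<bar>k\<bar> \<le> a ^ 4" "\<bar>m\<bar> \<le> a ^ 4"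
  shows "\<bar>tree_val x w j k m t\<bar> \<le> 6 * a ^ size (tree_labels t)"
proof -
  have x2: "\<bar>x\<^sup>2\<bar> \<le> a\<^sup>2" and x3: "\<bar>x ^ 3\<bar> \<le> a ^ 3" and x4: "\<bar>x ^ 4\<bar> \<le> a ^ 4" for n
    using power_mono[OF b(1) abs_ge_zero] by (simp_all only: power_abs[symmetric])
  have w2: "\<bar>w\<^sup>2\<bar> \<le> a ^ 4"
    using power_mono[OF b(2) abs_ge_zero, of 2] by (simp add: power_abs flip: power_mult)
  have xw: "\<bar>x * w\<bar> \<le> a ^ 3"
    using mult_mono[OF b(1,2)] a by (simp add: abs_mult power3_eq_cube power2_eq_square mult.assoc)
  have xxw: "\<bar>x\<^sup>2 * w\<bar> \<le> a ^ 4"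
    using mult_mono[OF x2 b(2)] a by (simp add: abs_mult power4_eq_xxxx power2_eq_square mult.assoc)
  have xj: "\<bar>x * j\<bar> \<le> a ^ 4"
    using mult_mono[OF b(1,3)] a by (simp add: abs_mult power4_eq_xxxx power3_eq_cube mult.assoc)
  note bounds = x2 x3 x4 w2 xw xxw xj b
  have nn: "0 \<le> a\<^sup>2" "0 \<le> a ^ 3" "0 \<le> a ^ 4" using a by simp_all
  have sizes: "size (tree_labels dot) = 1" "size (tree_labels ladder2) = 2"
    "size (tree_labels ladder3) = 3" "size (tree_labels cherry) = 3"
    "size (tree_labels cherry_stem) = 4" "size (tree_labels claw) = 4"
    "size (tree_labels fork) = 4" "size (tree_labels ladder4) = 4"
    by simp_all
  from tree_weight_le_4[OF t] show ?thesis
    apply (elim insertE emptyE; simp only: tree_val_simps sizes power_one_right)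
    using bounds nn by argo+
qed

lemma forest_val_bound:
  fixes a :: real
  assumes a: "0 \<le> a" and f: "weight f \<le> 4"
    and b: "\<bar>x\<bar> \<le> a" "\<bar>w\<bar> \<le> a\<^sup>2" "\<bar>j\<bar> \<le> a ^ 3" "\<bar>k\<bar> \<le> a ^ 4" "\<bar>m\<bar> \<le> a ^ 4"
  shows "\<bar>forest_val x w j k m f\<bar> \<le> 6 ^ size f * a ^ weight f"
  using f
proof (induction f)
  case (add t f)
  have "\<bar>tree_val x w j k m t\<bar> * \<bar>forest_val x w j k m f\<bar>
      \<le> (6 * a ^ size (tree_labels t)) * (6 ^ size f * a ^ weight f)"
    by (rule mult_mono[OF tree_val_bound[OF a _ b]]) (use add a in auto)
  then show ?case by (simp add: abs_mult power_add mult_ac)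
qed simp

text \<open>
  Chen relations for five words and one homogeneous bound are all that has to be known about the data:
  the former give Chen's identity on forests, the latter gives the estimate for every forest.
\<close>

lemma branched_rough_path_forest_val:
  fixes X W :: "real \<Rightarrow> real" and j k m :: "real \<Rightarrow> real \<Rightarrow> real"
  assumes \<rho>: "4 < \<rho>" "\<rho> < 5"
    and chen_j: "\<And>s u t. j s t = j s u + j u t + (X u - X s) * (W t - W u)"
    and chen_k: "\<And>s u t. k s t = k s u + k u t + ((X u - X s)\<^sup>2 - (W u - W s)) / 2 * (W t - W u)
      + (X u - X s) * j u t"
    and chen_m: "\<And>s u t. m s t = m s u + m u t + (W u - W s) * (W t - W u)"
    and K: "0 \<le> K"
    and bound: "\<And>s t. 0 \<le> s \<Longrightarrow> s < t \<Longrightarrow> t \<le> T \<Longrightarrow> 0 \<le> c s t \<and>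
      (let a = K * c s t powr (1 / \<rho>) in \<bar>X t - X s\<bar> \<le> a \<and> \<bar>W t - W s\<bar> \<le> a\<^sup>2 \<and>
        \<bar>j s t\<bar> \<le> a ^ 3 \<and> \<bar>k s t\<bar> \<le> a ^ 4 \<and> \<bar>m s t\<bar> \<le> a ^ 4)"
  shows "branched_rough_path \<rho> T c
    (\<lambda>s t. forest_val (X t - X s) (W t - W s) (j s t) (k s t) (m s t))"
proof -
  have fl: "\<lfloor>\<rho>\<rfloor> = 4" using \<rho> by linarith
  show ?thesis
    unfolding branched_rough_path_def fl
  proof (intro conjI allI impI)
    fix s u t :: real and f :: forest assume "0 \<le> s \<and> s \<le> u \<and> u \<le> t \<and> t \<le> T \<and> int (weight f) \<le> 4"
    then have "weight f \<le> 4" by simp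
    from chen_forest[OF this, of "X u - X s" "W u - W s" "j s u" "k s u" "m s u"
        "X t - X u" "W t - W u" "j u t" "k u t" "m u t"]
    show "forest_val (X t - X s) (W t - W s) (j s t) (k s t) (m s t) f =
      (\<Sum>(a, b)\<in>Poly_Mapping.keys (coproduct f). Poly_Mapping.lookup (coproduct f) (a, b) *
        (forest_val (X u - X s) (W u - W s) (j s u) (k s u) (m s u) a *
         forest_val (X t - X u) (W t - W u) (j u t) (k u t) (m u t) b))"
      by (simp add: ev_def case_prod_unfold chen_j[of s t u] chen_k[of s t u] chen_m[of s t u])
  next
    fix f :: forest assume f: "f \<noteq> {#} \<and> int (weight f) \<le> 4"
    have "\<bar>forest_val (X t - X s) (W t - W s) (j s t) (k s t) (m s t) f\<bar>
        \<le> (6 ^ size f * K ^ weight f) * c s t powr (real (weight f) / \<rho>)"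
      if st: "0 \<le> s \<and> s < t \<and> t \<le> T" for s t
    proof -
      let ?a = "K * c s t powr (1 / \<rho>)"
      have b: "0 \<le> c s t" "\<bar>X t - X s\<bar> \<le> ?a" "\<bar>W t - W s\<bar> \<le> ?a\<^sup>2" "\<bar>j s t\<bar> \<le> ?a ^ 3"
          "\<bar>k s t\<bar> \<le> ?a ^ 4" "\<bar>m s t\<bar> \<le> ?a ^ 4"
        using bound[of s t] st by (auto simp: Let_def)
      have "\<bar>forest_val (X t - X s) (W t - W s) (j s t) (k s t) (m s t) f\<bar> \<le> 6 ^ size f * ?a ^ weight f"
        by (rule forest_val_bound) (use b K f in auto)
      also have "?a ^ weight f = K ^ weight f * c s t powr (real (weight f) / \<rho>)"
      proof -
        have "weight f \<noteq> 0" using f forest_weight_0[of f] by auto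
        then have "(c s t powr (1 / \<rho>)) ^ weight f = c s t powr (real (weight f) / \<rho>)"
          by (simp add: powr_powr flip: powr_realpow')
        then show ?thesis by (simp add: power_mult_distrib)
      qed
      finally show ?thesis by (simp add: mult.assoc)
    qed
    then show "\<exists>C. \<forall>s t. 0 \<le> s \<and> s < t \<and> t \<le> T \<longrightarrow>
        \<bar>forest_val (X t - X s) (W t - W s) (j s t) (k s t) (m s t) f\<bar>
          \<le> C * c s t powr (real (weight f) / \<rho>)" by blast
  qed auto
qed

section \<open>Controls from dyadic sums\<close>

text \<open>
  If \<open>A\<close> is the integral of \<open>X\<close> against \<open>W\<close>, this is the integral of \<open>X - X s\<close> over \<open>[s, t]\<close>. Being
  defined from the path \<open>A\<close>, it satisfies its Chen relation for all times simultaneously.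
\<close>

definition area :: "(real \<Rightarrow> real) \<Rightarrow> (real \<Rightarrow> real) \<Rightarrow> (real \<Rightarrow> real) \<Rightarrow> real \<Rightarrow> real \<Rightarrow> real" where
  "area X W A s t = A t - A s - X s * (W t - W s)"

text \<open>
  If \<open>B\<close> is the integral of the square of \<open>X\<close>, this is the integral of the square of \<open>X - X s\<close>.
\<close>

definition sq_area :: "(real \<Rightarrow> real) \<Rightarrow> (real \<Rightarrow> real) \<Rightarrow> (real \<Rightarrow> real) \<Rightarrow> (real \<Rightarrow> real) \<Rightarrow> real \<Rightarrow> real \<Rightarrow> real" where
  "sq_area X W A B s t = B t - B s - 2 * X s * (A t - A s) + (X s)\<^sup>2 * (W t - W s)"

lemma area_chen: "area X W A s t = area X W A s u + area X W A u t + (X u - X s) * (W t - W u)"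
  by (simp add: area_def algebra_simps)

lemma sq_area_chen: "sq_area X W A B s t = sq_area X W A B s u + sq_area X W A B u t
    + (X u - X s)\<^sup>2 * (W t - W u) + 2 * (X u - X s) * area X W A u t"
  by (simp add: area_def sq_area_def algebra_simps power2_eq_square)

text \<open>
  The number \<open>a\<close> dominates a homogeneous norm of the increment of \<open>(X, W, A, B)\<close> over \<open>[s, t]\<close>, in
  which the coordinates have the degrees 1, 2, 3, 4 and time has the degree 4.
\<close>

definition hom_bound where
  "hom_bound X W A B s t a \<longleftrightarrow> 0 \<le> a \<and> \<bar>X t - X s\<bar> \<le> a \<and> \<bar>W t - W s\<bar> \<le> a\<^sup>2 \<and>
     \<bar>area X W A s t\<bar> \<le> a ^ 3 \<and> \<bar>sq_area X W A B s t\<bar> \<le> a ^ 4 \<and> t - s \<le> a ^ (4::nat)"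
  for X W A B :: "real \<Rightarrow> real" and a :: real

lemma hom_bound_refl: "0 \<le> a \<Longrightarrow> hom_bound X W A B s s a"
  by (simp add: hom_bound_def area_def sq_area_def)

lemma hom_bound_mono: "hom_bound X W A B s t a \<Longrightarrow> a \<le> b \<Longrightarrow> hom_bound X W A B s t b"
  unfolding hom_bound_def by (meson order.trans power_mono)

text \<open>
  The mixed terms of the Chen relations are dominated by those of the powers of \<open>a + b\<close>.
\<close>

lemma hom_bound_trans:
  assumes "hom_bound X W A B s u a" "hom_bound X W A B u t b"
  shows "hom_bound X W A B s t (a + b)"
proof -
  have h: "0 \<le> a" "\<bar>X u - X s\<bar> \<le> a" "\<bar>W u - W s\<bar> \<le> a\<^sup>2" "\<bar>area X W A s u\<bar> \<le> a ^ 3"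
      "\<bar>sq_area X W A B s u\<bar> \<le> a ^ 4" "u - s \<le> a ^ 4"
      "0 \<le> b" "\<bar>X t - X u\<bar> \<le> b" "\<bar>W t - W u\<bar> \<le> b\<^sup>2" "\<bar>area X W A u t\<bar> \<le> b ^ 3"
      "\<bar>sq_area X W A B u t\<bar> \<le> b ^ 4" "t - u \<le> b ^ 4"
    using assms by (auto simp: hom_bound_def)
  have a: "0 \<le> a" and b: "0 \<le> b" using h(1,7) .
  let ?x = "X u - X s" and ?w = "W t - W u"
  have xw: "\<bar>?x * ?w\<bar> \<le> a * b\<^sup>2"
    unfolding abs_mult by (rule mult_mono[OF h(2,9) a abs_ge_zero])
  have xxw: "\<bar>?x\<^sup>2 * ?w\<bar> \<le> a\<^sup>2 * b\<^sup>2"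
    unfolding abs_mult power_abs
    by (rule mult_mono[OF power_mono[OF h(2)] h(9)]) simp_all
  have xj: "\<bar>?x * area X W A u t\<bar> \<le> a * b ^ 3"
    unfolding abs_mult by (rule mult_mono[OF h(2,10) a abs_ge_zero])
  have nn: "0 \<le> a\<^sup>2 * b" "0 \<le> a * b\<^sup>2" "0 \<le> a * b ^ 3" "0 \<le> a\<^sup>2 * b\<^sup>2" "0 \<le> a ^ 3 * b" "0 \<le> a * b"
    using a b by simp_all
  have e2: "(a + b)\<^sup>2 = a\<^sup>2 + 2 * (a * b) + b\<^sup>2" by (simp add: power2_eq_square algebra_simps)
  have e3: "(a + b) ^ 3 = a ^ 3 + 3 * (a\<^sup>2 * b) + 3 * (a * b\<^sup>2) + b ^ 3"
    by (simp add: power2_eq_square power3_eq_cube algebra_simps)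
  have e4: "(a + b) ^ 4 = a ^ 4 + 4 * (a ^ 3 * b) + 6 * (a\<^sup>2 * b\<^sup>2) + 4 * (a * b ^ 3) + b ^ 4"
    by (simp add: power2_eq_square power3_eq_cube power4_eq_xxxx algebra_simps)
  have c3: "area X W A s t = area X W A s u + area X W A u t + ?x * ?w" by (rule area_chen)
  have c4: "sq_area X W A B s t = sq_area X W A B s u + sq_area X W A B u t
    + ?x\<^sup>2 * ?w + 2 * (?x * area X W A u t)" using sq_area_chen[of X W A B s t u] by simp
  have "\<bar>X t - X s\<bar> \<le> a + b"
    using h(2,8) abs_triangle_ineq[of "X t - X u" ?x] by simp
  moreover have "\<bar>W t - W s\<bar> \<le> a\<^sup>2 + b\<^sup>2"
    using h(3,9) abs_triangle_ineq[of ?w "W u - W s"] by simp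
  then have "\<bar>W t - W s\<bar> \<le> (a + b)\<^sup>2" using nn unfolding e2 by simp
  moreover have "\<bar>area X W A s t\<bar> \<le> a ^ 3 + b ^ 3 + a * b\<^sup>2"
    unfolding c3 by (rule order.trans[OF abs_triangle_ineq] add_mono h xw)+
  then have "\<bar>area X W A s t\<bar> \<le> (a + b) ^ 3" using nn unfolding e3 by simp
  moreover have "\<bar>2 * (?x * area X W A u t)\<bar> \<le> 2 * (a * b ^ 3)" using xj by simp
  then have "\<bar>sq_area X W A B s t\<bar> \<le> a ^ 4 + b ^ 4 + a\<^sup>2 * b\<^sup>2 + 2 * (a * b ^ 3)"
    unfolding c4 by - (rule order.trans[OF abs_triangle_ineq] add_mono h xxw | assumption)+
  then have "\<bar>sq_area X W A B s t\<bar> \<le> (a + b) ^ 4" using nn unfolding e4 by linarith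
  moreover have "t - s \<le> (a + b) ^ 4" using h(6,12) nn unfolding e4 by linarith
  ultimately show ?thesis using a b by (simp add: hom_bound_def)
qed

text \<open>
  Comparable to the \<open>\<rho>\<close>-th power of the homogeneous norm. A sum is used in place of a maximum since
  its expectation can be estimated term by term.
\<close>

definition variation where
  "variation \<rho> X W A B s t = \<bar>X t - X s\<bar> powr \<rho> + \<bar>W t - W s\<bar> powr (\<rho> / 2) +
     \<bar>area X W A s t\<bar> powr (\<rho> / 3) + \<bar>sq_area X W A B s t\<bar> powr (\<rho> / 4) + (t - s) powr (\<rho> / 4)"
  for \<rho> :: real

lemma variation_nonneg [simp]: "0 \<le> variation \<rho> X W A B s t"
  by (simp add: variation_def)

lemma le_powr_of_powr_le:
  fixes y v :: real
  assumes "0 \<le> y" "y powr (\<rho> / real n) \<le> v" "0 < \<rho>" "0 < n"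
  shows "y \<le> (v powr (1 / \<rho>)) ^ n"
proof -
  have v: "0 \<le> v" using assms(2) by (rule order.trans[OF powr_ge_zero])
  have "y = (y powr (\<rho> / real n)) powr (real n / \<rho>)"
    using assms by (simp add: powr_powr)
  also have "\<dots> \<le> v powr (real n / \<rho>)" using assms by (intro powr_mono2) auto
  also have "\<dots> = (v powr (1 / \<rho>)) ^ n"
    using assms(4) by (simp add: powr_powr flip: powr_realpow')
  finally show ?thesis .
qed

lemma hom_bound_variation:
  assumes "s \<le> t" "0 < \<rho>"
  shows "hom_bound X W A B s t (variation \<rho> X W A B s t powr (1 / \<rho>))"
proof -
  let ?v = "variation \<rho> X W A B s t"
  have le: "\<bar>X t - X s\<bar> powr (\<rho> / real 1) \<le> ?v" "\<bar>W t - W s\<bar> powr (\<rho> / real 2) \<le> ?v"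
    "\<bar>area X W A s t\<bar> powr (\<rho> / real 3) \<le> ?v" "\<bar>sq_area X W A B s t\<bar> powr (\<rho> / real 4) \<le> ?v"
    "(t - s) powr (\<rho> / real 4) \<le> ?v"
    by (simp_all add: variation_def)
  show ?thesis
    unfolding hom_bound_def
    using le_powr_of_powr_le[OF _ le(1)] le_powr_of_powr_le[OF _ le(2)] le_powr_of_powr_le[OF _ le(3)]
      le_powr_of_powr_le[OF _ le(4)] le_powr_of_powr_le[OF _ le(5)] assms by simp
qed

definition clamp01 :: "real \<Rightarrow> real" where "clamp01 x = max 0 (min 1 x)"

definition dyadic :: "real \<Rightarrow> nat \<Rightarrow> nat \<Rightarrow> real" where "dyadic T n k = T * real k / 2 ^ n"

lemma dyadic_mono: "0 < T \<Longrightarrow> i \<le> j \<Longrightarrow> dyadic T n i \<le> dyadic T n j"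
  by (simp add: dyadic_def divide_simps)

lemma dyadic_le_iff: "0 < T \<Longrightarrow> dyadic T n i \<le> dyadic T n j \<longleftrightarrow> i \<le> j"
  by (simp add: dyadic_def divide_le_cancel)

lemma dyadic_double: "dyadic T (Suc n) (2 * k) = dyadic T n k"
  by (simp add: dyadic_def)

text \<open>
  The mass \<open>r ^ n * v n k\<close> is spread uniformly over the dyadic interval with number \<open>k\<close> of level \<open>n\<close>,
  and \<open>G t\<close> is the mass to the left of \<open>t\<close>. Summability makes the series of continuous functions
  converge uniformly.
\<close>

lemma additive_control_exists:
  fixes v :: "nat \<Rightarrow> nat \<Rightarrow> real"
  assumes T: "0 < T" and v: "\<And>n k. 0 \<le> v n k" and r: "0 \<le> r"
    and sm: "summable (\<lambda>n. r ^ n * (\<Sum>k<2 ^ n. v n k))"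
  obtains G :: "real \<Rightarrow> real" where "continuous_on UNIV G" "mono G"
    "\<And>n k. k < 2 ^ n \<Longrightarrow> r ^ n * v n k \<le> G (dyadic T n (Suc k)) - G (dyadic T n k)"
proof -
  define g where "g n t = r ^ n * (\<Sum>k<2 ^ n. v n k * clamp01 (t * 2 ^ n / T - real k))" for n t
  have c01: "0 \<le> clamp01 x" "clamp01 x \<le> 1" "x \<le> y \<Longrightarrow> clamp01 x \<le> clamp01 y" for x y
    by (auto simp: clamp01_def)
  have g0: "0 \<le> g n t" for n t unfolding g_def using r v c01 by (intro mult_nonneg_nonneg sum_nonneg) auto
  have g1: "g n t \<le> r ^ n * (\<Sum>k<2 ^ n. v n k)" for n t
    unfolding g_def using r v c01 by (intro mult_left_mono sum_mono) (auto intro: mult_left_le)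
  have gm: "g n s \<le> g n t" if "s \<le> t" for n s t
    unfolding g_def using r v T that
    by (intro mult_left_mono sum_mono c01) (auto simp: divide_simps)
  have gs: "summable (\<lambda>n. g n t)" for t
    by (rule summable_comparison_test'[OF sm, of 0]) (use g0 g1 in \<open>simp add: abs_of_nonneg\<close>)
  define G where "G t = suminf (\<lambda>n. g n t)" for t
  show ?thesis
  proof
    have "uniform_limit UNIV (\<lambda>n t. \<Sum>i<n. g i t) (\<lambda>t. suminf (\<lambda>i. g i t)) sequentially"
      by (rule Weierstrass_m_test[OF _ sm]) (use g0 g1 in \<open>simp add: abs_of_nonneg\<close>)
    moreover have "continuous_on UNIV (\<lambda>t. \<Sum>i<n. g i t)" for n
      unfolding g_def clamp01_def using T by (intro continuous_intros) auto
    ultimately show "continuous_on UNIV G"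
      unfolding G_def by (intro uniform_limit_theorem[rotated]) auto
    show "mono G" unfolding G_def mono_def using suminf_le[OF _ gs gs] gm by blast
    fix n k :: nat assume k: "k < 2 ^ n"
    let ?s = "dyadic T n k" and ?t = "dyadic T n (Suc k)"
    have st: "?s \<le> ?t" using T by (intro dyadic_mono) auto
    have xs: "?s * 2 ^ n / T = real k" "?t * 2 ^ n / T = real (Suc k)"
      using T by (simp_all add: dyadic_def)
    have "r ^ n * v n k = r ^ n * (v n k * (clamp01 (?t * 2 ^ n / T - real k) - clamp01 (?s * 2 ^ n / T - real k)))"
      unfolding xs by (simp add: clamp01_def)
    also have "\<dots> \<le> r ^ n * (\<Sum>i<2 ^ n. v n i * (clamp01 (?t * 2 ^ n / T - real i) - clamp01 (?s * 2 ^ n / T - real i)))"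
      using r v T k st by (intro mult_left_mono member_le_sum mult_nonneg_nonneg)
        (auto simp: divide_simps intro!: c01)
    also have "\<dots> = g n ?t - g n ?s"
      unfolding g_def by (simp add: algebra_simps sum_subtractf)
    also have "\<dots> \<le> suminf (\<lambda>i. g i ?t - g i ?s)"
      using sum_le_suminf[OF summable_diff[OF gs gs], of "{n}" ?t ?s] gm[OF st] by simp
    also have "\<dots> = G ?t - G ?s" unfolding G_def by (rule suminf_diff[OF gs gs, symmetric])
    finally show "r ^ n * v n k \<le> G ?t - G ?s" .
  qed
qed

text \<open>
  An interval with endpoints of level \<open>n + 1\<close> is an interval with endpoints of level \<open>n\<close>, prolonged on
  either side by at most one dyadic interval of level \<open>n + 1\<close>.
\<close>

lemma dyadic_chaining:
  assumes T: "0 < T" and z: "0 \<le> z" and \<theta>: "0 \<le> \<theta>"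
    and step: "\<And>n k. k < 2 ^ n \<Longrightarrow> s \<le> dyadic T n k \<Longrightarrow> dyadic T n (Suc k) \<le> t \<Longrightarrow>
      hom_bound X W A B (dyadic T n k) (dyadic T n (Suc k)) (z ^ n * \<theta>)"
  shows "i \<le> l \<Longrightarrow> l \<le> 2 ^ n \<Longrightarrow> s \<le> dyadic T n i \<Longrightarrow> dyadic T n l \<le> t \<Longrightarrow>
    hom_bound X W A B (dyadic T n i) (dyadic T n l) (2 * (\<Sum>m\<le>n. z ^ m) * \<theta>)"
proof (induction n arbitrary: i l)
  case 0
  then consider "i = l" | "i = 0" "l = 1" by fastforce
  then show ?case
  proof cases
    case 1 then show ?thesis using \<theta> by (simp add: hom_bound_refl)
  next
    case 2
    have "hom_bound X W A B (dyadic T 0 i) (dyadic T 0 l) (1 * \<theta>)" using step[of 0 0] 2 0 by simp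
    then show ?thesis by (rule hom_bound_mono) (use \<theta> in simp)
  qed
next
  case (Suc n)
  let ?S = "2 * (\<Sum>m\<le>n. z ^ m) * \<theta>" and ?e = "z ^ Suc n * \<theta>"
  have S: "0 \<le> ?S" "0 \<le> ?e" using z \<theta> by (auto intro!: mult_nonneg_nonneg sum_nonneg)
  show ?case
  proof (cases "i = l")
    case True
    have "0 \<le> 2 * (\<Sum>m\<le>Suc n. z ^ m) * \<theta>"
      using z \<theta> by (intro mult_nonneg_nonneg sum_nonneg) auto
    then show ?thesis unfolding True by (rule hom_bound_refl)
  next
    case False
    \<comment> \<open>The endpoints are moved inwards to the nearest points of the coarser level.\<close>
    define i' l' where "i' = (i + 1) div 2" and "l' = l div 2"
    have il: "i' \<le> l'" "i \<le> 2 * i'" "2 * i' \<le> i + 1" "2 * l' \<le> l" "l \<le> 2 * l' + 1" "l' \<le> 2 ^ n"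
      using Suc.prems False by (auto simp: i'_def l'_def)
    have pt: "s \<le> dyadic T n i'" "dyadic T n l' \<le> t"
      using dyadic_mono[OF T il(2), of "Suc n"] dyadic_mono[OF T il(4), of "Suc n"] Suc.prems
      by (simp_all add: dyadic_double)
    have m: "hom_bound X W A B (dyadic T n i') (dyadic T n l') ?S"
      by (rule Suc.IH) (use il pt in auto)
    have l: "hom_bound X W A B (dyadic T (Suc n) i) (dyadic T n i') ?e"
    proof (cases "i = 2 * i'")
      case True
      then show ?thesis using S by (simp add: dyadic_double hom_bound_refl)
    next
      case False
      then have "Suc i = 2 * i'" using il by linarith
      then show ?thesis
        using step[of i "Suc n"] Suc.prems il pt dyadic_mono[OF T il(1), of n] \<open>i \<noteq> l\<close>
        by (simp add: dyadic_double)
    qed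
    have u: "hom_bound X W A B (dyadic T n l') (dyadic T (Suc n) l) ?e"
    proof (cases "l = 2 * l'")
      case True
      then show ?thesis using S by (simp add: dyadic_double hom_bound_refl)
    next
      case False
      then have "l = Suc (2 * l')" using il by linarith
      then show ?thesis
        using step[of "2 * l'" "Suc n"] Suc.prems il pt dyadic_mono[OF T il(1), of n]
        by (simp add: dyadic_double)
    qed
    have "hom_bound X W A B (dyadic T (Suc n) i) (dyadic T (Suc n) l) (?e + ?S + ?e)"
      by (rule hom_bound_trans[OF hom_bound_trans[OF l m] u])
    also have "?e + ?S + ?e = 2 * (\<Sum>m\<le>Suc n. z ^ m) * \<theta>" by (simp add: algebra_simps)
    finally show ?thesis .
  qed
qed

definition dyadic_floor :: "real \<Rightarrow> nat \<Rightarrow> real \<Rightarrow> real" where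
  "dyadic_floor T m t = dyadic T m (nat \<lfloor>t * 2 ^ m / T\<rfloor>)"

lemma dyadic_floor_bounds:
  assumes T: "0 < T" and t: "0 \<le> t"
  shows "0 \<le> dyadic_floor T m t" "dyadic_floor T m t \<le> t" "t - T / 2 ^ m \<le> dyadic_floor T m t"
proof -
  let ?y = "t * 2 ^ m / T"
  have y: "0 \<le> ?y" using T t by simp
  then have n: "real (nat \<lfloor>?y\<rfloor>) = of_int \<lfloor>?y\<rfloor>" by simp
  have 1: "of_int \<lfloor>?y\<rfloor> \<le> ?y" "?y - 1 \<le> of_int \<lfloor>?y\<rfloor>" by linarith+
  show "0 \<le> dyadic_floor T m t" using T by (simp add: dyadic_floor_def dyadic_def)
  have t': "t = T / 2 ^ m * ?y" using T by simp
  have c: "0 \<le> T / 2 ^ m" using T by simp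
  have d: "dyadic_floor T m t = T / 2 ^ m * of_int \<lfloor>?y\<rfloor>"
    unfolding dyadic_floor_def dyadic_def n by simp
  show "dyadic_floor T m t \<le> t" using mult_left_mono[OF 1(1) c] d t' by simp
  show "t - T / 2 ^ m \<le> dyadic_floor T m t"
    using mult_left_mono[OF 1(2) c] unfolding d[symmetric] right_diff_distrib t'[symmetric] by simp
qed

lemma dyadic_floor_tendsto:
  assumes T: "0 < T" and t: "0 \<le> t"
  shows "(\<lambda>m. dyadic_floor T m t) \<longlonglongrightarrow> t"
proof (rule tendsto_sandwich[OF always_eventually always_eventually _ tendsto_const])
  have "(\<lambda>m. T * (1 / 2) ^ m) \<longlonglongrightarrow> T * 0" by (intro tendsto_mult tendsto_const LIMSEQ_realpow_zero) auto
  then have "(\<lambda>m. t - T * (1 / 2) ^ m) \<longlonglongrightarrow> t - T * 0" by (rule tendsto_diff[OF tendsto_const])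
  then show "(\<lambda>m. t - T / 2 ^ m) \<longlonglongrightarrow> t" by (simp add: power_one_over field_simps)
qed (use dyadic_floor_bounds[OF T t] in auto)

lemma dyadic_refine: "m \<le> n \<Longrightarrow> dyadic T m k = dyadic T n (k * 2 ^ (n - m))"
  by (simp add: dyadic_def field_simps flip: power_add)

lemma dyadic_floor_mono_level:
  assumes T: "0 < T" and t: "0 \<le> t" and "m \<le> n"
  shows "dyadic_floor T m t \<le> dyadic_floor T n t"
proof -
  let ?k = "nat \<lfloor>t * 2 ^ m / T\<rfloor>"
  have "dyadic T n (?k * 2 ^ (n - m)) \<le> t"
    using dyadic_floor_bounds(2)[OF T t, of m] \<open>m \<le> n\<close> by (simp add: dyadic_floor_def flip: dyadic_refine)
  then have "real (?k * 2 ^ (n - m)) \<le> t * 2 ^ n / T" using T by (simp add: dyadic_def field_simps)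
  then have "?k * 2 ^ (n - m) \<le> nat \<lfloor>t * 2 ^ n / T\<rfloor>" by (simp add: le_nat_floor)
  then have "dyadic T n (?k * 2 ^ (n - m)) \<le> dyadic_floor T n t"
    unfolding dyadic_floor_def by (rule dyadic_mono[OF T])
  then show ?thesis unfolding dyadic_floor_def[of T m] dyadic_refine[OF \<open>m \<le> n\<close>] .
qed

lemma dyadic_floor_mono:
  "0 < T \<Longrightarrow> s \<le> t \<Longrightarrow> dyadic_floor T m s \<le> dyadic_floor T m t"
  unfolding dyadic_floor_def by (intro dyadic_mono nat_mono floor_mono) (auto simp: divide_simps)

lemma dyadic_index_le:
  fixes T t :: real
  shows "0 < T \<Longrightarrow> t \<le> T \<Longrightarrow> nat \<lfloor>t * 2 ^ m / T\<rfloor> \<le> 2 ^ m"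
proof -
  assume "0 < T" "t \<le> T"
  then have "t * 2 ^ m / T \<le> 2 ^ m" by (simp add: field_simps)
  then have "\<lfloor>t * 2 ^ m / T\<rfloor> \<le> \<lfloor>2 ^ m :: real\<rfloor>" by (rule floor_mono)
  also have "\<lfloor>2 ^ m :: real\<rfloor> = 2 ^ m" by (metis floor_of_int of_int_numeral of_int_power)
  finally show ?thesis by (simp add: nat_le_iff)
qed

text \<open>
  The processes \<open>Ad\<close> and \<open>Bd\<close> are only used at dyadic times. There, chaining gives the homogeneous
  bound, which also makes them Cauchy along the dyadic approximations of an arbitrary time; the bound
  then passes to the limit.
\<close>

lemma dyadic_control:
  fixes X W Ad Bd :: "real \<Rightarrow> real"
  assumes T: "0 < T" and \<rho>: "0 < \<rho>" and r: "1 < r"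
    and sm: "summable (\<lambda>n. r ^ n * (\<Sum>k<2 ^ n. variation \<rho> X W Ad Bd (dyadic T n k) (dyadic T n (Suc k))))"
    and X: "continuous_on {0..T} X" and W: "continuous_on {0..T} W"
  defines "A \<equiv> \<lambda>t. lim (\<lambda>m. Ad (dyadic_floor T m t))"
    and "B \<equiv> \<lambda>t. lim (\<lambda>m. Bd (dyadic_floor T m t))"
  obtains G K where "continuous_on UNIV G" "mono G" "0 \<le> K"
    "\<And>t. 0 \<le> t \<Longrightarrow> t \<le> T \<Longrightarrow> (\<lambda>m. Ad (dyadic_floor T m t)) \<longlonglongrightarrow> A t"
    "\<And>t. 0 \<le> t \<Longrightarrow> t \<le> T \<Longrightarrow> (\<lambda>m. Bd (dyadic_floor T m t)) \<longlonglongrightarrow> B t"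
    "\<And>s t. 0 \<le> s \<Longrightarrow> s \<le> t \<Longrightarrow> t \<le> T \<Longrightarrow> hom_bound X W A B s t (K * (G t - G s) powr (1 / \<rho>))"
proof -
  define v where "v n k = variation \<rho> X W Ad Bd (dyadic T n k) (dyadic T n (Suc k))" for n k
  have v0: "0 \<le> v n k" for n k by (simp add: v_def)
  obtain G where G: "continuous_on UNIV G" "mono G"
    and Gv: "\<And>n k. k < 2 ^ n \<Longrightarrow> r ^ n * v n k \<le> G (dyadic T n (Suc k)) - G (dyadic T n k)"
    using additive_control_exists[of T v r] T r sm v0 unfolding v_def by auto
  \<comment> \<open>The gain of a factor r per level becomes a geometric factor z < 1 for the norm.\<close>
  define z where "z = r powr (- 1 / \<rho>)"
  have z: "0 \<le> z" "z < 1"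
    using r \<rho> powr_less_mono[of "- 1 / \<rho>" 0 r] by (auto simp: z_def)
  \<comment> \<open>The sum of the chaining constants over all levels.\<close>
  define K where "K = 2 * (1 / (1 - z))"
  have K: "0 \<le> K" using z by (simp add: K_def)
  let ?h = "\<lambda>s t. K * (G t - G s) powr (1 / \<rho>)"
  have dy: "hom_bound X W Ad Bd (dyadic T n i) (dyadic T n l) (?h (dyadic T n i) (dyadic T n l))"
    if il: "i \<le> l" "l \<le> 2 ^ n" for n i l
  proof -
    let ?s = "dyadic T n i" and ?t = "dyadic T n l"
    define \<theta> where "\<theta> = (G ?t - G ?s) powr (1 / \<rho>)"
    have "hom_bound X W Ad Bd (dyadic T m k) (dyadic T m (Suc k)) (z ^ m * \<theta>)"
      if k: "k < 2 ^ m" "?s \<le> dyadic T m k" "dyadic T m (Suc k) \<le> ?t" for m k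
    proof (rule hom_bound_mono[OF hom_bound_variation[OF _ \<rho>]])
      show "dyadic T m k \<le> dyadic T m (Suc k)" using T by (intro dyadic_mono) auto
      have "r ^ m * v m k \<le> G ?t - G ?s"
        using Gv[OF k(1)] monoD[OF G(2) k(2)] monoD[OF G(2) k(3)] by linarith
      then have "v m k \<le> (G ?t - G ?s) * inverse (r ^ m)"
        using r by (simp add: field_simps)
      then have "v m k powr (1 / \<rho>) \<le> ((G ?t - G ?s) * inverse (r ^ m)) powr (1 / \<rho>)"
        using v0 \<rho> by (intro powr_mono2) auto
      also have "\<dots> = z ^ m * \<theta>"
      proof -
        have "inverse (r ^ m) powr (1 / \<rho>) = (r powr (- real m)) powr (1 / \<rho>)"
          using r by (simp add: powr_minus powr_realpow)
        also have "\<dots> = z ^ m" using r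
          by (simp add: z_def powr_powr mult.commute flip: powr_realpow)
        finally show ?thesis
          using monoD[OF G(2) dyadic_mono[OF T il(1), of n]] r
          by (simp add: \<theta>_def powr_mult)
      qed
      finally show "variation \<rho> X W Ad Bd (dyadic T m k) (dyadic T m (Suc k)) powr (1 / \<rho>) \<le> z ^ m * \<theta>"
        by (simp add: v_def)
    qed
    from dyadic_chaining[OF T z(1) _ this il]
    have "hom_bound X W Ad Bd ?s ?t (2 * (\<Sum>m\<le>n. z ^ m) * \<theta>)" by (simp add: \<theta>_def)
    moreover have "(\<Sum>m\<le>n. z ^ m) \<le> 1 / (1 - z)"
      using sum_le_suminf[of "\<lambda>m. z ^ m" "{..n}"] z by (simp add: suminf_geometric summable_geometric)
    then have "2 * (\<Sum>m\<le>n. z ^ m) * \<theta> \<le> K * \<theta>"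
      unfolding K_def by (intro mult_right_mono) (auto simp: \<theta>_def)
    ultimately show ?thesis unfolding \<theta>_def by (rule hom_bound_mono)
  qed
  define d where "d = dyadic_floor T"
  have dy_floor: "hom_bound X W Ad Bd (d m s) (d m t) (?h (d m s) (d m t))"
    if "0 \<le> s" "s \<le> t" "t \<le> T" for m s t
    unfolding d_def dyadic_floor_def
  proof (rule dy)
    show "nat \<lfloor>s * 2 ^ m / T\<rfloor> \<le> nat \<lfloor>t * 2 ^ m / T\<rfloor>"
      using that T by (intro nat_mono floor_mono) (simp add: divide_right_mono)
    show "nat \<lfloor>t * 2 ^ m / T\<rfloor> \<le> 2 ^ m" by (rule dyadic_index_le[OF T that(3)])
  qed
  have dy_levels: "hom_bound X W Ad Bd (d m t) (d n t) (?h (d m t) (d n t))"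
    if "m \<le> n" "0 \<le> t" "t \<le> T" for m n t
  proof -
    have 1: "d m t = dyadic T n (nat \<lfloor>t * 2 ^ m / T\<rfloor> * 2 ^ (n - m))"
      unfolding d_def dyadic_floor_def by (rule dyadic_refine[OF that(1)])
    have "d m t \<le> d n t" unfolding d_def by (rule dyadic_floor_mono_level[OF T that(2,1)])
    then have "nat \<lfloor>t * 2 ^ m / T\<rfloor> * 2 ^ (n - m) \<le> nat \<lfloor>t * 2 ^ n / T\<rfloor>"
      unfolding 1 unfolding d_def dyadic_floor_def dyadic_le_iff[OF T] .
    then show ?thesis
      unfolding 1 unfolding d_def dyadic_floor_def
      by (rule dy[OF _ dyadic_index_le[OF T that(3)]])
  qed
  have d_lim: "(\<lambda>m. d m t) \<longlonglongrightarrow> t" if "0 \<le> t" for t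
    unfolding d_def by (rule dyadic_floor_tendsto[OF T that])
  have d_in: "d m t \<in> {0..T}" if "0 \<le> t" "t \<le> T" for m t
    using dyadic_floor_bounds[OF T that(1), of m] that unfolding d_def by auto
  have Glim: "(\<lambda>m. G (d m t)) \<longlonglongrightarrow> G t" if "0 \<le> t" for t
    using continuous_on_tendsto_compose[OF G(1) d_lim[OF that]] by simp
  have Xlim: "(\<lambda>m. X (d m t)) \<longlonglongrightarrow> X t" and Wlim: "(\<lambda>m. W (d m t)) \<longlonglongrightarrow> W t"
    if "0 \<le> t" "t \<le> T" for t
  proof -
    have ev: "eventually (\<lambda>m. d m t \<in> {0..T}) sequentially"
      by (rule always_eventually) (intro allI d_in that)
    have t: "t \<in> {0..T}" using that by simp
    show "(\<lambda>m. X (d m t)) \<longlonglongrightarrow> X t" by (rule continuous_on_tendsto_compose[OF X d_lim[OF that(1)] t ev])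
    show "(\<lambda>m. W (d m t)) \<longlonglongrightarrow> W t" by (rule continuous_on_tendsto_compose[OF W d_lim[OF that(1)] t ev])
  qed
  have hlim: "(\<lambda>m. ?h (d m s) (d m t)) \<longlonglongrightarrow> ?h s t" if "0 \<le> s" "s \<le> t" "t \<le> T" for s t
  proof -
    have "(\<lambda>m. (G (d m t) - G (d m s)) powr (1 / \<rho>)) \<longlonglongrightarrow> (G t - G s) powr (1 / \<rho>)"
      using that \<rho> monoD[OF G(2) dyadic_floor_mono[OF T that(2)]]
      by (intro tendsto_powr' tendsto_diff Glim tendsto_const) (auto simp: d_def)
    then show ?thesis by (intro tendsto_mult tendsto_const)
  qed
  have convs: "(\<lambda>m. Ad (d m t)) \<longlonglongrightarrow> A t \<and> (\<lambda>m. Bd (d m t)) \<longlonglongrightarrow> B t" if t: "0 \<le> t" "t \<le> T" for t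
  proof -
    define h where "h m = K * (G t - G (d m t)) powr (1 / \<rho>)" for m
    have "(\<lambda>m. (G t - G (d m t)) powr (1 / \<rho>)) \<longlonglongrightarrow> (G t - G t) powr (1 / \<rho>)"
      using t \<rho> monoD[OF G(2) dyadic_floor_bounds(2)[OF T t(1)]]
      by (intro tendsto_powr' tendsto_diff Glim tendsto_const) (auto simp: d_def)
    then have h0: "h \<longlonglongrightarrow> 0" unfolding h_def using tendsto_mult[OF tendsto_const[of K]] by fastforce
    \<comment> \<open>The increments of Ad and Bd are recovered from the two areas and the increment of W.\<close>
    define eA where "eA m = h m ^ 3 + \<bar>X (d m t)\<bar> * (h m)\<^sup>2" for m
    define eB where "eB m = h m ^ 4 + 2 * \<bar>X (d m t)\<bar> * eA m + (X (d m t))\<^sup>2 * (h m)\<^sup>2" for m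
    have eA0: "eA \<longlonglongrightarrow> 0"
      unfolding eA_def using tendsto_add[OF tendsto_power[OF h0, of 3]
        tendsto_mult[OF tendsto_rabs[OF Xlim[OF t]] tendsto_power[OF h0, of 2]]] by simp
    have eB0: "eB \<longlonglongrightarrow> 0"
      unfolding eB_def
      using tendsto_add[OF tendsto_add[OF tendsto_power[OF h0, of 4]
        tendsto_mult[OF tendsto_mult[OF tendsto_const[of 2] tendsto_rabs[OF Xlim[OF t]]] eA0]]
        tendsto_mult[OF tendsto_power[OF Xlim[OF t], of 2] tendsto_power[OF h0, of 2]]] by simp
    have est: "\<bar>Ad (d n t) - Ad (d m t)\<bar> \<le> eA m \<and> \<bar>Bd (d n t) - Bd (d m t)\<bar> \<le> eB m" if "m \<le> n" for m n
    proof -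
      let ?a = "?h (d m t) (d n t)"
      have "G (d n t) \<le> G t" using monoD[OF G(2) dyadic_floor_bounds(2)[OF T t(1)]] by (simp add: d_def)
      then have ah: "?a \<le> h m" unfolding h_def
        using K \<rho> monoD[OF G(2) dyadic_floor_mono_level[OF T t(1) that]]
        by (intro mult_left_mono powr_mono2) (auto simp: d_def)
      have hb: "hom_bound X W Ad Bd (d m t) (d n t) (h m)"
        by (rule hom_bound_mono[OF dy_levels[OF that t] ah])
      have w: "\<bar>W (d n t) - W (d m t)\<bar> \<le> (h m)\<^sup>2" and j: "\<bar>area X W Ad (d m t) (d n t)\<bar> \<le> h m ^ 3"
        and q: "\<bar>sq_area X W Ad Bd (d m t) (d n t)\<bar> \<le> h m ^ 4"
        using hb by (auto simp: hom_bound_def)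
      have A1: "Ad (d n t) - Ad (d m t) = area X W Ad (d m t) (d n t) + X (d m t) * (W (d n t) - W (d m t))"
        by (simp add: area_def)
      have Ae: "\<bar>Ad (d n t) - Ad (d m t)\<bar> \<le> eA m"
        unfolding A1 eA_def
        by (rule order.trans[OF abs_triangle_ineq] add_mono j)+ (simp add: abs_mult w mult_left_mono)
      have B1: "Bd (d n t) - Bd (d m t) = sq_area X W Ad Bd (d m t) (d n t)
          + 2 * X (d m t) * (Ad (d n t) - Ad (d m t)) + - ((X (d m t))\<^sup>2 * (W (d n t) - W (d m t)))"
        by (simp add: sq_area_def)
      have "\<bar>2 * X (d m t) * (Ad (d n t) - Ad (d m t))\<bar> \<le> 2 * \<bar>X (d m t)\<bar> * eA m"
        using Ae by (simp add: abs_mult mult_left_mono)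
      moreover have "\<bar>- ((X (d m t))\<^sup>2 * (W (d n t) - W (d m t)))\<bar> \<le> (X (d m t))\<^sup>2 * (h m)\<^sup>2"
        using w by (simp add: abs_mult mult_left_mono)
      ultimately have "\<bar>Bd (d n t) - Bd (d m t)\<bar> \<le> eB m"
        unfolding B1 eB_def by - (rule order.trans[OF abs_triangle_ineq] add_mono q | assumption)+
      with Ae show ?thesis by simp
    qed
    have cauchy: "convergent u" if e: "e \<longlonglongrightarrow> 0" and le: "\<And>m n. m \<le> n \<Longrightarrow> \<bar>u n - u m\<bar> \<le> e m"
      for u e :: "nat \<Rightarrow> real"
    proof -
      have "Cauchy u"
      proof (rule CauchyI')
        fix \<epsilon> :: real assume "0 < \<epsilon>"
        then obtain M where M: "\<And>m. m \<ge> M \<Longrightarrow> norm (e m - 0) < \<epsilon>"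
          using LIMSEQ_D[OF e] by blast
        have "dist (u m) (u n) < \<epsilon>" if "M \<le> m" "m < n" for m n
          using M[of m] le[of m n] that by (simp add: dist_real_def)
        then show "\<exists>M. \<forall>m\<ge>M. \<forall>n>m. dist (u m) (u n) < \<epsilon>" by blast
      qed
      then show ?thesis by (rule Cauchy_convergent)
    qed
    have "convergent (\<lambda>m. Ad (d m t))" "convergent (\<lambda>m. Bd (d m t))"
      using cauchy[OF eA0, of "\<lambda>m. Ad (d m t)"] cauchy[OF eB0, of "\<lambda>m. Bd (d m t)"] est by auto
    then show ?thesis by (simp add: A_def B_def d_def convergent_LIMSEQ_iff)
  qed
  have "hom_bound X W A B s t (?h s t)" if st: "0 \<le> s" "s \<le> t" "t \<le> T" for s t
  proof -
    have s: "s \<le> T" and t: "0 \<le> t" using st by auto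
    note lims = Xlim[OF st(1) s] Xlim[OF t st(3)] Wlim[OF st(1) s] Wlim[OF t st(3)]
      conjunct1[OF convs[OF st(1) s]] conjunct1[OF convs[OF t st(3)]]
      conjunct2[OF convs[OF st(1) s]] conjunct2[OF convs[OF t st(3)]]
    have j: "(\<lambda>m. area X W Ad (d m s) (d m t)) \<longlonglongrightarrow> area X W A s t"
      unfolding area_def by (intro tendsto_intros lims)
    have q: "(\<lambda>m. sq_area X W Ad Bd (d m s) (d m t)) \<longlonglongrightarrow> sq_area X W A B s t"
      unfolding sq_area_def by (intro tendsto_intros lims)
    note hl = hlim[OF st] and db = dy_floor[OF st, unfolded hom_bound_def]
    show ?thesis
      unfolding hom_bound_def
    proof (intro conjI)
      show "0 \<le> ?h s t" using K by simp
      show "\<bar>X t - X s\<bar> \<le> ?h s t"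
        by (rule LIMSEQ_le[OF tendsto_rabs[OF tendsto_diff[OF lims(2,1)]] hl]) (use db in auto)
      show "\<bar>W t - W s\<bar> \<le> (?h s t)\<^sup>2"
        by (rule LIMSEQ_le[OF tendsto_rabs[OF tendsto_diff[OF lims(4,3)]] tendsto_power[OF hl]]) (use db in auto)
      show "\<bar>area X W A s t\<bar> \<le> ?h s t ^ 3"
        by (rule LIMSEQ_le[OF tendsto_rabs[OF j] tendsto_power[OF hl]]) (use db in auto)
      show "\<bar>sq_area X W A B s t\<bar> \<le> ?h s t ^ 4"
        by (rule LIMSEQ_le[OF tendsto_rabs[OF q] tendsto_power[OF hl]]) (use db in auto)
      show "t - s \<le> ?h s t ^ 4"
        by (rule LIMSEQ_le[OF tendsto_diff[OF d_lim[OF t] d_lim[OF st(1)]] tendsto_power[OF hl]])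
          (use db in auto)
    qed
  qed
  then show thesis using that[OF G K] convs unfolding d_def by blast
qed

section \<open>Independence of the past and Brownian increments\<close>

lemma Collect_in_sets: "f \<in> borel_measurable N \<Longrightarrow> B \<in> sets borel \<Longrightarrow> {x\<in>space N. f x \<in> B} \<in> sets N"
  using measurable_sets[of f N borel B] by (simp add: vimage_def Int_def conj_commute)

lemma component_borel:
  "r \<in> I \<Longrightarrow> (\<lambda>u. u r) \<in> borel_measurable (PiM I (\<lambda>_. borel :: real measure))"
  using measurable_component_singleton[of r I "\<lambda>_. borel"] by simp

locale fbm_bm = prob_space M for M :: "'a measure" +
  fixes X W :: "real \<Rightarrow> 'a \<Rightarrow> real" and T :: real
  assumes T_pos: "0 < T" and fbm: "fbm_quarter M T X" and bm: "brownian_motion M T W"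
    and indep: "independent_processes M {0..T} X W"
begin

lemma W_measurable [measurable]: "t \<in> {0..T} \<Longrightarrow> W t \<in> borel_measurable M"
  using bm by (auto simp: brownian_motion_def)

lemma gaussian_sum:
  "finite J \<Longrightarrow> J \<subseteq> {0..T} \<Longrightarrow> gaussian M (\<lambda>\<omega>. \<Sum>t\<in>J. c t * X t \<omega>)"
  using fbm unfolding fbm_quarter_def centred_gaussian_process_def by simp

lemma X_measurable [measurable]: "t \<in> {0..T} \<Longrightarrow> X t \<in> borel_measurable M"
  using gaussian_sum[of "{t}" "\<lambda>_. 1"] by (simp add: gaussian_def)

text \<open>
  All of \<open>X\<close> belongs to the past at every time. This enlargement of the natural filtration makes every
  functional of \<open>X\<close> adapted, even one that looks ahead.
\<close>

definition past_events :: "real \<Rightarrow> 'a set set" where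
  "past_events t = (\<Union>r\<in>{0..T}. {X r -` B \<inter> space M |B. B \<in> sets borel}) \<union>
     (\<Union>r\<in>{0..t}. {W r -` B \<inter> space M |B. B \<in> sets borel})"

definition past :: "real \<Rightarrow> 'a measure" where
  "past t = sigma (space M) (past_events t)"

lemma past_events_Pow: "past_events t \<subseteq> Pow (space M)"
  by (auto simp: past_events_def)

lemma sets_past: "sets (past t) = sigma_sets (space M) (past_events t)"
  and space_past [simp]: "space (past t) = space M"
  by (simp_all add: past_def past_events_Pow)

lemma past_mono: "s \<le> t \<Longrightarrow> sets (past s) \<subseteq> sets (past t)"
  unfolding sets_past past_events_def
  by (rule sigma_sets_mono'[OF Un_mono[OF order.refl UN_mono[OF _ order.refl]]]) simp

lemma measurable_past_mono: "s \<le> t \<Longrightarrow> f \<in> measurable (past s) N \<Longrightarrow> f \<in> measurable (past t) N"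
  using past_mono[of s t] by (auto simp: measurable_def)

lemma X_event: "r \<in> {0..T} \<Longrightarrow> B \<in> sets borel \<Longrightarrow> X r -` B \<inter> space M \<in> past_events t"
  and W_event: "r \<in> {0..t} \<Longrightarrow> B \<in> sets borel \<Longrightarrow> W r -` B \<inter> space M \<in> past_events t"
  unfolding past_events_def by blast+

lemma X_past: "r \<in> {0..T} \<Longrightarrow> X r \<in> borel_measurable (past t)"
  by (rule measurableI) (simp_all add: sets_past X_event sigma_sets.Basic)

lemma W_past: "0 \<le> r \<Longrightarrow> r \<le> t \<Longrightarrow> W r \<in> borel_measurable (past t)"
  by (rule measurableI) (simp_all add: sets_past W_event sigma_sets.Basic)

lemma past_events_M: "t \<le> T \<Longrightarrow> past_events t \<subseteq> sets M"
  unfolding past_events_def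
  using measurable_sets[OF X_measurable] measurable_sets[OF W_measurable] by fastforce

lemma measurable_past_M: "t \<le> T \<Longrightarrow> f \<in> measurable (past t) N \<Longrightarrow> f \<in> measurable M N"
  using sets.sigma_sets_subset[OF past_events_M[of t]] by (auto simp: measurable_def sets_past)

lemma natural_filtration_past:
  assumes "t \<le> T" "f \<in> measurable (natural_filtration M X W t) N"
  shows "f \<in> measurable (past t) N"
proof -
  let ?E = "\<Union>Z\<in>{X, W}. \<Union>r\<in>{0..t}. {Z r -` B \<inter> space M |B. B \<in> sets borel}"
  have "?E \<subseteq> past_events t"
  proof (intro UN_least)
    fix Z r assume "Z \<in> {X, W}" "r \<in> {0..t}"
    then show "{Z r -` B \<inter> space M |B. B \<in> sets borel} \<subseteq> past_events t"
      using X_event[of r _ t] W_event[of r t] assms(1) by auto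
  qed
  then have "sigma_sets (space M) ?E \<subseteq> sigma_sets (space M) (past_events t)"
    by (rule sigma_sets_mono')
  moreover have "?E \<subseteq> Pow (space M)" by auto
  ultimately show ?thesis
    using assms(2) by (auto simp: measurable_def sets_past natural_filtration_def)
qed

text \<open>
  Together with \<open>a\<close>, \<open>b\<close> and \<open>T\<close> the finitely many times form a partition, and \<open>W r - W 0\<close> is a sum of
  increments that precede \<open>a\<close>.
\<close>

lemma finite_past_indep:
  assumes S: "finite S" "S \<subseteq> {0..a}" and ab: "0 \<le> a" "a \<le> b" "b \<le> T"
    and B: "\<And>r. B r \<in> sets borel" and C: "C \<in> sets borel"
  shows "prob ({\<omega>\<in>space M. \<forall>r\<in>S. W r \<omega> - W 0 \<omega> \<in> B r} \<inter> {\<omega>\<in>space M. W b \<omega> - W a \<omega> \<in> C}) =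
    prob {\<omega>\<in>space M. \<forall>r\<in>S. W r \<omega> - W 0 \<omega> \<in> B r} * prob {\<omega>\<in>space M. W b \<omega> - W a \<omega> \<in> C}"
proof -
  define L where "L = sorted_list_of_set (insert 0 (insert a S))"
  have L: "sorted L" "set L = insert 0 (insert a S)"
    unfolding L_def using S(1) by (simp_all only: sorted_sorted_list_of_set set_sorted_list_of_set finite_insert)
  then have L0: "L \<noteq> []" by auto
  define m where "m = length L - 1"
  have len: "length L = Suc m" using L0 by (cases L) (auto simp: m_def)
  \<comment> \<open>The last point of L is a, and the increment with number m is the one over [a, b].\<close>
  define \<tau> where "\<tau> i = (if i \<le> m then L ! i else if i = Suc m then b else T)" for i
  have idx: "\<exists>i\<le>m. L ! i = x" if "x \<in> set L" for x
    using that len by (metis in_set_conv_nth less_Suc_eq_le)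
  have Lmono: "L ! i \<le> L ! l" if "i \<le> l" "l \<le> m" for i l
    using sorted_nth_mono[OF L(1), of i l] that len by auto
  have Lrange: "L ! i \<in> {0..a}" if "i \<le> m" for i
    using nth_mem[of i L] that len L(2) S ab by auto
  have \<tau>0: "\<tau> 0 = 0" using idx[of 0] L(2) Lmono[of 0] Lrange[of 0] by (force simp: \<tau>_def)
  have \<tau>m: "\<tau> m = a" using idx[of a] L(2) Lmono[of _ m] Lrange[of m] by (force simp: \<tau>_def)
  have part: "partition 0 T (m + 2) \<tau>"
    unfolding partition_def
  proof (intro conjI allI impI)
    show "\<tau> 0 = 0" by (rule \<tau>0)
    show "\<tau> (m + 2) = T" by (simp add: \<tau>_def)
    fix i assume "i < m + 2"
    then consider "Suc i \<le> m" | "i = m" | "i = Suc m" by linarith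
    then show "\<tau> i \<le> \<tau> (Suc i)"
    proof cases
      case 2 then show ?thesis using \<tau>m ab by (simp add: \<tau>_def)
    qed (use Lmono ab in \<open>auto simp: \<tau>_def\<close>)
  qed
  let ?incr = "\<lambda>i \<omega>. W (\<tau> (Suc i)) \<omega> - W (\<tau> i) \<omega>"
  have "indep_vars (\<lambda>_. borel) ?incr {..<m + 2}" using bm part by (auto simp: brownian_motion_def)
  then have iv: "indep_var (PiM {..<m} (\<lambda>_. borel)) (\<lambda>\<omega>. \<lambda>i\<in>{..<m}. ?incr i \<omega>)
      (PiM {m} (\<lambda>_. borel)) (\<lambda>\<omega>. \<lambda>i\<in>{m}. ?incr i \<omega>)"
    by (rule indep_var_restrict) auto
  obtain k where k: "\<And>r. r \<in> S \<Longrightarrow> k r \<le> m \<and> L ! (k r) = r" using idx L(2) by (metis insertCI)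
  have tele: "(\<Sum>i<k r. ?incr i \<omega>) = W r \<omega> - W 0 \<omega>" if "r \<in> S" for r \<omega>
    using k[OF that] \<tau>0 sum_lessThan_telescope[of "\<lambda>i. W (\<tau> i) \<omega>" "k r"] by (simp add: \<tau>_def)
  let ?U = "{u \<in> space (PiM {..<m} (\<lambda>_. borel :: real measure)). \<forall>r\<in>S. (\<Sum>i<k r. u i) \<in> B r}"
  let ?V = "{u \<in> space (PiM {m} (\<lambda>_. borel :: real measure)). u m \<in> C}"
  have sub: "i < m" if "r \<in> S" "i < k r" for r i using k[OF that(1)] that by auto
  have Um: "?U \<in> sets (PiM {..<m} (\<lambda>_. borel))"
  proof (rule sets.sets_Collect_finite_All[OF _ S(1)])
    fix r assume "r \<in> S"
    have "(\<lambda>u. \<Sum>i<k r. u i) \<in> borel_measurable (PiM {..<m} (\<lambda>_. borel :: real measure))"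
      using sub[OF \<open>r \<in> S\<close>] by (intro borel_measurable_sum measurable_component_singleton) auto
    then show "{u \<in> space (PiM {..<m} (\<lambda>_. borel :: real measure)). (\<Sum>i<k r. u i) \<in> B r} \<in> sets (PiM {..<m} (\<lambda>_. borel))"
      by (rule Collect_in_sets[OF _ B])
  qed
  have Vm: "?V \<in> sets (PiM {m} (\<lambda>_. borel))" using C by measurable
  have e1: "(\<lambda>x. (\<lambda>i\<in>{..<m}. ?incr i x, \<lambda>i\<in>{m}. ?incr i x)) -` (?U \<times> ?V) \<inter> space M =
     {\<omega>\<in>space M. \<forall>r\<in>S. W r \<omega> - W 0 \<omega> \<in> B r} \<inter> {\<omega>\<in>space M. W b \<omega> - W a \<omega> \<in> C}"
    and e2: "(\<lambda>\<omega>. \<lambda>i\<in>{..<m}. ?incr i \<omega>) -` ?U \<inter> space M = {\<omega>\<in>space M. \<forall>r\<in>S. W r \<omega> - W 0 \<omega> \<in> B r}"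
    and e3: "(\<lambda>\<omega>. \<lambda>i\<in>{m}. ?incr i \<omega>) -` ?V \<inter> space M = {\<omega>\<in>space M. W b \<omega> - W a \<omega> \<in> C}"
  proof -
    have a1: "(\<Sum>i<k r. (\<lambda>i\<in>{..<m}. ?incr i \<omega>) i) = W r \<omega> - W 0 \<omega>" if "r \<in> S" for r \<omega>
      unfolding tele[OF that, symmetric] using sub[OF that] by (intro sum.cong) auto
    have a2: "?incr m \<omega> = W b \<omega> - W a \<omega>" for \<omega> using \<tau>m by (simp add: \<tau>_def)
    show "(\<lambda>x. (\<lambda>i\<in>{..<m}. ?incr i x, \<lambda>i\<in>{m}. ?incr i x)) -` (?U \<times> ?V) \<inter> space M =
     {\<omega>\<in>space M. \<forall>r\<in>S. W r \<omega> - W 0 \<omega> \<in> B r} \<inter> {\<omega>\<in>space M. W b \<omega> - W a \<omega> \<in> C}"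
      using a1 a2 by (auto simp: space_PiM)
    show "(\<lambda>\<omega>. \<lambda>i\<in>{..<m}. ?incr i \<omega>) -` ?U \<inter> space M = {\<omega>\<in>space M. \<forall>r\<in>S. W r \<omega> - W 0 \<omega> \<in> B r}"
      using a1 by (auto simp: space_PiM)
    show "(\<lambda>\<omega>. \<lambda>i\<in>{m}. ?incr i \<omega>) -` ?V \<inter> space M = {\<omega>\<in>space M. W b \<omega> - W a \<omega> \<in> C}"
      using a2 by (auto simp: space_PiM)
  qed
  from indep_varD[OF iv Um Vm] show ?thesis unfolding e1 e2 e3 .
qed

lemma W_0: "AE \<omega> in M. W 0 \<omega> = 0"
  using bm by (simp add: brownian_motion_def)

lemma finite_past_indep':
  assumes S: "finite S" "S \<subseteq> {0..a}" and ab: "0 \<le> a" "a \<le> b" "b \<le> T"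
    and B: "\<And>r. B r \<in> sets borel" and C: "C \<in> sets borel"
  shows "prob ({\<omega>\<in>space M. \<forall>r\<in>S. W r \<omega> \<in> B r} \<inter> {\<omega>\<in>space M. W b \<omega> - W a \<omega> \<in> C}) =
    prob {\<omega>\<in>space M. \<forall>r\<in>S. W r \<omega> \<in> B r} * prob {\<omega>\<in>space M. W b \<omega> - W a \<omega> \<in> C}"
proof -
  have [measurable]: "W r \<in> borel_measurable M" if "r \<in> {0..a}" for r using that ab by auto
  have [measurable]: "W 0 \<in> borel_measurable M" "W a \<in> borel_measurable M" "W b \<in> borel_measurable M"
    using ab T_pos by auto
  note [measurable] = B C
  have m1: "{\<omega>\<in>space M. \<forall>r\<in>S. W r \<omega> \<in> B r} \<in> sets M"
    using S B by (intro sets.sets_Collect_finite_All Collect_in_sets) auto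
  have m2: "{\<omega>\<in>space M. \<forall>r\<in>S. W r \<omega> - W 0 \<omega> \<in> B r} \<in> sets M"
    using S B ab by (intro sets.sets_Collect_finite_All Collect_in_sets[OF borel_measurable_diff]) auto
  have m3: "{\<omega>\<in>space M. W b \<omega> - W a \<omega> \<in> C} \<in> sets M" by measurable
  have ae: "AE \<omega> in M. (\<forall>r\<in>S. W r \<omega> \<in> B r) = (\<forall>r\<in>S. W r \<omega> - W 0 \<omega> \<in> B r)"
    using W_0 by eventually_elim simp
  have "prob {\<omega>\<in>space M. \<forall>r\<in>S. W r \<omega> \<in> B r} = prob {\<omega>\<in>space M. \<forall>r\<in>S. W r \<omega> - W 0 \<omega> \<in> B r}"
    using ae by (intro finite_measure_eq_AE m1 m2) auto
  moreover have "prob ({\<omega>\<in>space M. \<forall>r\<in>S. W r \<omega> \<in> B r} \<inter> {\<omega>\<in>space M. W b \<omega> - W a \<omega> \<in> C}) =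
    prob ({\<omega>\<in>space M. \<forall>r\<in>S. W r \<omega> - W 0 \<omega> \<in> B r} \<inter> {\<omega>\<in>space M. W b \<omega> - W a \<omega> \<in> C})"
    using ae by (intro finite_measure_eq_AE sets.Int m1 m2 m3) auto
  ultimately show ?thesis using finite_past_indep[OF assms] by simp
qed

text \<open>
  The events that restrict all of \<open>X\<close> and finitely many values of \<open>W\<close> before \<open>a\<close> are stable under
  intersection and generate the past. On them the claim follows from the independence of the two
  processes and from \<open>finite_past_indep'\<close>.
\<close>

lemma past_indep_increment:
  assumes ab: "0 \<le> a" "a \<le> b" "b \<le> T" and Z: "Z \<in> measurable (past a) N"
  shows "indep_var N Z borel (\<lambda>\<omega>. W b \<omega> - W a \<omega>)"
proof -
  let ?I = "{0..T}"
  let ?XX = "\<lambda>\<omega>. \<lambda>t\<in>?I. X t \<omega>" and ?WW = "\<lambda>\<omega>. \<lambda>t\<in>?I. W t \<omega>"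
  let ?P = "PiM ?I (\<lambda>_. borel :: real measure)"
  let ?D = "\<lambda>C. {\<omega>\<in>space M. W b \<omega> - W a \<omega> \<in> C}"
  have aT: "a \<in> ?I" "b \<in> ?I" using ab by auto
  have [measurable]: "W a \<in> borel_measurable M" "W b \<in> borel_measurable M" using aT by auto
  have iv: "indep_var ?P ?XX ?P ?WW" using indep by (simp add: independent_processes_def)
  define cyl where "cyl E S B = (?XX -` E \<inter> space M) \<inter> {\<omega>\<in>space M. \<forall>r\<in>S. W r \<omega> \<in> B r}"
    for E and S :: "real set" and B
  define \<P> where "\<P> = {cyl E S B |E S B. E \<in> sets ?P \<and> finite S \<and> S \<subseteq> {0..a} \<and> (\<forall>r. B r \<in> sets borel)}"
  define \<D> where "\<D> = {(\<lambda>\<omega>. W b \<omega> - W a \<omega>) -` C \<inter> space M |C. C \<in> sets borel}"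
  have Xm: "?XX \<in> measurable M ?P" and Wm: "?WW \<in> measurable M ?P"
    using indep_var_rv1[OF iv] indep_var_rv2[OF iv] by auto
  have Wset: "{\<omega>\<in>space M. \<forall>r\<in>S. W r \<omega> \<in> B r} \<in> sets M"
    if "finite S" "S \<subseteq> {0..a}" "\<forall>r. B r \<in> sets borel" for S and B :: "real \<Rightarrow> real set"
    using that ab by (intro sets.sets_Collect_finite_All Collect_in_sets[OF W_measurable]) auto
  have "indep_set \<P> \<D>"
    unfolding indep_sets2_eq
  proof (intro conjI ballI)
    show "\<P> \<subseteq> events" unfolding \<P>_def cyl_def using Wset measurable_sets[OF Xm] by blast
    show "\<D> \<subseteq> events" unfolding \<D>_def by (auto intro!: measurable_sets[where A = borel])
    fix F D assume "F \<in> \<P>" "D \<in> \<D>"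
    then obtain E S B C where F: "F = cyl E S B" "E \<in> sets ?P" "finite S" "S \<subseteq> {0..a}" "\<And>r. B r \<in> sets borel"
      and D: "D = ?D C" "C \<in> sets borel" unfolding \<P>_def \<D>_def by blast
    let ?U = "{u \<in> space ?P. \<forall>r\<in>S. u r \<in> B r}" and ?V = "{u \<in> space ?P. u b - u a \<in> C}"
    have U: "?U \<in> sets ?P" using F ab
      by (intro sets.sets_Collect_finite_All Collect_in_sets[OF component_borel]) auto
    have V: "?V \<in> sets ?P" using D aT
      by (intro Collect_in_sets[OF borel_measurable_diff[OF component_borel component_borel]]) auto
    have eU: "?WW -` ?U \<inter> space M = {\<omega>\<in>space M. \<forall>r\<in>S. W r \<omega> \<in> B r}"
      using F(4) ab by (auto simp: space_PiM)
    have eV: "?WW -` ?V \<inter> space M = ?D C" using aT by (auto simp: space_PiM)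
    let ?A = "?XX -` E \<inter> space M" and ?B = "{\<omega>\<in>space M. \<forall>r\<in>S. W r \<omega> \<in> B r}"
    have p1: "(\<lambda>x. (?XX x, ?WW x)) -` (E \<times> ?U) \<inter> space M = ?A \<inter> ?B"
      and p2: "(\<lambda>x. (?XX x, ?WW x)) -` (E \<times> (?U \<inter> ?V)) \<inter> space M = ?A \<inter> (?B \<inter> ?D C)"
      and p3: "?WW -` (?U \<inter> ?V) \<inter> space M = ?B \<inter> ?D C"
      unfolding eU[symmetric] eV[symmetric] by blast+
    have "prob (?A \<inter> ?B) = prob ?A * prob ?B"
      using indep_varD[OF iv F(2) U] unfolding p1 eU .
    moreover have "prob (?A \<inter> (?B \<inter> ?D C)) = prob ?A * prob (?B \<inter> ?D C)"
      using indep_varD[OF iv F(2) sets.Int[OF U V]] unfolding p2 p3 .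
    moreover have "prob (?B \<inter> ?D C) = prob ?B * prob (?D C)"
      by (rule finite_past_indep'[OF F(3,4) ab F(5) D(2)])
    ultimately show "prob (F \<inter> D) = prob F * prob D"
      unfolding F(1) D(1) cyl_def by (simp add: Int_assoc)
  qed
  moreover have "Int_stable \<P>"
  proof (rule Int_stableI)
    fix F F' assume "F \<in> \<P>" "F' \<in> \<P>"
    then obtain E S B E' S' B' where F: "F = cyl E S B" "E \<in> sets ?P" "finite S" "S \<subseteq> {0..a}" "\<And>r. B r \<in> sets borel"
      and F': "F' = cyl E' S' B'" "E' \<in> sets ?P" "finite S'" "S' \<subseteq> {0..a}" "\<And>r. B' r \<in> sets borel"
      unfolding \<P>_def by blast
    let ?B = "\<lambda>r. (if r \<in> S then B r else UNIV) \<inter> (if r \<in> S' then B' r else UNIV)"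
    have "F \<inter> F' = cyl (E \<inter> E') (S \<union> S') ?B"
      unfolding F F' cyl_def by auto
    moreover have "E \<inter> E' \<in> sets ?P" "finite (S \<union> S')" "S \<union> S' \<subseteq> {0..a}" "\<forall>r. ?B r \<in> sets borel"
      using F F' by auto
    ultimately show "F \<inter> F' \<in> \<P>" unfolding \<P>_def by blast
  qed
  moreover have "Int_stable \<D>"
  proof (rule Int_stableI)
    fix D D' assume "D \<in> \<D>" "D' \<in> \<D>"
    then obtain C C' where "D = (\<lambda>\<omega>. W b \<omega> - W a \<omega>) -` C \<inter> space M" "C \<in> sets borel"
       "D' = (\<lambda>\<omega>. W b \<omega> - W a \<omega>) -` C' \<inter> space M" "C' \<in> sets borel" unfolding \<D>_def by blast
    then show "D \<inter> D' \<in> \<D>" unfolding \<D>_def by (intro CollectI exI[of _ "C \<inter> C'"]) auto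
  qed
  ultimately have ind: "indep_set (sigma_sets (space M) \<P>) (sigma_sets (space M) \<D>)"
    by (rule indep_set_sigma_sets)
  have sub: "past_events a \<subseteq> \<P>"
  proof
    fix F assume "F \<in> past_events a"
    then consider r B where "r \<in> {0..T}" "B \<in> sets borel" "F = X r -` B \<inter> space M"
      | r B where "r \<in> {0..a}" "B \<in> sets borel" "F = W r -` B \<inter> space M"
      unfolding past_events_def by blast
    then show "F \<in> \<P>"
    proof cases
      case 1
      then have "F = cyl {u \<in> space ?P. u r \<in> B} {} (\<lambda>_. UNIV)"
        by (auto simp: cyl_def space_PiM)
      moreover have "{u \<in> space ?P. u r \<in> B} \<in> sets ?P"
        using 1 by (intro Collect_in_sets[OF component_borel]) auto
      ultimately show ?thesis unfolding \<P>_def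
        by (intro CollectI exI[of _ "{u \<in> space ?P. u r \<in> B}"] exI[of _ "{}"] exI[of _ "\<lambda>_. UNIV"]) auto
    next
      case 2
      then have "F = cyl (space ?P) {r} (\<lambda>_. B)"
        by (auto simp: cyl_def space_PiM)
      then show ?thesis unfolding \<P>_def using 2
        by (intro CollectI exI[of _ "space ?P"] exI[of _ "{r}"] exI[of _ "\<lambda>_. B"]) auto
    qed
  qed
  have aT': "a \<le> T" using ab by simp
  have ZM: "Z \<in> measurable M N" by (rule measurable_past_M[OF aT' Z])
  have Zs: "Z -` A \<inter> space M \<in> sigma_sets (space M) \<P>" if "A \<in> sets N" for A
    using measurable_sets[OF Z that] sigma_sets_mono'[OF sub] by (auto simp: sets_past)
  show ?thesis
    unfolding indep_var_eq
  proof (intro conjI)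
    show "indep_set (sigma_sets (space M) {Z -` A \<inter> space M |A. A \<in> sets N})
     (sigma_sets (space M) {(\<lambda>\<omega>. W b \<omega> - W a \<omega>) -` A \<inter> space M |A. A \<in> sets borel})"
    proof -
      have "sigma_sets (space M) {Z -` A \<inter> space M |A. A \<in> sets N} \<subseteq> sigma_sets (space M) \<P>"
        using Zs by (intro sigma_sets_mono) auto
      then show ?thesis using ind unfolding indep_sets2_eq \<D>_def by blast
    qed
  qed (use ZM in auto)
qed

end

section \<open>Moments and the isometry\<close>

context prob_space begin

text \<open>
  The degenerate law has no density and is treated on its own.
\<close>

lemma gaussian_even_moment:
  assumes Y: "gaussian M Y" and mean: "expectation Y = 0" and var: "expectation (\<lambda>\<omega>. Y \<omega> * Y \<omega>) = v"
    and k: "0 < k"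
  shows "integrable M (\<lambda>\<omega>. Y \<omega> ^ (2 * k))"
    and "expectation (\<lambda>\<omega>. Y \<omega> ^ (2 * k)) = fact (2 * k) / (2 ^ k * fact k) * v ^ k"
proof -
  have Ym [measurable]: "Y \<in> borel_measurable M" using Y by (simp add: gaussian_def)
  from Y consider \<mu> where "AE \<omega> in M. Y \<omega> = \<mu>"
    | \<mu> \<sigma> where "\<sigma> > 0" "distributed M lborel Y (normal_density \<mu> \<sigma>)"
    by (auto simp: gaussian_def)
  then have "integrable M (\<lambda>\<omega>. Y \<omega> ^ (2 * k)) \<and>
    expectation (\<lambda>\<omega>. Y \<omega> ^ (2 * k)) = fact (2 * k) / (2 ^ k * fact k) * v ^ k"
  proof cases
    case 1
    then have "expectation Y = expectation (\<lambda>_. \<mu>)" by (intro integral_cong_AE) auto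
    then have "\<mu> = 0" using mean by (simp add: prob_space)
    with 1 have ae: "AE \<omega> in M. Y \<omega> = 0" by simp
    then have "v = expectation (\<lambda>_. 0)" unfolding var[symmetric]
      by (intro integral_cong_AE) auto
    then have v: "v = 0" by simp
    have ae': "AE \<omega> in M. Y \<omega> ^ (2 * k) = 0" using ae k by (auto elim: eventually_mono)
    have "expectation (\<lambda>\<omega>. Y \<omega> ^ (2 * k)) = expectation (\<lambda>_. 0)"
      by (intro integral_cong_AE ae') auto
    moreover have "integrable M (\<lambda>\<omega>. Y \<omega> ^ (2 * k))"
      by (rule integrable_cong_AE_imp[OF integrable_zero _ ]) (use ae' in \<open>auto elim: eventually_mono\<close>)
    ultimately show ?thesis using v k by (simp add: power_0_left)
  next
    case 2
    have "\<mu> = 0" using normal_distributed_expectation[OF 2] mean by simp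
    with 2 have D: "distributed M lborel Y (normal_density 0 \<sigma>)" by simp
    have int: "integrable M (\<lambda>\<omega>. Y \<omega> ^ (2 * n))"
      and val: "expectation (\<lambda>\<omega>. Y \<omega> ^ (2 * n)) = fact (2 * n) / (2 ^ n * fact n) * (\<sigma>\<^sup>2) ^ n" for n
    proof -
      have hb: "has_bochner_integral lborel (\<lambda>x. normal_density 0 \<sigma> x * x ^ (2 * n))
          (fact (2 * n) / ((2 / \<sigma>\<^sup>2) ^ n * fact n))"
        using normal_moment_even[OF 2(1), of 0 n] by simp
      show "integrable M (\<lambda>\<omega>. Y \<omega> ^ (2 * n))"
        using integrable.intros[OF hb] distributed_integrable[OF D, of "\<lambda>x. x ^ (2 * n)"] by simp
      show "expectation (\<lambda>\<omega>. Y \<omega> ^ (2 * n)) = fact (2 * n) / (2 ^ n * fact n) * (\<sigma>\<^sup>2) ^ n"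
        using distributed_integral[OF D, of "\<lambda>x. x ^ (2 * n)"] has_bochner_integral_integral_eq[OF hb] 2(1)
        by (simp add: power_divide field_simps)
    qed
    have "v = \<sigma>\<^sup>2" using val[of 1] var by (simp add: power2_eq_square)
    with int val show ?thesis by simp
  qed
  then show "integrable M (\<lambda>\<omega>. Y \<omega> ^ (2 * k))"
    and "expectation (\<lambda>\<omega>. Y \<omega> ^ (2 * k)) = fact (2 * k) / (2 ^ k * fact k) * v ^ k" by auto
qed

lemma integrable_mult_L2:
  fixes f g :: "'a \<Rightarrow> real"
  assumes [measurable]: "f \<in> borel_measurable M" "g \<in> borel_measurable M"
    and "integrable M (\<lambda>\<omega>. (f \<omega>)\<^sup>2)" "integrable M (\<lambda>\<omega>. (g \<omega>)\<^sup>2)"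
  shows "integrable M (\<lambda>\<omega>. f \<omega> * g \<omega>)"
proof (rule Bochner_Integration.integrable_bound[OF Bochner_Integration.integrable_add[OF assms(3,4)]])
  have "\<bar>x * y\<bar> \<le> x\<^sup>2 + y\<^sup>2" for x y :: real
  proof -
    have "2 * (\<bar>x\<bar> * \<bar>y\<bar>) \<le> x\<^sup>2 + y\<^sup>2" using sum_squares_bound[of "\<bar>x\<bar>" "\<bar>y\<bar>"] by (simp add: mult.assoc)
    moreover have "0 \<le> \<bar>x\<bar> * \<bar>y\<bar>" by simp
    ultimately show ?thesis unfolding abs_mult by linarith
  qed
  then show "AE \<omega> in M. norm (f \<omega> * g \<omega>) \<le> norm ((f \<omega>)\<^sup>2 + (g \<omega>)\<^sup>2)" by auto
qed simp

end

context fbm_bm begin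

lemma X_square_integrable: "t \<in> {0..T} \<Longrightarrow> integrable M (\<lambda>\<omega>. (X t \<omega>)\<^sup>2)"
  and X_mean: "t \<in> {0..T} \<Longrightarrow> expectation (X t) = 0"
  and X_cov: "s \<in> {0..T} \<Longrightarrow> t \<in> {0..T} \<Longrightarrow>
    expectation (\<lambda>\<omega>. X s \<omega> * X t \<omega>) = (sqrt s + sqrt t - sqrt \<bar>t - s\<bar>) / 2"
proof -
  note f = fbm[unfolded fbm_quarter_def centred_gaussian_process_def]
  show m: "expectation (X t) = 0" if "t \<in> {0..T}" for t using f that by blast
  show c: "expectation (\<lambda>\<omega>. X s \<omega> * X t \<omega>) = (sqrt s + sqrt t - sqrt \<bar>t - s\<bar>) / 2"
    if "s \<in> {0..T}" "t \<in> {0..T}" for s t using f that by blast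
  show "integrable M (\<lambda>\<omega>. (X t \<omega>)\<^sup>2)" if t: "t \<in> {0..T}" for t
  proof -
    have "gaussian M (X t)" using gaussian_sum[of "{t}" "\<lambda>_. 1"] t by simp
    from gaussian_even_moment(1)[OF this m[OF t] refl, of 1] show ?thesis by simp
  qed
qed

lemma X_increment_even_moment:
  assumes st: "s \<in> {0..T}" "t \<in> {0..T}" and k: "0 < k"
  shows "integrable M (\<lambda>\<omega>. (X t \<omega> - X s \<omega>) ^ (2 * k))"
    and "expectation (\<lambda>\<omega>. (X t \<omega> - X s \<omega>) ^ (2 * k)) =
      fact (2 * k) / (2 ^ k * fact k) * sqrt \<bar>t - s\<bar> ^ k"
proof -
  note [measurable] = X_measurable[OF st(1)] X_measurable[OF st(2)]
  have g: "gaussian M (\<lambda>\<omega>. X t \<omega> - X s \<omega>)"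
  proof (cases "s = t")
    case True
    then show ?thesis using gaussian_sum[of "{}"] by simp
  next
    case False
    have "gaussian M (\<lambda>\<omega>. \<Sum>r\<in>{s, t}. (if r = t then 1 else - 1) * X r \<omega>)"
      by (rule gaussian_sum) (use st in auto)
    then show ?thesis using False by simp
  qed
  have int: "integrable M (X r)" if "r \<in> {0..T}" for r
  proof (rule Bochner_Integration.integrable_bound[OF Bochner_Integration.integrable_add[OF integrable_const[of 1] X_square_integrable[OF that]]])
    have "\<bar>x\<bar> \<le> 1 + x\<^sup>2" for x :: real using sum_squares_bound[of "\<bar>x\<bar>" 1] by (simp; linarith)
    then show "AE \<omega> in M. norm (X r \<omega>) \<le> norm (1 + (X r \<omega>)\<^sup>2)" by auto
  qed (use that in simp)
  have m: "expectation (\<lambda>\<omega>. X t \<omega> - X s \<omega>) = 0"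
    using int st X_mean by simp
  have ip: "integrable M (\<lambda>\<omega>. X r \<omega> * X q \<omega>)" if "r \<in> {0..T}" "q \<in> {0..T}" for r q
    using that by (intro integrable_mult_L2 X_square_integrable) auto
  have "expectation (\<lambda>\<omega>. (X t \<omega> - X s \<omega>) * (X t \<omega> - X s \<omega>)) =
      expectation (\<lambda>\<omega>. X t \<omega> * X t \<omega> - X t \<omega> * X s \<omega> - (X s \<omega> * X t \<omega> - X s \<omega> * X s \<omega>))"
    by (simp add: algebra_simps)
  also have "\<dots> = sqrt \<bar>t - s\<bar>"
    using st by (simp add: ip X_cov) (simp add: abs_minus_commute field_simps)
  finally have v: "expectation (\<lambda>\<omega>. (X t \<omega> - X s \<omega>) * (X t \<omega> - X s \<omega>)) = sqrt \<bar>t - s\<bar>" .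
  show "integrable M (\<lambda>\<omega>. (X t \<omega> - X s \<omega>) ^ (2 * k))"
    and "expectation (\<lambda>\<omega>. (X t \<omega> - X s \<omega>) ^ (2 * k)) =
      fact (2 * k) / (2 ^ k * fact k) * sqrt \<bar>t - s\<bar> ^ k"
    using gaussian_even_moment[OF g m v k] by auto
qed

lemma W_increment_even_moment:
  assumes st: "0 \<le> s" "s \<le> t" "t \<le> T" and k: "0 < k"
  shows "integrable M (\<lambda>\<omega>. (W t \<omega> - W s \<omega>) ^ (2 * k))"
    and "expectation (\<lambda>\<omega>. (W t \<omega> - W s \<omega>) ^ (2 * k)) = fact (2 * k) / (2 ^ k * fact k) * (t - s) ^ k"
    and "integrable M (\<lambda>\<omega>. W t \<omega> - W s \<omega>)"
    and "expectation (\<lambda>\<omega>. W t \<omega> - W s \<omega>) = 0"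
proof -
  let ?D = "\<lambda>\<omega>. W t \<omega> - W s \<omega>"
  have D: "s < t \<Longrightarrow> distributed M lborel ?D (normal_density 0 (sqrt (t - s)))"
    using bm st by (simp add: brownian_motion_def)
  have Dm [measurable]: "?D \<in> borel_measurable M" using st by (intro borel_measurable_diff W_measurable) auto
  have g: "gaussian M ?D"
  proof (cases "s = t")
    case True
    then show ?thesis using gaussian_sum[of "{}"] by simp
  next
    case False
    then have "0 < sqrt (t - s)" "distributed M lborel ?D (normal_density 0 (sqrt (t - s)))"
      using D st by simp_all
    then show ?thesis unfolding gaussian_def using Dm by blast
  qed
  show i: "integrable M ?D"
  proof (cases "s = t")
    case False
    then show ?thesis using distributed_integrable[OF D, of "\<lambda>x. x"] st
        integrable_normal_moment[of "sqrt (t - s)" 0 1] by simp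
  qed simp
  show m: "expectation ?D = 0"
  proof (cases "s = t")
    case False
    then show ?thesis using normal_distributed_expectation[OF _ D] st by simp
  qed simp
  have v: "expectation (\<lambda>\<omega>. ?D \<omega> * ?D \<omega>) = t - s"
  proof (cases "s = t")
    case False
    then have "variance ?D = (sqrt (t - s))\<^sup>2" using normal_distributed_variance[OF _ D] st by simp
    then show ?thesis using st m by (simp add: power2_eq_square)
  qed simp
  show "integrable M (\<lambda>\<omega>. (W t \<omega> - W s \<omega>) ^ (2 * k))"
    and "expectation (\<lambda>\<omega>. (W t \<omega> - W s \<omega>) ^ (2 * k)) = fact (2 * k) / (2 ^ k * fact k) * (t - s) ^ k"
    using gaussian_even_moment[OF g m v k] by auto
qed

lemmas W_increment_moments = W_increment_even_moment(1,2)[where k = 1, simplified] W_increment_even_moment(3,4)[where k = 1, simplified]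
  W_increment_even_moment(1,2)[where k = 2, simplified]

lemma past_times_increment:
  assumes ab: "0 \<le> a" "a \<le> b" "b \<le> T" and Z: "Z \<in> borel_measurable (past a)" "integrable M Z"
  shows "integrable M (\<lambda>\<omega>. Z \<omega> * (W b \<omega> - W a \<omega>))" "expectation (\<lambda>\<omega>. Z \<omega> * (W b \<omega> - W a \<omega>)) = 0"
    "integrable M (\<lambda>\<omega>. Z \<omega> * (W b \<omega> - W a \<omega>)\<^sup>2)"
    "expectation (\<lambda>\<omega>. Z \<omega> * (W b \<omega> - W a \<omega>)\<^sup>2) = expectation Z * (b - a)"
proof -
  note i = past_indep_increment[OF ab Z(1)]
  have i2: "indep_var borel Z borel (\<lambda>\<omega>. (W b \<omega> - W a \<omega>)\<^sup>2)"
    using indep_var_compose[OF i, of "\<lambda>x. x" borel "\<lambda>x. x\<^sup>2" borel] by (simp add: comp_def)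
  note wm = W_increment_moments[OF ab]
  show "integrable M (\<lambda>\<omega>. Z \<omega> * (W b \<omega> - W a \<omega>))" by (rule indep_var_integrable[OF i Z(2) wm(3)])
  show "expectation (\<lambda>\<omega>. Z \<omega> * (W b \<omega> - W a \<omega>)) = 0"
    using indep_var_lebesgue_integral[OF i Z(2) wm(3)] wm(4) by simp
  show "integrable M (\<lambda>\<omega>. Z \<omega> * (W b \<omega> - W a \<omega>)\<^sup>2)" by (rule indep_var_integrable[OF i2 Z(2) wm(1)])
  show "expectation (\<lambda>\<omega>. Z \<omega> * (W b \<omega> - W a \<omega>)\<^sup>2) = expectation Z * (b - a)"
    using indep_var_lebesgue_integral[OF i2 Z(2) wm(1)] wm(2) by simp
qed

lemma elementary_square_integrable:
  assumes ab: "0 \<le> a" "a \<le> b" "b \<le> T"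
    and Z: "Z \<in> borel_measurable (past a)" "integrable M (\<lambda>\<omega>. (Z \<omega>)\<^sup>2)"
  shows "integrable M (\<lambda>\<omega>. (Z \<omega> * (W b \<omega> - W a \<omega>))\<^sup>2)"
  using past_times_increment(3)[OF ab, of "\<lambda>\<omega>. (Z \<omega>)\<^sup>2"] Z by (simp add: power_mult_distrib)

lemma W_increment_past: "0 \<le> a \<Longrightarrow> a \<le> b \<Longrightarrow> b \<le> c \<Longrightarrow> (\<lambda>\<omega>. W b \<omega> - W a \<omega>) \<in> borel_measurable (past c)"
  by (intro borel_measurable_diff W_past) auto

definition overlap :: "real \<Rightarrow> real \<Rightarrow> real \<Rightarrow> real \<Rightarrow> real" where
  "overlap a b c d = max 0 (min b d - max a c)"

text \<open>
  Both increments of \<open>W\<close> are cut at \<open>c\<close> and at the smaller right endpoint. Any product of increments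
  over different pieces has a later factor that is centred and independent of the rest, so that only
  the squared increment over the common piece contributes.
\<close>

lemma elementary_isometry_ordered:
  assumes ab: "0 \<le> a" "a \<le> b" "b \<le> T" and cd: "0 \<le> c" "c \<le> d" "d \<le> T" and ac: "a \<le> c"
    and \<xi>: "\<xi> \<in> borel_measurable (past a)" "integrable M (\<lambda>\<omega>. (\<xi> \<omega>)\<^sup>2)"
    and \<eta>: "\<eta> \<in> borel_measurable (past c)" "integrable M (\<lambda>\<omega>. (\<eta> \<omega>)\<^sup>2)"
  shows "expectation (\<lambda>\<omega>. (\<xi> \<omega> * (W b \<omega> - W a \<omega>)) * (\<eta> \<omega> * (W d \<omega> - W c \<omega>))) =
    expectation (\<lambda>\<omega>. \<xi> \<omega> * \<eta> \<omega>) * overlap a b c d"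
proof -
  have aT: "a \<le> T" "c \<le> T" using ab cd by auto
  have \<xi>c: "\<xi> \<in> borel_measurable (past c)" by (rule measurable_past_mono[OF ac \<xi>(1)])
  have \<xi>M: "\<xi> \<in> borel_measurable M" by (rule measurable_past_M[OF aT(1) \<xi>(1)])
  have \<eta>M: "\<eta> \<in> borel_measurable M" by (rule measurable_past_M[OF aT(2) \<eta>(1)])
  have \<xi>\<eta>: "integrable M (\<lambda>\<omega>. \<xi> \<omega> * \<eta> \<omega>)" by (rule integrable_mult_L2[OF \<xi>M \<eta>M \<xi>(2) \<eta>(2)])
  have \<xi>\<eta>c: "(\<lambda>\<omega>. \<xi> \<omega> * \<eta> \<omega>) \<in> borel_measurable (past c)" using \<xi>c \<eta>(1) by simp
  have Z0: "integrable M (\<lambda>\<omega>. (\<xi> \<omega> * (W e \<omega> - W a \<omega>)) * \<eta> \<omega>)"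
    "(\<lambda>\<omega>. (\<xi> \<omega> * (W e \<omega> - W a \<omega>)) * \<eta> \<omega>) \<in> borel_measurable (past c)" if "a \<le> e" "e \<le> c" for e
  proof -
    have eT: "e \<le> T" using that aT by simp
    have "(\<lambda>\<omega>. \<xi> \<omega> * (W e \<omega> - W a \<omega>)) \<in> borel_measurable (past c)"
      using \<xi>c W_increment_past[OF ab(1) that] by simp
    then show "(\<lambda>\<omega>. (\<xi> \<omega> * (W e \<omega> - W a \<omega>)) * \<eta> \<omega>) \<in> borel_measurable (past c)"
      using \<eta>(1) by simp
    show "integrable M (\<lambda>\<omega>. (\<xi> \<omega> * (W e \<omega> - W a \<omega>)) * \<eta> \<omega>)"
      by (rule integrable_mult_L2[OF measurable_past_M[OF aT(2)] \<eta>M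
            elementary_square_integrable[OF ab(1) that(1) eT \<xi>] \<eta>(2)]) fact
  qed
  show ?thesis
  proof (cases "b \<le> c")
    case True
    then have "expectation (\<lambda>\<omega>. (\<xi> \<omega> * (W b \<omega> - W a \<omega>) * \<eta> \<omega>) * (W d \<omega> - W c \<omega>)) = 0"
      using past_times_increment(2)[OF cd Z0(2)[OF ab(2) True] Z0(1)[OF ab(2) True]] by simp
    moreover have "overlap a b c d = 0" using True by (auto simp: overlap_def)
    ultimately show ?thesis by (simp add: mult.assoc)
  next
    case False
    \<comment> \<open>The common part of the two intervals is [c, e].\<close>
    define e where "e = min b d"
    have e: "c \<le> e" "e \<le> b" "e \<le> d" "0 \<le> e" "e \<le> T" "e = b \<or> e = d"
      using False ab cd by (auto simp: e_def)
    let ?z = "\<lambda>\<omega>. \<xi> \<omega> * \<eta> \<omega>"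
    let ?t1 = "\<lambda>\<omega>. (\<xi> \<omega> * (W c \<omega> - W a \<omega>)) * \<eta> \<omega> * (W d \<omega> - W c \<omega>)"
    let ?t2 = "\<lambda>\<omega>. ?z \<omega> * (W e \<omega> - W c \<omega>)\<^sup>2"
    let ?t3 = "\<lambda>\<omega>. (?z \<omega> * (W e \<omega> - W c \<omega>)) * (W d \<omega> - W e \<omega>)"
    let ?t4 = "\<lambda>\<omega>. (?z \<omega> * (W e \<omega> - W c \<omega>)) * (W b \<omega> - W e \<omega>)"
    have zce: "integrable M (\<lambda>\<omega>. ?z \<omega> * (W e \<omega> - W c \<omega>))"
      by (rule past_times_increment(1)[OF cd(1) e(1,5) \<xi>\<eta>c \<xi>\<eta>])
    have zcm: "(\<lambda>\<omega>. ?z \<omega> * (W e \<omega> - W c \<omega>)) \<in> borel_measurable (past e)"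
      using measurable_past_mono[OF e(1) \<xi>\<eta>c] W_increment_past[OF cd(1) e(1) order.refl] by simp
    note t1 = past_times_increment(1,2)[OF cd Z0(2)[OF ac order.refl] Z0(1)[OF ac order.refl]]
    note t2 = past_times_increment(3,4)[OF cd(1) e(1,5) \<xi>\<eta>c \<xi>\<eta>]
    note t3 = past_times_increment(1,2)[OF e(4,3) cd(3) zcm zce]
    note t4 = past_times_increment(1,2)[OF e(4,2) ab(3) zcm zce]
    have "(\<xi> \<omega> * (W b \<omega> - W a \<omega>)) * (\<eta> \<omega> * (W d \<omega> - W c \<omega>)) = ?t1 \<omega> + ?t2 \<omega> + ?t3 \<omega> + ?t4 \<omega>" for \<omega>
      using e(6) by (auto simp: power2_eq_square algebra_simps)
    then have "expectation (\<lambda>\<omega>. (\<xi> \<omega> * (W b \<omega> - W a \<omega>)) * (\<eta> \<omega> * (W d \<omega> - W c \<omega>))) =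
      expectation ?t1 + expectation ?t2 + expectation ?t3 + expectation ?t4"
      using t1(1) t2(1) t3(1) t4(1) by (simp only: Bochner_Integration.integral_add Bochner_Integration.integrable_add)
    also have "\<dots> = expectation ?z * (e - c)" using t1(2) t2(2) t3(2) t4(2) by simp
    also have "e - c = overlap a b c d" using e ac by (auto simp: overlap_def e_def)
    finally show ?thesis .
  qed
qed

lemma elementary_isometry:
  assumes ab: "0 \<le> a" "a \<le> b" "b \<le> T" and cd: "0 \<le> c" "c \<le> d" "d \<le> T"
    and \<xi>: "\<xi> \<in> borel_measurable (past a)" "integrable M (\<lambda>\<omega>. (\<xi> \<omega>)\<^sup>2)"
    and \<eta>: "\<eta> \<in> borel_measurable (past c)" "integrable M (\<lambda>\<omega>. (\<eta> \<omega>)\<^sup>2)"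
  shows "expectation (\<lambda>\<omega>. (\<xi> \<omega> * (W b \<omega> - W a \<omega>)) * (\<eta> \<omega> * (W d \<omega> - W c \<omega>))) =
    expectation (\<lambda>\<omega>. \<xi> \<omega> * \<eta> \<omega>) * overlap a b c d"
proof (cases "a \<le> c")
  case True
  then show ?thesis by (rule elementary_isometry_ordered[OF ab cd _ \<xi> \<eta>])
next
  case False
  then have "c \<le> a" by simp
  from elementary_isometry_ordered[OF cd ab this \<eta> \<xi>] show ?thesis
    by (simp add: mult.commute overlap_def min.commute max.commute)
qed

end

section \<open>Limits of simple stochastic integrals\<close>

lemma partition_mono:
  assumes "partition s t n \<tau>" "i \<le> j" "j \<le> n"
  shows "\<tau> i \<le> \<tau> j"
  using assms(2,3)
proof (induction j rule: dec_induct)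
  case (step j)
  then have "\<tau> j \<le> \<tau> (Suc j)" using assms(1) by (simp add: partition_def)
  with step show ?case by simp
qed simp

lemma partition_bounds:
  assumes "partition s t n \<tau>" "i \<le> n"
  shows "s \<le> \<tau> i" "\<tau> i \<le> t"
  using partition_mono[OF assms(1), of 0 i] partition_mono[OF assms(1), of i n] assms
  by (auto simp: partition_def)

context prob_space begin

definition dist2 :: "real \<Rightarrow> real \<Rightarrow> (real \<Rightarrow> 'a \<Rightarrow> real) \<Rightarrow> (real \<Rightarrow> 'a \<Rightarrow> real) \<Rightarrow> ennreal" where
  "dist2 s t F G = (\<integral>\<^sup>+\<omega>. (\<integral>\<^sup>+r\<in>{s..t}. ennreal ((F r \<omega> - G r \<omega>)\<^sup>2) \<partial>lborel) \<partial>M)"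

text \<open>
  The paths of \<open>X\<close> and \<open>W\<close> are continuous only almost surely, so joint measurability can only be asked
  of a process that agrees with \<open>H\<close> almost surely.
\<close>

definition regular :: "real \<Rightarrow> real \<Rightarrow> (real \<Rightarrow> 'a \<Rightarrow> real) \<Rightarrow> bool" where
  "regular s t H \<longleftrightarrow> (\<exists>H'. (\<lambda>(\<omega>, r). H' r \<omega>) \<in> borel_measurable (M \<Otimes>\<^sub>M lborel) \<and>
     (AE \<omega> in M. \<forall>r\<in>{s..t}. H r \<omega> = H' r \<omega>))"

lemma dist2_commute: "dist2 s t F G = dist2 s t G F"
  by (simp add: dist2_def power2_commute)

lemma dist2_cong_AE:
  assumes "AE \<omega> in M. \<forall>r\<in>{s..t}. F r \<omega> = F' r \<omega>" "AE \<omega> in M. \<forall>r\<in>{s..t}. G r \<omega> = G' r \<omega>"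
  shows "dist2 s t F G = dist2 s t F' G'"
  unfolding dist2_def
proof (rule nn_integral_cong_AE)
  show "AE \<omega> in M. (\<integral>\<^sup>+r\<in>{s..t}. ennreal ((F r \<omega> - G r \<omega>)\<^sup>2) \<partial>lborel) =
      (\<integral>\<^sup>+r\<in>{s..t}. ennreal ((F' r \<omega> - G' r \<omega>)\<^sup>2) \<partial>lborel)"
    using assms
  proof eventually_elim
    case (elim \<omega>)
    then show ?case by (intro nn_integral_cong) (auto simp: indicator_def)
  qed
qed

lemma ennreal_square_triangle:
  "ennreal ((x - z)\<^sup>2) \<le> 2 * ennreal ((x - y)\<^sup>2) + 2 * ennreal ((y - z)\<^sup>2)"
proof -
  have "0 \<le> ((x - y) - (y - z))\<^sup>2" by simp
  then have "(x - z)\<^sup>2 \<le> 2 * (x - y)\<^sup>2 + 2 * (y - z)\<^sup>2"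
    by (simp add: power2_eq_square algebra_simps)
  then have "ennreal ((x - z)\<^sup>2) \<le> ennreal (2 * (x - y)\<^sup>2 + 2 * (y - z)\<^sup>2)" by (rule ennreal_leI)
  also have "\<dots> = 2 * ennreal ((x - y)\<^sup>2) + 2 * ennreal ((y - z)\<^sup>2)"
    by (simp add: ennreal_plus ennreal_mult)
  finally show ?thesis .
qed

lemma nn_L2_triangle:
  fixes f g h :: "'a \<Rightarrow> real"
  assumes [measurable]: "f \<in> borel_measurable M" "g \<in> borel_measurable M" "h \<in> borel_measurable M"
  shows "(\<integral>\<^sup>+\<omega>. ennreal ((f \<omega> - h \<omega>)\<^sup>2) \<partial>M) \<le>
    2 * (\<integral>\<^sup>+\<omega>. ennreal ((f \<omega> - g \<omega>)\<^sup>2) \<partial>M) + 2 * (\<integral>\<^sup>+\<omega>. ennreal ((g \<omega> - h \<omega>)\<^sup>2) \<partial>M)"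
proof -
  have "(\<integral>\<^sup>+\<omega>. ennreal ((f \<omega> - h \<omega>)\<^sup>2) \<partial>M) \<le>
     (\<integral>\<^sup>+\<omega>. 2 * ennreal ((f \<omega> - g \<omega>)\<^sup>2) + 2 * ennreal ((g \<omega> - h \<omega>)\<^sup>2) \<partial>M)"
    by (intro nn_integral_mono ennreal_square_triangle)
  also have "\<dots> = 2 * (\<integral>\<^sup>+\<omega>. ennreal ((f \<omega> - g \<omega>)\<^sup>2) \<partial>M) + 2 * (\<integral>\<^sup>+\<omega>. ennreal ((g \<omega> - h \<omega>)\<^sup>2) \<partial>M)"
    by (simp add: nn_integral_add nn_integral_cmult)
  finally show ?thesis .
qed

text \<open>
  Lower integrals of non-measurable functions need not be subadditive; this is where \<open>regular\<close> enters.
\<close>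

lemma dist2_triangle:
  assumes "regular s t F" "regular s t G" "regular s t H"
  shows "dist2 s t F H \<le> 2 * dist2 s t F G + 2 * dist2 s t G H"
proof -
  obtain F' where [measurable]: "(\<lambda>(\<omega>, r). F' r \<omega>) \<in> borel_measurable (M \<Otimes>\<^sub>M lborel)"
    and F: "AE \<omega> in M. \<forall>r\<in>{s..t}. F r \<omega> = F' r \<omega>" using assms(1) by (auto simp: regular_def)
  obtain G' where [measurable]: "(\<lambda>(\<omega>, r). G' r \<omega>) \<in> borel_measurable (M \<Otimes>\<^sub>M lborel)"
    and G: "AE \<omega> in M. \<forall>r\<in>{s..t}. G r \<omega> = G' r \<omega>" using assms(2) by (auto simp: regular_def)
  obtain H' where [measurable]: "(\<lambda>(\<omega>, r). H' r \<omega>) \<in> borel_measurable (M \<Otimes>\<^sub>M lborel)"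
    and H: "AE \<omega> in M. \<forall>r\<in>{s..t}. H r \<omega> = H' r \<omega>" using assms(3) by (auto simp: regular_def)
  have "dist2 s t F' H' \<le> (\<integral>\<^sup>+\<omega>. (\<integral>\<^sup>+r. 2 * (ennreal ((F' r \<omega> - G' r \<omega>)\<^sup>2) * indicator {s..t} r) +
      2 * (ennreal ((G' r \<omega> - H' r \<omega>)\<^sup>2) * indicator {s..t} r) \<partial>lborel) \<partial>M)"
    unfolding dist2_def
    by (intro nn_integral_mono) (auto simp: indicator_def intro!: ennreal_square_triangle)
  also have "\<dots> = (\<integral>\<^sup>+\<omega>. 2 * (\<integral>\<^sup>+r\<in>{s..t}. ennreal ((F' r \<omega> - G' r \<omega>)\<^sup>2) \<partial>lborel) +
      2 * (\<integral>\<^sup>+r\<in>{s..t}. ennreal ((G' r \<omega> - H' r \<omega>)\<^sup>2) \<partial>lborel) \<partial>M)"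
    by (intro nn_integral_cong) (simp add: nn_integral_add nn_integral_cmult)
  also have "\<dots> = 2 * dist2 s t F' G' + 2 * dist2 s t G' H'"
    unfolding dist2_def by (simp add: nn_integral_add nn_integral_cmult)
  finally show ?thesis
    by (simp add: dist2_cong_AE[OF F G] dist2_cong_AE[OF F H] dist2_cong_AE[OF G H])
qed

text \<open>
  Tonelli's theorem. The left endpoint is left out since step functions vanish there.
\<close>

lemma dist2_le:
  assumes st: "s \<le> t" and \<eta>: "0 \<le> \<eta>" and "regular s t F" "regular s t G"
    and le: "\<And>r. s < r \<Longrightarrow> r \<le> t \<Longrightarrow> (\<integral>\<^sup>+\<omega>. ennreal ((F r \<omega> - G r \<omega>)\<^sup>2) \<partial>M) \<le> ennreal \<eta>"
  shows "dist2 s t F G \<le> ennreal (\<eta> * (t - s))"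
proof -
  obtain F' where F'[measurable]: "(\<lambda>(\<omega>, r). F' r \<omega>) \<in> borel_measurable (M \<Otimes>\<^sub>M lborel)"
    and F: "AE \<omega> in M. \<forall>r\<in>{s..t}. F r \<omega> = F' r \<omega>" using assms(3) by (auto simp: regular_def)
  obtain G' where G'[measurable]: "(\<lambda>(\<omega>, r). G' r \<omega>) \<in> borel_measurable (M \<Otimes>\<^sub>M lborel)"
    and G: "AE \<omega> in M. \<forall>r\<in>{s..t}. G r \<omega> = G' r \<omega>" using assms(4) by (auto simp: regular_def)
  interpret P: pair_sigma_finite M lborel by unfold_locales
  have "dist2 s t F G = dist2 s t F' G'" by (rule dist2_cong_AE[OF F G])
  also have "\<dots> = (\<integral>\<^sup>+r. (\<integral>\<^sup>+\<omega>. ennreal ((F' r \<omega> - G' r \<omega>)\<^sup>2) * indicator {s..t} r \<partial>M) \<partial>lborel)"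
    unfolding dist2_def by (rule P.Fubini'[symmetric]) measurable
  also have "\<dots> \<le> (\<integral>\<^sup>+r. ennreal \<eta> * indicator {s..t} r \<partial>lborel)"
  proof (rule nn_integral_mono_AE)
    show "AE r in lborel. (\<integral>\<^sup>+\<omega>. ennreal ((F' r \<omega> - G' r \<omega>)\<^sup>2) * indicator {s..t} r \<partial>M)
        \<le> ennreal \<eta> * indicator {s..t} r"
      using AE_lborel_singleton[of s]
    proof eventually_elim
      case (elim r)
      show ?case
      proof (cases "r \<in> {s..t}")
        case True
        have "(\<integral>\<^sup>+\<omega>. ennreal ((F' r \<omega> - G' r \<omega>)\<^sup>2) \<partial>M) = (\<integral>\<^sup>+\<omega>. ennreal ((F r \<omega> - G r \<omega>)\<^sup>2) \<partial>M)"
        proof (rule nn_integral_cong_AE)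
          show "AE \<omega> in M. ennreal ((F' r \<omega> - G' r \<omega>)\<^sup>2) = ennreal ((F r \<omega> - G r \<omega>)\<^sup>2)"
            using F G by eventually_elim (use True in simp)
        qed
        then show ?thesis using le[of r] True elim by simp
      qed simp
    qed
  qed
  also have "\<dots> = ennreal (\<eta> * (t - s))"
    using st \<eta> by (simp add: nn_integral_cmult_indicator ennreal_mult)
  finally show ?thesis .
qed

lemma regular_const: "regular s t (\<lambda>r \<omega>. 0)"
  unfolding regular_def by (intro exI[of _ "\<lambda>r \<omega>. 0"]) auto

end

context fbm_bm begin

text \<open>
  Both sides are the same quadratic form in the coefficients: the left one by \<open>elementary_isometry\<close>,
  the right one because the integral of a product of two indicators is the overlap.
\<close>

lemma family_isometry:
  fixes I :: "'i set" and a b :: "'i \<Rightarrow> real" and \<xi> :: "'i \<Rightarrow> 'a \<Rightarrow> real"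
  assumes I: "finite I" and st: "0 \<le> s" "t \<le> T"
    and ab: "\<And>i. i \<in> I \<Longrightarrow> s \<le> a i \<and> a i \<le> b i \<and> b i \<le> t"
    and \<xi>: "\<And>i. i \<in> I \<Longrightarrow> \<xi> i \<in> borel_measurable (past (a i))"
      "\<And>i. i \<in> I \<Longrightarrow> integrable M (\<lambda>\<omega>. (\<xi> i \<omega>)\<^sup>2)"
  shows "(\<integral>\<^sup>+\<omega>. ennreal ((\<Sum>i\<in>I. \<xi> i \<omega> * (W (b i) \<omega> - W (a i) \<omega>))\<^sup>2) \<partial>M) =
    (\<integral>\<^sup>+\<omega>. (\<integral>\<^sup>+r\<in>{s..t}. ennreal ((\<Sum>i\<in>I. \<xi> i \<omega> * indicator {a i<..b i} r)\<^sup>2) \<partial>lborel) \<partial>M)"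
proof -
  let ?S = "\<lambda>i \<omega>. \<xi> i \<omega> * (W (b i) \<omega> - W (a i) \<omega>)"
  let ?ov = "\<lambda>i j. overlap (a i) (b i) (a j) (b j)"
  let ?Q = "\<lambda>\<omega>. \<Sum>i\<in>I. \<Sum>j\<in>I. \<xi> i \<omega> * \<xi> j \<omega> * ?ov i j"
  have bds: "0 \<le> a i" "a i \<le> b i" "b i \<le> T" "a i \<le> T" if "i \<in> I" for i using ab[OF that] st by auto
  have \<xi>M: "\<xi> i \<in> borel_measurable M" if "i \<in> I" for i
    by (rule measurable_past_M[OF bds(4)[OF that] \<xi>(1)[OF that]])
  have SM: "?S i \<in> borel_measurable M" if "i \<in> I" for i
    using \<xi>M[OF that] bds[OF that] by (intro borel_measurable_times borel_measurable_diff W_measurable) auto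
  have S2: "integrable M (\<lambda>\<omega>. (?S i \<omega>)\<^sup>2)" if "i \<in> I" for i
    by (rule elementary_square_integrable) (use bds \<xi> that in auto)
  have SS: "integrable M (\<lambda>\<omega>. ?S i \<omega> * ?S j \<omega>)" if "i \<in> I" "j \<in> I" for i j
    by (rule integrable_mult_L2) (use SM S2 that in auto)
  have \<xi>\<xi>: "integrable M (\<lambda>\<omega>. \<xi> i \<omega> * \<xi> j \<omega>)" if "i \<in> I" "j \<in> I" for i j
    by (rule integrable_mult_L2) (use \<xi>M \<xi> that in auto)
  have E: "expectation (\<lambda>\<omega>. ?S i \<omega> * ?S j \<omega>) = expectation (\<lambda>\<omega>. \<xi> i \<omega> * \<xi> j \<omega>) * ?ov i j"
    if "i \<in> I" "j \<in> I" for i j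
    by (rule elementary_isometry) (use bds \<xi> that in auto)
  have sq: "(\<Sum>i\<in>I. ?S i \<omega>)\<^sup>2 = (\<Sum>i\<in>I. \<Sum>j\<in>I. ?S i \<omega> * ?S j \<omega>)" for \<omega>
    by (simp only: power2_eq_square sum_product)
  have intS: "integrable M (\<lambda>\<omega>. (\<Sum>i\<in>I. ?S i \<omega>)\<^sup>2)"
    unfolding sq by (intro Bochner_Integration.integrable_sum SS)
  have intQ: "integrable M ?Q"
    by (intro Bochner_Integration.integrable_sum integrable_mult_left \<xi>\<xi>)
  have "expectation (\<lambda>\<omega>. (\<Sum>i\<in>I. ?S i \<omega>)\<^sup>2) = (\<Sum>i\<in>I. \<Sum>j\<in>I. expectation (\<lambda>\<omega>. ?S i \<omega> * ?S j \<omega>))"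
    unfolding sq by (subst Bochner_Integration.integral_sum, intro Bochner_Integration.integrable_sum SS, assumption+)
      (intro sum.cong refl Bochner_Integration.integral_sum SS)
  also have "\<dots> = (\<Sum>i\<in>I. \<Sum>j\<in>I. expectation (\<lambda>\<omega>. \<xi> i \<omega> * \<xi> j \<omega> * ?ov i j))"
    by (intro sum.cong refl) (simp add: E)
  also have "\<dots> = expectation ?Q"
    by (subst Bochner_Integration.integral_sum, intro Bochner_Integration.integrable_sum integrable_mult_left \<xi>\<xi>, assumption+)
      (intro sum.cong refl Bochner_Integration.integral_sum[symmetric] integrable_mult_left \<xi>\<xi>)
  finally have EQ: "expectation (\<lambda>\<omega>. (\<Sum>i\<in>I. ?S i \<omega>)\<^sup>2) = expectation ?Q" .
  have inner: "(\<integral>\<^sup>+r\<in>{s..t}. ennreal ((\<Sum>i\<in>I. \<xi> i \<omega> * indicator {a i<..b i} r)\<^sup>2) \<partial>lborel) = ennreal (?Q \<omega>)"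
    and Q0: "0 \<le> ?Q \<omega>" for \<omega>
  proof -
    let ?v = "\<lambda>r. \<Sum>i\<in>I. \<xi> i \<omega> * indicator {a i<..b i} r"
    let ?A = "\<lambda>i j. {max (a i) (a j)<..min (b i) (b j)}"
    have v2: "(?v r)\<^sup>2 = (\<Sum>i\<in>I. \<Sum>j\<in>I. \<xi> i \<omega> * \<xi> j \<omega> * indicator (?A i j) r)" for r
      unfolding power2_eq_square sum_product
      by (intro sum.cong refl) (auto simp: indicator_def)
    have hb1: "has_bochner_integral lborel (\<lambda>r. \<xi> i \<omega> * \<xi> j \<omega> * indicator (?A i j) r) (\<xi> i \<omega> * \<xi> j \<omega> * ?ov i j)" for i j
    proof -
      have "has_bochner_integral lborel (indicator (?A i j) :: real \<Rightarrow> real) (measure lborel (?A i j))"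
        by (rule has_bochner_integral_real_indicator)
          (auto, cases "max (a i) (a j) \<le> min (b i) (b j)", auto)
      moreover have "measure lborel (?A i j) = ?ov i j"
        by (cases "max (a i) (a j) \<le> min (b i) (b j)") (auto simp: overlap_def)
      ultimately show ?thesis by (intro has_bochner_integral_mult_right) simp
    qed
    have hb: "has_bochner_integral lborel (\<lambda>r. (?v r)\<^sup>2) (?Q \<omega>)"
      unfolding v2 by (intro has_bochner_integral_sum hb1)
    have "(\<integral>\<^sup>+r\<in>{s..t}. ennreal ((?v r)\<^sup>2) \<partial>lborel) = (\<integral>\<^sup>+r. ennreal ((?v r)\<^sup>2) \<partial>lborel)"
    proof (rule nn_integral_cong)
      fix r
      have "?v r = 0" if "r \<notin> {s..t}"
        by (rule sum.neutral) (use that ab in \<open>fastforce simp: indicator_def\<close>)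
      then show "ennreal ((?v r)\<^sup>2) * indicator {s..t} r = ennreal ((?v r)\<^sup>2)"
        by (cases "r \<in> {s..t}") auto
    qed
    also have "\<dots> = ennreal (?Q \<omega>)"
      using nn_integral_eq_integral[OF integrable.intros[OF hb]] has_bochner_integral_integral_eq[OF hb] by simp
    finally show "(\<integral>\<^sup>+r\<in>{s..t}. ennreal ((?v r)\<^sup>2) \<partial>lborel) = ennreal (?Q \<omega>)" .
    have "0 \<le> integral\<^sup>L lborel (\<lambda>r. (?v r)\<^sup>2)" by (rule integral_nonneg_AE) simp
    then show "0 \<le> ?Q \<omega>" using has_bochner_integral_integral_eq[OF hb] by simp
  qed
  have "(\<integral>\<^sup>+\<omega>. ennreal ((\<Sum>i\<in>I. ?S i \<omega>)\<^sup>2) \<partial>M) = ennreal (expectation ?Q)"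
    unfolding EQ[symmetric] by (rule nn_integral_eq_integral[OF intS]) simp
  also have "\<dots> = (\<integral>\<^sup>+\<omega>. ennreal (?Q \<omega>) \<partial>M)"
    by (rule nn_integral_eq_integral[OF intQ, symmetric]) (simp add: Q0)
  finally show ?thesis by (simp only: inner)
qed

lemma simple_process_measurable:
  assumes "simple_process M past s t n \<tau> \<xi>" "0 \<le> s" "t \<le> T"
  shows "simple_integral W n \<tau> \<xi> \<in> borel_measurable M" "regular s t (simple_value n \<tau> \<xi>)"
proof -
  have p: "partition s t n \<tau>" and \<xi>p: "\<And>i. i < n \<Longrightarrow> \<xi> i \<in> borel_measurable (past (\<tau> i))"
    using assms(1) by (auto simp: simple_process_def)
  have \<tau>: "\<tau> i \<in> {0..T}" if "i \<le> n" for i using partition_bounds[OF p that] assms by auto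
  have \<xi>m [measurable]: "\<xi> i \<in> borel_measurable M" if "i < n" for i
    by (rule measurable_past_M[OF _ \<xi>p[OF that]]) (use \<tau>[of i] that in auto)
  show "simple_integral W n \<tau> \<xi> \<in> borel_measurable M"
    unfolding simple_integral_def using \<tau>
    by (intro borel_measurable_sum borel_measurable_times borel_measurable_diff W_measurable \<xi>m) auto
  have "(\<lambda>(\<omega>, r). simple_value n \<tau> \<xi> r \<omega>) \<in> borel_measurable (M \<Otimes>\<^sub>M lborel)"
    unfolding simple_value_def case_prod_unfold
    by (intro borel_measurable_sum borel_measurable_times measurable_compose[OF measurable_fst \<xi>m]) auto
  then show "regular s t (simple_value n \<tau> \<xi>)" unfolding regular_def by blast
qed

text \<open>
  Two simple processes on different partitions are joined into one weighted family of intervals, with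
  the coefficients of the second one negated.
\<close>

lemma simple_isometry:
  assumes P: "simple_process M past s t n \<tau> \<xi>" and Q: "simple_process M past s t n' \<tau>' \<xi>'"
    and st: "0 \<le> s" "t \<le> T"
  shows "(\<integral>\<^sup>+\<omega>. ennreal ((simple_integral W n \<tau> \<xi> \<omega> - simple_integral W n' \<tau>' \<xi>' \<omega>)\<^sup>2) \<partial>M) =
    dist2 s t (simple_value n \<tau> \<xi>) (simple_value n' \<tau>' \<xi>')"
proof -
  let ?I = "{..<n} <+> {..<n'}"
  let ?a = "case_sum \<tau> \<tau>'" and ?b = "case_sum (\<lambda>i. \<tau> (Suc i)) (\<lambda>i. \<tau>' (Suc i))"
  let ?\<xi> = "case_sum \<xi> (\<lambda>i \<omega>. - \<xi>' i \<omega>)"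
  have p: "partition s t n \<tau>" "partition s t n' \<tau>'"
    and \<xi>p: "\<And>i. i < n \<Longrightarrow> \<xi> i \<in> borel_measurable (past (\<tau> i))" "\<And>i. i < n \<Longrightarrow> integrable M (\<lambda>\<omega>. (\<xi> i \<omega>)\<^sup>2)"
    "\<And>i. i < n' \<Longrightarrow> \<xi>' i \<in> borel_measurable (past (\<tau>' i))" "\<And>i. i < n' \<Longrightarrow> integrable M (\<lambda>\<omega>. (\<xi>' i \<omega>)\<^sup>2)"
    using P Q by (auto simp: simple_process_def)
  have "(\<integral>\<^sup>+\<omega>. ennreal ((\<Sum>i\<in>?I. ?\<xi> i \<omega> * (W (?b i) \<omega> - W (?a i) \<omega>))\<^sup>2) \<partial>M) =
    (\<integral>\<^sup>+\<omega>. (\<integral>\<^sup>+r\<in>{s..t}. ennreal ((\<Sum>i\<in>?I. ?\<xi> i \<omega> * indicator {?a i<..?b i} r)\<^sup>2) \<partial>lborel) \<partial>M)"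
  proof (rule family_isometry[OF _ st])
    show "s \<le> ?a i \<and> ?a i \<le> ?b i \<and> ?b i \<le> t" if "i \<in> ?I" for i
      using that partition_bounds[OF p(1)] partition_bounds[OF p(2)]
        partition_mono[OF p(1) le_SucI[OF order.refl]] partition_mono[OF p(2) le_SucI[OF order.refl]]
      by (auto simp: Suc_le_eq)
  qed (use \<xi>p in auto)
  moreover have "(\<Sum>i\<in>?I. ?\<xi> i \<omega> * indicator {?a i<..?b i} r) =
      simple_value n \<tau> \<xi> r \<omega> - simple_value n' \<tau>' \<xi>' r \<omega>" for \<omega> r
    unfolding simple_value_def sum.Plus[OF finite_lessThan finite_lessThan] by (simp add: sum_negf)
  moreover have "(\<Sum>i\<in>?I. ?\<xi> i \<omega> * (W (?b i) \<omega> - W (?a i) \<omega>)) =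
      simple_integral W n \<tau> \<xi> \<omega> - simple_integral W n' \<tau>' \<xi>' \<omega>" for \<omega>
    unfolding simple_integral_def sum.Plus[OF finite_lessThan finite_lessThan] by (simp add: sum_negf)
  ultimately show ?thesis by (simp only: dist2_def)
qed

text \<open>
  \<open>J\<close> is at most as far from any simple integral as \<open>H\<close> is from the simple process, up to a constant.
  The factor 4 pays for two applications of the inequality \<open>(a + b)\<^sup>2 \<le> 2 * a\<^sup>2 + 2 * b\<^sup>2\<close>. The condition
  contains no approximating sequence, so that any convenient one can be chosen later.
\<close>

definition ito_limit :: "(real \<Rightarrow> 'a \<Rightarrow> real) \<Rightarrow> real \<Rightarrow> real \<Rightarrow> ('a \<Rightarrow> real) \<Rightarrow> bool" where
  "ito_limit H s t J \<longleftrightarrow> J \<in> borel_measurable M \<and>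
     (\<forall>n \<tau> \<xi>. simple_process M past s t n \<tau> \<xi> \<longrightarrow>
        (\<integral>\<^sup>+\<omega>. ennreal ((J \<omega> - simple_integral W n \<tau> \<xi> \<omega>)\<^sup>2) \<partial>M) \<le> 4 * dist2 s t H (simple_value n \<tau> \<xi>))"

lemma ito_limit_L2:
  assumes st: "0 \<le> s" "t \<le> T" and J [measurable]: "J \<in> borel_measurable M" and H: "regular s t H"
    and P: "\<And>k. simple_process M past s t (n k) (\<tau> k) (\<xi> k)"
    and v: "(\<lambda>k. dist2 s t H (simple_value (n k) (\<tau> k) (\<xi> k))) \<longlonglongrightarrow> 0"
    and I: "(\<lambda>k. \<integral>\<^sup>+\<omega>. ennreal ((J \<omega> - simple_integral W (n k) (\<tau> k) (\<xi> k) \<omega>)\<^sup>2) \<partial>M) \<longlonglongrightarrow> 0"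
  shows "ito_limit H s t J"
  unfolding ito_limit_def
proof (intro conjI allI impI J)
  fix n' \<tau>' \<xi>' assume Q: "simple_process M past s t n' \<tau>' \<xi>'"
  let ?S = "\<lambda>k. simple_integral W (n k) (\<tau> k) (\<xi> k)" and ?S' = "simple_integral W n' \<tau>' \<xi>'"
  let ?v = "\<lambda>k. simple_value (n k) (\<tau> k) (\<xi> k)" and ?v' = "simple_value n' \<tau>' \<xi>'"
  note m = simple_process_measurable[OF P st] simple_process_measurable[OF Q st]
  let ?u = "\<lambda>k. 2 * (\<integral>\<^sup>+\<omega>. ennreal ((J \<omega> - ?S k \<omega>)\<^sup>2) \<partial>M) + 2 * (2 * dist2 s t H (?v k) + 2 * dist2 s t H ?v')"
  have le: "(\<integral>\<^sup>+\<omega>. ennreal ((J \<omega> - ?S' \<omega>)\<^sup>2) \<partial>M) \<le> ?u k" for k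
  proof -
    have "(\<integral>\<^sup>+\<omega>. ennreal ((J \<omega> - ?S' \<omega>)\<^sup>2) \<partial>M) \<le>
        2 * (\<integral>\<^sup>+\<omega>. ennreal ((J \<omega> - ?S k \<omega>)\<^sup>2) \<partial>M) + 2 * (\<integral>\<^sup>+\<omega>. ennreal ((?S k \<omega> - ?S' \<omega>)\<^sup>2) \<partial>M)"
      by (rule nn_L2_triangle) (use m in auto)
    also have "(\<integral>\<^sup>+\<omega>. ennreal ((?S k \<omega> - ?S' \<omega>)\<^sup>2) \<partial>M) = dist2 s t (?v k) ?v'"
      by (rule simple_isometry[OF P Q st])
    also have "\<dots> \<le> 2 * dist2 s t H (?v k) + 2 * dist2 s t H ?v'"
      using dist2_triangle[OF m(2) H m(4)] by (simp add: dist2_commute)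
    finally show ?thesis by (simp add: add_mono mult_left_mono)
  qed
  have "?u \<longlonglongrightarrow> 2 * 0 + 2 * (2 * 0 + 2 * dist2 s t H ?v')"
    by (intro tendsto_add ennreal_tendsto_cmult tendsto_const v I) auto
  from LIMSEQ_le_const[OF this] le
  have "(\<integral>\<^sup>+\<omega>. ennreal ((J \<omega> - ?S' \<omega>)\<^sup>2) \<partial>M) \<le> 2 * 0 + 2 * (2 * 0 + 2 * dist2 s t H ?v')" by blast
  then show "(\<integral>\<^sup>+\<omega>. ennreal ((J \<omega> - ?S' \<omega>)\<^sup>2) \<partial>M) \<le> 4 * dist2 s t H ?v'"
    by (simp flip: mult.assoc)
qed

text \<open>
  Fatou's lemma replaces convergence in mean square by almost sure convergence of the simple integrals.
\<close>

lemma ito_limit_AE: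
  assumes st: "0 \<le> s" "t \<le> T" and J [measurable]: "J \<in> borel_measurable M" and H: "regular s t H"
    and P: "\<And>k. simple_process M past s t (n k) (\<tau> k) (\<xi> k)"
    and v: "(\<lambda>k. dist2 s t H (simple_value (n k) (\<tau> k) (\<xi> k))) \<longlonglongrightarrow> 0"
    and I: "AE \<omega> in M. (\<lambda>k. simple_integral W (n k) (\<tau> k) (\<xi> k) \<omega>) \<longlonglongrightarrow> J \<omega>"
  shows "ito_limit H s t J"
  unfolding ito_limit_def
proof (intro conjI allI impI J)
  fix n' \<tau>' \<xi>' assume Q: "simple_process M past s t n' \<tau>' \<xi>'"
  let ?S = "\<lambda>k. simple_integral W (n k) (\<tau> k) (\<xi> k)" and ?S' = "simple_integral W n' \<tau>' \<xi>'"
  let ?v = "\<lambda>k. simple_value (n k) (\<tau> k) (\<xi> k)" and ?v' = "simple_value n' \<tau>' \<xi>'"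
  note m = simple_process_measurable[OF P st] simple_process_measurable[OF Q st]
  note [measurable] = m(1,3)
  let ?u = "\<lambda>k. 2 * dist2 s t H (?v k) + 2 * dist2 s t H ?v'"
  have le: "(\<integral>\<^sup>+\<omega>. ennreal ((?S k \<omega> - ?S' \<omega>)\<^sup>2) \<partial>M) \<le> ?u k" for k
    using dist2_triangle[OF m(2) H m(4)] simple_isometry[OF P Q st] by (simp add: dist2_commute)
  have ul: "?u \<longlonglongrightarrow> 2 * 0 + 2 * dist2 s t H ?v'"
    by (intro tendsto_add ennreal_tendsto_cmult tendsto_const v) auto
  have "(\<integral>\<^sup>+\<omega>. ennreal ((J \<omega> - ?S' \<omega>)\<^sup>2) \<partial>M) = (\<integral>\<^sup>+\<omega>. liminf (\<lambda>k. ennreal ((?S k \<omega> - ?S' \<omega>)\<^sup>2)) \<partial>M)"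
  proof (rule nn_integral_cong_AE)
    show "AE \<omega> in M. ennreal ((J \<omega> - ?S' \<omega>)\<^sup>2) = liminf (\<lambda>k. ennreal ((?S k \<omega> - ?S' \<omega>)\<^sup>2))"
      using I
    proof eventually_elim
      case (elim \<omega>)
      then have "(\<lambda>k. ennreal ((?S k \<omega> - ?S' \<omega>)\<^sup>2)) \<longlonglongrightarrow> ennreal ((J \<omega> - ?S' \<omega>)\<^sup>2)"
        by (intro tendsto_ennrealI tendsto_power tendsto_diff tendsto_const)
      from lim_imp_Liminf[OF sequentially_bot this] show ?case by (rule sym)
    qed
  qed
  also have "\<dots> \<le> liminf (\<lambda>k. \<integral>\<^sup>+\<omega>. ennreal ((?S k \<omega> - ?S' \<omega>)\<^sup>2) \<partial>M)"
    by (rule nn_integral_liminf) measurable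
  also have "\<dots> \<le> liminf ?u" by (rule Liminf_mono) (use le in auto)
  also have "\<dots> = 2 * 0 + 2 * dist2 s t H ?v'" by (rule lim_imp_Liminf[OF sequentially_bot ul])
  also have "\<dots> \<le> 4 * dist2 s t H ?v'" by (simp add: mult_right_mono)
  finally show "(\<integral>\<^sup>+\<omega>. ennreal ((J \<omega> - ?S' \<omega>)\<^sup>2) \<partial>M) \<le> 4 * dist2 s t H ?v'" .
qed

lemma ito_limit_unique:
  assumes st: "0 \<le> s" "t \<le> T" and J: "ito_limit H s t J" "ito_limit H s t J'"
    and P: "\<And>k. simple_process M past s t (n k) (\<tau> k) (\<xi> k)"
    and v: "(\<lambda>k. dist2 s t H (simple_value (n k) (\<tau> k) (\<xi> k))) \<longlonglongrightarrow> 0"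
  shows "AE \<omega> in M. J \<omega> = J' \<omega>"
proof -
  let ?S = "\<lambda>k. simple_integral W (n k) (\<tau> k) (\<xi> k)" and ?v = "\<lambda>k. simple_value (n k) (\<tau> k) (\<xi> k)"
  have [measurable]: "J \<in> borel_measurable M" "J' \<in> borel_measurable M" using J by (auto simp: ito_limit_def)
  have "(\<integral>\<^sup>+\<omega>. ennreal ((J \<omega> - J' \<omega>)\<^sup>2) \<partial>M) \<le> 16 * dist2 s t H (?v k)" for k
  proof -
    have "(\<integral>\<^sup>+\<omega>. ennreal ((J \<omega> - J' \<omega>)\<^sup>2) \<partial>M) \<le>
      2 * (\<integral>\<^sup>+\<omega>. ennreal ((J \<omega> - ?S k \<omega>)\<^sup>2) \<partial>M) + 2 * (\<integral>\<^sup>+\<omega>. ennreal ((?S k \<omega> - J' \<omega>)\<^sup>2) \<partial>M)"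
      by (rule nn_L2_triangle) (use simple_process_measurable(1)[OF P st] in auto)
    also have "\<dots> \<le> 2 * (4 * dist2 s t H (?v k)) + 2 * (4 * dist2 s t H (?v k))"
      using J P by (intro add_mono mult_left_mono) (auto simp: ito_limit_def power2_commute[of _ "J' _"])
    also have "\<dots> = 16 * dist2 s t H (?v k)" by (simp flip: mult.assoc distrib_right)
    finally show ?thesis .
  qed
  moreover have "(\<lambda>k. 16 * dist2 s t H (?v k)) \<longlonglongrightarrow> 16 * 0"
    by (intro ennreal_tendsto_cmult v) auto
  ultimately have "(\<integral>\<^sup>+\<omega>. ennreal ((J \<omega> - J' \<omega>)\<^sup>2) \<partial>M) \<le> 16 * 0"
    using LIMSEQ_le_const by blast
  then have "(\<integral>\<^sup>+\<omega>. ennreal ((J \<omega> - J' \<omega>)\<^sup>2) \<partial>M) = 0" by simp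
  then have "AE \<omega> in M. ennreal ((J \<omega> - J' \<omega>)\<^sup>2) = 0" by (subst (asm) nn_integral_0_iff_AE) auto
  then show ?thesis by eventually_elim (simp add: ennreal_eq_0_iff)
qed

lemma ito_limit_cong_AE:
  assumes J: "ito_limit H s t J" and J' [measurable]: "J' \<in> borel_measurable M" and ae: "AE \<omega> in M. J \<omega> = J' \<omega>"
  shows "ito_limit H s t J'"
proof -
  have "(\<integral>\<^sup>+\<omega>. ennreal ((J' \<omega> - S \<omega>)\<^sup>2) \<partial>M) = (\<integral>\<^sup>+\<omega>. ennreal ((J \<omega> - S \<omega>)\<^sup>2) \<partial>M)" for S
    by (rule nn_integral_cong_AE) (use ae in \<open>auto elim: eventually_mono\<close>)
  then show ?thesis using J J' by (simp add: ito_limit_def)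
qed

text \<open>
  This is the comparison with the zero process.
\<close>

lemma ito_limit_moment:
  assumes "s \<le> t" and J: "ito_limit H s t J"
  shows "(\<integral>\<^sup>+\<omega>. ennreal ((J \<omega>)\<^sup>2) \<partial>M) \<le> 4 * dist2 s t H (\<lambda>r \<omega>. 0)"
proof -
  let ?\<tau> = "\<lambda>i::nat. if i = 0 then s else t"
  have P: "simple_process M past s t 1 ?\<tau> (\<lambda>_ _. 0)"
    using assms by (auto simp: simple_process_def partition_def)
  have "simple_integral W 1 ?\<tau> (\<lambda>_ _. 0) = (\<lambda>\<omega>. 0)" "simple_value 1 ?\<tau> (\<lambda>_ _. 0) = (\<lambda>r (\<omega>::'a). 0)"
    by (auto simp: simple_integral_def simple_value_def fun_eq_iff)
  moreover have "(\<integral>\<^sup>+\<omega>. ennreal ((J \<omega> - simple_integral W 1 ?\<tau> (\<lambda>_ _. 0) \<omega>)\<^sup>2) \<partial>M)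
      \<le> 4 * dist2 s t H (simple_value 1 ?\<tau> (\<lambda>_ _. 0))"
    using J P unfolding ito_limit_def by blast
  ultimately show ?thesis by simp
qed

lemma simple_process_natural_past:
  assumes "simple_process M (natural_filtration M X W) s t n \<tau> \<xi>" "t \<le> T"
  shows "simple_process M past s t n \<tau> \<xi>"
  unfolding simple_process_def
proof (intro conjI allI impI)
  show p: "partition s t n \<tau>" using assms by (simp add: simple_process_def)
  fix i assume i: "i < n"
  show "integrable M (\<lambda>\<omega>. (\<xi> i \<omega>)\<^sup>2)" using assms i by (simp add: simple_process_def)
  show "\<xi> i \<in> borel_measurable (past (\<tau> i))"
    using assms i partition_bounds[OF p, of i] by (intro natural_filtration_past) (auto simp: simple_process_def)
qed

lemma ito_integral_limit:
  assumes st: "0 \<le> s" "t \<le> T" and H: "regular s t H"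
    and J: "has_ito_integral M (natural_filtration M X W) W H s t J"
  shows "ito_limit H s t J"
proof -
  note J0 = J[unfolded has_ito_integral_def, folded dist2_def]
  from J0 obtain n \<tau> \<xi> where J': "J \<in> borel_measurable M"
    and P: "\<forall>k. simple_process M (natural_filtration M X W) s t (n k) (\<tau> k) (\<xi> k)"
    and v: "(\<lambda>k. dist2 s t H (simple_value (n k) (\<tau> k) (\<xi> k))) \<longlonglongrightarrow> 0"
    and I: "(\<lambda>k. \<integral>\<^sup>+\<omega>. ennreal ((J \<omega> - simple_integral W (n k) (\<tau> k) (\<xi> k) \<omega>)\<^sup>2) \<partial>M) \<longlonglongrightarrow> 0"
    by (elim conjE exE)
  show ?thesis
    by (rule ito_limit_L2[OF st J' H simple_process_natural_past[OF spec[OF P] st(2)] v I])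
qed

lemma ito_limit_integral:
  assumes st: "0 \<le> s" "t \<le> T" and J: "ito_limit H s t J"
    and P: "\<And>k. simple_process M (natural_filtration M X W) s t (n k) (\<tau> k) (\<xi> k)"
    and v: "(\<lambda>k. dist2 s t H (simple_value (n k) (\<tau> k) (\<xi> k))) \<longlonglongrightarrow> 0"
  shows "has_ito_integral M (natural_filtration M X W) W H s t J"
  unfolding has_ito_integral_def
proof (intro conjI exI allI)
  show "simple_process M (natural_filtration M X W) s t (n k) (\<tau> k) (\<xi> k)" for k by (rule P)
  show "J \<in> borel_measurable M" using J by (simp add: ito_limit_def)
  show "(\<lambda>k. \<integral>\<^sup>+\<omega>. (\<integral>\<^sup>+r\<in>{s..t}. ennreal ((H r \<omega> - simple_value (n k) (\<tau> k) (\<xi> k) r \<omega>)\<^sup>2) \<partial>lborel) \<partial>M) \<longlonglongrightarrow> 0"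
    using v by (simp add: dist2_def)
  let ?d = "\<lambda>k. \<integral>\<^sup>+\<omega>. ennreal ((J \<omega> - simple_integral W (n k) (\<tau> k) (\<xi> k) \<omega>)\<^sup>2) \<partial>M"
  have lim: "(\<lambda>k. 4 * dist2 s t H (simple_value (n k) (\<tau> k) (\<xi> k))) \<longlonglongrightarrow> 0"
    using ennreal_tendsto_cmult[OF _ v, of 4] by simp
  have "?d k \<le> 4 * dist2 s t H (simple_value (n k) (\<tau> k) (\<xi> k))" for k
    using J simple_process_natural_past[OF P[of k] st(2)] unfolding ito_limit_def by blast
  then show "?d \<longlonglongrightarrow> 0"
    by (intro tendsto_sandwich[OF always_eventually always_eventually tendsto_const lim]) simp_all
qed

end

section \<open>Riemann sums of mean-square continuous integrands\<close>

lemma square_half_diff_le: "((a - b) / 2)\<^sup>2 \<le> a\<^sup>2 + (b::real)\<^sup>2"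
proof -
  have "0 \<le> (a + b)\<^sup>2" by simp
  then have "(a - b)\<^sup>2 \<le> 2 * (a\<^sup>2 + b\<^sup>2)" by (simp add: power2_diff power2_sum)
  also have "\<dots> \<le> 4 * (a\<^sup>2 + b\<^sup>2)" by simp
  finally show ?thesis by (simp add: power_divide)
qed

text \<open>
  The process is set to zero on a null set and extended by constants outside of the interval. What
  results is the pointwise limit of its values on the grids of mesh \<open>1 / 2 ^ n\<close>.
\<close>

lemma (in prob_space) regular_continuous:
  assumes st: "s \<le> t" and m: "\<And>r. r \<in> {s..t} \<Longrightarrow> H r \<in> borel_measurable M"
    and c: "AE \<omega> in M. continuous_on {s..t} (\<lambda>r. H r \<omega>)"
  shows "regular s t H"
proof -
  obtain N where N: "{\<omega>\<in>space M. \<not> continuous_on {s..t} (\<lambda>r. H r \<omega>)} \<subseteq> N" "emeasure M N = 0" "N \<in> sets M"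
    by (rule AE_E[OF c])
  define cl where "cl r = max s (min t r)" for r
  have cl: "cl r \<in> {s..t}" "r \<in> {s..t} \<Longrightarrow> cl r = r" for r using st by (auto simp: cl_def)
  have cl_cont: "continuous_on UNIV cl" unfolding cl_def[abs_def] by (intro continuous_intros)
  define H' where "H' r \<omega> = (if \<omega> \<in> N then 0 else H (cl r) \<omega>)" for r \<omega>
  have H'm [measurable]: "H' r \<in> borel_measurable M" for r
  proof -
    show ?thesis unfolding H'_def
      by (rule measurable_If_set[OF measurable_const m[OF cl(1)] sets.Int[OF N(3) sets.top]]) simp
  qed
  have cont: "continuous_on UNIV (\<lambda>r. H' r \<omega>)" if "\<omega> \<in> space M" for \<omega>
  proof (cases "\<omega> \<in> N")
    case False
    then have "continuous_on {s..t} (\<lambda>r. H r \<omega>)" using N(1) that by blast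
    then have "continuous_on UNIV (\<lambda>r. H (cl r) \<omega>)"
      by (rule continuous_on_compose2[OF _ cl_cont]) (use cl(1) in blast)
    then show ?thesis using False by (simp add: H'_def)
  qed (simp add: H'_def)
  define Hn where "Hn n = (\<lambda>(\<omega>, r :: real). H' (of_int \<lfloor>2 ^ n * r\<rfloor> / 2 ^ n) \<omega>)" for n :: nat
  have Hn: "Hn n \<in> borel_measurable (M \<Otimes>\<^sub>M lborel)" for n
  proof -
    have fl: "(\<lambda>x::'a \<times> real. \<lfloor>2 ^ n * snd x\<rfloor>) \<in> measurable (M \<Otimes>\<^sub>M lborel) (count_space UNIV)"
      by measurable
    have "(\<lambda>x::'a \<times> real. H' (of_int \<lfloor>2 ^ n * snd x\<rfloor> / 2 ^ n) (fst x)) \<in> borel_measurable (M \<Otimes>\<^sub>M lborel)"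
      by (rule measurable_compose_countable[OF _ fl, of "\<lambda>i x. H' (of_int i / 2 ^ n) (fst x)"])
        (rule measurable_compose[OF measurable_fst H'm])
    then show ?thesis by (simp add: Hn_def case_prod_unfold)
  qed
  have lim: "(\<lambda>n. Hn n x) \<longlonglongrightarrow> (\<lambda>(\<omega>, r). H' r \<omega>) x" if "x \<in> space (M \<Otimes>\<^sub>M lborel)" for x
  proof -
    obtain \<omega> r where x: "x = (\<omega>, r)" by (cases x)
    then have \<omega>: "\<omega> \<in> space M" using that by (auto simp: space_pair_measure)
    have "(\<lambda>n. of_int \<lfloor>2 ^ n * r\<rfloor> / 2 ^ n) \<longlonglongrightarrow> r"
    proof (rule tendsto_sandwich[OF always_eventually always_eventually _ tendsto_const])
      have "(\<lambda>n. (1 / 2) ^ n :: real) \<longlonglongrightarrow> 0" by (rule LIMSEQ_realpow_zero) auto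
      from tendsto_diff[OF tendsto_const[of r] this] show "(\<lambda>n. r - (1 / 2) ^ n) \<longlonglongrightarrow> r" by simp
      show "\<forall>n. r - (1 / 2) ^ n \<le> of_int \<lfloor>2 ^ n * r\<rfloor> / 2 ^ n"
      proof
        fix n :: nat
        have "2 ^ n * r - 1 \<le> of_int \<lfloor>2 ^ n * r\<rfloor>" by linarith
        from divide_right_mono[OF this, of "2 ^ n"] show "r - (1 / 2) ^ n \<le> of_int \<lfloor>2 ^ n * r\<rfloor> / 2 ^ n"
          by (simp add: diff_divide_distrib power_one_over)
      qed
      show "\<forall>n. of_int \<lfloor>2 ^ n * r\<rfloor> / 2 ^ n \<le> r"
      proof
        fix n :: nat
        have "of_int \<lfloor>2 ^ n * r\<rfloor> \<le> 2 ^ n * r" by linarith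
        from divide_right_mono[OF this, of "2 ^ n"] show "of_int \<lfloor>2 ^ n * r\<rfloor> / 2 ^ n \<le> r" by simp
      qed
    qed
    from continuous_on_tendsto_compose[OF cont[OF \<omega>] this] show ?thesis by (simp add: x Hn_def)
  qed
  have "(\<lambda>(\<omega>, r). H' r \<omega>) \<in> borel_measurable (M \<Otimes>\<^sub>M lborel)"
    by (rule borel_measurable_LIMSEQ_real[OF lim Hn])
  moreover have "AE \<omega> in M. \<omega> \<notin> N" by (rule AE_not_in) (use N in \<open>auto simp: null_sets_def\<close>)
  then have "AE \<omega> in M. \<forall>r\<in>{s..t}. H r \<omega> = H' r \<omega>"
    by eventually_elim (simp add: H'_def cl)
  ultimately show ?thesis unfolding regular_def by blast
qed

lemma simple_value_eq:
  assumes p: "partition s t n \<tau>" and r: "s < r" "r \<le> t"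
  obtains i where "i < n" "\<tau> i < r" "r \<le> \<tau> (Suc i)" "\<And>\<xi> \<omega>. simple_value n \<tau> \<xi> r \<omega> = \<xi> i \<omega>"
proof -
  have "\<tau> 0 < r" "r \<le> \<tau> n" using p r by (auto simp: partition_def)
  then have "\<exists>i<n. \<tau> i < r \<and> r \<le> \<tau> (Suc i)"
  proof (induction n)
    case (Suc n)
    then show ?case by (cases "r \<le> \<tau> n") (auto intro: less_SucI)
  qed simp
  then obtain i where i: "i < n" "\<tau> i < r" "r \<le> \<tau> (Suc i)" by blast
  have other: "indicator {\<tau> k<..\<tau> (Suc k)} r = (if k = i then 1 else 0 :: real)" if "k < n" for k
  proof (cases k i rule: linorder_cases)
    case less
    then have "\<tau> (Suc k) \<le> \<tau> i" using partition_mono[OF p, of "Suc k" i] i by simp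
    then show ?thesis using less i by (auto simp: indicator_def)
  next
    case greater
    then have "\<tau> (Suc i) \<le> \<tau> k" using partition_mono[OF p, of "Suc i" k] that by simp
    then show ?thesis using greater i by (auto simp: indicator_def)
  qed (use i in auto)
  have "simple_value n \<tau> \<xi> r \<omega> = (\<Sum>k<n. \<xi> k \<omega> * (if k = i then 1 else 0))" for \<xi> \<omega>
    unfolding simple_value_def using other by (intro sum.cong) auto
  then have "simple_value n \<tau> \<xi> r \<omega> = \<xi> i \<omega>" for \<xi> \<omega>
    using i(1) by (simp add: if_distrib[of "\<lambda>x. _ * x"] cong: if_cong)
  with i that show thesis by blast
qed

context fbm_bm begin

text \<open>
  The last condition is Hoelder continuity in mean square with exponent 1/4, which is the regularity
  of \<open>X\<close>. It turns the mesh of a partition into an error bound for Riemann sums.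
\<close>

definition integrand :: "real \<Rightarrow> (real \<Rightarrow> 'a \<Rightarrow> real) \<Rightarrow> bool" where
  "integrand C H \<longleftrightarrow> 0 \<le> C \<and> (\<forall>r\<in>{0..T}. H r \<in> borel_measurable M \<and> integrable M (\<lambda>\<omega>. (H r \<omega>)\<^sup>2)) \<and>
     (AE \<omega> in M. continuous_on {0..T} (\<lambda>r. H r \<omega>)) \<and>
     (\<forall>r\<in>{0..T}. \<forall>u\<in>{0..T}. (\<integral>\<^sup>+\<omega>. ennreal ((H r \<omega> - H u \<omega>)\<^sup>2) \<partial>M) \<le> ennreal (C * sqrt \<bar>r - u\<bar>))"

lemma integrand_regular:
  assumes H: "integrand C H" and st: "0 \<le> s" "s \<le> t" "t \<le> T"
  shows "regular s t H"
proof (rule regular_continuous[OF st(2)])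
  show "H r \<in> borel_measurable M" if "r \<in> {s..t}" for r using H that st by (auto simp: integrand_def)
  have "AE \<omega> in M. continuous_on {0..T} (\<lambda>r. H r \<omega>)" using H by (simp add: integrand_def)
  then show "AE \<omega> in M. continuous_on {s..t} (\<lambda>r. H r \<omega>)"
    by eventually_elim (rule continuous_on_subset, use st in auto)
qed

lemma riemann_dist2:
  assumes H: "integrand C H" and st: "0 \<le> s" "s \<le> t" "t \<le> T"
    and P: "simple_process M past s t n \<tau> (\<lambda>i. H (\<sigma> i))"
    and \<sigma>: "\<And>i. i < n \<Longrightarrow> \<sigma> i \<in> {0..T}"
    and mesh: "\<And>i r. i < n \<Longrightarrow> \<tau> i < r \<Longrightarrow> r \<le> \<tau> (Suc i) \<Longrightarrow> \<bar>r - \<sigma> i\<bar> \<le> \<delta>" and \<delta>: "0 \<le> \<delta>"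
  shows "dist2 s t H (simple_value n \<tau> (\<lambda>i. H (\<sigma> i))) \<le> ennreal (C * sqrt \<delta> * (t - s))"
proof (rule dist2_le[OF st(2)])
  have C: "0 \<le> C" using H by (simp add: integrand_def)
  show "0 \<le> C * sqrt \<delta>" using C \<delta> by simp
  show "regular s t H" by (rule integrand_regular[OF H st])
  show "regular s t (simple_value n \<tau> (\<lambda>i. H (\<sigma> i)))" by (rule simple_process_measurable(2)[OF P st(1,3)])
  have p: "partition s t n \<tau>" using P by (simp add: simple_process_def)
  fix r assume r: "s < r" "r \<le> t"
  obtain i where i: "i < n" "\<tau> i < r" "r \<le> \<tau> (Suc i)" "\<And>(\<xi> :: nat \<Rightarrow> 'a \<Rightarrow> real) \<omega>. simple_value n \<tau> \<xi> r \<omega> = \<xi> i \<omega>"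
    by (rule simple_value_eq[OF p r]) blast
  have "(\<integral>\<^sup>+\<omega>. ennreal ((H r \<omega> - H (\<sigma> i) \<omega>)\<^sup>2) \<partial>M) \<le> ennreal (C * sqrt \<bar>r - \<sigma> i\<bar>)"
    using H \<sigma>[OF i(1)] r st by (simp add: integrand_def)
  also have "\<dots> \<le> ennreal (C * sqrt \<delta>)"
    using mesh[OF i(1-3)] C by (intro ennreal_leI mult_left_mono) auto
  finally show "(\<integral>\<^sup>+\<omega>. ennreal ((H r \<omega> - simple_value n \<tau> (\<lambda>i. H (\<sigma> i)) r \<omega>)\<^sup>2) \<partial>M) \<le> ennreal (C * sqrt \<delta>)"
    by (simp add: i(4))
qed

lemma X_continuous: "AE \<omega> in M. continuous_on {0..T} (\<lambda>t. X t \<omega>)"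
  using fbm by (simp add: fbm_quarter_def)

lemma W_continuous: "AE \<omega> in M. continuous_on {0..T} (\<lambda>t. W t \<omega>)"
  using bm by (simp add: brownian_motion_def)

lemma nn_X_increment:
  assumes "s \<in> {0..T}" "t \<in> {0..T}"
  shows "(\<integral>\<^sup>+\<omega>. ennreal ((X t \<omega> - X s \<omega>)\<^sup>2) \<partial>M) = ennreal (sqrt \<bar>t - s\<bar>)"
    and "(\<integral>\<^sup>+\<omega>. ennreal ((X t \<omega> - X s \<omega>) ^ 4) \<partial>M) = ennreal (3 * \<bar>t - s\<bar>)"
    and "(\<integral>\<^sup>+\<omega>. ennreal ((X t \<omega> - X s \<omega>) ^ 6) \<partial>M) = ennreal (15 * sqrt \<bar>t - s\<bar> ^ 3)"
  using X_increment_even_moment[OF assms, of 1] X_increment_even_moment[OF assms, of 2]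
    X_increment_even_moment[OF assms, of 3]
  by (simp_all add: nn_integral_eq_integral fact_numeral)

lemma nn_W_increment:
  assumes "0 \<le> s" "s \<le> t" "t \<le> T"
  shows "(\<integral>\<^sup>+\<omega>. ennreal ((W t \<omega> - W s \<omega>)\<^sup>2) \<partial>M) = ennreal (t - s)"
    and "(\<integral>\<^sup>+\<omega>. ennreal ((W t \<omega> - W s \<omega>) ^ 4) \<partial>M) = ennreal (3 * (t - s)\<^sup>2)"
  using W_increment_even_moment(1,2)[OF assms, of 1] W_increment_even_moment(1,2)[OF assms, of 2]
  by (simp_all add: nn_integral_eq_integral fact_numeral)

lemma integrand_X:
  assumes s: "s \<in> {0..T}"
  shows "integrand 1 (\<lambda>r \<omega>. X r \<omega> - X s \<omega>)"
  unfolding integrand_def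
proof (intro conjI ballI)
  show "(\<lambda>\<omega>. X r \<omega> - X s \<omega>) \<in> borel_measurable M" if "r \<in> {0..T}" for r using s that by simp
  show "integrable M (\<lambda>\<omega>. (X r \<omega> - X s \<omega>)\<^sup>2)" if "r \<in> {0..T}" for r
    using X_increment_even_moment(1)[OF s that, of 1] by simp
  show "AE \<omega> in M. continuous_on {0..T} (\<lambda>r. X r \<omega> - X s \<omega>)"
    using X_continuous by eventually_elim (intro continuous_intros)
  fix r u assume ru: "r \<in> {0..T}" "u \<in> {0..T}"
  then show "(\<integral>\<^sup>+\<omega>. ennreal ((X r \<omega> - X s \<omega> - (X u \<omega> - X s \<omega>))\<^sup>2) \<partial>M) \<le> ennreal (1 * sqrt \<bar>r - u\<bar>)"
    using nn_X_increment(1)[OF ru(2,1)] by simp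
qed simp

lemma integrand_W:
  assumes s: "s \<in> {0..T}"
  shows "integrand (sqrt T) (\<lambda>r \<omega>. W r \<omega> - W s \<omega>)"
  unfolding integrand_def
proof (intro conjI ballI)
  have sq: "integrable M (\<lambda>\<omega>. (W r \<omega> - W u \<omega>)\<^sup>2) \<and> (\<integral>\<^sup>+\<omega>. ennreal ((W r \<omega> - W u \<omega>)\<^sup>2) \<partial>M) = ennreal \<bar>r - u\<bar>"
    if "r \<in> {0..T}" "u \<in> {0..T}" for r u
  proof (cases "u \<le> r")
    case True
    then show ?thesis using W_increment_even_moment(1)[of u r 1] nn_W_increment(1)[of u r] that by simp
  next
    case False
    then show ?thesis using W_increment_even_moment(1)[of r u 1] nn_W_increment(1)[of r u] that
      by (simp add: power2_commute)
  qed
  show "(\<lambda>\<omega>. W r \<omega> - W s \<omega>) \<in> borel_measurable M" if "r \<in> {0..T}" for r using s that by simp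
  show "integrable M (\<lambda>\<omega>. (W r \<omega> - W s \<omega>)\<^sup>2)" if "r \<in> {0..T}" for r using sq[OF that s] by simp
  show "AE \<omega> in M. continuous_on {0..T} (\<lambda>r. W r \<omega> - W s \<omega>)"
    using W_continuous by eventually_elim (intro continuous_intros)
  show "0 \<le> sqrt T" using T_pos by simp
  fix r u assume ru: "r \<in> {0..T}" "u \<in> {0..T}"
  have "\<bar>r - u\<bar> = sqrt \<bar>r - u\<bar> * sqrt \<bar>r - u\<bar>" by simp
  also have "\<dots> \<le> sqrt T * sqrt \<bar>r - u\<bar>" using ru by (intro mult_right_mono real_sqrt_le_mono) auto
  finally show "(\<integral>\<^sup>+\<omega>. ennreal ((W r \<omega> - W s \<omega> - (W u \<omega> - W s \<omega>))\<^sup>2) \<partial>M) \<le> ennreal (sqrt T * sqrt \<bar>r - u\<bar>)"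
    using sq[OF ru] by (simp add: ennreal_leI)
qed

text \<open>
  Young's inequality with a weight \<open>h\<close>, applied to \<open>a\<^sup>2 - b\<^sup>2 = (a - b) * (a + b)\<close>.
\<close>

lemma square_difference_bound:
  fixes a b h :: real
  assumes "0 < h"
  shows "(a\<^sup>2 - b\<^sup>2)\<^sup>2 \<le> (a - b) ^ 4 / (2 * h) + 4 * h * (a ^ 4 + b ^ 4)"
proof -
  have e: "(p - h * q)\<^sup>2 = p\<^sup>2 - 2 * h * (p * q) + h\<^sup>2 * q\<^sup>2" for p q
    by (simp add: power2_eq_square algebra_simps)
  have "0 \<le> ((a - b)\<^sup>2 - h * (a + b)\<^sup>2)\<^sup>2" by simp
  then have "2 * h * ((a - b)\<^sup>2 * (a + b)\<^sup>2) \<le> (a - b) ^ 4 + h\<^sup>2 * (a + b) ^ 4"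
    unfolding e by (simp flip: power_mult)
  moreover have "(a + b) ^ 4 \<le> 8 * (a ^ 4 + b ^ 4)"
  proof -
    have "(a + b)\<^sup>2 \<le> 2 * (a\<^sup>2 + b\<^sup>2)" using sum_squares_bound[of a b] by (simp add: power2_sum)
    then have "((a + b)\<^sup>2)\<^sup>2 \<le> (2 * (a\<^sup>2 + b\<^sup>2))\<^sup>2" by (rule power_mono) simp
    also have "\<dots> \<le> 8 * (a ^ 4 + b ^ 4)"
      using sum_squares_bound[of "a\<^sup>2" "b\<^sup>2"] by (simp add: power2_sum power_mult_distrib flip: power_mult)
    finally show ?thesis by (simp flip: power_mult)
  qed
  then have "h\<^sup>2 * (a + b) ^ 4 \<le> h\<^sup>2 * (8 * (a ^ 4 + b ^ 4))" by (rule mult_left_mono) simp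
  ultimately have "2 * h * ((a - b)\<^sup>2 * (a + b)\<^sup>2) \<le> (a - b) ^ 4 + h\<^sup>2 * (8 * (a ^ 4 + b ^ 4))" by linarith
  also have "\<dots> = 2 * h * ((a - b) ^ 4 / (2 * h) + 4 * h * (a ^ 4 + b ^ 4))"
    using assms by (simp add: field_simps power2_eq_square)
  finally have "(a - b)\<^sup>2 * (a + b)\<^sup>2 \<le> (a - b) ^ 4 / (2 * h) + 4 * h * (a ^ 4 + b ^ 4)"
    using assms by simp
  moreover have "(a\<^sup>2 - b\<^sup>2)\<^sup>2 = (a - b)\<^sup>2 * (a + b)\<^sup>2"
    by (simp add: power2_eq_square algebra_simps)
  ultimately show ?thesis by simp
qed

lemma integrand_X_square:
  assumes s: "s \<in> {0..T}"
  shows "integrand (3 / 2 + 24 * T) (\<lambda>r \<omega>. (X r \<omega> - X s \<omega>)\<^sup>2)"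
  unfolding integrand_def
proof (intro conjI ballI)
  show "(\<lambda>\<omega>. (X r \<omega> - X s \<omega>)\<^sup>2) \<in> borel_measurable M" if "r \<in> {0..T}" for r using s that by simp
  show "integrable M (\<lambda>\<omega>. ((X r \<omega> - X s \<omega>)\<^sup>2)\<^sup>2)" if "r \<in> {0..T}" for r
    using X_increment_even_moment(1)[OF s that, of 2] by simp
  show "AE \<omega> in M. continuous_on {0..T} (\<lambda>r. (X r \<omega> - X s \<omega>)\<^sup>2)"
    using X_continuous by eventually_elim (intro continuous_intros)
  show "0 \<le> 3 / 2 + 24 * T" using T_pos by simp
  fix r u assume ru: "r \<in> {0..T}" "u \<in> {0..T}"
  show "(\<integral>\<^sup>+\<omega>. ennreal (((X r \<omega> - X s \<omega>)\<^sup>2 - (X u \<omega> - X s \<omega>)\<^sup>2)\<^sup>2) \<partial>M) \<le> ennreal ((3 / 2 + 24 * T) * sqrt \<bar>r - u\<bar>)"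
  proof (cases "r = u")
    case False
    \<comment> \<open>With this weight both terms of Young's inequality have expectations of order h.\<close>
    define h where "h = sqrt \<bar>r - u\<bar>"
    have h: "0 < h" "h * h = \<bar>r - u\<bar>" using False by (auto simp: h_def)
    let ?R = "\<lambda>\<omega>. (X r \<omega> - X u \<omega>) ^ 4 / (2 * h) + 4 * h * ((X r \<omega> - X s \<omega>) ^ 4 + (X u \<omega> - X s \<omega>) ^ 4)"
    have m: "integrable M (\<lambda>\<omega>. (X p \<omega> - X q \<omega>) ^ 4)" "expectation (\<lambda>\<omega>. (X p \<omega> - X q \<omega>) ^ 4) = 3 * \<bar>p - q\<bar>"
      if "p \<in> {0..T}" "q \<in> {0..T}" for p q
      using X_increment_even_moment[OF that(2,1), of 2] by (simp_all add: fact_numeral)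
    have intR: "integrable M ?R" using m ru s
      by (intro Bochner_Integration.integrable_add integrable_divide_zero integrable_mult_right) auto
    have "expectation ?R = 3 * \<bar>r - u\<bar> / (2 * h) + 4 * h * (3 * \<bar>r - s\<bar> + 3 * \<bar>u - s\<bar>)"
      using m ru s by simp
    also have "\<dots> = (3 / 2 + 12 * (\<bar>r - s\<bar> + \<bar>u - s\<bar>)) * h"
      using h by (simp add: field_simps flip: h(2))
    also have "\<dots> \<le> (3 / 2 + 24 * T) * h"
    proof (rule mult_right_mono)
      have "\<bar>r - s\<bar> \<le> T" "\<bar>u - s\<bar> \<le> T" using ru s by (auto simp: abs_le_iff)
      then show "3 / 2 + 12 * (\<bar>r - s\<bar> + \<bar>u - s\<bar>) \<le> 3 / 2 + 24 * T" by simp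
    qed (use h in simp)
    finally have E: "expectation ?R \<le> (3 / 2 + 24 * T) * h" .
    have "(\<integral>\<^sup>+\<omega>. ennreal (((X r \<omega> - X s \<omega>)\<^sup>2 - (X u \<omega> - X s \<omega>)\<^sup>2)\<^sup>2) \<partial>M) \<le> (\<integral>\<^sup>+\<omega>. ennreal (?R \<omega>) \<partial>M)"
    proof (intro nn_integral_mono ennreal_leI)
      fix \<omega>
      show "((X r \<omega> - X s \<omega>)\<^sup>2 - (X u \<omega> - X s \<omega>)\<^sup>2)\<^sup>2 \<le> ?R \<omega>"
        using square_difference_bound[OF h(1), of "X r \<omega> - X s \<omega>" "X u \<omega> - X s \<omega>"] by simp
    qed
    also have "\<dots> = ennreal (expectation ?R)"
      by (rule nn_integral_eq_integral[OF intR]) (use h in simp)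
    also have "\<dots> \<le> ennreal ((3 / 2 + 24 * T) * h)" by (rule ennreal_leI[OF E])
    finally show ?thesis by (simp add: h_def)
  qed simp
qed

lemma integrand_half_diff:
  assumes F: "integrand C F" and G: "integrand D G"
  shows "integrand (C + D) (\<lambda>r \<omega>. (F r \<omega> - G r \<omega>) / 2)"
  unfolding integrand_def
proof (intro conjI ballI)
  have CD: "0 \<le> C" "0 \<le> D" using F G by (auto simp: integrand_def)
  then show "0 \<le> C + D" by simp
  have [measurable]: "F r \<in> borel_measurable M" "G r \<in> borel_measurable M" if "r \<in> {0..T}" for r
    using F G that by (auto simp: integrand_def)
  note sq = square_half_diff_le
  show "(\<lambda>\<omega>. (F r \<omega> - G r \<omega>) / 2) \<in> borel_measurable M" if "r \<in> {0..T}" for r using that by measurable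
  show "integrable M (\<lambda>\<omega>. ((F r \<omega> - G r \<omega>) / 2)\<^sup>2)" if "r \<in> {0..T}" for r
  proof (rule Bochner_Integration.integrable_bound)
    show "integrable M (\<lambda>\<omega>. (F r \<omega>)\<^sup>2 + (G r \<omega>)\<^sup>2)" using F G that by (auto simp: integrand_def)
    show "AE \<omega> in M. norm (((F r \<omega> - G r \<omega>) / 2)\<^sup>2) \<le> norm ((F r \<omega>)\<^sup>2 + (G r \<omega>)\<^sup>2)"
      using sq by simp
  qed (use that in measurable)
  have "AE \<omega> in M. continuous_on {0..T} (\<lambda>r. F r \<omega>)" "AE \<omega> in M. continuous_on {0..T} (\<lambda>r. G r \<omega>)"
    using F G by (auto simp: integrand_def)
  then show "AE \<omega> in M. continuous_on {0..T} (\<lambda>r. (F r \<omega> - G r \<omega>) / 2)"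
    by eventually_elim (intro continuous_intros, auto)
  fix r u assume ru: "r \<in> {0..T}" "u \<in> {0..T}"
  have "(\<integral>\<^sup>+\<omega>. ennreal (((F r \<omega> - G r \<omega>) / 2 - (F u \<omega> - G u \<omega>) / 2)\<^sup>2) \<partial>M) \<le>
      (\<integral>\<^sup>+\<omega>. ennreal ((F r \<omega> - F u \<omega>)\<^sup>2) + ennreal ((G r \<omega> - G u \<omega>)\<^sup>2) \<partial>M)"
  proof (rule nn_integral_mono)
    fix \<omega>
    have "((F r \<omega> - G r \<omega>) / 2 - (F u \<omega> - G u \<omega>) / 2)\<^sup>2 \<le> (F r \<omega> - F u \<omega>)\<^sup>2 + (G r \<omega> - G u \<omega>)\<^sup>2"
    proof -
      have "(F r \<omega> - G r \<omega>) / 2 - (F u \<omega> - G u \<omega>) / 2 = ((F r \<omega> - F u \<omega>) - (G r \<omega> - G u \<omega>)) / 2"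
        by (simp add: field_simps)
      then show ?thesis using sq[of "F r \<omega> - F u \<omega>" "G r \<omega> - G u \<omega>"] by (simp only:)
    qed
    then show "ennreal (((F r \<omega> - G r \<omega>) / 2 - (F u \<omega> - G u \<omega>) / 2)\<^sup>2) \<le>
        ennreal ((F r \<omega> - F u \<omega>)\<^sup>2) + ennreal ((G r \<omega> - G u \<omega>)\<^sup>2)"
      by (simp flip: ennreal_plus add: ennreal_leI)
  qed
  also have "\<dots> = (\<integral>\<^sup>+\<omega>. ennreal ((F r \<omega> - F u \<omega>)\<^sup>2) \<partial>M) + (\<integral>\<^sup>+\<omega>. ennreal ((G r \<omega> - G u \<omega>)\<^sup>2) \<partial>M)"
    using ru by (intro nn_integral_add) measurable
  also have "\<dots> \<le> ennreal (C * sqrt \<bar>r - u\<bar>) + ennreal (D * sqrt \<bar>r - u\<bar>)"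
    using F G ru by (intro add_mono) (auto simp: integrand_def)
  also have "\<dots> = ennreal ((C + D) * sqrt \<bar>r - u\<bar>)"
    using CD by (simp flip: ennreal_plus add: distrib_right)
  finally show "(\<integral>\<^sup>+\<omega>. ennreal (((F r \<omega> - G r \<omega>) / 2 - (F u \<omega> - G u \<omega>) / 2)\<^sup>2) \<partial>M) \<le> ennreal ((C + D) * sqrt \<bar>r - u\<bar>)" .
qed

end

section \<open>Integrals of polynomials in X along dyadic partitions\<close>

lemma ennreal_affine: "0 \<le> a \<Longrightarrow> 0 \<le> b \<Longrightarrow> 0 \<le> c \<Longrightarrow> ennreal (a + b * c) = ennreal a + ennreal b * ennreal c"
  by (simp add: ennreal_plus ennreal_mult)

lemma numeral_times_ennreal: "0 \<le> a \<Longrightarrow> numeral k * ennreal a = ennreal (numeral k * a)"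
  by (simp add: ennreal_mult)

context prob_space begin

lemma summable_AE_of_nn_integral:
  fixes f :: "nat \<Rightarrow> 'a \<Rightarrow> real"
  assumes [measurable]: "\<And>n. f n \<in> borel_measurable M" and nn: "\<And>n \<omega>. 0 \<le> f n \<omega>"
    and le: "\<And>n. (\<integral>\<^sup>+\<omega>. ennreal (f n \<omega>) \<partial>M) \<le> ennreal (K * q ^ n)" and K: "0 \<le> K" and q: "0 \<le> q" "q < 1"
  shows "AE \<omega> in M. summable (\<lambda>n. f n \<omega>)"
proof -
  have sm: "summable (\<lambda>n. K * q ^ n)" using q by (intro summable_mult summable_geometric) simp
  have "(\<integral>\<^sup>+\<omega>. suminf (\<lambda>n. ennreal (f n \<omega>)) \<partial>M) = suminf (\<lambda>n. \<integral>\<^sup>+\<omega>. ennreal (f n \<omega>) \<partial>M)"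
    by (rule nn_integral_suminf) measurable
  also have "\<dots> \<le> suminf (\<lambda>n. ennreal (K * q ^ n))" by (rule suminf_le[OF le]) auto
  also have "\<dots> < \<infinity>" using K q sm by (simp add: suminf_ennreal2)
  finally have "AE \<omega> in M. suminf (\<lambda>n. ennreal (f n \<omega>)) \<noteq> \<infinity>"
    by (intro nn_integral_PInf_AE) auto
  then show ?thesis
    by eventually_elim (rule summable_suminf_not_top, use nn in auto)
qed

lemma square_tendsto_zero_AE:
  fixes f :: "nat \<Rightarrow> 'a \<Rightarrow> real"
  assumes [measurable]: "\<And>n. f n \<in> borel_measurable M"
    and le: "\<And>n. (\<integral>\<^sup>+\<omega>. ennreal ((f n \<omega>)\<^sup>2) \<partial>M) \<le> ennreal (K * q ^ n)" and K: "0 \<le> K" and q: "0 \<le> q" "q < 1"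
  shows "AE \<omega> in M. (\<lambda>n. f n \<omega>) \<longlonglongrightarrow> 0"
proof -
  have "AE \<omega> in M. summable (\<lambda>n. (f n \<omega>)\<^sup>2)"
    by (rule summable_AE_of_nn_integral[OF _ _ le K q]) auto
  then show ?thesis
  proof eventually_elim
    case (elim \<omega>)
    then have "(\<lambda>n. (f n \<omega>)\<^sup>2) \<longlonglongrightarrow> 0" by (rule summable_LIMSEQ_zero)
    from tendsto_real_sqrt[OF this] have "(\<lambda>n. \<bar>f n \<omega>\<bar>) \<longlonglongrightarrow> 0" by simp
    then show ?case by (rule tendsto_rabs_zero_cancel)
  qed
qed

text \<open>
  Geometric decay of the squares implies summability of the increments themselves, since
  \<open>|x| \<le> x\<^sup>2 / p ^ n + p ^ n\<close> and \<open>p\<close> can be taken as the square root of the rate.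
\<close>

lemma convergent_AE_of_square_increments:
  fixes f :: "nat \<Rightarrow> 'a \<Rightarrow> real"
  assumes m [measurable]: "\<And>n. f n \<in> borel_measurable M"
    and le: "\<And>n. (\<integral>\<^sup>+\<omega>. ennreal ((f (Suc n) \<omega> - f n \<omega>)\<^sup>2) \<partial>M) \<le> ennreal (K * q ^ n)"
    and K: "0 \<le> K" and q: "0 < q" "q < 1"
  shows "AE \<omega> in M. convergent (\<lambda>n. f n \<omega>)"
proof -
  define p where "p = sqrt q"
  have p: "0 < p" "p < 1" "p * p = q" using q by (auto simp: p_def)
  have "AE \<omega> in M. summable (\<lambda>n. \<bar>f (Suc n) \<omega> - f n \<omega>\<bar>)"
  proof (rule summable_AE_of_nn_integral[where K = "K + 1" and q = p])
    fix n
    have pt: "\<bar>x\<bar> \<le> x\<^sup>2 / p ^ n + p ^ n" for x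
    proof -
      have pn: "0 < p ^ n" using p by simp
      have "2 * (\<bar>x\<bar> * p ^ n) \<le> x\<^sup>2 + p ^ n * p ^ n"
        using sum_squares_bound[of "\<bar>x\<bar>" "p ^ n"] by (simp add: power2_eq_square mult.assoc)
      moreover have "0 \<le> \<bar>x\<bar> * p ^ n" using pn by simp
      ultimately have "\<bar>x\<bar> * p ^ n \<le> x\<^sup>2 + p ^ n * p ^ n" by linarith
      then have "\<bar>x\<bar> \<le> (x\<^sup>2 + p ^ n * p ^ n) / p ^ n" using pn by (simp add: pos_le_divide_eq)
      then show ?thesis using pn p(1) by (simp add: add_divide_distrib)
    qed
    have "(\<integral>\<^sup>+\<omega>. ennreal \<bar>f (Suc n) \<omega> - f n \<omega>\<bar> \<partial>M) \<le>
        (\<integral>\<^sup>+\<omega>. ennreal (1 / p ^ n) * ennreal ((f (Suc n) \<omega> - f n \<omega>)\<^sup>2) + ennreal (p ^ n) \<partial>M)"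
    proof (rule nn_integral_mono)
      fix \<omega>
      have "ennreal \<bar>f (Suc n) \<omega> - f n \<omega>\<bar> \<le> ennreal (p ^ n + 1 / p ^ n * (f (Suc n) \<omega> - f n \<omega>)\<^sup>2)"
        using pt[of "f (Suc n) \<omega> - f n \<omega>"] by (intro ennreal_leI) simp
      also have "\<dots> = ennreal (1 / p ^ n) * ennreal ((f (Suc n) \<omega> - f n \<omega>)\<^sup>2) + ennreal (p ^ n)"
        using p by (subst ennreal_affine) (simp_all add: add.commute)
      finally show "ennreal \<bar>f (Suc n) \<omega> - f n \<omega>\<bar> \<le> \<dots>" .
    qed
    also have "\<dots> = ennreal (1 / p ^ n) * (\<integral>\<^sup>+\<omega>. ennreal ((f (Suc n) \<omega> - f n \<omega>)\<^sup>2) \<partial>M) + ennreal (p ^ n)"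
      by (simp add: nn_integral_add nn_integral_cmult emeasure_space_1)
    also have "\<dots> \<le> ennreal (1 / p ^ n) * ennreal (K * q ^ n) + ennreal (p ^ n)"
      by (intro add_mono mult_left_mono le) auto
    also have "\<dots> = ennreal (p ^ n + 1 / p ^ n * (K * q ^ n))"
      using p q K by (subst ennreal_affine) (simp_all add: add.commute)
    also have "p ^ n + 1 / p ^ n * (K * q ^ n) = (K + 1) * p ^ n"
      using p(1) by (simp add: field_simps power_mult_distrib flip: p(3))
    finally show "(\<integral>\<^sup>+\<omega>. ennreal \<bar>f (Suc n) \<omega> - f n \<omega>\<bar> \<partial>M) \<le> ennreal ((K + 1) * p ^ n)" .
  qed (use p K in auto)
  then show ?thesis
  proof eventually_elim
    case (elim \<omega>)
    then have "summable (\<lambda>n. f (Suc n) \<omega> - f n \<omega>)" by (rule summable_rabs_cancel)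
    then have "convergent (\<lambda>n. \<Sum>i<n. f (Suc i) \<omega> - f i \<omega>)" by (simp add: summable_iff_convergent)
    then have "convergent (\<lambda>n. f n \<omega> - f 0 \<omega>)"
      unfolding sum_lessThan_telescope[of "\<lambda>i. f i \<omega>"] .
    then have "convergent (\<lambda>n. (f n \<omega> - f 0 \<omega>) + f 0 \<omega>)" by (intro convergent_add convergent_const)
    then show ?case by simp
  qed
qed

text \<open>
  Scaling by \<open>\<sigma>\<close> and the inequality \<open>|z| powr e \<le> 1 + z ^ (2 * k)\<close>.
\<close>

lemma nn_powr_moment:
  fixes Y :: "'a \<Rightarrow> real"
  assumes [measurable]: "Y \<in> borel_measurable M" and \<sigma>: "0 < \<sigma>" and e: "0 \<le> e" "e \<le> real (2 * k)"
    and c: "0 \<le> c" and le: "(\<integral>\<^sup>+\<omega>. ennreal (Y \<omega> ^ (2 * k)) \<partial>M) \<le> ennreal (c * \<sigma> ^ (2 * k))"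
  shows "(\<integral>\<^sup>+\<omega>. ennreal (\<bar>Y \<omega>\<bar> powr e) \<partial>M) \<le> ennreal ((1 + c) * \<sigma> powr e)"
proof -
  have pt: "\<bar>y\<bar> powr e \<le> \<sigma> powr e + \<sigma> powr e / \<sigma> ^ (2 * k) * y ^ (2 * k)" for y
  proof (cases "\<bar>y\<bar> \<le> \<sigma>")
    case True
    then have "\<bar>y\<bar> powr e \<le> \<sigma> powr e" using e by (intro powr_mono2) auto
    also have "\<dots> \<le> \<sigma> powr e + \<sigma> powr e / \<sigma> ^ (2 * k) * y ^ (2 * k)" using \<sigma> by simp
    finally show ?thesis .
  next
    case False
    define z where "z = \<bar>y\<bar> / \<sigma>"
    have z: "1 \<le> z" "\<bar>y\<bar> = \<sigma> * z" using False \<sigma> by (auto simp: z_def)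
    have "\<bar>y\<bar> powr e = \<sigma> powr e * z powr e" using z \<sigma> by (simp add: powr_mult)
    also have "\<dots> \<le> \<sigma> powr e * z powr real (2 * k)" using z e by (intro mult_left_mono powr_mono) auto
    also have "z powr real (2 * k) = z ^ (2 * k)" using z by (intro powr_realpow) simp
    also have "z ^ (2 * k) = y ^ (2 * k) / \<sigma> ^ (2 * k)"
      by (simp add: z_def power_divide power_even_abs)
    finally show ?thesis using \<sigma> by (simp add: add_increasing)
  qed
  have "(\<integral>\<^sup>+\<omega>. ennreal (\<bar>Y \<omega>\<bar> powr e) \<partial>M) \<le>
      (\<integral>\<^sup>+\<omega>. ennreal (\<sigma> powr e) + ennreal (\<sigma> powr e / \<sigma> ^ (2 * k)) * ennreal (Y \<omega> ^ (2 * k)) \<partial>M)"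
  proof (rule nn_integral_mono)
    fix \<omega>
    have "ennreal (\<bar>Y \<omega>\<bar> powr e) \<le> ennreal (\<sigma> powr e + \<sigma> powr e / \<sigma> ^ (2 * k) * Y \<omega> ^ (2 * k))"
      by (rule ennreal_leI[OF pt])
    also have "\<dots> = ennreal (\<sigma> powr e) + ennreal (\<sigma> powr e / \<sigma> ^ (2 * k)) * ennreal (Y \<omega> ^ (2 * k))"
      using \<sigma> by (intro ennreal_affine) (simp_all add: zero_le_even_power)
    finally show "ennreal (\<bar>Y \<omega>\<bar> powr e) \<le> \<dots>" .
  qed
  also have "\<dots> = ennreal (\<sigma> powr e) + ennreal (\<sigma> powr e / \<sigma> ^ (2 * k)) * (\<integral>\<^sup>+\<omega>. ennreal (Y \<omega> ^ (2 * k)) \<partial>M)"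
    by (simp add: nn_integral_add nn_integral_cmult emeasure_space_1)
  also have "\<dots> \<le> ennreal (\<sigma> powr e) + ennreal (\<sigma> powr e / \<sigma> ^ (2 * k)) * ennreal (c * \<sigma> ^ (2 * k))"
    by (intro add_mono mult_left_mono le) auto
  also have "\<dots> = ennreal (\<sigma> powr e + \<sigma> powr e / \<sigma> ^ (2 * k) * (c * \<sigma> ^ (2 * k)))"
    using \<sigma> c by (intro ennreal_affine[symmetric]) simp_all
  also have "\<sigma> powr e + \<sigma> powr e / \<sigma> ^ (2 * k) * (c * \<sigma> ^ (2 * k)) = (1 + c) * \<sigma> powr e"
    using \<sigma> by (simp add: field_simps)
  finally show ?thesis .
qed

end

context fbm_bm begin

lemma simple_process_integrand:
  assumes H: "integrand C H" and p: "partition s t n \<tau>"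
    and \<sigma>: "\<And>i. i < n \<Longrightarrow> \<sigma> i \<in> {0..T}" and m: "\<And>i. i < n \<Longrightarrow> H (\<sigma> i) \<in> borel_measurable (past (\<tau> i))"
  shows "simple_process M past s t n \<tau> (\<lambda>i. H (\<sigma> i))"
  using H p \<sigma> m by (simp add: simple_process_def integrand_def)

text \<open>
  The dyadic partition of \<open>[0, T]\<close> clipped to \<open>[s, t]\<close>; many of its intervals are degenerate.
\<close>

definition between :: "real \<Rightarrow> real \<Rightarrow> nat \<Rightarrow> nat \<Rightarrow> real" where
  "between s t n k = max s (min t (dyadic T n k))"

definition dyadic_sum :: "(real \<Rightarrow> 'a \<Rightarrow> real) \<Rightarrow> real \<Rightarrow> real \<Rightarrow> nat \<Rightarrow> 'a \<Rightarrow> real" where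
  "dyadic_sum H s t n = simple_integral W (2 ^ n) (between s t n) (\<lambda>k. H (dyadic T n k))"

lemma dyadic_range: "k \<le> 2 ^ n \<Longrightarrow> dyadic T n k \<in> {0..T}"
  using T_pos dyadic_mono[of T k "2 ^ n" n] by (simp add: dyadic_def)

lemma dyadic_range': "k < 2 ^ n \<Longrightarrow> dyadic T n k \<in> {0..T}"
  by (rule dyadic_range) simp

lemma dyadic_ends: "dyadic T n 0 = 0" "dyadic T n (2 ^ n) = T"
  by (simp_all add: dyadic_def)

lemma partition_between: "0 \<le> s \<Longrightarrow> s \<le> t \<Longrightarrow> t \<le> T \<Longrightarrow> partition s t (2 ^ n) (between s t n)"
  unfolding partition_def between_def dyadic_ends
  by (intro conjI allI impI max.mono min.mono order.refl dyadic_mono T_pos) simp_all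

text \<open>
  The integrand is evaluated at the unclipped dyadic point, which can lie outside of the interval to
  which its value belongs. For functionals of \<open>X\<close> this value is adapted all the same.
\<close>

lemma dyadic_approximation:
  assumes H: "integrand C H" and past: "\<And>r u. r \<in> {0..T} \<Longrightarrow> H r \<in> borel_measurable (past u)"
    and st: "0 \<le> s" "s \<le> t" "t \<le> T"
  shows "simple_process M past s t (2 ^ n) (between s t n) (\<lambda>k. H (dyadic T n k))"
    and "dist2 s t H (simple_value (2 ^ n) (between s t n) (\<lambda>k. H (dyadic T n k))) \<le>
      ennreal (C * sqrt T * (t - s) * sqrt (1 / 2) ^ n)"
proof -
  note p = partition_between[OF st]
  show P: "simple_process M past s t (2 ^ n) (between s t n) (\<lambda>k. H (dyadic T n k))"
    by (rule simple_process_integrand[OF H p dyadic_range' past[OF dyadic_range']])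
  have "dist2 s t H (simple_value (2 ^ n) (between s t n) (\<lambda>k. H (dyadic T n k))) \<le>
      ennreal (C * sqrt (T / 2 ^ n) * (t - s))"
  proof (rule riemann_dist2[OF H st P])
    fix i r assume i: "i < 2 ^ n" and r: "between s t n i < r" "r \<le> between s t n (Suc i)"
    have "s \<le> between s t n i" "r \<le> t" using r st by (auto simp: between_def)
    then have "dyadic T n i < r" "r \<le> dyadic T n (Suc i)"
      using r by (auto simp: between_def max_def min_def split: if_splits)
    moreover have "dyadic T n (Suc i) - dyadic T n i = T / 2 ^ n"
      by (simp add: dyadic_def field_simps)
    ultimately show "\<bar>r - dyadic T n i\<bar> \<le> T / 2 ^ n" by linarith
  next
    show "0 \<le> T / 2 ^ n" using T_pos by simp
  qed (rule dyadic_range')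
  also have "C * sqrt (T / 2 ^ n) * (t - s) = C * sqrt T * (t - s) * sqrt (1 / 2) ^ n"
    by (simp add: real_sqrt_divide real_sqrt_power power_divide)
  finally show "dist2 s t H (simple_value (2 ^ n) (between s t n) (\<lambda>k. H (dyadic T n k))) \<le>
      ennreal (C * sqrt T * (t - s) * sqrt (1 / 2) ^ n)" .
qed

lemma dyadic_approximation_tendsto:
  assumes H: "integrand C H" and past: "\<And>r u. r \<in> {0..T} \<Longrightarrow> H r \<in> borel_measurable (past u)"
    and st: "0 \<le> s" "s \<le> t" "t \<le> T"
  shows "(\<lambda>n. dist2 s t H (simple_value (2 ^ n) (between s t n) (\<lambda>k. H (dyadic T n k)))) \<longlonglongrightarrow> 0"
proof (rule tendsto_sandwich[OF always_eventually always_eventually tendsto_const])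
  have "(\<lambda>n. sqrt (1 / 2) ^ n) \<longlonglongrightarrow> 0"
    by (rule LIMSEQ_realpow_zero) (auto simp: real_sqrt_lt_1_iff)
  from tendsto_mult[OF tendsto_const[of "C * sqrt T * (t - s)"] this]
  show "(\<lambda>n. ennreal (C * sqrt T * (t - s) * sqrt (1 / 2) ^ n)) \<longlonglongrightarrow> 0"
    using tendsto_ennrealI by fastforce
qed (use dyadic_approximation(2)[OF H past st] in auto)

lemma dyadic_sum_convergent:
  assumes H: "integrand C H" and past: "\<And>r u. r \<in> {0..T} \<Longrightarrow> H r \<in> borel_measurable (past u)"
    and st: "0 \<le> s" "s \<le> t" "t \<le> T"
  shows "AE \<omega> in M. convergent (\<lambda>n. dyadic_sum H s t n \<omega>)"
proof (rule convergent_AE_of_square_increments[where K = "4 * (C * sqrt T * (t - s))" and q = "sqrt (1 / 2)"])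
  note P = dyadic_approximation(1)[OF H past st]
  let ?v = "\<lambda>n. simple_value (2 ^ n) (between s t n) (\<lambda>k. H (dyadic T n k))"
  let ?K = "C * sqrt T * (t - s)"
  note m = simple_process_measurable[OF P st(1,3)]
  show "dyadic_sum H s t n \<in> borel_measurable M" for n unfolding dyadic_sum_def by (rule m(1))
  have K: "0 \<le> ?K" using H st T_pos by (simp add: integrand_def)
  then show "0 \<le> 4 * ?K" by simp
  fix n
  have d: "dist2 s t H (?v n) \<le> ennreal (?K * sqrt (1 / 2) ^ n)" for n
    by (rule dyadic_approximation(2)[OF H past st])
  have "(\<integral>\<^sup>+\<omega>. ennreal ((dyadic_sum H s t (Suc n) \<omega> - dyadic_sum H s t n \<omega>)\<^sup>2) \<partial>M) = dist2 s t (?v (Suc n)) (?v n)"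
    unfolding dyadic_sum_def by (rule simple_isometry[OF P P st(1,3)])
  also have "\<dots> \<le> 2 * dist2 s t H (?v (Suc n)) + 2 * dist2 s t H (?v n)"
    using dist2_triangle[OF m(2)[of "Suc n"] integrand_regular[OF H st] m(2)[of n]] by (simp add: dist2_commute)
  also have "\<dots> \<le> 2 * ennreal (?K * sqrt (1 / 2) ^ n) + 2 * ennreal (?K * sqrt (1 / 2) ^ n)"
  proof (intro add_mono mult_left_mono d)
    have "sqrt (1 / 2) ^ Suc n \<le> sqrt (1 / 2) ^ n" by (rule power_decreasing) (auto simp: real_sqrt_le_1_iff)
    then have "?K * sqrt (1 / 2) ^ Suc n \<le> ?K * sqrt (1 / 2) ^ n" using K by (rule mult_left_mono)
    then show "dist2 s t H (?v (Suc n)) \<le> ennreal (?K * sqrt (1 / 2) ^ n)"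
      using d[of "Suc n"] by (meson ennreal_leI order.trans)
  qed auto
  also have "\<dots> = ennreal (4 * ?K * sqrt (1 / 2) ^ n)"
  proof -
    have k0: "0 \<le> ?K * sqrt (1 / 2) ^ n" using K by simp
    have "2 * e + 2 * e = 4 * e" for e :: ennreal by (simp flip: distrib_right)
    then show ?thesis unfolding numeral_times_ennreal[OF k0, symmetric] mult.assoc[of 4 ?K] .
  qed
  finally show "(\<integral>\<^sup>+\<omega>. ennreal ((dyadic_sum H s t (Suc n) \<omega> - dyadic_sum H s t n \<omega>)\<^sup>2) \<partial>M) \<le>
      ennreal (4 * ?K * sqrt (1 / 2) ^ n)" .
qed (auto simp: real_sqrt_lt_1_iff)

definition Asum :: "nat \<Rightarrow> real \<Rightarrow> 'a \<Rightarrow> real" where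
  "Asum n t \<omega> = (\<Sum>k<2 ^ n. X (dyadic T n k) \<omega> *
     (W (min t (dyadic T n (Suc k))) \<omega> - W (min t (dyadic T n k)) \<omega>))"

definition Bsum :: "nat \<Rightarrow> real \<Rightarrow> 'a \<Rightarrow> real" where
  "Bsum n t \<omega> = (\<Sum>k<2 ^ n. (X (dyadic T n k) \<omega>)\<^sup>2 *
     (W (min t (dyadic T n (Suc k))) \<omega> - W (min t (dyadic T n k)) \<omega>))"

text \<open>
  The relations that define \<open>area\<close> and \<open>sq_area\<close> hold for the Riemann sums, so the limits of the
  sums over \<open>[0, t]\<close> determine those over all intervals.
\<close>

lemma dyadic_sum_expand:
  assumes st: "0 \<le> s" "s \<le> t" "t \<le> T"
  shows "dyadic_sum (\<lambda>r \<omega>. X r \<omega> - X s \<omega>) s t n \<omega> = Asum n t \<omega> - Asum n s \<omega> - X s \<omega> * (W t \<omega> - W s \<omega>)"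
    and "dyadic_sum (\<lambda>r \<omega>. (X r \<omega> - X s \<omega>)\<^sup>2) s t n \<omega> = Bsum n t \<omega> - Bsum n s \<omega>
      - 2 * X s \<omega> * (Asum n t \<omega> - Asum n s \<omega>) + (X s \<omega>)\<^sup>2 * (W t \<omega> - W s \<omega>)"
proof -
  let ?d = "dyadic T n" and ?I = "\<lambda>t k. W (min t (dyadic T n (Suc k))) \<omega> - W (min t (dyadic T n k)) \<omega>"
  let ?J = "\<lambda>k. W (between s t n (Suc k)) \<omega> - W (between s t n k) \<omega>"
  have "W (between s t n k) \<omega> = W (min t (?d k)) \<omega> - W (min s (?d k)) \<omega> + W s \<omega>" for k
    using st by (cases "?d k \<le> s") (auto simp: between_def max_def min_def)
  then have J: "?J k = ?I t k - ?I s k" for k by simp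
  have ends: "between s t n (2 ^ n) = t" "between s t n 0 = s"
    using st by (simp_all add: between_def dyadic_ends)
  have tot: "(\<Sum>k<2 ^ n. ?I t k - ?I s k) = W t \<omega> - W s \<omega>"
    using sum_lessThan_telescope[of "\<lambda>k. W (between s t n k) \<omega>" "2 ^ n"] unfolding J ends .
  have "dyadic_sum (\<lambda>r \<omega>. X r \<omega> - X s \<omega>) s t n \<omega> =
     (\<Sum>k<2 ^ n. X (?d k) \<omega> * ?I t k - X (?d k) \<omega> * ?I s k - X s \<omega> * (?I t k - ?I s k))"
    unfolding dyadic_sum_def simple_integral_def J by (intro sum.cong refl) (simp add: algebra_simps)
  also have "\<dots> = Asum n t \<omega> - Asum n s \<omega> - X s \<omega> * (W t \<omega> - W s \<omega>)"
    unfolding sum_subtractf sum_distrib_left[symmetric] Asum_def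
    unfolding sum_subtractf[symmetric] tot by (simp add: sum_subtractf)
  finally show "dyadic_sum (\<lambda>r \<omega>. X r \<omega> - X s \<omega>) s t n \<omega> = Asum n t \<omega> - Asum n s \<omega> - X s \<omega> * (W t \<omega> - W s \<omega>)" .
  have "dyadic_sum (\<lambda>r \<omega>. (X r \<omega> - X s \<omega>)\<^sup>2) s t n \<omega> =
     (\<Sum>k<2 ^ n. (X (?d k) \<omega>)\<^sup>2 * ?I t k - (X (?d k) \<omega>)\<^sup>2 * ?I s k
       - 2 * X s \<omega> * (X (?d k) \<omega> * ?I t k - X (?d k) \<omega> * ?I s k) + (X s \<omega>)\<^sup>2 * (?I t k - ?I s k))"
    unfolding dyadic_sum_def simple_integral_def J
    by (intro sum.cong refl) (simp add: algebra_simps power2_eq_square)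
  also have "\<dots> = (\<Sum>k<2 ^ n. (X (?d k) \<omega>)\<^sup>2 * ?I t k) - (\<Sum>k<2 ^ n. (X (?d k) \<omega>)\<^sup>2 * ?I s k)
      - 2 * X s \<omega> * ((\<Sum>k<2 ^ n. X (?d k) \<omega> * ?I t k) - (\<Sum>k<2 ^ n. X (?d k) \<omega> * ?I s k))
      + (X s \<omega>)\<^sup>2 * (\<Sum>k<2 ^ n. ?I t k - ?I s k)"
    by (simp only: sum.distrib sum_subtractf sum_distrib_left[symmetric])
  finally show "dyadic_sum (\<lambda>r \<omega>. (X r \<omega> - X s \<omega>)\<^sup>2) s t n \<omega> = Bsum n t \<omega> - Bsum n s \<omega>
      - 2 * X s \<omega> * (Asum n t \<omega> - Asum n s \<omega>) + (X s \<omega>)\<^sup>2 * (W t \<omega> - W s \<omega>)"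
    unfolding tot Asum_def Bsum_def .
qed

definition Alim :: "real \<Rightarrow> 'a \<Rightarrow> real" where "Alim t \<omega> = lim (\<lambda>n. Asum n t \<omega>)"
definition Blim :: "real \<Rightarrow> 'a \<Rightarrow> real" where "Blim t \<omega> = lim (\<lambda>n. Bsum n t \<omega>)"

lemma past_X: "s \<in> {0..T} \<Longrightarrow> r \<in> {0..T} \<Longrightarrow> (\<lambda>\<omega>. X r \<omega> - X s \<omega>) \<in> borel_measurable (past u)"
  "s \<in> {0..T} \<Longrightarrow> r \<in> {0..T} \<Longrightarrow> (\<lambda>\<omega>. (X r \<omega> - X s \<omega>)\<^sup>2) \<in> borel_measurable (past u)"
  by (intro borel_measurable_diff borel_measurable_power X_past; assumption)+

lemma sums_measurable [measurable]:
  assumes "t \<in> {0..T}"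
  shows "Asum n t \<in> borel_measurable M" "Bsum n t \<in> borel_measurable M"
    "Alim t \<in> borel_measurable M" "Blim t \<in> borel_measurable M"
proof -
  have mn: "min t (dyadic T n k) \<in> {0..T}" if "k \<le> 2 ^ n" for n k
    using assms dyadic_range[OF that] by auto
  show A: "Asum n t \<in> borel_measurable M" and B: "Bsum n t \<in> borel_measurable M" for n
    unfolding Asum_def Bsum_def
    by (intro borel_measurable_sum borel_measurable_times borel_measurable_diff borel_measurable_power
        W_measurable X_measurable mn dyadic_range; simp)+
  show "Alim t \<in> borel_measurable M" "Blim t \<in> borel_measurable M"
    unfolding Alim_def Blim_def using A B by (auto intro!: borel_measurable_lim_metric)
qed

lemma sums_tendsto:
  assumes t: "t \<in> {0..T}"
  shows "AE \<omega> in M. (\<lambda>n. Asum n t \<omega>) \<longlonglongrightarrow> Alim t \<omega> \<and> (\<lambda>n. Bsum n t \<omega>) \<longlonglongrightarrow> Blim t \<omega>"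
proof -
  have z: "0 \<in> {0..T}" using T_pos by simp
  have t': "0 \<le> (0::real)" "0 \<le> t" "t \<le> T" using t by auto
  have zero: "Asum n 0 \<omega> = 0" "Bsum n 0 \<omega> = 0" for n \<omega>
    using dyadic_mono[OF T_pos, of 0 _ n] T_pos
    by (auto simp: Asum_def Bsum_def dyadic_def min_def intro!: sum.neutral)
  have 1: "AE \<omega> in M. convergent (\<lambda>n. dyadic_sum (\<lambda>r \<omega>. X r \<omega> - X 0 \<omega>) 0 t n \<omega>)"
    by (rule dyadic_sum_convergent[OF integrand_X[OF z] past_X(1)[OF z] t'])
  have 2: "AE \<omega> in M. convergent (\<lambda>n. dyadic_sum (\<lambda>r \<omega>. (X r \<omega> - X 0 \<omega>)\<^sup>2) 0 t n \<omega>)"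
    by (rule dyadic_sum_convergent[OF integrand_X_square[OF z] past_X(2)[OF z] t'])
  from 1 2 show ?thesis
  proof eventually_elim
    case (elim \<omega>)
    note c = elim[unfolded dyadic_sum_expand[OF t'] zero diff_0_right]
    have "convergent (\<lambda>n. (Asum n t \<omega> - X 0 \<omega> * (W t \<omega> - W 0 \<omega>)) + X 0 \<omega> * (W t \<omega> - W 0 \<omega>))"
      by (rule convergent_add[OF c(1) convergent_const])
    then have A: "convergent (\<lambda>n. Asum n t \<omega>)" by simp
    have "convergent (\<lambda>n. (Bsum n t \<omega> - 2 * X 0 \<omega> * Asum n t \<omega> + (X 0 \<omega>)\<^sup>2 * (W t \<omega> - W 0 \<omega>))
       + (2 * X 0 \<omega> * Asum n t \<omega> + - ((X 0 \<omega>)\<^sup>2 * (W t \<omega> - W 0 \<omega>))))"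
      by (intro convergent_add[OF c(2)] convergent_add convergent_mult convergent_const A)
    then have "convergent (\<lambda>n. Bsum n t \<omega>)" by simp
    with A show ?case by (simp add: Alim_def Blim_def convergent_LIMSEQ_iff)
  qed
qed

abbreviation "area_lim s t \<omega> \<equiv> area (\<lambda>r. X r \<omega>) (\<lambda>r. W r \<omega>) (\<lambda>r. Alim r \<omega>) s t"
abbreviation "sq_area_lim s t \<omega> \<equiv> sq_area (\<lambda>r. X r \<omega>) (\<lambda>r. W r \<omega>) (\<lambda>r. Alim r \<omega>) (\<lambda>r. Blim r \<omega>) s t"

lemma areas_ito_limit:
  assumes st: "0 \<le> s" "s \<le> t" "t \<le> T"
  shows "ito_limit (\<lambda>r \<omega>. X r \<omega> - X s \<omega>) s t (\<lambda>\<omega>. area_lim s t \<omega>)"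
    and "ito_limit (\<lambda>r \<omega>. (X r \<omega> - X s \<omega>)\<^sup>2) s t (\<lambda>\<omega>. sq_area_lim s t \<omega>)"
proof -
  have s: "s \<in> {0..T}" and t: "t \<in> {0..T}" using st by auto
  note [measurable] = sums_measurable[OF s] sums_measurable[OF t] X_measurable[OF s] X_measurable[OF t]
    W_measurable[OF s] W_measurable[OF t]
  have m: "(\<lambda>\<omega>. area_lim s t \<omega>) \<in> borel_measurable M" "(\<lambda>\<omega>. sq_area_lim s t \<omega>) \<in> borel_measurable M"
    unfolding area_def sq_area_def by measurable
  show "ito_limit (\<lambda>r \<omega>. X r \<omega> - X s \<omega>) s t (\<lambda>\<omega>. area_lim s t \<omega>)"
  proof (rule ito_limit_AE[OF st(1,3) m(1) integrand_regular[OF integrand_X[OF s] st]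
      dyadic_approximation(1)[OF integrand_X[OF s] past_X(1)[OF s] st]
      dyadic_approximation_tendsto[OF integrand_X[OF s] past_X(1)[OF s] st]])
    show "AE \<omega> in M. (\<lambda>k. simple_integral W (2 ^ k) (between s t k)
        (\<lambda>i \<omega>. X (dyadic T k i) \<omega> - X s \<omega>) \<omega>) \<longlonglongrightarrow> area_lim s t \<omega>"
      using sums_tendsto[OF s] sums_tendsto[OF t]
    proof eventually_elim
      case (elim \<omega>)
      show ?case
        using dyadic_sum_expand(1)[OF st, unfolded dyadic_sum_def] elim
        by (simp add: area_def) (intro tendsto_intros, auto)
    qed
  qed
  show "ito_limit (\<lambda>r \<omega>. (X r \<omega> - X s \<omega>)\<^sup>2) s t (\<lambda>\<omega>. sq_area_lim s t \<omega>)"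
  proof (rule ito_limit_AE[OF st(1,3) m(2) integrand_regular[OF integrand_X_square[OF s] st]
      dyadic_approximation(1)[OF integrand_X_square[OF s] past_X(2)[OF s] st]
      dyadic_approximation_tendsto[OF integrand_X_square[OF s] past_X(2)[OF s] st]])
    show "AE \<omega> in M. (\<lambda>k. simple_integral W (2 ^ k) (between s t k)
        (\<lambda>i \<omega>. (X (dyadic T k i) \<omega> - X s \<omega>)\<^sup>2) \<omega>) \<longlonglongrightarrow> sq_area_lim s t \<omega>"
      using sums_tendsto[OF s] sums_tendsto[OF t]
    proof eventually_elim
      case (elim \<omega>)
      show ?case
        using dyadic_sum_expand(2)[OF st, unfolded dyadic_sum_def] elim
        by (simp add: sq_area_def) (intro tendsto_intros, auto)
    qed
  qed
qed

text \<open>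
  The increments of \<open>X\<close> over an interval of length \<open>h\<close> have the second moment \<open>sqrt h\<close> and the fourth
  moment \<open>3 * h\<close>; the isometry adds one power of \<open>h\<close>.
\<close>

lemma areas_moment:
  assumes st: "0 \<le> s" "s \<le> t" "t \<le> T"
  shows "(\<integral>\<^sup>+\<omega>. ennreal ((area_lim s t \<omega>)\<^sup>2) \<partial>M) \<le> ennreal (4 * (sqrt (t - s) * (t - s)))"
    and "(\<integral>\<^sup>+\<omega>. ennreal ((sq_area_lim s t \<omega>)\<^sup>2) \<partial>M) \<le> ennreal (12 * (t - s)\<^sup>2)"
proof -
  have s: "s \<in> {0..T}" using st by auto
  have "dist2 s t (\<lambda>r \<omega>. X r \<omega> - X s \<omega>) (\<lambda>r \<omega>. 0) \<le> ennreal (sqrt (t - s) * (t - s))"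
  proof (rule dist2_le[OF st(2) _ integrand_regular[OF integrand_X[OF s] st] regular_const])
    fix r assume "s < r" "r \<le> t"
    then show "(\<integral>\<^sup>+\<omega>. ennreal ((X r \<omega> - X s \<omega> - 0)\<^sup>2) \<partial>M) \<le> ennreal (sqrt (t - s))"
      using nn_X_increment(1)[of s r] st by (auto intro!: ennreal_leI)
  qed (use st in simp)
  then have "4 * dist2 s t (\<lambda>r \<omega>. X r \<omega> - X s \<omega>) (\<lambda>r \<omega>. 0) \<le> 4 * ennreal (sqrt (t - s) * (t - s))"
    by (rule mult_left_mono) simp
  also have "\<dots> = ennreal (4 * (sqrt (t - s) * (t - s)))" using st by (simp add: ennreal_mult)
  finally show "(\<integral>\<^sup>+\<omega>. ennreal ((area_lim s t \<omega>)\<^sup>2) \<partial>M) \<le> ennreal (4 * (sqrt (t - s) * (t - s)))"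
    using ito_limit_moment[OF st(2) areas_ito_limit(1)[OF st]] by (rule order.trans[rotated])
  have "dist2 s t (\<lambda>r \<omega>. (X r \<omega> - X s \<omega>)\<^sup>2) (\<lambda>r \<omega>. 0) \<le> ennreal (3 * (t - s) * (t - s))"
  proof (rule dist2_le[OF st(2) _ integrand_regular[OF integrand_X_square[OF s] st] regular_const])
    fix r assume "s < r" "r \<le> t"
    then show "(\<integral>\<^sup>+\<omega>. ennreal (((X r \<omega> - X s \<omega>)\<^sup>2 - 0)\<^sup>2) \<partial>M) \<le> ennreal (3 * (t - s))"
      using nn_X_increment(2)[of s r] st by (auto intro!: ennreal_leI)
  qed (use st in simp)
  then have "4 * dist2 s t (\<lambda>r \<omega>. (X r \<omega> - X s \<omega>)\<^sup>2) (\<lambda>r \<omega>. 0) \<le> 4 * ennreal (3 * (t - s) * (t - s))"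
    by (rule mult_left_mono) simp
  also have "\<dots> = ennreal (12 * (t - s)\<^sup>2)"
    using st by (subst numeral_times_ennreal) (simp_all add: power2_eq_square)
  finally show "(\<integral>\<^sup>+\<omega>. ennreal ((sq_area_lim s t \<omega>)\<^sup>2) \<partial>M) \<le> ennreal (12 * (t - s)\<^sup>2)"
    using ito_limit_moment[OF st(2) areas_ito_limit(2)[OF st]] by (rule order.trans[rotated])
qed

end

section \<open>Almost sure regularity\<close>

context fbm_bm begin

abbreviation "variation_lim \<rho> s t \<omega> \<equiv>
  variation \<rho> (\<lambda>r. X r \<omega>) (\<lambda>r. W r \<omega>) (\<lambda>r. Alim r \<omega>) (\<lambda>r. Blim r \<omega>) s t"

lemma areas_measurable:
  assumes "s \<in> {0..T}" "t \<in> {0..T}"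
  shows "(\<lambda>\<omega>. area_lim s t \<omega>) \<in> borel_measurable M" "(\<lambda>\<omega>. sq_area_lim s t \<omega>) \<in> borel_measurable M"
  unfolding area_def sq_area_def
  by (intro borel_measurable_diff borel_measurable_add borel_measurable_times borel_measurable_power
      borel_measurable_const sums_measurable X_measurable W_measurable assms)+

text \<open>
  The exponents \<open>\<rho>\<close>, \<open>\<rho> / 2\<close>, \<open>\<rho> / 3\<close>, \<open>\<rho> / 4\<close> are at most 6, 4, 2, 2, the orders of the moments at hand,
  and each of the quantities scales so that its term is of order \<open>(t - s) powr (\<rho> / 4)\<close>.
\<close>

lemma variation_moment:
  assumes \<rho>: "4 < \<rho>" "\<rho> < 5" and st: "0 \<le> s" "s < t" "t \<le> T"
  shows "(\<lambda>\<omega>. variation_lim \<rho> s t \<omega>) \<in> borel_measurable M"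
    and "(\<integral>\<^sup>+\<omega>. ennreal (variation_lim \<rho> s t \<omega>) \<partial>M) \<le> ennreal (39 * (t - s) powr (\<rho> / 4))"
proof -
  have s: "s \<in> {0..T}" and t: "t \<in> {0..T}" and st': "s \<le> t" using st by auto
  let ?h = "t - s"
  let ?X = "\<lambda>\<omega>. X t \<omega> - X s \<omega>" and ?W = "\<lambda>\<omega>. W t \<omega> - W s \<omega>"
  have h: "0 < ?h" using st by simp
  have Xm [measurable]: "?X \<in> borel_measurable M" and Wm [measurable]: "?W \<in> borel_measurable M"
    using s t by simp_all
  note am [measurable] = areas_measurable[OF s t]
  show "(\<lambda>\<omega>. variation_lim \<rho> s t \<omega>) \<in> borel_measurable M"
    unfolding variation_def by measurable
  have half: "?h powr (1 / 2) = sqrt ?h" using h by (simp add: powr_half_sqrt)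
  have 1: "(\<integral>\<^sup>+\<omega>. ennreal (\<bar>?X \<omega>\<bar> powr \<rho>) \<partial>M) \<le> ennreal ((1 + 15) * ?h powr (\<rho> / 4))"
  proof -
    \<comment> \<open>The standard deviation of the increment of X.\<close>
    let ?\<sigma> = "?h powr (1 / 4)"
    have "?\<sigma> ^ 2 = ?h powr (1 / 2)" using h by (simp add: power2_eq_square flip: powr_add)
    then have "?\<sigma> ^ 2 = sqrt ?h" using half by simp
    then have "sqrt ?h ^ 3 = (?\<sigma> ^ 2) ^ 3" by simp
    then have "sqrt ?h ^ 3 = ?\<sigma> ^ (2 * 3)" by (simp only: power_mult)
    then have "(\<integral>\<^sup>+\<omega>. ennreal (?X \<omega> ^ (2 * 3)) \<partial>M) \<le> ennreal (15 * ?\<sigma> ^ (2 * 3))"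
      using nn_X_increment(3)[OF s t] h by simp
    from nn_powr_moment[OF Xm _ _ _ _ this, of \<rho>]
    have "(\<integral>\<^sup>+\<omega>. ennreal (\<bar>?X \<omega>\<bar> powr \<rho>) \<partial>M) \<le> ennreal ((1 + 15) * ?\<sigma> powr \<rho>)" using h \<rho> by simp
    then show ?thesis by (simp add: powr_powr)
  qed
  have 2: "(\<integral>\<^sup>+\<omega>. ennreal (\<bar>?W \<omega>\<bar> powr (\<rho> / 2)) \<partial>M) \<le> ennreal ((1 + 3) * ?h powr (\<rho> / 4))"
  proof -
    let ?\<sigma> = "?h powr (1 / 2)"
    have "?\<sigma> ^ (2 * 2) = (sqrt ?h ^ 2) ^ 2" unfolding half by (simp only: power_mult)
    then have "?\<sigma> ^ (2 * 2) = ?h\<^sup>2" using h by simp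
    then have "(\<integral>\<^sup>+\<omega>. ennreal (?W \<omega> ^ (2 * 2)) \<partial>M) \<le> ennreal (3 * ?\<sigma> ^ (2 * 2))"
      using nn_W_increment(2)[OF st(1) st' st(3)] by simp
    from nn_powr_moment[OF Wm _ _ _ _ this, of "\<rho> / 2"]
    have "(\<integral>\<^sup>+\<omega>. ennreal (\<bar>?W \<omega>\<bar> powr (\<rho> / 2)) \<partial>M) \<le> ennreal ((1 + 3) * ?\<sigma> powr (\<rho> / 2))" using h \<rho> by simp
    then show ?thesis by (simp add: powr_powr)
  qed
  have 3: "(\<integral>\<^sup>+\<omega>. ennreal (\<bar>area_lim s t \<omega>\<bar> powr (\<rho> / 3)) \<partial>M) \<le> ennreal ((1 + 4) * ?h powr (\<rho> / 4))"
  proof -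
    let ?\<sigma> = "?h powr (3 / 4)"
    have "?\<sigma> ^ (2 * 1) = ?h powr (1 / 2 + 1)" using h by (simp add: power2_eq_square flip: powr_add)
    also have "\<dots> = sqrt ?h * ?h" unfolding powr_add half using h by simp
    finally have "(\<integral>\<^sup>+\<omega>. ennreal (area_lim s t \<omega> ^ (2 * 1)) \<partial>M) \<le> ennreal (4 * ?\<sigma> ^ (2 * 1))"
      using areas_moment(1)[OF st(1) st' st(3)] by (simp only: mult_1_right)
    from nn_powr_moment[OF am(1) _ _ _ _ this, of "\<rho> / 3"]
    have "(\<integral>\<^sup>+\<omega>. ennreal (\<bar>area_lim s t \<omega>\<bar> powr (\<rho> / 3)) \<partial>M) \<le> ennreal ((1 + 4) * ?\<sigma> powr (\<rho> / 3))"
      using h \<rho> by simp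
    then show ?thesis by (simp add: powr_powr)
  qed
  have 4: "(\<integral>\<^sup>+\<omega>. ennreal (\<bar>sq_area_lim s t \<omega>\<bar> powr (\<rho> / 4)) \<partial>M) \<le> ennreal ((1 + 12) * ?h powr (\<rho> / 4))"
  proof -
    have "(\<integral>\<^sup>+\<omega>. ennreal (sq_area_lim s t \<omega> ^ (2 * 1)) \<partial>M) \<le> ennreal (12 * ?h ^ (2 * 1))"
      using areas_moment(2)[OF st(1) st' st(3)] by (simp only: mult_1_right)
    from nn_powr_moment[OF am(2) h _ _ _ this, of "\<rho> / 4"] show ?thesis using \<rho> by simp
  qed
  have "(\<integral>\<^sup>+\<omega>. ennreal (variation_lim \<rho> s t \<omega>) \<partial>M) =
    (\<integral>\<^sup>+\<omega>. ennreal (\<bar>?X \<omega>\<bar> powr \<rho>) + ennreal (\<bar>?W \<omega>\<bar> powr (\<rho> / 2)) + ennreal (\<bar>area_lim s t \<omega>\<bar> powr (\<rho> / 3))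
      + ennreal (\<bar>sq_area_lim s t \<omega>\<bar> powr (\<rho> / 4)) + ennreal (?h powr (\<rho> / 4)) \<partial>M)"
    unfolding variation_def by (intro nn_integral_cong) (simp add: ennreal_plus)
  also have "\<dots> = (\<integral>\<^sup>+\<omega>. ennreal (\<bar>?X \<omega>\<bar> powr \<rho>) \<partial>M) + (\<integral>\<^sup>+\<omega>. ennreal (\<bar>?W \<omega>\<bar> powr (\<rho> / 2)) \<partial>M)
      + (\<integral>\<^sup>+\<omega>. ennreal (\<bar>area_lim s t \<omega>\<bar> powr (\<rho> / 3)) \<partial>M)
      + (\<integral>\<^sup>+\<omega>. ennreal (\<bar>sq_area_lim s t \<omega>\<bar> powr (\<rho> / 4)) \<partial>M) + ennreal (?h powr (\<rho> / 4))"
    by (simp add: nn_integral_add emeasure_space_1)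
  also have "\<dots> \<le> ennreal ((1 + 15) * ?h powr (\<rho> / 4)) + ennreal ((1 + 3) * ?h powr (\<rho> / 4))
      + ennreal ((1 + 4) * ?h powr (\<rho> / 4)) + ennreal ((1 + 12) * ?h powr (\<rho> / 4)) + ennreal (?h powr (\<rho> / 4))"
    by (intro add_mono 1 2 3 4 order.refl)
  also have "\<dots> = ennreal (39 * ?h powr (\<rho> / 4))"
    by (simp flip: ennreal_plus)
  finally show "(\<integral>\<^sup>+\<omega>. ennreal (variation_lim \<rho> s t \<omega>) \<partial>M) \<le> ennreal (39 * (t - s) powr (\<rho> / 4))" .
qed

text \<open>
  The \<open>2 ^ n\<close> intervals of level \<open>n\<close> contribute a multiple of \<open>2 powr (n * (1 - \<rho> / 4))\<close> to the
  expectation. The factor \<open>r ^ n\<close> uses up half of this decay.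
\<close>

lemma variation_summable:
  assumes \<rho>: "4 < \<rho>" "\<rho> < 5"
  defines "r \<equiv> 2 powr ((\<rho> / 4 - 1) / 2)"
  shows "AE \<omega> in M. summable (\<lambda>n. r ^ n * (\<Sum>k<2 ^ n. variation_lim \<rho> (dyadic T n k) (dyadic T n (Suc k)) \<omega>))"
proof (rule summable_AE_of_nn_integral[where K = "39 * T powr (\<rho> / 4)" and q = "r * (2 * 2 powr (- \<rho> / 4))"])
  have r0: "0 < r" by (simp add: r_def)
  have "r * (2 * 2 powr (- \<rho> / 4)) = 2 powr ((\<rho> / 4 - 1) / 2) * (2 powr 1 * 2 powr (- \<rho> / 4))"
    by (simp add: r_def)
  also have "\<dots> = 2 powr (- ((\<rho> / 4 - 1) / 2))"
    unfolding powr_add[symmetric] by (rule arg_cong[where f = "\<lambda>x. 2 powr x"]) (simp add: field_simps)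
  also have "\<dots> < 2 powr 0" using \<rho> by (intro powr_less_mono) auto
  finally show "r * (2 * 2 powr (- \<rho> / 4)) < 1" by simp
  show "0 \<le> r * (2 * 2 powr (- \<rho> / 4))" using r0 by simp
  show "0 \<le> 39 * T powr (\<rho> / 4)" by simp
  fix n
  let ?V = "\<lambda>k \<omega>. variation_lim \<rho> (dyadic T n k) (dyadic T n (Suc k)) \<omega>"
  have d: "0 \<le> dyadic T n k" "dyadic T n k < dyadic T n (Suc k)" "dyadic T n (Suc k) \<le> T"
    "dyadic T n (Suc k) - dyadic T n k = T / 2 ^ n" if "k < 2 ^ n" for k
    using dyadic_range[of k n] dyadic_range[of "Suc k" n] that T_pos
    by (auto simp: dyadic_def field_simps)
  have m: "?V k \<in> borel_measurable M" if "k < 2 ^ n" for k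
    by (rule variation_moment(1)[OF \<rho> d(1-3)[OF that]])
  show "(\<lambda>\<omega>. r ^ n * (\<Sum>k<2 ^ n. ?V k \<omega>)) \<in> borel_measurable M"
    by (intro borel_measurable_times borel_measurable_const borel_measurable_sum m) simp
  show "0 \<le> r ^ n * (\<Sum>k<2 ^ n. ?V k \<omega>)" for \<omega> using r0 by (intro mult_nonneg_nonneg sum_nonneg) auto
  have "(\<integral>\<^sup>+\<omega>. ennreal (r ^ n * (\<Sum>k<2 ^ n. ?V k \<omega>)) \<partial>M) =
      (\<integral>\<^sup>+\<omega>. ennreal (r ^ n) * (\<Sum>k<2 ^ n. ennreal (?V k \<omega>)) \<partial>M)"
    using r0 by (intro nn_integral_cong) (simp add: ennreal_mult sum_nonneg)
  also have "\<dots> = ennreal (r ^ n) * (\<Sum>k<2 ^ n. \<integral>\<^sup>+\<omega>. ennreal (?V k \<omega>) \<partial>M)"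
  proof -
    have "(\<lambda>\<omega>. \<Sum>k<2 ^ n. ennreal (?V k \<omega>)) \<in> borel_measurable M"
      by (intro borel_measurable_sum measurable_compose[OF m measurable_ennreal]) simp
    moreover have "(\<integral>\<^sup>+\<omega>. (\<Sum>k<2 ^ n. ennreal (?V k \<omega>)) \<partial>M) = (\<Sum>k<2 ^ n. \<integral>\<^sup>+\<omega>. ennreal (?V k \<omega>) \<partial>M)"
      by (rule nn_integral_sum, rule measurable_compose[OF m measurable_ennreal]) simp
    ultimately show ?thesis by (simp add: nn_integral_cmult)
  qed
  also have "\<dots> \<le> ennreal (r ^ n) * (\<Sum>k<(2::nat) ^ n. ennreal (39 * (T / 2 ^ n) powr (\<rho> / 4)))"
    using variation_moment(2)[OF \<rho> d(1-3)] d(4) by (intro mult_left_mono sum_mono) auto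
  also have "\<dots> = ennreal (r ^ n) * ennreal (2 ^ n * (39 * (T / 2 ^ n) powr (\<rho> / 4)))"
    by (simp add: ennreal_mult flip: ennreal_numeral ennreal_power)
  also have "\<dots> = ennreal (r ^ n * (2 ^ n * (39 * (T / 2 ^ n) powr (\<rho> / 4))))"
    using r0 by (simp add: ennreal_mult)
  also have "r ^ n * (2 ^ n * (39 * (T / 2 ^ n) powr (\<rho> / 4))) =
      39 * T powr (\<rho> / 4) * (r * (2 * 2 powr (- \<rho> / 4))) ^ n"
  proof -
    have "T / 2 ^ n = T * 2 powr - real n" by (simp add: powr_minus powr_realpow divide_inverse)
    then have "(T / 2 ^ n) powr (\<rho> / 4) = T powr (\<rho> / 4) * (2 powr - real n) powr (\<rho> / 4)"
      using T_pos by (simp only: powr_mult)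
    also have "(2 powr - real n) powr (\<rho> / 4) = (2 powr (- \<rho> / 4)) ^ n"
    proof -
      have "(2 powr (- \<rho> / 4)) ^ n = (2 powr (- \<rho> / 4)) powr real n" by (rule powr_realpow[symmetric]) simp
      then show ?thesis by (simp add: powr_powr mult.commute)
    qed
    finally show ?thesis by (simp add: power_mult_distrib)
  qed
  finally show "(\<integral>\<^sup>+\<omega>. ennreal (r ^ n * (\<Sum>k<2 ^ n. ?V k \<omega>)) \<partial>M) \<le>
      ennreal (39 * T powr (\<rho> / 4) * (r * (2 * 2 powr (- \<rho> / 4))) ^ n)" .
qed

text \<open>
  \<open>Alim\<close> is the stochastic integral for each fixed time, with a null set depending on it. Its limits
  along dyadic times involve countably many null sets only and inherit the pathwise bound.
\<close>

definition Afin :: "real \<Rightarrow> 'a \<Rightarrow> real" where "Afin t \<omega> = lim (\<lambda>m. Alim (dyadic_floor T m t) \<omega>)"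
definition Bfin :: "real \<Rightarrow> 'a \<Rightarrow> real" where "Bfin t \<omega> = lim (\<lambda>m. Blim (dyadic_floor T m t) \<omega>)"

lemma dyadic_floor_range: "t \<in> {0..T} \<Longrightarrow> dyadic_floor T m t \<in> {0..T}"
  using dyadic_floor_bounds[OF T_pos, of t m] by auto

lemma fin_measurable:
  assumes "t \<in> {0..T}"
  shows "Afin t \<in> borel_measurable M" "Bfin t \<in> borel_measurable M"
  unfolding Afin_def Bfin_def
  by (intro borel_measurable_lim_metric sums_measurable dyadic_floor_range assms)+

text \<open>
  The second moments of \<open>area\<close> and \<open>sq_area\<close> from the dyadic approximation of \<open>t\<close> to \<open>t\<close> decay
  geometrically, so that both tend to zero almost surely.
\<close>

lemma fin_eq_lim:
  assumes t: "t \<in> {0..T}"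
  shows "AE \<omega> in M. Afin t \<omega> = Alim t \<omega> \<and> Bfin t \<omega> = Blim t \<omega>"
proof -
  let ?d = "\<lambda>m. dyadic_floor T m t"
  have t0: "0 \<le> t" "t \<le> T" using t by auto
  have d: "0 \<le> ?d m" "?d m \<le> t" "t - ?d m \<le> T / 2 ^ m" "t - ?d m \<le> T" for m
    using dyadic_floor_bounds[OF T_pos t0(1), of m] t by auto
  have dlim: "?d \<longlonglongrightarrow> t" by (rule dyadic_floor_tendsto[OF T_pos t0(1)])
  have a: "AE \<omega> in M. (\<lambda>m. area_lim (?d m) t \<omega>) \<longlonglongrightarrow> 0"
  proof (rule square_tendsto_zero_AE[where K = "4 * (sqrt T * T)" and q = "1 / 2"])
    show "(\<lambda>\<omega>. area_lim (?d m) t \<omega>) \<in> borel_measurable M" for m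
      by (rule areas_measurable(1)[OF dyadic_floor_range[OF t] t])
    fix m
    have "sqrt (t - ?d m) * (t - ?d m) \<le> sqrt T * (T / 2 ^ m)"
      using d[of m] T_pos by (intro mult_mono real_sqrt_le_mono) auto
    then have "4 * (sqrt (t - ?d m) * (t - ?d m)) \<le> 4 * (sqrt T * T) * (1 / 2) ^ m"
      by (simp add: power_one_over)
    then show "(\<integral>\<^sup>+\<omega>. ennreal ((area_lim (?d m) t \<omega>)\<^sup>2) \<partial>M) \<le> ennreal (4 * (sqrt T * T) * (1 / 2) ^ m)"
      by (rule order.trans[OF areas_moment(1)[OF d(1,2) t0(2)] ennreal_leI])
  qed (use T_pos in auto)
  have b: "AE \<omega> in M. (\<lambda>m. sq_area_lim (?d m) t \<omega>) \<longlonglongrightarrow> 0"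
  proof (rule square_tendsto_zero_AE[where K = "12 * (T * T)" and q = "1 / 2"])
    show "(\<lambda>\<omega>. sq_area_lim (?d m) t \<omega>) \<in> borel_measurable M" for m
      by (rule areas_measurable(2)[OF dyadic_floor_range[OF t] t])
    fix m
    have "(t - ?d m) * (t - ?d m) \<le> T * (T / 2 ^ m)"
      using d[of m] T_pos by (intro mult_mono) auto
    then have "12 * (t - ?d m)\<^sup>2 \<le> 12 * (T * T) * (1 / 2) ^ m"
      by (simp add: power_one_over power2_eq_square)
    then show "(\<integral>\<^sup>+\<omega>. ennreal ((sq_area_lim (?d m) t \<omega>)\<^sup>2) \<partial>M) \<le> ennreal (12 * (T * T) * (1 / 2) ^ m)"
      by (rule order.trans[OF areas_moment(2)[OF d(1,2) t0(2)] ennreal_leI])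
  qed (use T_pos in auto)
  from a b X_continuous W_continuous show ?thesis
  proof eventually_elim
    case (elim \<omega>)
    have ev: "eventually (\<lambda>m. ?d m \<in> {0..T}) sequentially"
      by (rule always_eventually) (intro allI dyadic_floor_range t)
    have Xl: "(\<lambda>m. X (?d m) \<omega>) \<longlonglongrightarrow> X t \<omega>" by (rule continuous_on_tendsto_compose[OF elim(3) dlim t ev])
    have Wl: "(\<lambda>m. W (?d m) \<omega>) \<longlonglongrightarrow> W t \<omega>" by (rule continuous_on_tendsto_compose[OF elim(4) dlim t ev])
    have "(\<lambda>m. Alim t \<omega> - area_lim (?d m) t \<omega> - X (?d m) \<omega> * (W t \<omega> - W (?d m) \<omega>)) \<longlonglongrightarrow>
        Alim t \<omega> - 0 - X t \<omega> * (W t \<omega> - W t \<omega>)"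
      by (intro tendsto_intros elim(1) Xl Wl)
    then have A: "(\<lambda>m. Alim (?d m) \<omega>) \<longlonglongrightarrow> Alim t \<omega>" by (simp add: area_def)
    have "(\<lambda>m. Blim t \<omega> - sq_area_lim (?d m) t \<omega> - 2 * X (?d m) \<omega> * (Alim t \<omega> - Alim (?d m) \<omega>)
         + (X (?d m) \<omega>)\<^sup>2 * (W t \<omega> - W (?d m) \<omega>)) \<longlonglongrightarrow>
        Blim t \<omega> - 0 - 2 * X t \<omega> * (Alim t \<omega> - Alim t \<omega>) + (X t \<omega>)\<^sup>2 * (W t \<omega> - W t \<omega>)"
      by (intro tendsto_intros elim(2) Xl Wl A)
    then have B: "(\<lambda>m. Blim (?d m) \<omega>) \<longlonglongrightarrow> Blim t \<omega>" by (simp add: sq_area_def)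
    show ?case using A B by (simp add: Afin_def Bfin_def limI)
  qed
qed

abbreviation "area_fin s t \<omega> \<equiv> area (\<lambda>r. X r \<omega>) (\<lambda>r. W r \<omega>) (\<lambda>r. Afin r \<omega>) s t"
abbreviation "sq_area_fin s t \<omega> \<equiv> sq_area (\<lambda>r. X r \<omega>) (\<lambda>r. W r \<omega>) (\<lambda>r. Afin r \<omega>) (\<lambda>r. Bfin r \<omega>) s t"

lemma areas_fin_measurable:
  assumes "s \<in> {0..T}" "t \<in> {0..T}"
  shows "(\<lambda>\<omega>. area_fin s t \<omega>) \<in> borel_measurable M" "(\<lambda>\<omega>. sq_area_fin s t \<omega>) \<in> borel_measurable M"
  unfolding area_def sq_area_def
  by (intro borel_measurable_diff borel_measurable_add borel_measurable_times borel_measurable_power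
      borel_measurable_const fin_measurable X_measurable W_measurable assms)+

lemma areas_fin_ito_limit:
  assumes st: "0 \<le> s" "s \<le> t" "t \<le> T"
  shows "ito_limit (\<lambda>r \<omega>. X r \<omega> - X s \<omega>) s t (\<lambda>\<omega>. area_fin s t \<omega>)"
    and "ito_limit (\<lambda>r \<omega>. (X r \<omega> - X s \<omega>)\<^sup>2) s t (\<lambda>\<omega>. sq_area_fin s t \<omega>)"
proof -
  have s: "s \<in> {0..T}" and t: "t \<in> {0..T}" using st by auto
  have "AE \<omega> in M. area_lim s t \<omega> = area_fin s t \<omega> \<and> sq_area_lim s t \<omega> = sq_area_fin s t \<omega>"
    using fin_eq_lim[OF s] fin_eq_lim[OF t] by eventually_elim (simp add: area_def sq_area_def)
  then have ae: "AE \<omega> in M. area_lim s t \<omega> = area_fin s t \<omega>" "AE \<omega> in M. sq_area_lim s t \<omega> = sq_area_fin s t \<omega>"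
    by auto
  show "ito_limit (\<lambda>r \<omega>. X r \<omega> - X s \<omega>) s t (\<lambda>\<omega>. area_fin s t \<omega>)"
    by (rule ito_limit_cong_AE[OF areas_ito_limit(1)[OF st] areas_fin_measurable(1)[OF s t] ae(1)])
  show "ito_limit (\<lambda>r \<omega>. (X r \<omega> - X s \<omega>)\<^sup>2) s t (\<lambda>\<omega>. sq_area_fin s t \<omega>)"
    by (rule ito_limit_cong_AE[OF areas_ito_limit(2)[OF st] areas_fin_measurable(2)[OF s t] ae(2)])
qed

end

section \<open>Arbitrary partitions and quadratic variation\<close>

context fbm_bm begin

lemma mesh_dist2:
  assumes H: "integrand C H" and st: "0 \<le> s" "s \<le> t" "t \<le> T" and p: "partition s t n \<tau>"
    and past: "\<And>r. s \<le> r \<Longrightarrow> r \<le> t \<Longrightarrow> H r \<in> borel_measurable (past r)"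
    and mesh: "\<And>i. i < n \<Longrightarrow> \<tau> (Suc i) - \<tau> i \<le> \<delta>" and \<delta>: "0 \<le> \<delta>"
  shows "simple_process M past s t n \<tau> (\<lambda>i. H (\<tau> i))"
    and "dist2 s t H (simple_value n \<tau> (\<lambda>i. H (\<tau> i))) \<le> ennreal (C * sqrt \<delta> * (t - s))"
proof -
  have \<tau>: "s \<le> \<tau> i" "\<tau> i \<le> t" "\<tau> i \<in> {0..T}" if "i < n" for i
    using partition_bounds[OF p, of i] that st by auto
  show P: "simple_process M past s t n \<tau> (\<lambda>i. H (\<tau> i))"
    by (rule simple_process_integrand[OF H p \<tau>(3) past[OF \<tau>(1,2)]])
  show "dist2 s t H (simple_value n \<tau> (\<lambda>i. H (\<tau> i))) \<le> ennreal (C * sqrt \<delta> * (t - s))"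
  proof (rule riemann_dist2[OF H st P \<tau>(3) _ \<delta>])
    fix i r assume "i < n" "\<tau> i < r" "r \<le> \<tau> (Suc i)"
    then show "\<bar>r - \<tau> i\<bar> \<le> \<delta>" using mesh[of i] by simp
  qed
qed

definition uniform_partition :: "real \<Rightarrow> real \<Rightarrow> nat \<Rightarrow> nat \<Rightarrow> real" where
  "uniform_partition s t k i = s + (t - s) * (real i / real (Suc k))"

lemma uniform_partition:
  assumes "s \<le> t"
  shows "partition s t (Suc k) (uniform_partition s t k)"
    and "uniform_partition s t k (Suc i) - uniform_partition s t k i = (t - s) / real (Suc k)"
proof -
  show step: "uniform_partition s t k (Suc i) - uniform_partition s t k i = (t - s) / real (Suc k)" for i
    by (simp add: uniform_partition_def field_simps del: of_nat_Suc) (simp add: field_simps)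
  have "uniform_partition s t k i \<le> uniform_partition s t k (Suc i)" for i
    using step[of i] assms by (smt (verit) divide_nonneg_nonneg of_nat_0_le_iff)
  then show "partition s t (Suc k) (uniform_partition s t k)"
    unfolding partition_def by (simp add: uniform_partition_def)
qed

lemma uniform_mesh_tendsto: "(\<lambda>k. (t - s) / real (Suc k)) \<longlonglongrightarrow> 0"
  using tendsto_mult[OF tendsto_const[of "t - s"] LIMSEQ_inverse_real_of_nat] by (simp add: divide_inverse)

lemma uniform_dist2_tendsto:
  assumes H: "integrand C H" and st: "0 \<le> s" "s \<le> t" "t \<le> T"
    and past: "\<And>r. s \<le> r \<Longrightarrow> r \<le> t \<Longrightarrow> H r \<in> borel_measurable (past r)"
  shows "(\<lambda>k. dist2 s t H (simple_value (Suc k) (uniform_partition s t k) (\<lambda>i. H (uniform_partition s t k i)))) \<longlonglongrightarrow> 0"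
proof (rule tendsto_sandwich[OF always_eventually always_eventually tendsto_const])
  have "(\<lambda>k. C * sqrt ((t - s) / real (Suc k)) * (t - s)) \<longlonglongrightarrow> C * sqrt 0 * (t - s)"
    by (intro tendsto_mult tendsto_const tendsto_real_sqrt uniform_mesh_tendsto)
  from tendsto_ennrealI[OF this]
  show "(\<lambda>k. ennreal (C * sqrt ((t - s) / real (Suc k)) * (t - s))) \<longlonglongrightarrow> 0" by simp
  show "\<forall>k. dist2 s t H (simple_value (Suc k) (uniform_partition s t k) (\<lambda>i. H (uniform_partition s t k i)))
      \<le> ennreal (C * sqrt ((t - s) / real (Suc k)) * (t - s))"
  proof
    fix k
    show "dist2 s t H (simple_value (Suc k) (uniform_partition s t k) (\<lambda>i. H (uniform_partition s t k i)))
      \<le> ennreal (C * sqrt ((t - s) / real (Suc k)) * (t - s))"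
      by (rule mesh_dist2(2)[OF H st uniform_partition(1)[OF st(2)] past])
        (use st uniform_partition(2)[OF st(2)] in auto)
  qed
qed simp

lemma ito_limit_unique':
  assumes H: "integrand C H" and st: "0 \<le> s" "s \<le> t" "t \<le> T"
    and past: "\<And>r. s \<le> r \<Longrightarrow> r \<le> t \<Longrightarrow> H r \<in> borel_measurable (past r)"
    and J: "ito_limit H s t J" "ito_limit H s t J'"
  shows "AE \<omega> in M. J \<omega> = J' \<omega>"
proof (rule ito_limit_unique[OF st(1,3) J _ uniform_dist2_tendsto[OF H st past]])
  show "simple_process M past s t (Suc k) (uniform_partition s t k) (\<lambda>i. H (uniform_partition s t k i))" for k
    by (rule mesh_dist2(1)[OF H st uniform_partition(1)[OF st(2)] past, where \<delta> = "(t - s) / real (Suc k)"])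
      (use st uniform_partition(2)[OF st(2)] in auto)
qed

lemma ito_limit_has_integral:
  assumes H: "integrand C H" and st: "0 \<le> s" "s \<le> t" "t \<le> T"
    and nat: "\<And>r. s \<le> r \<Longrightarrow> r \<le> t \<Longrightarrow> H r \<in> borel_measurable (natural_filtration M X W r)"
    and J: "ito_limit H s t J"
  shows "has_ito_integral M (natural_filtration M X W) W H s t J"
proof (rule ito_limit_integral[OF st(1,3) J _ uniform_dist2_tendsto[OF H st]])
  show "H r \<in> borel_measurable (past r)" if "s \<le> r" "r \<le> t" for r
    by (rule natural_filtration_past[OF _ nat[OF that]]) (use that st in simp)
  fix k
  note p = uniform_partition(1)[OF st(2), of k]
  show "simple_process M (natural_filtration M X W) s t (Suc k) (uniform_partition s t k) (\<lambda>i. H (uniform_partition s t k i))"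
    unfolding simple_process_def
  proof (intro conjI allI impI p)
    fix i assume "i < Suc k"
    then have b: "s \<le> uniform_partition s t k i" "uniform_partition s t k i \<le> t"
      using partition_bounds[OF p, of i] by auto
    then show "H (uniform_partition s t k i) \<in> borel_measurable (natural_filtration M X W (uniform_partition s t k i))"
      by (rule nat)
    show "integrable M (\<lambda>\<omega>. (H (uniform_partition s t k i) \<omega>)\<^sup>2)"
      using H b st by (auto simp: integrand_def)
  qed
qed

lemma natural_X: "0 \<le> r \<Longrightarrow> r \<le> t \<Longrightarrow> X r \<in> borel_measurable (natural_filtration M X W t)"
  and natural_W: "0 \<le> r \<Longrightarrow> r \<le> t \<Longrightarrow> W r \<in> borel_measurable (natural_filtration M X W t)"
proof -
  let ?E = "\<Union>Z\<in>{X, W}. \<Union>r\<in>{0..t}. {Z r -` B \<inter> space M |B. B \<in> sets borel}"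
  have E: "?E \<subseteq> Pow (space M)" by auto
  have *: "Z r \<in> borel_measurable (natural_filtration M X W t)" if "Z \<in> {X, W}" "0 \<le> r" "r \<le> t" for Z r
  proof (rule measurableI)
    fix B :: "real set" assume "B \<in> sets borel"
    then have "Z r -` B \<inter> space M \<in> ?E" using that by fastforce
    then show "Z r -` B \<inter> space (natural_filtration M X W t) \<in> sets (natural_filtration M X W t)"
      unfolding natural_filtration_def using E by (simp add: space_measure_of sets_measure_of sigma_sets.Basic)
  qed simp
  show "0 \<le> r \<Longrightarrow> r \<le> t \<Longrightarrow> X r \<in> borel_measurable (natural_filtration M X W t)"
    "0 \<le> r \<Longrightarrow> r \<le> t \<Longrightarrow> W r \<in> borel_measurable (natural_filtration M X W t)"
    using * by auto
qed

text \<open>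
  The centred squares of the increments are orthogonal, and each has the second moment twice the
  squared length of its interval.
\<close>

lemma quadratic_variation:
  assumes st: "0 \<le> s" "s \<le> t" "t \<le> T" and p: "partition s t n \<tau>"
    and mesh: "\<And>i. i < n \<Longrightarrow> \<tau> (Suc i) - \<tau> i \<le> \<delta>"
  shows "(\<integral>\<^sup>+\<omega>. ennreal (((\<Sum>i<n. (W (\<tau> (Suc i)) \<omega> - W (\<tau> i) \<omega>)\<^sup>2) - (t - s))\<^sup>2) \<partial>M) \<le> ennreal (2 * \<delta> * (t - s))"
proof -
  let ?D = "\<lambda>i \<omega>. W (\<tau> (Suc i)) \<omega> - W (\<tau> i) \<omega>"
  let ?Z = "\<lambda>i \<omega>. (?D i \<omega>)\<^sup>2 - (\<tau> (Suc i) - \<tau> i)"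
  let ?P = "\<lambda>m \<omega>. \<Sum>i<m. ?Z i \<omega>"
  have \<tau>: "0 \<le> \<tau> i" "\<tau> i \<le> \<tau> (Suc i)" "\<tau> (Suc i) \<le> T" "\<tau> i \<le> T" if "i < n" for i
    using partition_bounds[OF p, of i] partition_bounds[OF p, of "Suc i"] partition_mono[OF p, of i "Suc i"] that st by auto
  have Zp: "?Z i \<in> borel_measurable (past (\<tau> m))" if "i < m" "m \<le> n" for i m
  proof -
    have "\<tau> (Suc i) \<le> \<tau> m" using partition_mono[OF p, of "Suc i" m] that by simp
    then show ?thesis using \<tau>[of i] that
      by (intro borel_measurable_diff borel_measurable_power borel_measurable_const W_past) auto
  qed
  have Pp: "?P m \<in> borel_measurable (past (\<tau> m))" if "m \<le> n" for m
    by (intro borel_measurable_sum Zp) (use that in auto)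
  have "integrable M (\<lambda>\<omega>. (?P m \<omega>)\<^sup>2) \<and> expectation (\<lambda>\<omega>. (?P m \<omega>)\<^sup>2) \<le> 2 * \<delta> * (\<tau> m - s)" if "m \<le> n" for m
    using that
  proof (induction m)
    case 0
    then show ?case using p by (simp add: partition_def)
  next
    case (Suc m)
    then have m: "m < n" "m \<le> n" by auto
    then have IH: "integrable M (\<lambda>\<omega>. (?P m \<omega>)\<^sup>2)" "expectation (\<lambda>\<omega>. (?P m \<omega>)\<^sup>2) \<le> 2 * \<delta> * (\<tau> m - s)"
      using Suc.IH by auto
    have PM: "?P m \<in> borel_measurable M" by (rule measurable_past_M[OF \<tau>(4)[OF m(1)] Pp[OF m(2)]])
    have Pint: "integrable M (?P m)" using integrable_mult_L2[OF PM borel_measurable_const IH(1), of 1] by simp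
    let ?h = "\<tau> (Suc m) - \<tau> m"
    note w = W_increment_moments[OF \<tau>(1-3)[OF m(1)]]
    note w4 = W_increment_even_moment(1,2)[OF \<tau>(1-3)[OF m(1)], of 2]
    note pt = past_times_increment(3,4)[OF \<tau>(1-3)[OF m(1)] Pp[OF m(2)] Pint]
    have Z2: "(?Z m \<omega>)\<^sup>2 = (?D m \<omega>) ^ 4 - 2 * ?h * (?D m \<omega>)\<^sup>2 + ?h\<^sup>2" for \<omega>
    proof -
      have "(d\<^sup>2 - h)\<^sup>2 = d ^ 4 - 2 * h * d\<^sup>2 + h\<^sup>2" for d h :: real
        by (simp add: power2_eq_square power4_eq_xxxx algebra_simps)
      then show ?thesis .
    qed
    have i4: "integrable M (\<lambda>\<omega>. (?D m \<omega>) ^ 4)" "expectation (\<lambda>\<omega>. (?D m \<omega>) ^ 4) = 3 * ?h\<^sup>2"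
      using w4 by (simp_all add: fact_numeral)
    have iZ: "integrable M (\<lambda>\<omega>. (?Z m \<omega>)\<^sup>2)" unfolding Z2
      by (intro Bochner_Integration.integrable_add Bochner_Integration.integrable_diff i4(1) integrable_mult_right w(1)) simp
    have eZ: "expectation (\<lambda>\<omega>. (?Z m \<omega>)\<^sup>2) = 2 * ?h\<^sup>2"
    proof -
      have "expectation (\<lambda>\<omega>. (?D m \<omega>) ^ 4 - 2 * ?h * (?D m \<omega>)\<^sup>2 + ?h\<^sup>2) = 3 * ?h\<^sup>2 - 2 * ?h * ?h + ?h\<^sup>2"
        using i4 w(1,2) by (simp add: prob_space)
      then show ?thesis unfolding Z2 by (simp add: power2_eq_square)
    qed
    have iPZ: "integrable M (\<lambda>\<omega>. ?P m \<omega> * ?Z m \<omega>)" and ePZ: "expectation (\<lambda>\<omega>. ?P m \<omega> * ?Z m \<omega>) = 0"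
    proof -
      have e: "?P m \<omega> * ?Z m \<omega> = ?P m \<omega> * (?D m \<omega>)\<^sup>2 - ?P m \<omega> * ?h" for \<omega> by (simp add: right_diff_distrib)
      show "integrable M (\<lambda>\<omega>. ?P m \<omega> * ?Z m \<omega>)" unfolding e
        by (intro Bochner_Integration.integrable_diff pt(1) integrable_mult_left Pint)
      have "expectation (\<lambda>\<omega>. ?P m \<omega> * (?D m \<omega>)\<^sup>2 - ?P m \<omega> * ?h) = expectation (\<lambda>\<omega>. ?P m \<omega> * (?D m \<omega>)\<^sup>2) - expectation (\<lambda>\<omega>. ?P m \<omega> * ?h)"
        by (intro Bochner_Integration.integral_diff pt(1) integrable_mult_left Pint)
      also have "expectation (\<lambda>\<omega>. ?P m \<omega> * ?h) = expectation (?P m) * ?h" by (rule integral_mult_left_zero)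
      finally show "expectation (\<lambda>\<omega>. ?P m \<omega> * ?Z m \<omega>) = 0" unfolding e pt(2) by simp
    qed
    have S2: "(?P (Suc m) \<omega>)\<^sup>2 = (?P m \<omega>)\<^sup>2 + 2 * (?P m \<omega> * ?Z m \<omega>) + (?Z m \<omega>)\<^sup>2" for \<omega>
      by (simp only: sum.lessThan_Suc power2_sum mult.assoc)
    have "integrable M (\<lambda>\<omega>. (?P (Suc m) \<omega>)\<^sup>2)" unfolding S2
      by (intro Bochner_Integration.integrable_add integrable_mult_right IH(1) iPZ iZ)
    moreover have "expectation (\<lambda>\<omega>. (?P (Suc m) \<omega>)\<^sup>2) = expectation (\<lambda>\<omega>. (?P m \<omega>)\<^sup>2) + 2 * 0 + 2 * ?h\<^sup>2"
      unfolding S2 eZ[symmetric] ePZ[symmetric] using IH(1) iPZ iZ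
      by (simp only: Bochner_Integration.integral_add Bochner_Integration.integrable_add integrable_mult_right integral_mult_right_zero)
    moreover have "?h\<^sup>2 \<le> \<delta> * ?h"
      unfolding power2_eq_square by (rule mult_right_mono) (use mesh[OF m(1)] \<tau>[OF m(1)] in auto)
    ultimately show ?case using IH(2) by (simp add: algebra_simps)
  qed
  from this[of n] have Q: "integrable M (\<lambda>\<omega>. (?P n \<omega>)\<^sup>2)" "expectation (\<lambda>\<omega>. (?P n \<omega>)\<^sup>2) \<le> 2 * \<delta> * (t - s)"
    using p by (auto simp: partition_def)
  have "(\<Sum>i<n. \<tau> (Suc i) - \<tau> i) = t - s"
    using sum_lessThan_telescope[of \<tau> n] p by (simp add: partition_def)
  then have "?P n \<omega> = (\<Sum>i<n. (?D i \<omega>)\<^sup>2) - (t - s)" for \<omega>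
    unfolding sum_subtractf by simp
  then have "(\<integral>\<^sup>+\<omega>. ennreal (((\<Sum>i<n. (?D i \<omega>)\<^sup>2) - (t - s))\<^sup>2) \<partial>M) = ennreal (expectation (\<lambda>\<omega>. (?P n \<omega>)\<^sup>2))"
    using nn_integral_eq_integral[OF Q(1)] by simp
  also have "\<dots> \<le> ennreal (2 * \<delta> * (t - s))" by (rule ennreal_leI[OF Q(2)])
  finally show ?thesis .
qed

text \<open>
  Summation by parts: the left-point sums of \<open>W\<close> against itself are governed by the quadratic variation.
\<close>

lemma sum_W_dW:
  assumes p: "partition s t n \<tau>"
  shows "simple_integral W n \<tau> (\<lambda>i \<omega>. W (\<tau> i) \<omega> - W s \<omega>) \<omega> =
    ((W t \<omega> - W s \<omega>)\<^sup>2 - (\<Sum>i<n. (W (\<tau> (Suc i)) \<omega> - W (\<tau> i) \<omega>)\<^sup>2)) / 2"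
proof -
  have "(\<Sum>i<n. (W (\<tau> (Suc i)) \<omega> - W s \<omega>)\<^sup>2 - (W (\<tau> i) \<omega> - W s \<omega>)\<^sup>2) = (W t \<omega> - W s \<omega>)\<^sup>2"
    using sum_lessThan_telescope[of "\<lambda>i. (W (\<tau> i) \<omega> - W s \<omega>)\<^sup>2" n] p by (simp add: partition_def)
  moreover have "(W (\<tau> i) \<omega> - W s \<omega>) * (W (\<tau> (Suc i)) \<omega> - W (\<tau> i) \<omega>) =
      (((W (\<tau> (Suc i)) \<omega> - W s \<omega>)\<^sup>2 - (W (\<tau> i) \<omega> - W s \<omega>)\<^sup>2) - (W (\<tau> (Suc i)) \<omega> - W (\<tau> i) \<omega>)\<^sup>2) / 2" for i
    by (simp add: power2_eq_square algebra_simps)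
  ultimately show ?thesis
    unfolding simple_integral_def by (simp only: sum_divide_distrib[symmetric] sum_subtractf)
qed

lemma W_integrand_past: "0 \<le> s \<Longrightarrow> s \<le> r \<Longrightarrow> (\<lambda>\<omega>. W r \<omega> - W s \<omega>) \<in> borel_measurable (past r)"
  by (intro borel_measurable_diff W_past) auto

lemma W_ito_limit:
  assumes st: "0 \<le> s" "s \<le> t" "t \<le> T"
  shows "ito_limit (\<lambda>r \<omega>. W r \<omega> - W s \<omega>) s t (\<lambda>\<omega>. ((W t \<omega> - W s \<omega>)\<^sup>2 - (t - s)) / 2)"
proof -
  have s: "s \<in> {0..T}" and t: "t \<in> {0..T}" using st by auto
  note H = integrand_W[OF s] and wp = W_integrand_past[OF st(1)]
  have J: "(\<lambda>\<omega>. ((W t \<omega> - W s \<omega>)\<^sup>2 - (t - s)) / 2) \<in> borel_measurable M"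
    using W_measurable[OF s] W_measurable[OF t] by measurable
  let ?\<tau> = "uniform_partition s t"
  note p = uniform_partition[OF st(2)]
  have P: "simple_process M past s t (Suc k) (?\<tau> k) (\<lambda>i \<omega>. W (?\<tau> k i) \<omega> - W s \<omega>)" for k
    by (rule mesh_dist2(1)[OF H st p(1) wp, where \<delta> = "(t - s) / real (Suc k)"]) (use st p(2) in auto)
  show ?thesis
  proof (rule ito_limit_L2[OF st(1,3) J integrand_regular[OF H st] P uniform_dist2_tendsto[OF H st wp]])
    let ?I = "\<lambda>k. \<integral>\<^sup>+\<omega>. ennreal ((((W t \<omega> - W s \<omega>)\<^sup>2 - (t - s)) / 2 -
        simple_integral W (Suc k) (?\<tau> k) (\<lambda>i \<omega>. W (?\<tau> k i) \<omega> - W s \<omega>) \<omega>)\<^sup>2) \<partial>M"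
    have le: "?I k \<le> ennreal (2 * ((t - s) / real (Suc k)) * (t - s))" for k
    proof -
      let ?Q = "\<lambda>\<omega>. \<Sum>i<Suc k. (W (?\<tau> k (Suc i)) \<omega> - W (?\<tau> k i) \<omega>)\<^sup>2"
      have "?I k = (\<integral>\<^sup>+\<omega>. ennreal (((?Q \<omega> - (t - s)) / 2)\<^sup>2) \<partial>M)"
      proof -
        have "(a - b) / 2 - (a - c) / 2 = (c - b) / 2" for a b c :: real by (simp add: field_simps)
        then show ?thesis unfolding sum_W_dW[OF p(1)] by (simp only:)
      qed
      also have "\<dots> \<le> (\<integral>\<^sup>+\<omega>. ennreal ((?Q \<omega> - (t - s))\<^sup>2) \<partial>M)"
        by (intro nn_integral_mono ennreal_leI) (simp add: power_divide)
      also have "\<dots> \<le> ennreal (2 * ((t - s) / real (Suc k)) * (t - s))"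
        by (rule quadratic_variation[OF st p(1)]) (simp add: p(2))
      finally show ?thesis .
    qed
    show "?I \<longlonglongrightarrow> 0"
    proof (rule tendsto_sandwich[OF always_eventually always_eventually tendsto_const])
      have "(\<lambda>k. 2 * ((t - s) / real (Suc k)) * (t - s)) \<longlonglongrightarrow> 2 * 0 * (t - s)"
        by (intro tendsto_mult tendsto_const uniform_mesh_tendsto)
      from tendsto_ennrealI[OF this]
      show "(\<lambda>k. ennreal (2 * ((t - s) / real (Suc k)) * (t - s))) \<longlonglongrightarrow> 0" by simp
    qed (use le in auto)
  qed
qed

end

section \<open>Stratonovich integrals\<close>

lemma (in prob_space) chebyshev_nn:
  assumes Z [measurable]: "Z \<in> borel_measurable M" and le: "(\<integral>\<^sup>+\<omega>. ennreal ((Z \<omega>)\<^sup>2) \<partial>M) \<le> ennreal K"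
    and \<epsilon>: "0 < \<epsilon>" and K: "0 \<le> K" "K < \<epsilon> ^ 3"
  shows "measure M {\<omega>\<in>space M. \<bar>Z \<omega>\<bar> > \<epsilon>} < \<epsilon>"
proof -
  let ?A = "{\<omega>\<in>space M. \<bar>Z \<omega>\<bar> > \<epsilon>}"
  have A: "?A \<in> sets M" by measurable
  have "ennreal (\<epsilon>\<^sup>2 * measure M ?A) = (\<integral>\<^sup>+\<omega>. ennreal (\<epsilon>\<^sup>2) * indicator ?A \<omega> \<partial>M)"
    using A by (simp add: nn_integral_cmult_indicator emeasure_eq_measure ennreal_mult)
  also have "\<dots> \<le> (\<integral>\<^sup>+\<omega>. ennreal ((Z \<omega>)\<^sup>2) \<partial>M)"
  proof (rule nn_integral_mono)
    fix \<omega>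
    have "\<epsilon>\<^sup>2 \<le> (Z \<omega>)\<^sup>2" if "\<epsilon> < \<bar>Z \<omega>\<bar>"
      using power_mono[of \<epsilon> "\<bar>Z \<omega>\<bar>" 2] that \<epsilon> by simp
    then show "ennreal (\<epsilon>\<^sup>2) * indicator ?A \<omega> \<le> ennreal ((Z \<omega>)\<^sup>2)"
      by (auto simp: indicator_def intro: ennreal_leI)
  qed
  also have "\<dots> \<le> ennreal K" by (rule le)
  finally have "\<epsilon>\<^sup>2 * measure M ?A \<le> K" using K by simp
  also have "\<dots> < \<epsilon>\<^sup>2 * \<epsilon>" using K by (simp add: power2_eq_square power3_eq_cube)
  finally show ?thesis using \<epsilon> by simp
qed

context fbm_bm begin

lemma integrand_measurable: "integrand C H \<Longrightarrow> r \<in> {0..T} \<Longrightarrow> H r \<in> borel_measurable M"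
  by (simp add: integrand_def)

lemma ito_limit_half_diff:
  assumes F: "integrand C F" and G: "integrand D G" and st: "0 \<le> s" "s \<le> t" "t \<le> T"
    and Fp: "\<And>r. s \<le> r \<Longrightarrow> r \<le> t \<Longrightarrow> F r \<in> borel_measurable (past r)"
    and Gp: "\<And>r. s \<le> r \<Longrightarrow> r \<le> t \<Longrightarrow> G r \<in> borel_measurable (past r)"
    and JF: "ito_limit F s t JF" and JG: "ito_limit G s t JG"
  shows "ito_limit (\<lambda>r \<omega>. (F r \<omega> - G r \<omega>) / 2) s t (\<lambda>\<omega>. (JF \<omega> - JG \<omega>) / 2)"
proof -
  let ?H = "\<lambda>r \<omega>. (F r \<omega> - G r \<omega>) / 2"
  note H = integrand_half_diff[OF F G]
  have Hp: "?H r \<in> borel_measurable (past r)" if "s \<le> r" "r \<le> t" for r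
    using Fp[OF that] Gp[OF that] by measurable
  have Jm [measurable]: "JF \<in> borel_measurable M" "JG \<in> borel_measurable M" using JF JG by (auto simp: ito_limit_def)
  have J: "(\<lambda>\<omega>. (JF \<omega> - JG \<omega>) / 2) \<in> borel_measurable M" by measurable
  let ?\<tau> = "uniform_partition s t"
  note p = uniform_partition[OF st(2)]
  have mesh: "?\<tau> k (Suc i) - ?\<tau> k i \<le> (t - s) / real (Suc k)" "0 \<le> (t - s) / real (Suc k)" for k i
    using p(2) st by auto
  note P = mesh_dist2(1)[OF H st p(1) Hp mesh] mesh_dist2(1)[OF F st p(1) Fp mesh] mesh_dist2(1)[OF G st p(1) Gp mesh]
  let ?S = "\<lambda>H k. simple_integral W (Suc k) (?\<tau> k) (\<lambda>i. H (?\<tau> k i))"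
  have lin: "?S ?H k \<omega> = (?S F k \<omega> - ?S G k \<omega>) / 2" for k \<omega>
    unfolding simple_integral_def sum_subtractf[symmetric] sum_divide_distrib
    by (intro sum.cong refl) (simp add: field_simps)
  show ?thesis
  proof (rule ito_limit_L2[OF st(1,3) J integrand_regular[OF H st] P(1) uniform_dist2_tendsto[OF H st Hp]])
    note m = simple_process_measurable(1)[OF P(2) st(1,3)] simple_process_measurable(1)[OF P(3) st(1,3)]
    note [measurable] = m
    let ?v = "\<lambda>H k. simple_value (Suc k) (?\<tau> k) (\<lambda>i. H (?\<tau> k i))"
    let ?I = "\<lambda>k. \<integral>\<^sup>+\<omega>. ennreal (((JF \<omega> - JG \<omega>) / 2 - ?S ?H k \<omega>)\<^sup>2) \<partial>M"
    have le: "?I k \<le> 4 * dist2 s t F (?v F k) + 4 * dist2 s t G (?v G k)" for k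
    proof -
      have "?I k \<le> (\<integral>\<^sup>+\<omega>. ennreal ((JF \<omega> - ?S F k \<omega>)\<^sup>2) + ennreal ((JG \<omega> - ?S G k \<omega>)\<^sup>2) \<partial>M)"
      proof (rule nn_integral_mono)
        fix \<omega>
        have e: "(a - b) / 2 - (c - d) / 2 = ((a - c) - (b - d)) / 2" for a b c d :: real by (simp add: field_simps)
        have "((JF \<omega> - JG \<omega>) / 2 - ?S ?H k \<omega>)\<^sup>2 \<le> (JF \<omega> - ?S F k \<omega>)\<^sup>2 + (JG \<omega> - ?S G k \<omega>)\<^sup>2"
          unfolding lin e by (rule square_half_diff_le)
        then show "ennreal (((JF \<omega> - JG \<omega>) / 2 - ?S ?H k \<omega>)\<^sup>2) \<le> ennreal ((JF \<omega> - ?S F k \<omega>)\<^sup>2) + ennreal ((JG \<omega> - ?S G k \<omega>)\<^sup>2)"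
          by (simp flip: ennreal_plus add: ennreal_leI)
      qed
      also have "\<dots> = (\<integral>\<^sup>+\<omega>. ennreal ((JF \<omega> - ?S F k \<omega>)\<^sup>2) \<partial>M) + (\<integral>\<^sup>+\<omega>. ennreal ((JG \<omega> - ?S G k \<omega>)\<^sup>2) \<partial>M)"
        by (rule nn_integral_add) measurable
      also have "\<dots> \<le> 4 * dist2 s t F (?v F k) + 4 * dist2 s t G (?v G k)"
      proof (rule add_mono)
        show "(\<integral>\<^sup>+\<omega>. ennreal ((JF \<omega> - ?S F k \<omega>)\<^sup>2) \<partial>M) \<le> 4 * dist2 s t F (?v F k)"
          using JF P(2)[of k] unfolding ito_limit_def by blast
        show "(\<integral>\<^sup>+\<omega>. ennreal ((JG \<omega> - ?S G k \<omega>)\<^sup>2) \<partial>M) \<le> 4 * dist2 s t G (?v G k)"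
          using JG P(3)[of k] unfolding ito_limit_def by blast
      qed
      finally show ?thesis .
    qed
    have "(\<lambda>k. 4 * dist2 s t F (?v F k) + 4 * dist2 s t G (?v G k)) \<longlonglongrightarrow> 4 * 0 + 4 * 0"
      by (intro tendsto_add ennreal_tendsto_cmult uniform_dist2_tendsto[OF F st Fp] uniform_dist2_tendsto[OF G st Gp]) auto
    then have lim: "(\<lambda>k. 4 * dist2 s t F (?v F k) + 4 * dist2 s t G (?v G k)) \<longlonglongrightarrow> 0" by simp
    show "?I \<longlonglongrightarrow> 0"
    proof (rule tendsto_sandwich[OF always_eventually always_eventually tendsto_const lim])
      show "\<forall>k. ?I k \<le> 4 * dist2 s t F (?v F k) + 4 * dist2 s t G (?v G k)" by (intro allI le)
    qed simp
  qed
qed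

text \<open>
  A trapezoidal sum is the left-point sum plus half the sum of products of increments. For this
  integrand the latter consists of a covariation of \<open>F\<close> with \<open>W\<close>, which is small as \<open>F\<close> is a functional
  of \<open>X\<close> and thus belongs to the past, and of the quadratic variation of \<open>W\<close>, which turns the Ito
  correction \<open>(t - s) / 4\<close> into zero.
\<close>

lemma trapezoid_bound:
  assumes F: "integrand C F" and Fp: "\<And>r u. r \<in> {0..T} \<Longrightarrow> F r \<in> borel_measurable (past u)"
    and JF: "ito_limit F s t JF" and st: "0 \<le> s" "s \<le> t" "t \<le> T" and p: "partition s t n \<tau>"
    and mesh: "\<And>i. i < n \<Longrightarrow> \<tau> (Suc i) - \<tau> i \<le> \<delta>" and \<delta>: "0 \<le> \<delta>"
  defines "H \<equiv> \<lambda>r \<omega>. (F r \<omega> - (W r \<omega> - W s \<omega>)) / 2"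
    and "J \<equiv> \<lambda>\<omega>. JF \<omega> / 2 - (W t \<omega> - W s \<omega>)\<^sup>2 / 4"
  defines "Z \<equiv> \<lambda>\<omega>. (\<Sum>i<n. (H (\<tau> i) \<omega> + H (\<tau> (Suc i)) \<omega>) / 2 * (W (\<tau> (Suc i)) \<omega> - W (\<tau> i) \<omega>)) - J \<omega>"
  shows "Z \<in> borel_measurable M"
    and "(\<integral>\<^sup>+\<omega>. ennreal ((Z \<omega>)\<^sup>2) \<partial>M) \<le> ennreal ((12 * (C + sqrt T) + C) * sqrt \<delta> * (t - s) + 2 * \<delta> * (t - s))"
proof -
  have s: "s \<in> {0..T}" and t: "t \<in> {0..T}" using st by auto
  note G = integrand_W[OF s] and Gp = W_integrand_past[OF st(1)]
  have C: "0 \<le> C" using F by (simp add: integrand_def)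
  note Hi = integrand_half_diff[OF F G, folded H_def]
  have Fpr: "F r \<in> borel_measurable (past r)" if "s \<le> r" "r \<le> t" for r by (rule Fp) (use that st in auto)
  have Hp: "H r \<in> borel_measurable (past r)" if "s \<le> r" "r \<le> t" for r
    unfolding H_def using Fpr[OF that] Gp[OF that(1)] by measurable
  define I where "I \<omega> = (JF \<omega> - ((W t \<omega> - W s \<omega>)\<^sup>2 - (t - s)) / 2) / 2" for \<omega>
  have I: "ito_limit H s t I"
    unfolding I_def[abs_def] H_def by (rule ito_limit_half_diff[OF F G st Fpr Gp JF W_ito_limit[OF st]])
  have \<tau>: "s \<le> \<tau> i" "\<tau> i \<le> t" "\<tau> i \<in> {0..T}" if "i \<le> n" for i
    using partition_bounds[OF p that] st by auto
  define D where "D i \<omega> = W (\<tau> (Suc i)) \<omega> - W (\<tau> i) \<omega>" for i \<omega>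
  define S where "S = simple_integral W n \<tau> (\<lambda>i. H (\<tau> i))"
  \<comment> \<open>The increment of F looks ahead, yet it is measurable for the past.\<close>
  define \<xi> where "\<xi> i \<omega> = F (\<tau> (Suc i)) \<omega> - F (\<tau> i) \<omega>" for i \<omega>
  define R where "R = simple_integral W n \<tau> \<xi>"
  define Q where "Q \<omega> = (\<Sum>i<n. (D i \<omega>)\<^sup>2)" for \<omega>
  have PS: "simple_process M past s t n \<tau> (\<lambda>i. H (\<tau> i))" by (rule mesh_dist2(1)[OF Hi st p Hp mesh \<delta>])
  have PR: "simple_process M past s t n \<tau> \<xi>"
    unfolding simple_process_def
  proof (intro conjI allI impI p)
    fix i assume i: "i < n"
    have t1: "\<tau> i \<in> {0..T}" "\<tau> (Suc i) \<in> {0..T}" using \<tau>[of i] \<tau>[of "Suc i"] i by auto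
    show "\<xi> i \<in> borel_measurable (past (\<tau> i))"
      unfolding \<xi>_def[abs_def] by (intro borel_measurable_diff Fp t1)
    have "integrable M (\<lambda>\<omega>. 4 * ((F (\<tau> (Suc i)) \<omega>)\<^sup>2 + (F (\<tau> i) \<omega>)\<^sup>2))"
      using F t1 by (auto simp: integrand_def)
    then show "integrable M (\<lambda>\<omega>. (\<xi> i \<omega>)\<^sup>2)"
    proof (rule Bochner_Integration.integrable_bound)
      show "(\<lambda>\<omega>. (\<xi> i \<omega>)\<^sup>2) \<in> borel_measurable M"
        unfolding \<xi>_def by (intro borel_measurable_power borel_measurable_diff integrand_measurable[OF F] t1)
      have "(a - b)\<^sup>2 \<le> 4 * (a\<^sup>2 + b\<^sup>2)" for a b :: real
        using square_half_diff_le[of a b] by (simp add: power_divide)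
      then show "AE \<omega> in M. norm ((\<xi> i \<omega>)\<^sup>2) \<le> norm (4 * ((F (\<tau> (Suc i)) \<omega>)\<^sup>2 + (F (\<tau> i) \<omega>)\<^sup>2))"
        by (simp add: \<xi>_def)
    qed
  qed
  have Wm: "D i \<in> borel_measurable M" if "i < n" for i
    unfolding D_def[abs_def] using \<tau>[of i] \<tau>[of "Suc i"] that by (intro borel_measurable_diff W_measurable) auto
  have [measurable]: "S \<in> borel_measurable M" "R \<in> borel_measurable M"
    unfolding S_def R_def by (rule simple_process_measurable(1)[OF PS st(1,3)], rule simple_process_measurable(1)[OF PR st(1,3)])
  have [measurable]: "Q \<in> borel_measurable M" unfolding Q_def[abs_def]
    by (intro borel_measurable_sum borel_measurable_power Wm) simp
  have [measurable]: "I \<in> borel_measurable M" using I by (simp add: ito_limit_def)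
  have Zeq: "Z \<omega> = (S \<omega> - I \<omega>) + R \<omega> / 4 - (Q \<omega> - (t - s)) / 4" for \<omega>
  proof -
    have "(H (\<tau> i) \<omega> + H (\<tau> (Suc i)) \<omega>) / 2 * D i \<omega> = H (\<tau> i) \<omega> * D i \<omega> + \<xi> i \<omega> * D i \<omega> / 4 - (D i \<omega>)\<^sup>2 / 4" for i
      by (simp add: H_def \<xi>_def D_def field_simps power2_eq_square)
    then have "(\<Sum>i<n. (H (\<tau> i) \<omega> + H (\<tau> (Suc i)) \<omega>) / 2 * D i \<omega>) = S \<omega> + R \<omega> / 4 - Q \<omega> / 4"
      unfolding S_def R_def Q_def simple_integral_def D_def[symmetric]
      by (simp only: sum.distrib sum_subtractf sum_divide_distrib[symmetric])
    then show ?thesis by (simp add: Z_def D_def[symmetric] J_def I_def field_simps)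
  qed
  show "Z \<in> borel_measurable M" unfolding Zeq[abs_def] by measurable
  have pt: "(a + r / 4 - q / 4)\<^sup>2 \<le> 3 * a\<^sup>2 + r\<^sup>2 + q\<^sup>2" for a r q :: real
  proof -
    have "3 * a\<^sup>2 + r\<^sup>2 + q\<^sup>2 - (a + r / 4 - q / 4)\<^sup>2 =
        (a - r / 4)\<^sup>2 + (a + q / 4)\<^sup>2 + (r / 4 + q / 4)\<^sup>2 + 13 / 16 * r\<^sup>2 + 13 / 16 * q\<^sup>2"
      by (simp add: power2_eq_square algebra_simps)
    also have "0 \<le> \<dots>" by (intro add_nonneg_nonneg mult_nonneg_nonneg zero_le_power2) simp_all
    finally show ?thesis by simp
  qed
  have b1: "(\<integral>\<^sup>+\<omega>. ennreal ((S \<omega> - I \<omega>)\<^sup>2) \<partial>M) \<le> ennreal (4 * ((C + sqrt T) * sqrt \<delta> * (t - s)))"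
  proof -
    have "(\<integral>\<^sup>+\<omega>. ennreal ((I \<omega> - S \<omega>)\<^sup>2) \<partial>M) \<le> 4 * dist2 s t H (simple_value n \<tau> (\<lambda>i. H (\<tau> i)))"
      using I PS unfolding ito_limit_def S_def by blast
    also have "\<dots> \<le> 4 * ennreal ((C + sqrt T) * sqrt \<delta> * (t - s))"
      by (rule mult_left_mono[OF mesh_dist2(2)[OF Hi st p Hp mesh \<delta>]]) simp_all
    also have "\<dots> = ennreal (4 * ((C + sqrt T) * sqrt \<delta> * (t - s)))"
      using C \<delta> st T_pos by (intro numeral_times_ennreal) simp
    finally show ?thesis by (simp add: power2_commute)
  qed
  have b2: "(\<integral>\<^sup>+\<omega>. ennreal ((R \<omega>)\<^sup>2) \<partial>M) \<le> ennreal (C * sqrt \<delta> * (t - s))"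
  proof -
    have P0: "simple_process M past s t n \<tau> (\<lambda>_ _. 0)" using p by (simp add: simple_process_def)
    have z: "simple_integral W n \<tau> (\<lambda>_ _. 0) = (\<lambda>\<omega>. 0)" "simple_value n \<tau> (\<lambda>_ _. 0) = (\<lambda>r (\<omega>::'a). 0)"
      by (auto simp: simple_integral_def simple_value_def fun_eq_iff)
    have "(\<integral>\<^sup>+\<omega>. ennreal ((R \<omega>)\<^sup>2) \<partial>M) = dist2 s t (simple_value n \<tau> \<xi>) (\<lambda>r \<omega>. 0)"
      using simple_isometry[OF PR P0 st(1,3)] by (simp add: z R_def)
    also have "\<dots> \<le> ennreal (C * sqrt \<delta> * (t - s))"
    proof (rule dist2_le[OF st(2) _ simple_process_measurable(2)[OF PR st(1,3)] regular_const])
      show "0 \<le> C * sqrt \<delta>" using C \<delta> by simp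
      fix r assume r: "s < r" "r \<le> t"
      obtain i where i: "i < n" "\<And>(\<xi> :: nat \<Rightarrow> 'a \<Rightarrow> real) \<omega>. simple_value n \<tau> \<xi> r \<omega> = \<xi> i \<omega>"
        by (rule simple_value_eq[OF p r]) blast
      have t1: "\<tau> i \<in> {0..T}" "\<tau> (Suc i) \<in> {0..T}" "\<tau> i \<le> \<tau> (Suc i)"
        using \<tau>[of i] \<tau>[of "Suc i"] i p by (auto simp: partition_def)
      have "(\<integral>\<^sup>+\<omega>. ennreal ((\<xi> i \<omega>)\<^sup>2) \<partial>M) \<le> ennreal (C * sqrt \<bar>\<tau> (Suc i) - \<tau> i\<bar>)"
        using F t1 unfolding integrand_def \<xi>_def by blast
      also have "\<dots> \<le> ennreal (C * sqrt \<delta>)"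
        using mesh[OF i(1)] t1 C by (intro ennreal_leI mult_left_mono) auto
      finally show "(\<integral>\<^sup>+\<omega>. ennreal ((simple_value n \<tau> \<xi> r \<omega> - 0)\<^sup>2) \<partial>M) \<le> ennreal (C * sqrt \<delta>)"
        by (simp add: i(2))
    qed
    finally show ?thesis .
  qed
  have b3: "(\<integral>\<^sup>+\<omega>. ennreal ((Q \<omega> - (t - s))\<^sup>2) \<partial>M) \<le> ennreal (2 * \<delta> * (t - s))"
    unfolding Q_def D_def by (rule quadratic_variation[OF st p mesh])
  have "(\<integral>\<^sup>+\<omega>. ennreal ((Z \<omega>)\<^sup>2) \<partial>M) \<le>
      (\<integral>\<^sup>+\<omega>. 3 * ennreal ((S \<omega> - I \<omega>)\<^sup>2) + ennreal ((R \<omega>)\<^sup>2) + ennreal ((Q \<omega> - (t - s))\<^sup>2) \<partial>M)"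
  proof (rule nn_integral_mono)
    fix \<omega>
    have "ennreal ((Z \<omega>)\<^sup>2) \<le> ennreal (3 * (S \<omega> - I \<omega>)\<^sup>2 + (R \<omega>)\<^sup>2 + (Q \<omega> - (t - s))\<^sup>2)"
      unfolding Zeq by (rule ennreal_leI[OF pt])
    also have "\<dots> = 3 * ennreal ((S \<omega> - I \<omega>)\<^sup>2) + ennreal ((R \<omega>)\<^sup>2) + ennreal ((Q \<omega> - (t - s))\<^sup>2)"
      by (subst numeral_times_ennreal) (simp_all add: ennreal_plus)
    finally show "ennreal ((Z \<omega>)\<^sup>2) \<le> \<dots>" .
  qed
  also have "\<dots> = 3 * (\<integral>\<^sup>+\<omega>. ennreal ((S \<omega> - I \<omega>)\<^sup>2) \<partial>M) + (\<integral>\<^sup>+\<omega>. ennreal ((R \<omega>)\<^sup>2) \<partial>M)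
      + (\<integral>\<^sup>+\<omega>. ennreal ((Q \<omega> - (t - s))\<^sup>2) \<partial>M)"
    by (simp add: nn_integral_add nn_integral_cmult)
  also have "\<dots> \<le> 3 * ennreal (4 * ((C + sqrt T) * sqrt \<delta> * (t - s))) + ennreal (C * sqrt \<delta> * (t - s)) + ennreal (2 * \<delta> * (t - s))"
    by (intro add_mono mult_left_mono b1 b2 b3) simp
  also have "\<dots> = ennreal ((12 * (C + sqrt T) + C) * sqrt \<delta> * (t - s) + 2 * \<delta> * (t - s))"
  proof -
    have nn: "0 \<le> (C + sqrt T) * sqrt \<delta> * (t - s)" "0 \<le> C * sqrt \<delta> * (t - s)" "0 \<le> 2 * \<delta> * (t - s)"
      using C \<delta> st T_pos by simp_all
    have "(12 * (C + sqrt T) + C) * sqrt \<delta> * (t - s) + 2 * \<delta> * (t - s) =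
      3 * (4 * ((C + sqrt T) * sqrt \<delta> * (t - s))) + C * sqrt \<delta> * (t - s) + 2 * \<delta> * (t - s)"
      by (simp add: algebra_simps)
    then show ?thesis using nn by (subst numeral_times_ennreal) (simp_all add: ennreal_plus)
  qed
  finally show "(\<integral>\<^sup>+\<omega>. ennreal ((Z \<omega>)\<^sup>2) \<partial>M) \<le> ennreal ((12 * (C + sqrt T) + C) * sqrt \<delta> * (t - s) + 2 * \<delta> * (t - s))" .
qed

lemma stratonovich_half_diff:
  assumes F: "integrand C F" and Fp: "\<And>r u. r \<in> {0..T} \<Longrightarrow> F r \<in> borel_measurable (past u)"
    and JF: "ito_limit F s t JF" and st: "0 \<le> s" "s \<le> t" "t \<le> T"
  shows "has_stratonovich_integral M W (\<lambda>r \<omega>. (F r \<omega> - (W r \<omega> - W s \<omega>)) / 2) s t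
    (\<lambda>\<omega>. JF \<omega> / 2 - (W t \<omega> - W s \<omega>)\<^sup>2 / 4)"
  unfolding has_stratonovich_integral_def
proof (intro conjI allI impI)
  have s: "s \<in> {0..T}" and t: "t \<in> {0..T}" using st by auto
  have [measurable]: "JF \<in> borel_measurable M" using JF by (simp add: ito_limit_def)
  show "(\<lambda>\<omega>. JF \<omega> / 2 - (W t \<omega> - W s \<omega>)\<^sup>2 / 4) \<in> borel_measurable M"
    using W_measurable[OF s] W_measurable[OF t] by measurable
  fix \<epsilon> :: real assume \<epsilon>: "0 < \<epsilon>"
  define e where "e \<delta> = (12 * (C + sqrt T) + C) * sqrt \<delta> * (t - s) + 2 * \<delta> * (t - s)" for \<delta>
  have C: "0 \<le> C" using F by (simp add: integrand_def)
  have "(\<lambda>n. e (inverse (real (Suc n)))) \<longlonglongrightarrow> (12 * (C + sqrt T) + C) * sqrt 0 * (t - s) + 2 * 0 * (t - s)"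
    unfolding e_def by (intro tendsto_add tendsto_mult tendsto_const tendsto_real_sqrt LIMSEQ_inverse_real_of_nat)
  then have "eventually (\<lambda>n. e (inverse (real (Suc n))) < \<epsilon> ^ 3) sequentially"
    using \<epsilon> by (intro order_tendstoD(2)) auto
  then obtain n0 where n0: "e (inverse (real (Suc n0))) < \<epsilon> ^ 3" by (auto simp: eventually_sequentially)
  \<comment> \<open>A mesh for which the mean square error is below the cube required by Chebyshev's
    inequality.\<close>
  define \<delta> where "\<delta> = inverse (real (Suc n0))"
  have \<delta>: "0 < \<delta>" "e \<delta> < \<epsilon> ^ 3" using n0 by (simp_all add: \<delta>_def)
  have e0: "0 \<le> e \<delta>" using C \<delta> st T_pos by (simp add: e_def)
  show "\<exists>\<delta>>0. \<forall>n \<tau>. partition s t n \<tau> \<and> (\<forall>i<n. \<tau> (Suc i) - \<tau> i < \<delta>) \<longrightarrow>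
        measure M {\<omega> \<in> space M.
          \<bar>(\<Sum>i<n. ((F (\<tau> i) \<omega> - (W (\<tau> i) \<omega> - W s \<omega>)) / 2 + (F (\<tau> (Suc i)) \<omega> - (W (\<tau> (Suc i)) \<omega> - W s \<omega>)) / 2) / 2 *
             (W (\<tau> (Suc i)) \<omega> - W (\<tau> i) \<omega>)) - (JF \<omega> / 2 - (W t \<omega> - W s \<omega>)\<^sup>2 / 4)\<bar> > \<epsilon>} < \<epsilon>"
  proof (intro exI[of _ \<delta>] conjI \<delta>(1) allI impI, elim conjE)
    fix n \<tau> assume p: "partition s t n \<tau>" and "\<forall>i<n. \<tau> (Suc i) - \<tau> i < \<delta>"
    then have mesh: "\<tau> (Suc i) - \<tau> i \<le> \<delta>" if "i < n" for i using that by auto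
    note tb = trapezoid_bound[OF F Fp JF st p mesh less_imp_le[OF \<delta>(1)]]
    show "measure M {\<omega> \<in> space M.
          \<bar>(\<Sum>i<n. ((F (\<tau> i) \<omega> - (W (\<tau> i) \<omega> - W s \<omega>)) / 2 + (F (\<tau> (Suc i)) \<omega> - (W (\<tau> (Suc i)) \<omega> - W s \<omega>)) / 2) / 2 *
             (W (\<tau> (Suc i)) \<omega> - W (\<tau> i) \<omega>)) - (JF \<omega> / 2 - (W t \<omega> - W s \<omega>)\<^sup>2 / 4)\<bar> > \<epsilon>} < \<epsilon>"
      by (rule chebyshev_nn[OF tb(1) tb(2)[folded e_def] \<epsilon> e0 \<delta>(2)])
  qed
qed

text \<open>
  The trapezoidal sums telescope and equal the limit exactly.
\<close>

lemma stratonovich_W: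
  assumes st: "0 \<le> s" "s \<le> t" "t \<le> T"
  shows "has_stratonovich_integral M W (\<lambda>r \<omega>. W r \<omega> - W s \<omega>) s t (\<lambda>\<omega>. (W t \<omega> - W s \<omega>)\<^sup>2 / 2)"
  unfolding has_stratonovich_integral_def
proof (intro conjI allI impI)
  have s: "s \<in> {0..T}" and t: "t \<in> {0..T}" using st by auto
  show "(\<lambda>\<omega>. (W t \<omega> - W s \<omega>)\<^sup>2 / 2) \<in> borel_measurable M"
    using W_measurable[OF s] W_measurable[OF t] by measurable
  fix \<epsilon> :: real assume \<epsilon>: "0 < \<epsilon>"
  have z: "(\<Sum>i<n. (W (\<tau> i) \<omega> - W s \<omega> + (W (\<tau> (Suc i)) \<omega> - W s \<omega>)) / 2 * (W (\<tau> (Suc i)) \<omega> - W (\<tau> i) \<omega>)) =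
      (W t \<omega> - W s \<omega>)\<^sup>2 / 2" if p: "partition s t n \<tau>" for n \<tau> \<omega>
  proof -
    have "(\<Sum>i<n. (W (\<tau> (Suc i)) \<omega> - W s \<omega>)\<^sup>2 / 2 - (W (\<tau> i) \<omega> - W s \<omega>)\<^sup>2 / 2) = (W t \<omega> - W s \<omega>)\<^sup>2 / 2"
      using sum_lessThan_telescope[of "\<lambda>i. (W (\<tau> i) \<omega> - W s \<omega>)\<^sup>2 / 2" n] p by (simp add: partition_def)
    moreover have "(W (\<tau> i) \<omega> - W s \<omega> + (W (\<tau> (Suc i)) \<omega> - W s \<omega>)) / 2 * (W (\<tau> (Suc i)) \<omega> - W (\<tau> i) \<omega>) =
        (W (\<tau> (Suc i)) \<omega> - W s \<omega>)\<^sup>2 / 2 - (W (\<tau> i) \<omega> - W s \<omega>)\<^sup>2 / 2" for i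
      by (simp add: power2_eq_square field_simps)
    ultimately show ?thesis by (simp only:)
  qed
  show "\<exists>\<delta>>0. \<forall>n \<tau>. partition s t n \<tau> \<and> (\<forall>i<n. \<tau> (Suc i) - \<tau> i < \<delta>) \<longrightarrow>
        measure M {\<omega> \<in> space M. \<bar>(\<Sum>i<n. (W (\<tau> i) \<omega> - W s \<omega> + (W (\<tau> (Suc i)) \<omega> - W s \<omega>)) / 2 *
          (W (\<tau> (Suc i)) \<omega> - W (\<tau> i) \<omega>)) - (W t \<omega> - W s \<omega>)\<^sup>2 / 2\<bar> > \<epsilon>} < \<epsilon>"
  proof (intro exI[of _ 1] conjI allI impI zero_less_one, elim conjE)
    fix n \<tau> assume p: "partition s t n \<tau>"
    show "measure M {\<omega> \<in> space M. \<bar>(\<Sum>i<n. (W (\<tau> i) \<omega> - W s \<omega> + (W (\<tau> (Suc i)) \<omega> - W s \<omega>)) / 2 *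
          (W (\<tau> (Suc i)) \<omega> - W (\<tau> i) \<omega>)) - (W t \<omega> - W s \<omega>)\<^sup>2 / 2\<bar> > \<epsilon>} < \<epsilon>"
      unfolding z[OF p] using \<epsilon> by simp
  qed
qed

text \<open>
  Limits in probability along the uniform partitions are unique.
\<close>

lemma stratonovich_unique:
  assumes H: "\<And>r. s \<le> r \<Longrightarrow> r \<le> t \<Longrightarrow> H r \<in> borel_measurable M" and st: "0 \<le> s" "s \<le> t" "t \<le> T"
    and J: "has_stratonovich_integral M W H s t J" "has_stratonovich_integral M W H s t J'"
  shows "AE \<omega> in M. J \<omega> = J' \<omega>"
proof -
  have [measurable]: "J \<in> borel_measurable M" "J' \<in> borel_measurable M"
    using J by (auto simp: has_stratonovich_integral_def)
  have small: "measure M {\<omega>\<in>space M. \<bar>J \<omega> - J' \<omega>\<bar> > 2 * \<epsilon>} < 2 * \<epsilon>" if \<epsilon>: "0 < \<epsilon>" for \<epsilon>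
  proof -
    let ?S = "\<lambda>n \<tau> \<omega>. \<Sum>i<n. (H (\<tau> i) \<omega> + H (\<tau> (Suc i)) \<omega>) / 2 * (W (\<tau> (Suc i)) \<omega> - W (\<tau> i) \<omega>)"
    let ?good = "\<lambda>J \<delta>. \<forall>n \<tau>. partition s t n \<tau> \<and> (\<forall>i<n. \<tau> (Suc i) - \<tau> i < \<delta>) \<longrightarrow>
        measure M {\<omega> \<in> space M. \<bar>?S n \<tau> \<omega> - J \<omega>\<bar> > \<epsilon>} < \<epsilon>"
    have "\<exists>\<delta>>0. ?good J \<delta>" "\<exists>\<delta>>0. ?good J' \<delta>"
      using J \<epsilon> unfolding has_stratonovich_integral_def by blast+
    then obtain \<delta> \<delta>' where d: "0 < \<delta>" "?good J \<delta>" "0 < \<delta>'" "?good J' \<delta>'" by blast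
    have "eventually (\<lambda>k. (t - s) / real (Suc k) < min \<delta> \<delta>') sequentially"
      using d by (intro order_tendstoD(2)[OF uniform_mesh_tendsto]) auto
    then obtain k where k: "(t - s) / real (Suc k) < min \<delta> \<delta>'" by (auto simp: eventually_sequentially)
    let ?\<tau> = "uniform_partition s t k"
    note p = uniform_partition[OF st(2), of k]
    let ?T = "?S (Suc k) ?\<tau>"
    have b: "?\<tau> i \<in> {0..T}" "s \<le> ?\<tau> i" "?\<tau> i \<le> t" if "i \<le> Suc k" for i
      using partition_bounds[OF p(1) that] st by auto
    have Tm [measurable]: "?T \<in> borel_measurable M"
      by (intro borel_measurable_sum borel_measurable_times borel_measurable_divide borel_measurable_add
          borel_measurable_diff borel_measurable_const H W_measurable b) auto
    let ?A = "{\<omega>\<in>space M. \<bar>?T \<omega> - J \<omega>\<bar> > \<epsilon>}" and ?B = "{\<omega>\<in>space M. \<bar>?T \<omega> - J' \<omega>\<bar> > \<epsilon>}"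
    have AB: "?A \<in> sets M" "?B \<in> sets M" by measurable
    have mesh: "\<forall>i<Suc k. ?\<tau> (Suc i) - ?\<tau> i < \<delta>" "\<forall>i<Suc k. ?\<tau> (Suc i) - ?\<tau> i < \<delta>'"
      using k unfolding p(2) by simp_all
    have "measure M ?A < \<epsilon>" by (rule d(2)[rule_format, OF conjI[OF p(1) mesh(1)]])
    moreover have "measure M ?B < \<epsilon>" by (rule d(4)[rule_format, OF conjI[OF p(1) mesh(2)]])
    moreover have "measure M {\<omega>\<in>space M. \<bar>J \<omega> - J' \<omega>\<bar> > 2 * \<epsilon>} \<le> measure M (?A \<union> ?B)"
    proof (rule finite_measure_mono)
      have "\<epsilon> < \<bar>u - j\<bar> \<or> \<epsilon> < \<bar>u - j'\<bar>" if "2 * \<epsilon> < \<bar>j - j'\<bar>" for u j j' :: real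
        using that by linarith
      then show "{\<omega>\<in>space M. \<bar>J \<omega> - J' \<omega>\<bar> > 2 * \<epsilon>} \<subseteq> ?A \<union> ?B" by blast
    qed (rule sets.Un[OF AB])
    moreover have "measure M (?A \<union> ?B) \<le> measure M ?A + measure M ?B"
      by (rule measure_Un_le[OF AB])
    ultimately show ?thesis by linarith
  qed
  have "AE \<omega> in M. \<bar>J \<omega> - J' \<omega>\<bar> \<le> inverse (real (Suc n))" for n
  proof -
    let ?A = "{\<omega>\<in>space M. \<bar>J \<omega> - J' \<omega>\<bar> > inverse (real (Suc n))}"
    have A: "?A \<in> sets M" by measurable
    have "measure M ?A \<le> 0"
    proof (rule field_le_epsilon)
      fix e :: real assume e: "0 < e"
      \<comment> \<open>The exceptional set only grows when the threshold is lowered.\<close>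
      define \<epsilon> where "\<epsilon> = min e (inverse (real (Suc n))) / 2"
      have \<epsilon>: "0 < \<epsilon>" "2 * \<epsilon> \<le> e" "2 * \<epsilon> \<le> inverse (real (Suc n))" using e by (auto simp: \<epsilon>_def)
      have "measure M ?A \<le> measure M {\<omega>\<in>space M. \<bar>J \<omega> - J' \<omega>\<bar> > 2 * \<epsilon>}"
        by (rule finite_measure_mono) (use \<epsilon>(3) in auto)
      then show "measure M ?A \<le> 0 + e" using small[OF \<epsilon>(1)] \<epsilon>(2) by linarith
    qed
    then have "measure M ?A = 0" using measure_nonneg[of M ?A] by linarith
    then have "emeasure M ?A = 0" by (simp add: emeasure_eq_measure)
    then have "AE \<omega> in M. \<omega> \<notin> ?A" using A by (intro AE_not_in) (auto simp: null_sets_def)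
    then show ?thesis by (rule AE_mp) (auto intro!: AE_I2)
  qed
  then have "AE \<omega> in M. \<forall>n. \<bar>J \<omega> - J' \<omega>\<bar> \<le> inverse (real (Suc n))" by (simp add: AE_all_countable)
  then show ?thesis
  proof eventually_elim
    case (elim \<omega>)
    have "\<bar>J \<omega> - J' \<omega>\<bar> \<le> 0"
      by (rule LIMSEQ_le_const[OF LIMSEQ_inverse_real_of_nat]) (use elim in auto)
    then show ?case by simp
  qed
qed

end

section \<open>The four lifts\<close>

text \<open>
  The deterministic part of the quadratic variation of \<open>W\<close>, present in the Ito calculus only.
\<close>

definition ito_correction :: "calculus \<Rightarrow> real \<Rightarrow> real" where
  "ito_correction \<alpha> h = (if \<alpha> = Ito then h else 0)"

lemma half_difference_bound:
  fixes v c A :: real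
  assumes "0 \<le> v" "v \<le> A" "0 \<le> c" "c \<le> A"
  shows "\<bar>(v - c) / 2\<bar> \<le> A"
  using assms by (auto simp: abs_le_iff field_simps)

lemma half_minus_quarter_bound:
  fixes q v c A :: real
  assumes "\<bar>q\<bar> \<le> A" "0 \<le> v" "v \<le> A" "0 \<le> c" "c \<le> A"
  shows "\<bar>q / 2 - (v - c) / 4\<bar> \<le> A"
  using assms by (auto simp: abs_le_iff field_simps)

lemma tree_val_measurable:
  assumes [measurable]: "x \<in> borel_measurable M" "w \<in> borel_measurable M" "j \<in> borel_measurable M"
    "k \<in> borel_measurable M" "m \<in> borel_measurable M"
  shows "(\<lambda>\<omega>. tree_val (x \<omega>) (w \<omega>) (j \<omega>) (k \<omega>) (m \<omega>) t) \<in> borel_measurable M"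
  unfolding tree_val_def Let_def by measurable

lemma forest_val_measurable:
  assumes "x \<in> borel_measurable M" "w \<in> borel_measurable M" "j \<in> borel_measurable M"
    "k \<in> borel_measurable M" "m \<in> borel_measurable M"
  shows "(\<lambda>\<omega>. forest_val (x \<omega>) (w \<omega>) (j \<omega>) (k \<omega>) (m \<omega>) f) \<in> borel_measurable M"
proof (induction f)
  case (add t f)
  from borel_measurable_times[OF tree_val_measurable[OF assms, of t] add.IH] show ?case by simp
qed simp

context fbm_bm begin

text \<open>
  The integral of the square of \<open>X - X s\<close> is the same in both calculi; the correction comes from the
  integral of \<open>W - W s\<close>.
\<close>

definition cubic :: "calculus \<Rightarrow> real \<Rightarrow> real \<Rightarrow> 'a \<Rightarrow> real" where
  "cubic \<alpha> s t \<omega> = sq_area_fin s t \<omega> / 2 - ((W t \<omega> - W s \<omega>)\<^sup>2 - ito_correction \<alpha> (t - s)) / 4"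

definition quadratic :: "calculus \<Rightarrow> real \<Rightarrow> real \<Rightarrow> 'a \<Rightarrow> real" where
  "quadratic \<beta> s t \<omega> = ((W t \<omega> - W s \<omega>)\<^sup>2 - ito_correction \<beta> (t - s)) / 2"

definition lift :: "calculus \<Rightarrow> calculus \<Rightarrow> 'a random_path" where
  "lift \<alpha> \<beta> \<omega> s t = forest_val (X t \<omega> - X s \<omega>) (W t \<omega> - W s \<omega>) (area_fin s t \<omega>)
     (cubic \<alpha> s t \<omega>) (quadratic \<beta> s t \<omega>)"

lemma parts_measurable:
  assumes s: "s \<in> {0..T}" and t: "t \<in> {0..T}"
  shows "cubic \<alpha> s t \<in> borel_measurable M" "quadratic \<beta> s t \<in> borel_measurable M"
proof -
  note [measurable] = areas_fin_measurable[OF s t] W_measurable[OF s] W_measurable[OF t]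
  show "cubic \<alpha> s t \<in> borel_measurable M" unfolding cubic_def[abs_def] by measurable
  show "quadratic \<beta> s t \<in> borel_measurable M" unfolding quadratic_def[abs_def] by measurable
qed

text \<open>
  The control is the increment of the function \<open>G\<close> of \<open>dyadic_control\<close> along the path at hand.
\<close>

lemma lift_rough_path:
  assumes \<rho>: "4 < \<rho>" "\<rho> < 5"
  shows "AE \<omega> in M. \<exists>c. control T c \<and> branched_rough_path \<rho> T c (lift \<alpha> \<beta> \<omega>)"
  using X_continuous W_continuous variation_summable[OF \<rho>]
proof eventually_elim
  case (elim \<omega>)
  have r: "1 < 2 powr ((\<rho> / 4 - 1) / 2)" using \<rho> by simp
  have \<rho>0: "0 < \<rho>" using \<rho> by simp
  obtain G K where G: "continuous_on UNIV G" "mono G" and K: "0 \<le> K"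
    and hb: "\<And>s t. 0 \<le> s \<Longrightarrow> s \<le> t \<Longrightarrow> t \<le> T \<Longrightarrow>
      hom_bound (\<lambda>r. X r \<omega>) (\<lambda>r. W r \<omega>) (\<lambda>r. Afin r \<omega>) (\<lambda>r. Bfin r \<omega>) s t (K * (G t - G s) powr (1 / \<rho>))"
    by (rule dyadic_control[OF T_pos \<rho>0 r elim(3,1,2), folded Afin_def Bfin_def]) blast
  let ?c = "\<lambda>s t. G t - G s"
  have "control T ?c"
    unfolding control_def
  proof (intro conjI allI impI)
    show "continuous_on {(s, t). 0 \<le> s \<and> s \<le> t \<and> t \<le> T} (\<lambda>(s, t). G t - G s)"
      unfolding case_prod_unfold
      by (intro continuous_on_diff continuous_on_compose2[OF G(1)] continuous_intros) auto
  qed (use monoD[OF G(2)] in auto)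
  moreover have "branched_rough_path \<rho> T ?c (lift \<alpha> \<beta> \<omega>)"
    unfolding lift_def[abs_def]
  proof (rule branched_rough_path_forest_val[OF \<rho> _ _ _ K])
    show "area_fin s t \<omega> = area_fin s u \<omega> + area_fin u t \<omega> + (X u \<omega> - X s \<omega>) * (W t \<omega> - W u \<omega>)" for s u t
      by (rule area_chen)
    show "cubic \<alpha> s t \<omega> = cubic \<alpha> s u \<omega> + cubic \<alpha> u t \<omega> + ((X u \<omega> - X s \<omega>)\<^sup>2 - (W u \<omega> - W s \<omega>)) / 2 * (W t \<omega> - W u \<omega>)
        + (X u \<omega> - X s \<omega>) * area_fin u t \<omega>" for s u t
      unfolding cubic_def sq_area_chen[of _ _ _ _ s t u]
      by (simp add: ito_correction_def field_simps power2_eq_square)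
    show "quadratic \<beta> s t \<omega> = quadratic \<beta> s u \<omega> + quadratic \<beta> u t \<omega> + (W u \<omega> - W s \<omega>) * (W t \<omega> - W u \<omega>)" for s u t
      by (simp add: quadratic_def ito_correction_def field_simps power2_eq_square)
    fix s t assume st: "0 \<le> s" "s < t" "t \<le> T"
    define a where "a = K * (G t - G s) powr (1 / \<rho>)"
    have h: "0 \<le> a" "\<bar>X t \<omega> - X s \<omega>\<bar> \<le> a" "\<bar>W t \<omega> - W s \<omega>\<bar> \<le> a\<^sup>2" "\<bar>area_fin s t \<omega>\<bar> \<le> a ^ 3"
      "\<bar>sq_area_fin s t \<omega>\<bar> \<le> a ^ 4" "t - s \<le> a ^ 4"
      using hb[OF st(1) less_imp_le[OF st(2)] st(3)] unfolding hom_bound_def a_def by blast+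
    have w2: "(W t \<omega> - W s \<omega>)\<^sup>2 \<le> a ^ 4"
      using power_mono[OF h(3) abs_ge_zero, of 2] by (simp flip: power_mult)
    have w0: "0 \<le> (W t \<omega> - W s \<omega>)\<^sup>2" by simp
    have c: "0 \<le> ito_correction \<gamma> (t - s)" "ito_correction \<gamma> (t - s) \<le> a ^ 4" for \<gamma>
      using st h(1,6) by (auto simp: ito_correction_def)
    have "\<bar>cubic \<alpha> s t \<omega>\<bar> \<le> a ^ 4"
      unfolding cubic_def by (rule half_minus_quarter_bound[OF h(5) w0 w2 c])
    moreover have "\<bar>quadratic \<beta> s t \<omega>\<bar> \<le> a ^ 4"
      unfolding quadratic_def by (rule half_difference_bound[OF w0 w2 c])
    moreover have "0 \<le> G t - G s" using monoD[OF G(2), of s t] st by simp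
    ultimately show "0 \<le> ?c s t \<and> (let a = K * ?c s t powr (1 / \<rho>) in \<bar>X t \<omega> - X s \<omega>\<bar> \<le> a \<and> \<bar>W t \<omega> - W s \<omega>\<bar> \<le> a\<^sup>2 \<and>
        \<bar>area_fin s t \<omega>\<bar> \<le> a ^ 3 \<and> \<bar>cubic \<alpha> s t \<omega>\<bar> \<le> a ^ 4 \<and> \<bar>quadratic \<beta> s t \<omega>\<bar> \<le> a ^ 4)"
      using h by (simp add: Let_def a_def)
  qed
  ultimately show ?case by blast
qed

lemma integrand_past:
  assumes s: "0 \<le> s" and r: "s \<le> r" "r \<le> T"
  shows "(\<lambda>\<omega>. X r \<omega> - X s \<omega>) \<in> borel_measurable (past r)"
    and "(\<lambda>\<omega>. ((X r \<omega> - X s \<omega>)\<^sup>2 - (W r \<omega> - W s \<omega>)) / 2) \<in> borel_measurable (past r)"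
proof -
  have sr: "s \<in> {0..T}" "r \<in> {0..T}" using assms by auto
  show "(\<lambda>\<omega>. X r \<omega> - X s \<omega>) \<in> borel_measurable (past r)" by (rule past_X(1)[OF sr])
  show "(\<lambda>\<omega>. ((X r \<omega> - X s \<omega>)\<^sup>2 - (W r \<omega> - W s \<omega>)) / 2) \<in> borel_measurable (past r)"
    using past_X(2)[OF sr] W_integrand_past[OF s r(1)] by measurable
qed

lemma integrand_natural:
  assumes s: "0 \<le> s" and r: "s \<le> r"
  shows "(\<lambda>\<omega>. X r \<omega> - X s \<omega>) \<in> borel_measurable (natural_filtration M X W r)"
    and "(\<lambda>\<omega>. W r \<omega> - W s \<omega>) \<in> borel_measurable (natural_filtration M X W r)"
    and "(\<lambda>\<omega>. ((X r \<omega> - X s \<omega>)\<^sup>2 - (W r \<omega> - W s \<omega>)) / 2) \<in> borel_measurable (natural_filtration M X W r)"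
proof -
  have r0: "0 \<le> r" using assms by simp
  note [measurable] = natural_X[OF s r] natural_X[OF r0 order.refl] natural_W[OF s r] natural_W[OF r0 order.refl]
  show "(\<lambda>\<omega>. X r \<omega> - X s \<omega>) \<in> borel_measurable (natural_filtration M X W r)"
    "(\<lambda>\<omega>. W r \<omega> - W s \<omega>) \<in> borel_measurable (natural_filtration M X W r)"
    "(\<lambda>\<omega>. ((X r \<omega> - X s \<omega>)\<^sup>2 - (W r \<omega> - W s \<omega>)) / 2) \<in> borel_measurable (natural_filtration M X W r)"
    by measurable
qed

lemma cubic_ito_limit:
  assumes st: "0 \<le> s" "s \<le> t" "t \<le> T"
  shows "ito_limit (\<lambda>r \<omega>. ((X r \<omega> - X s \<omega>)\<^sup>2 - (W r \<omega> - W s \<omega>)) / 2) s t (cubic Ito s t)"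
proof -
  have s: "s \<in> {0..T}" using st by auto
  have "ito_limit (\<lambda>r \<omega>. ((X r \<omega> - X s \<omega>)\<^sup>2 - (W r \<omega> - W s \<omega>)) / 2) s t
     (\<lambda>\<omega>. (sq_area_fin s t \<omega> - ((W t \<omega> - W s \<omega>)\<^sup>2 - (t - s)) / 2) / 2)"
    by (rule ito_limit_half_diff[OF integrand_X_square[OF s] integrand_W[OF s] st _ W_integrand_past[OF st(1)]
          areas_fin_ito_limit(2)[OF st] W_ito_limit[OF st]]) (use past_X(2)[OF s] st in auto)
  moreover have "(\<lambda>\<omega>. (sq_area_fin s t \<omega> - ((W t \<omega> - W s \<omega>)\<^sup>2 - (t - s)) / 2) / 2) = cubic Ito s t"
    by (simp add: fun_eq_iff cubic_def ito_correction_def diff_divide_distrib)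
  ultimately show ?thesis by simp
qed

lemma quadratic_ito_limit:
  assumes st: "0 \<le> s" "s \<le> t" "t \<le> T"
  shows "ito_limit (\<lambda>r \<omega>. W r \<omega> - W s \<omega>) s t (quadratic Ito s t)"
  using W_ito_limit[OF st] by (simp add: quadratic_def[abs_def] ito_correction_def)

lemma cubic_stratonovich:
  assumes st: "0 \<le> s" "s \<le> t" "t \<le> T"
  shows "has_stratonovich_integral M W (\<lambda>r \<omega>. ((X r \<omega> - X s \<omega>)\<^sup>2 - (W r \<omega> - W s \<omega>)) / 2) s t (cubic Stratonovich s t)"
proof -
  have s: "s \<in> {0..T}" using st by auto
  have "cubic Stratonovich s t = (\<lambda>\<omega>. sq_area_fin s t \<omega> / 2 - (W t \<omega> - W s \<omega>)\<^sup>2 / 4)"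
    by (simp add: fun_eq_iff cubic_def ito_correction_def)
  then show ?thesis
    using stratonovich_half_diff[OF integrand_X_square[OF s] past_X(2)[OF s] areas_fin_ito_limit(2)[OF st] st] by simp
qed

lemma cubic_integral:
  assumes st: "0 \<le> s" "s \<le> t" "t \<le> T"
  shows "has_stochastic_integral \<alpha> M (natural_filtration M X W) W
    (\<lambda>r \<omega>. ((X r \<omega> - X s \<omega>)\<^sup>2 - (W r \<omega> - W s \<omega>)) / 2) s t (cubic \<alpha> s t)"
proof (cases \<alpha>)
  case Ito
  have s: "s \<in> {0..T}" using st by auto
  show ?thesis unfolding Ito has_stochastic_integral.simps
    by (rule ito_limit_has_integral[OF integrand_half_diff[OF integrand_X_square[OF s] integrand_W[OF s]] st
          integrand_natural(3)[OF st(1)] cubic_ito_limit[OF st]])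
next
  case Stratonovich
  show ?thesis unfolding Stratonovich has_stochastic_integral.simps by (rule cubic_stratonovich[OF st])
qed

lemma quadratic_integral:
  assumes st: "0 \<le> s" "s \<le> t" "t \<le> T"
  shows "has_stochastic_integral \<beta> M (natural_filtration M X W) W (\<lambda>r \<omega>. W r \<omega> - W s \<omega>) s t (quadratic \<beta> s t)"
proof (cases \<beta>)
  case Ito
  have s: "s \<in> {0..T}" using st by auto
  show ?thesis unfolding Ito has_stochastic_integral.simps
    by (rule ito_limit_has_integral[OF integrand_W[OF s] st integrand_natural(2)[OF st(1)] quadratic_ito_limit[OF st]])
next
  case Stratonovich
  have "quadratic Stratonovich s t = (\<lambda>\<omega>. (W t \<omega> - W s \<omega>)\<^sup>2 / 2)"
    by (simp add: fun_eq_iff quadratic_def ito_correction_def)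
  then show ?thesis unfolding Stratonovich has_stochastic_integral.simps using stratonovich_W[OF st] by simp
qed

lemma lift_is_lift:
  assumes \<rho>: "4 < \<rho>" "\<rho> < 5"
  shows "is_lift M \<rho> T X W \<alpha> \<beta> (lift \<alpha> \<beta>)"
  unfolding is_lift_def Let_def
proof (intro conjI allI impI)
  show "random_branched_rough_path M \<rho> T (lift \<alpha> \<beta>)"
    unfolding random_branched_rough_path_def
  proof (intro conjI allI impI lift_rough_path[OF \<rho>])
    fix s t and f :: forest assume "0 \<le> s \<and> s \<le> t \<and> t \<le> T \<and> int (weight f) \<le> \<lfloor>\<rho>\<rfloor>"
    then have s: "s \<in> {0..T}" and t: "t \<in> {0..T}" by auto
    show "(\<lambda>\<omega>. lift \<alpha> \<beta> \<omega> s t f) \<in> borel_measurable M"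
      unfolding lift_def
      by (intro forest_val_measurable borel_measurable_diff X_measurable W_measurable areas_fin_measurable parts_measurable s t)
  qed
  show "AE \<omega> in M. \<forall>s t. 0 \<le> s \<and> s \<le> t \<and> t \<le> T \<longrightarrow>
          \<langle>\<^bold>\<bullet>, lift \<alpha> \<beta> \<omega> s t\<rangle> = X t \<omega> - X s \<omega> \<and> \<langle>p2, lift \<alpha> \<beta> \<omega> s t\<rangle> = W t \<omega> - W s \<omega> \<and>
          \<langle>p3, lift \<alpha> \<beta> \<omega> s t\<rangle> = 0 \<and> \<langle>p3 \<^bold>\<top> \<^bold>\<bullet>, lift \<alpha> \<beta> \<omega> s t\<rangle> = 0 \<and> \<langle>\<^bold>\<bullet> \<^bold>\<top> p3, lift \<alpha> \<beta> \<omega> s t\<rangle> = 0"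
    unfolding lift_def pairing_forest_val by simp
  fix s t assume "0 \<le> s \<and> s \<le> t \<and> t \<le> T"
  then have st: "0 \<le> s" "s \<le> t" "t \<le> T" by auto
  have s: "s \<in> {0..T}" using st by auto
  have 1: "has_ito_integral M (natural_filtration M X W) W (\<lambda>r \<omega>. X r \<omega> - X s \<omega>) s t (\<lambda>\<omega>. area_fin s t \<omega>)"
    by (rule ito_limit_has_integral[OF integrand_X[OF s] st integrand_natural(1)[OF st(1)] areas_fin_ito_limit(1)[OF st]])
  show "\<exists>J. has_ito_integral M (natural_filtration M X W) W (\<lambda>r \<omega>. X r \<omega> - X s \<omega>) s t J \<and>
       (AE \<omega> in M. \<langle>\<^bold>\<bullet> \<^bold>\<top> p2, lift \<alpha> \<beta> \<omega> s t\<rangle> = J \<omega> \<and>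
          \<langle>p2 \<^bold>\<top> \<^bold>\<bullet>, lift \<alpha> \<beta> \<omega> s t\<rangle> = (X t \<omega> - X s \<omega>) * (W t \<omega> - W s \<omega>) - J \<omega>)"
    by (intro exI[of _ "\<lambda>\<omega>. area_fin s t \<omega>"] conjI 1) (simp add: lift_def pairing_forest_val)
  show "\<exists>J. has_stochastic_integral \<alpha> M (natural_filtration M X W) W
         (\<lambda>r \<omega>. ((X r \<omega> - X s \<omega>)\<^sup>2 - (W r \<omega> - W s \<omega>)) / 2) s t J \<and>
       (AE \<omega> in M. \<langle>(\<^bold>\<bullet> \<^bold>\<top> \<^bold>\<bullet>) \<^bold>\<top> p2, lift \<alpha> \<beta> \<omega> s t\<rangle> = J \<omega>)"
    by (intro exI[of _ "cubic \<alpha> s t"] conjI cubic_integral[OF st]) (simp add: lift_def pairing_forest_val)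
  show "\<exists>J. has_stochastic_integral \<beta> M (natural_filtration M X W) W (\<lambda>r \<omega>. W r \<omega> - W s \<omega>) s t J \<and>
       (AE \<omega> in M. \<langle>p2 \<^bold>\<top> p2, lift \<alpha> \<beta> \<omega> s t\<rangle> = J \<omega> \<and>
          (\<beta> = Stratonovich \<longrightarrow> J \<omega> = (W t \<omega> - W s \<omega>)\<^sup>2 / 2))"
    by (intro exI[of _ "quadratic \<beta> s t"] conjI quadratic_integral[OF st])
      (simp add: lift_def pairing_forest_val quadratic_def ito_correction_def)
qed

lemma cubic_unique:
  assumes st: "0 \<le> s" "s \<le> t" "t \<le> T"
    and J: "has_stochastic_integral \<alpha> M (natural_filtration M X W) W
      (\<lambda>r \<omega>. ((X r \<omega> - X s \<omega>)\<^sup>2 - (W r \<omega> - W s \<omega>)) / 2) s t J"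
  shows "AE \<omega> in M. J \<omega> = cubic \<alpha> s t \<omega>"
proof (cases \<alpha>)
  case Ito
  have s: "s \<in> {0..T}" using st by auto
  note H = integrand_half_diff[OF integrand_X_square[OF s] integrand_W[OF s]]
  have Hp: "(\<lambda>\<omega>. ((X r \<omega> - X s \<omega>)\<^sup>2 - (W r \<omega> - W s \<omega>)) / 2) \<in> borel_measurable (past r)" if "s \<le> r" "r \<le> t" for r
    by (rule integrand_past(2)[OF st(1) that(1)]) (use that st in simp)
  show ?thesis unfolding Ito
    by (rule ito_limit_unique'[OF H st Hp ito_integral_limit[OF st(1,3) integrand_regular[OF H st]] cubic_ito_limit[OF st]])
      (use J Ito in simp_all)
next
  case Stratonovich
  have m: "(\<lambda>\<omega>. ((X r \<omega> - X s \<omega>)\<^sup>2 - (W r \<omega> - W s \<omega>)) / 2) \<in> borel_measurable M" if "s \<le> r" "r \<le> t" for r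
  proof -
    have "s \<in> {0..T}" "r \<in> {0..T}" using that st by auto
    then show ?thesis by measurable
  qed
  show ?thesis unfolding Stratonovich
    by (rule stratonovich_unique[OF m st _ cubic_stratonovich[OF st]]) (use J Stratonovich in simp_all)
qed

lemma quadratic_unique:
  assumes st: "0 \<le> s" "s \<le> t" "t \<le> T"
    and J: "has_stochastic_integral \<beta> M (natural_filtration M X W) W (\<lambda>r \<omega>. W r \<omega> - W s \<omega>) s t J"
    and strat: "AE \<omega> in M. \<beta> = Stratonovich \<longrightarrow> J \<omega> = (W t \<omega> - W s \<omega>)\<^sup>2 / 2"
  shows "AE \<omega> in M. J \<omega> = quadratic \<beta> s t \<omega>"
proof (cases \<beta>)
  case Ito
  have s: "s \<in> {0..T}" using st by auto
  note H = integrand_W[OF s]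
  show ?thesis unfolding Ito
    by (rule ito_limit_unique'[OF H st W_integrand_past[OF st(1)] ito_integral_limit[OF st(1,3) integrand_regular[OF H st]]
          quadratic_ito_limit[OF st]]) (use J Ito in simp_all)
next
  case Stratonovich
  with strat show ?thesis by (simp add: quadratic_def ito_correction_def)
qed

lemma area_unique:
  assumes st: "0 \<le> s" "s \<le> t" "t \<le> T"
    and J: "has_ito_integral M (natural_filtration M X W) W (\<lambda>r \<omega>. X r \<omega> - X s \<omega>) s t J"
  shows "AE \<omega> in M. J \<omega> = area_fin s t \<omega>"
proof -
  have s: "s \<in> {0..T}" using st by auto
  note H = integrand_X[OF s]
  have Hp: "(\<lambda>\<omega>. X r \<omega> - X s \<omega>) \<in> borel_measurable (past r)" if "s \<le> r" "r \<le> t" for r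
    by (rule integrand_past(1)[OF st(1) that(1)]) (use that st in simp)
  show ?thesis
    by (rule ito_limit_unique'[OF H st Hp ito_integral_limit[OF st(1,3) integrand_regular[OF H st] J] areas_fin_ito_limit(1)[OF st]])
qed

lemma lift_unique:
  assumes \<rho>: "4 < \<rho>" "\<rho> < 5" and Y: "is_lift M \<rho> T X W \<alpha> \<beta> Y"
  shows "modification M \<rho> T Y (lift \<alpha> \<beta>)"
  unfolding modification_def
proof (intro allI impI)
  fix s t assume asm: "0 \<le> s \<and> s \<le> t \<and> t \<le> T"
  then have st: "0 \<le> s" "s \<le> t" "t \<le> T" by auto
  have fl: "\<lfloor>\<rho>\<rfloor> = 4" using \<rho> by linarith
  note Y' = Y[unfolded is_lift_def Let_def]
  have rough: "AE \<omega> in M. \<exists>c. control T c \<and> branched_rough_path \<rho> T c (Y \<omega>)"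
    by (rule conjunct2[OF conjunct1[OF Y', unfolded random_branched_rough_path_def]])
  have words: "AE \<omega> in M. \<forall>s t. 0 \<le> s \<and> s \<le> t \<and> t \<le> T \<longrightarrow>
          \<langle>\<^bold>\<bullet>, Y \<omega> s t\<rangle> = X t \<omega> - X s \<omega> \<and> \<langle>p2, Y \<omega> s t\<rangle> = W t \<omega> - W s \<omega> \<and>
          \<langle>p3, Y \<omega> s t\<rangle> = 0 \<and> \<langle>p3 \<^bold>\<top> \<^bold>\<bullet>, Y \<omega> s t\<rangle> = 0 \<and> \<langle>\<^bold>\<bullet> \<^bold>\<top> p3, Y \<omega> s t\<rangle> = 0"
    by (rule conjunct1[OF conjunct2[OF Y']])
  note ints = conjunct2[OF conjunct2[OF Y'], THEN spec, THEN spec, THEN mp, OF asm]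
  from conjunct1[OF ints] obtain J1 where J1: "has_ito_integral M (natural_filtration M X W) W (\<lambda>r \<omega>. X r \<omega> - X s \<omega>) s t J1"
    "AE \<omega> in M. \<langle>\<^bold>\<bullet> \<^bold>\<top> p2, Y \<omega> s t\<rangle> = J1 \<omega> \<and>
       \<langle>p2 \<^bold>\<top> \<^bold>\<bullet>, Y \<omega> s t\<rangle> = (X t \<omega> - X s \<omega>) * (W t \<omega> - W s \<omega>) - J1 \<omega>"
    by (elim exE conjE)
  from conjunct1[OF conjunct2[OF ints]] obtain J2 where J2: "has_stochastic_integral \<alpha> M (natural_filtration M X W) W
         (\<lambda>r \<omega>. ((X r \<omega> - X s \<omega>)\<^sup>2 - (W r \<omega> - W s \<omega>)) / 2) s t J2"
       "AE \<omega> in M. \<langle>(\<^bold>\<bullet> \<^bold>\<top> \<^bold>\<bullet>) \<^bold>\<top> p2, Y \<omega> s t\<rangle> = J2 \<omega>"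
    by (elim exE conjE)
  from conjunct2[OF conjunct2[OF ints]] obtain J3 where J3: "has_stochastic_integral \<beta> M (natural_filtration M X W) W (\<lambda>r \<omega>. W r \<omega> - W s \<omega>) s t J3"
       "AE \<omega> in M. \<langle>p2 \<^bold>\<top> p2, Y \<omega> s t\<rangle> = J3 \<omega> \<and> (\<beta> = Stratonovich \<longrightarrow> J3 \<omega> = (W t \<omega> - W s \<omega>)\<^sup>2 / 2)"
    by (elim exE conjE)
  have J3': "AE \<omega> in M. \<beta> = Stratonovich \<longrightarrow> J3 \<omega> = (W t \<omega> - W s \<omega>)\<^sup>2 / 2"
    using J3(2) by eventually_elim simp
  from rough words J1(2) J2(2) J3(2) area_unique[OF st J1(1)] cubic_unique[OF st J2(1)] quadratic_unique[OF st J3(1) J3']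
  show "AE \<omega> in M. \<forall>f. int (weight f) \<le> \<lfloor>\<rho>\<rfloor> \<longrightarrow> Y \<omega> s t f = lift \<alpha> \<beta> \<omega> s t f"
  proof eventually_elim
    case (elim \<omega>)
    obtain c where c: "branched_rough_path \<rho> T c (Y \<omega>)" using elim(1) by blast
    note c1 = conjunct1[OF c[unfolded branched_rough_path_def], THEN spec, THEN spec, THEN mp, OF asm]
    have one: "Y \<omega> s t {#} = 1" by (rule conjunct1[OF c1])
    have mult: "Y \<omega> s t (f + g) = Y \<omega> s t f * Y \<omega> s t g" if "weight (f + g) \<le> 4" for f g :: forest
    proof -
      have "int (weight (f + g)) \<le> \<lfloor>\<rho>\<rfloor>" using that fl by simp
      then show ?thesis by (rule conjunct2[OF c1, THEN spec, THEN spec, THEN mp])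
    qed
    have w: "\<langle>\<^bold>\<bullet>, Y \<omega> s t\<rangle> = X t \<omega> - X s \<omega>" "\<langle>p2, Y \<omega> s t\<rangle> = W t \<omega> - W s \<omega>"
      "\<langle>p3, Y \<omega> s t\<rangle> = 0" "\<langle>p3 \<^bold>\<top> \<^bold>\<bullet>, Y \<omega> s t\<rangle> = 0" "\<langle>\<^bold>\<bullet> \<^bold>\<top> p3, Y \<omega> s t\<rangle> = 0"
      using elim(2) asm by blast+
    have j: "\<langle>\<^bold>\<bullet> \<^bold>\<top> p2, Y \<omega> s t\<rangle> = area_fin s t \<omega>" "\<langle>(\<^bold>\<bullet> \<^bold>\<top> \<^bold>\<bullet>) \<^bold>\<top> p2, Y \<omega> s t\<rangle> = cubic \<alpha> s t \<omega>"
      "\<langle>p2 \<^bold>\<top> p2, Y \<omega> s t\<rangle> = quadratic \<beta> s t \<omega>"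
      using elim(3-8) by simp_all
    show ?case
    proof (intro allI impI)
      fix f :: forest assume "int (weight f) \<le> \<lfloor>\<rho>\<rfloor>"
      then have f: "weight f \<le> 4" using fl by simp
      show "Y \<omega> s t f = lift \<alpha> \<beta> \<omega> s t f" unfolding lift_def
        by (rule forest_val_unique[OF one mult w(1-3) j(1) w(4,5) j(2,3) f])
    qed
  qed
qed

text \<open>
  The values on \<open>ladder4\<close> and then on \<open>fork\<close> over \<open>[0, T]\<close> recover the two corrections, which are 0 or
  \<open>T\<close> according to the calculus.
\<close>

lemma lifts_distinct:
  assumes \<rho>: "4 < \<rho>" "\<rho> < 5" and mod: "modification M \<rho> T (lift \<alpha> \<beta>) (lift \<alpha>' \<beta>')"
  shows "(\<alpha>, \<beta>) = (\<alpha>', \<beta>')"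
proof -
  have fl: "\<lfloor>\<rho>\<rfloor> = 4" using \<rho> by linarith
  have "AE \<omega> in M. \<forall>f. int (weight f) \<le> \<lfloor>\<rho>\<rfloor> \<longrightarrow> lift \<alpha> \<beta> \<omega> 0 T f = lift \<alpha>' \<beta>' \<omega> 0 T f"
    using mod T_pos unfolding modification_def by simp
  then have "\<exists>\<omega>. \<forall>f. int (weight f) \<le> \<lfloor>\<rho>\<rfloor> \<longrightarrow> lift \<alpha> \<beta> \<omega> 0 T f = lift \<alpha>' \<beta>' \<omega> 0 T f"
  proof (rule contrapos_pp)
    assume n: "\<not> (\<exists>\<omega>. \<forall>f. int (weight f) \<le> \<lfloor>\<rho>\<rfloor> \<longrightarrow> lift \<alpha> \<beta> \<omega> 0 T f = lift \<alpha>' \<beta>' \<omega> 0 T f)"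
    show "\<not> (AE \<omega> in M. \<forall>f. int (weight f) \<le> \<lfloor>\<rho>\<rfloor> \<longrightarrow> lift \<alpha> \<beta> \<omega> 0 T f = lift \<alpha>' \<beta>' \<omega> 0 T f)"
    proof
      assume "AE \<omega> in M. \<forall>f. int (weight f) \<le> \<lfloor>\<rho>\<rfloor> \<longrightarrow> lift \<alpha> \<beta> \<omega> 0 T f = lift \<alpha>' \<beta>' \<omega> 0 T f"
      then have "AE \<omega> in M. False" by eventually_elim (use n in blast)
      then show False by simp
    qed
  qed
  then obtain \<omega> where eq: "\<And>f. weight f \<le> 4 \<Longrightarrow> lift \<alpha> \<beta> \<omega> 0 T f = lift \<alpha>' \<beta>' \<omega> 0 T f"
    using fl by auto
  have q: "quadratic \<beta> 0 T \<omega> = quadratic \<beta>' 0 T \<omega>"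
    using eq[of "{#ladder4#}"] by (simp add: lift_def tree_val_simps)
  have c: "cubic \<alpha> 0 T \<omega> = cubic \<alpha>' 0 T \<omega>"
    using eq[of "{#fork#}"] q by (simp add: lift_def tree_val_simps)
  have inj: "\<gamma> = \<gamma>'" if "ito_correction \<gamma> T = ito_correction \<gamma>' T" for \<gamma> \<gamma>'
    using that T_pos by (cases \<gamma>; cases \<gamma>') (auto simp: ito_correction_def)
  show ?thesis using q c inj by (simp add: quadratic_def cubic_def)
qed

end

theorem proposition4p10:
  fixes M :: "'a measure" and X W :: "real \<Rightarrow> 'a \<Rightarrow> real" and T \<rho> :: real
  assumes "prob_space M"
    and "0 < T"
    and "fbm_quarter M T X"
    and "brownian_motion M T W"
    and "independent_processes M {0..T} X W"
    and "4 < \<rho>" and "\<rho> < 5"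
  shows "\<exists>XX :: calculus \<Rightarrow> calculus \<Rightarrow> 'a random_path.
    (\<forall>\<alpha> \<beta>. is_lift M \<rho> T X W \<alpha> \<beta> (XX \<alpha> \<beta>) \<and>
       (\<forall>Y. is_lift M \<rho> T X W \<alpha> \<beta> Y \<longrightarrow> modification M \<rho> T Y (XX \<alpha> \<beta>))) \<and>
    (\<forall>\<alpha> \<beta> \<alpha>' \<beta>'. (\<alpha>, \<beta>) \<noteq> (\<alpha>', \<beta>') \<longrightarrow> \<not> modification M \<rho> T (XX \<alpha> \<beta>) (XX \<alpha>' \<beta>'))"
proof -
  interpret prob_space M by fact
  interpret fbm_bm M X W T by unfold_locales fact+
  show ?thesis
  proof (intro exI[of _ lift] conjI allI impI notI)
    show "is_lift M \<rho> T X W \<alpha> \<beta> (lift \<alpha> \<beta>)" for \<alpha> \<beta> by (rule lift_is_lift[OF assms(6,7)])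
    show "modification M \<rho> T Y (lift \<alpha> \<beta>)" if "is_lift M \<rho> T X W \<alpha> \<beta> Y" for \<alpha> \<beta> Y
      by (rule lift_unique[OF assms(6,7) that])
    show False if "(\<alpha>, \<beta>) \<noteq> (\<alpha>', \<beta>')" "modification M \<rho> T (lift \<alpha> \<beta>) (lift \<alpha>' \<beta>')" for \<alpha> \<beta> \<alpha>' \<beta>'
      using lifts_distinct[OF assms(6,7) that(2)] that(1) by contradiction
  qed
qed

end
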